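(* Let $H$ be a GJMLS which is a realization of $y$ and satisfies Assumption (G). Then $H$ is a minimal realization of $y$ if and only if $H$ is reachable and observable. Moreover, if $\hat H$ is another minimal GJMLS realization of $y$ satisfying Assumption (G), then $H$ and $\hat H$ are isomorphic.
   Context: Setting (GJMLS). All random variables on one probability space. $Q=\{1,\dots,d\}$; $\theta(t)\in Q$ is a fixed stationary ergodic Markov chain with $p_{i,j}=P(\theta(t+1)=j\mid\theta(t)=i)>0$ for all $i,j$. $\chi$ = indicator. $\mathcal{D}_t$: $\sigma$-algebra generated by $\{\theta(t-k)\}_{k\ge0}$; $\mathcal{D}_{t,t-l}$: generated by $\theta(t-l),\dots,\theta(t)$. A GJMLS $H$: integers $n_q$, matrices $M_{q_1,q_2}\in\mathbb{R}^{n_{q_2}\times n_{q_1}}$, $B_{q_1,q_2}\in\mathbb{R}^{n_{q_2}\times m}$, $C_q\in\mathbb{R}^{p\times n_q}$, $D_q\in\mathbb{R}^{p\times m}$, processes $x(t)\in\mathbb{R}^{n_{\theta(t)}}$, $v(t)\in\mathbb{R}^m$, $y(t)\in\mathbb{R}^p$ with $x(t+1)=M_{\theta(t),\theta(t+1)}x(t)+B_{\theta(t),\theta(t+1)}v(t)$, $y(t)=C_{\theta(t)}x(t)+D_{\theta(t)}v(t)$; realization of $y$ if its output equals $y$; $\dim H=\sum_qn_q$. Assumption (G): (G1) $v(t)$ square integrable, $E[v(t)\mid\mathcal{D}_{t+k}]=0$ ($k\ge0$), $E[v(t)v(t-l)^T\mid\mathcal{D}_{t,t-l}]=0$ ($l>0$),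 $Q_q:=E[v(t)v(t)^T\chi(\theta(t)=q)]$ independent of $t$; (G2) $\sigma(\{v(t-l)\}_{l\ge0})$ and $\sigma(\{\theta(t+l)\}_{l>0})$ conditionally independent given $\mathcal{D}_t$; (G3) $x(t)$ belongs to the mean-square closure of the span of the coordinates of $v(t-k)\chi(\theta(t-k)=q_0,\dots,\theta(t)=q_k)$, $q_i\in Q$, $k>0$; (G4) $\theta$ stationary ergodic; (G5) the block matrix with $(i,j)$ block $p_{i,j}M_{i,j}^T\otimes M_{i,j}^T$ has all eigenvalues of modulus $<1$; (G6) $D_qQ_qD_q^T$ positive definite. A realization $H$ of $y$ satisfying (G) is minimal if $\dim H\le\dim H'$ for all GJMLS realizations $H'$ of $y$ satisfying (G). Under (G), let $P_q=E[x(t)x(t)^T\chi(\theta(t)=q)]$ and $G_{q_1,q_2}=p_{q_1,q_2}(M_{q_1,q_2}P_{q_1}C_{q_1}^T+B_{q_1,q_2}Q_{q_1}D_{q_1}^T)\in\mathbb{R}^{n_{q_2}\times p}$. Words: $L$ = set of nonempty words $(q_1,q_2)(q_2,q_3)\cdots(q_{k-1},q_k)$ over the alphabet $Q\times Q$; for $w=(q_1,q_2)\cdots(q_{k-1},q_k)\in L$, $M_w=M_{q_{k-1},q_k}\cdots M_{q_1,q_2}$; $M_\epsilon$ = identity; $|w|$ = number of letters; $N=\dim H$. Reachability: for $q\in Q$, $\mathcal{R}_{H,q}$ is the matrix whose columns blocks are $M_vG_{q_1,q_2}$ over all $q_1,q_2\in Q$ and words $v$ (possibly empty) with $(q_1,q_2)v\in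 L$, $|(q_1,q_2)v|\le N$, and $(q_1,q_2)v$ ending in a letter of the form $(\cdot,q)$; $H$ is reachable if $\mathrm{rank}\,\mathcal{R}_{H,q}=n_q$ for all $q$. Observability: for $q\in Q$, $\mathcal{O}_{H,q}$ is the matrix whose row blocks are $C_q$ and $C_rM_w$ over all $w\in L$ with $|w|\le N$, $w$ beginning with a letter $(q,\cdot)$ and ending with a letter $(\cdot,r)$; $H$ is observable if $\mathrm{rank}\,\mathcal{O}_{H,q}=n_q$ for all $q$. Isomorphism: for GJMLSs $H$, $\hat H$ (hatted data $\hat n_q,\hat M,\hat C,\hat G$, with $\hat G$ defined from $\hat H$ as $G$ from $H$), an isomorphism is a family of invertible matrices $T_q\in\mathbb{R}^{n_q\times n_q}$ (requiring $\hat n_q=n_q$) with $T_{q_2}M_{q_1,q_2}=\hat M_{q_1,q_2}T_{q_1}$, $C_{q_1}=\hat C_{q_1}T_{q_1}$, $T_{q_2}G_{q_1,q_2}=\hat G_{q_1,q_2}$ for all $q_1,q_2\in Q$. *)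

theory Defs
  imports "HOL-Probability.Probability" "Jordan_Normal_Form.DL_Rank"
          "Jordan_Normal_Form.Char_Poly"
begin

definition Qs :: "nat \<Rightarrow> nat set" where
  "Qs d = {1..d}"

definition sig_past :: "'w measure \<Rightarrow> (int \<Rightarrow> 'w \<Rightarrow> nat) \<Rightarrow> int \<Rightarrow> 'w measure" where
  "sig_past M \<theta> t = sigma (space M) {\<theta> s -` {q} \<inter> space M | s q. s \<le> t}"

definition sig_window :: "'w measure \<Rightarrow> (int \<Rightarrow> 'w \<Rightarrow> nat) \<Rightarrow> int \<Rightarrow> int \<Rightarrow> 'w measure" where
  "sig_window M \<theta> t l = sigma (space M) {\<theta> s -` {q} \<inter> space M | s q. t - l \<le> s \<and> s \<le> t}"

definition sig_future :: "'w measure \<Rightarrow> (int \<Rightarrow> 'w \<Rightarrow> nat) \<Rightarrow> int \<Rightarrow> 'w measure" where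
  "sig_future M \<theta> t = sigma (space M) {\<theta> s -` {q} \<inter> space M | s q. t < s}"

definition sig_vpast :: "'w measure \<Rightarrow> (int \<Rightarrow> 'w \<Rightarrow> real vec) \<Rightarrow> nat \<Rightarrow> int \<Rightarrow> 'w measure" where
  "sig_vpast M v m t = sigma (space M)
     {(\<lambda>\<omega>. v s \<omega> $ i) -` U \<inter> space M | s i U. s \<le> t \<and> i < m \<and> U \<in> sets borel}"

definition cond_indep :: "'w measure \<Rightarrow> 'w measure \<Rightarrow> 'w measure \<Rightarrow> 'w measure \<Rightarrow> bool" where
  "cond_indep M F1 F2 G \<longleftrightarrow>
     (\<forall>A \<in> sets F1. \<forall>B \<in> sets F2. AE \<omega> in M.
        real_cond_exp M G (indicator (A \<inter> B)) \<omega> =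
        real_cond_exp M G (indicator A) \<omega> * real_cond_exp M G (indicator B) \<omega>)"

definition ms_closure :: "'w measure \<Rightarrow> ('w \<Rightarrow> real) set \<Rightarrow> ('w \<Rightarrow> real) set" where
  "ms_closure M G = {f. f \<in> borel_measurable M \<and> integrable M (\<lambda>\<omega>. (f \<omega>)\<^sup>2) \<and>
     (\<forall>e > 0. \<exists>S c. finite S \<and> S \<subseteq> G \<and>
        integrable M (\<lambda>\<omega>. (f \<omega> - (\<Sum>g\<in>S. c g * g \<omega>))\<^sup>2) \<and>
        integral\<^sup>L M (\<lambda>\<omega>. (f \<omega> - (\<Sum>g\<in>S. c g * g \<omega>))\<^sup>2) < e)}"

definition ind :: "'w measure \<Rightarrow> (int \<Rightarrow> 'w \<Rightarrow> nat) \<Rightarrow> nat \<Rightarrow> int \<Rightarrow> 'w \<Rightarrow> real" where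
  "ind M \<theta> q t = indicator {\<omega> \<in> space M. \<theta> t \<omega> = q}"

definition stat_markov_chain ::
  "'w measure \<Rightarrow> nat \<Rightarrow> (int \<Rightarrow> 'w \<Rightarrow> nat) \<Rightarrow> (nat \<Rightarrow> nat \<Rightarrow> real) \<Rightarrow> bool" where
  "stat_markov_chain M d \<theta> P \<longleftrightarrow>
     prob_space M \<and>
     (\<forall>t. \<theta> t \<in> measurable M (count_space UNIV)) \<and>
     (\<forall>t. \<forall>\<omega> \<in> space M. \<theta> t \<omega> \<in> Qs d) \<and>
     (\<forall>i \<in> Qs d. \<forall>j \<in> Qs d. P i j > 0) \<and>
     (\<forall>t. \<forall>j \<in> Qs d. AE \<omega> in M.
        real_cond_exp M (sig_past M \<theta> t) (indicator {\<omega> \<in> space M. \<theta> (t + 1) \<omega> = j}) \<omega>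
          = P (\<theta> t \<omega>) j) \<and>
     (\<forall>t qs. measure M {\<omega> \<in> space M. \<forall>i < length qs. \<theta> (t + int i) \<omega> = qs ! i} =
             measure M {\<omega> \<in> space M. \<forall>i < length qs. \<theta> (int i) \<omega> = qs ! i})"

record 'w gjmls =
  nst :: "nat \<Rightarrow> nat"
  mdim :: nat
  Mm :: "nat \<Rightarrow> nat \<Rightarrow> real mat"
  Bm :: "nat \<Rightarrow> nat \<Rightarrow> real mat"
  Cm :: "nat \<Rightarrow> real mat"
  Dm :: "nat \<Rightarrow> real mat"
  xp :: "int \<Rightarrow> 'w \<Rightarrow> real vec"
  vp :: "int \<Rightarrow> 'w \<Rightarrow> real vec"

definition is_gjmls ::
  "'w measure \<Rightarrow> nat \<Rightarrow> (int \<Rightarrow> 'w \<Rightarrow> nat) \<Rightarrow> nat \<Rightarrow> 'w gjmls \<Rightarrow> bool" where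
  "is_gjmls M d \<theta> p H \<longleftrightarrow>
     (\<forall>q1 \<in> Qs d. \<forall>q2 \<in> Qs d.
        Mm H q1 q2 \<in> carrier_mat (nst H q2) (nst H q1) \<and>
        Bm H q1 q2 \<in> carrier_mat (nst H q2) (mdim H)) \<and>
     (\<forall>q \<in> Qs d. Cm H q \<in> carrier_mat p (nst H q) \<and> Dm H q \<in> carrier_mat p (mdim H)) \<and>
     (\<forall>t. \<forall>\<omega> \<in> space M. xp H t \<omega> \<in> carrier_vec (nst H (\<theta> t \<omega>)) \<and>
                         vp H t \<omega> \<in> carrier_vec (mdim H)) \<and>
     (\<forall>t. AE \<omega> in M. xp H (t + 1) \<omega> =
            Mm H (\<theta> t \<omega>) (\<theta> (t + 1) \<omega>) *\<^sub>v xp H t \<omega> +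
            Bm H (\<theta> t \<omega>) (\<theta> (t + 1) \<omega>) *\<^sub>v vp H t \<omega>)"

definition realizes ::
  "'w measure \<Rightarrow> (int \<Rightarrow> 'w \<Rightarrow> nat) \<Rightarrow> 'w gjmls \<Rightarrow> (int \<Rightarrow> 'w \<Rightarrow> real vec) \<Rightarrow> bool" where
  "realizes M \<theta> H y \<longleftrightarrow>
     (\<forall>t. AE \<omega> in M. y t \<omega> = Cm H (\<theta> t \<omega>) *\<^sub>v xp H t \<omega> + Dm H (\<theta> t \<omega>) *\<^sub>v vp H t \<omega>)"

definition dimH :: "nat \<Rightarrow> 'w gjmls \<Rightarrow> nat" where
  "dimH d H = (\<Sum>q \<in> Qs d. nst H q)"

text \<open>Q_q = E[v(t) v(t)^T chi(theta(t)=q)] (evaluated at t = 0; independent of t by (G1))\<close>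
definition Qmat :: "'w measure \<Rightarrow> (int \<Rightarrow> 'w \<Rightarrow> nat) \<Rightarrow> 'w gjmls \<Rightarrow> nat \<Rightarrow> real mat" where
  "Qmat M \<theta> H q = mat (mdim H) (mdim H)
     (\<lambda>(i, j). integral\<^sup>L M (\<lambda>\<omega>. vp H 0 \<omega> $ i * vp H 0 \<omega> $ j * ind M \<theta> q 0 \<omega>))"

definition Pmat :: "'w measure \<Rightarrow> (int \<Rightarrow> 'w \<Rightarrow> nat) \<Rightarrow> 'w gjmls \<Rightarrow> nat \<Rightarrow> real mat" where
  "Pmat M \<theta> H q = mat (nst H q) (nst H q)
     (\<lambda>(i, j). integral\<^sup>L M (\<lambda>\<omega>. xp H 0 \<omega> $ i * xp H 0 \<omega> $ j * ind M \<theta> q 0 \<omega>))"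

definition kron :: "real mat \<Rightarrow> real mat \<Rightarrow> real mat" where
  "kron A B = mat (dim_row A * dim_row B) (dim_col A * dim_col B)
     (\<lambda>(i, j). A $$ (i div dim_row B, j div dim_col B) * B $$ (i mod dim_row B, j mod dim_col B))"

definition blk_off :: "'w gjmls \<Rightarrow> nat \<Rightarrow> nat" where
  "blk_off H i = (\<Sum>r \<in> {1..<i}. (nst H r)\<^sup>2)"

definition stab_mat :: "nat \<Rightarrow> (nat \<Rightarrow> nat \<Rightarrow> real) \<Rightarrow> 'w gjmls \<Rightarrow> real mat" where
  "stab_mat d P H = mat (\<Sum>r \<in> Qs d. (nst H r)\<^sup>2) (\<Sum>r \<in> Qs d. (nst H r)\<^sup>2)
     (\<lambda>(a, b). \<Sum>i \<in> Qs d. \<Sum>j \<in> Qs d.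
        if blk_off H i \<le> a \<and> a < blk_off H i + (nst H i)\<^sup>2 \<and>
           blk_off H j \<le> b \<and> b < blk_off H j + (nst H j)\<^sup>2
        then (P i j \<cdot>\<^sub>m kron (transpose_mat (Mm H i j)) (transpose_mat (Mm H i j)))
               $$ (a - blk_off H i, b - blk_off H j)
        else 0)"

definition assumptionG ::
  "'w measure \<Rightarrow> nat \<Rightarrow> (int \<Rightarrow> 'w \<Rightarrow> nat) \<Rightarrow> (nat \<Rightarrow> nat \<Rightarrow> real) \<Rightarrow> nat \<Rightarrow> 'w gjmls \<Rightarrow> bool" where
  "assumptionG M d \<theta> P p H \<longleftrightarrow>
     \<comment> \<open>(G1)\<close>
     (\<forall>t. \<forall>i < mdim H. (\<lambda>\<omega>. vp H t \<omega> $ i) \<in> borel_measurable M \<and>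
                        integrable M (\<lambda>\<omega>. (vp H t \<omega> $ i)\<^sup>2)) \<and>
     (\<forall>t k. \<forall>i < mdim H. k \<ge> 0 \<longrightarrow>
        (AE \<omega> in M. real_cond_exp M (sig_past M \<theta> (t + k)) (\<lambda>\<omega>. vp H t \<omega> $ i) \<omega> = 0)) \<and>
     (\<forall>t l. \<forall>i < mdim H. \<forall>j < mdim H. l > 0 \<longrightarrow>
        (AE \<omega> in M. real_cond_exp M (sig_window M \<theta> t l)
                        (\<lambda>\<omega>. vp H t \<omega> $ i * vp H (t - l) \<omega> $ j) \<omega> = 0)) \<and>
     (\<forall>t. \<forall>q \<in> Qs d. \<forall>i < mdim H. \<forall>j < mdim H.
        integral\<^sup>L M (\<lambda>\<omega>. vp H t \<omega> $ i * vp H t \<omega> $ j * ind M \<theta> q t \<omega>) = Qmat M \<theta> H q $$ (i, j)) \<and>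
     \<comment> \<open>(G2)\<close>
     (\<forall>t. cond_indep M (sig_vpast M (vp H) (mdim H) t) (sig_future M \<theta> t) (sig_past M \<theta> t)) \<and>
     \<comment> \<open>(G3)\<close>
     (\<forall>t. \<forall>q \<in> Qs d. \<forall>i < nst H q.
        (\<lambda>\<omega>. xp H t \<omega> $ i * ind M \<theta> q t \<omega>) \<in> ms_closure M
          {(\<lambda>\<omega>. vp H (t - int k) \<omega> $ j *
                  indicator {\<omega> \<in> space M. \<forall>r \<le> k. \<theta> (t - int k + int r) \<omega> = qs ! r} \<omega>)
           | k qs j. k > 0 \<and> length qs = k + 1 \<and> set qs \<subseteq> Qs d \<and> j < mdim H}) \<and>
     \<comment> \<open>(G4) is part of stat_markov_chain; (G5)\<close>
     (\<forall>ev. eigenvalue (map_mat complex_of_real (stab_mat d P H)) ev \<longrightarrow> cmod ev < 1) \<and>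
     \<comment> \<open>(G6)\<close>
     (\<forall>q \<in> Qs d. \<forall>z \<in> carrier_vec p. z \<noteq> 0\<^sub>v p \<longrightarrow>
        scalar_prod z ((Dm H q * Qmat M \<theta> H q * transpose_mat (Dm H q)) *\<^sub>v z) > 0)"

definition minimal_realization ::
  "'w measure \<Rightarrow> nat \<Rightarrow> (int \<Rightarrow> 'w \<Rightarrow> nat) \<Rightarrow> (nat \<Rightarrow> nat \<Rightarrow> real) \<Rightarrow> nat \<Rightarrow>
   (int \<Rightarrow> 'w \<Rightarrow> real vec) \<Rightarrow> 'w gjmls \<Rightarrow> bool" where
  "minimal_realization M d \<theta> P p y H \<longleftrightarrow>
     is_gjmls M d \<theta> p H \<and> realizes M \<theta> H y \<and> assumptionG M d \<theta> P p H \<and>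
     (\<forall>H'. is_gjmls M d \<theta> p H' \<and> realizes M \<theta> H' y \<and> assumptionG M d \<theta> P p H' \<longrightarrow>
            dimH d H \<le> dimH d H')"

definition Gmat ::
  "'w measure \<Rightarrow> (int \<Rightarrow> 'w \<Rightarrow> nat) \<Rightarrow> (nat \<Rightarrow> nat \<Rightarrow> real) \<Rightarrow> 'w gjmls \<Rightarrow> nat \<Rightarrow> nat \<Rightarrow> real mat" where
  "Gmat M \<theta> P H q1 q2 = P q1 q2 \<cdot>\<^sub>m
     (Mm H q1 q2 * Pmat M \<theta> H q1 * transpose_mat (Cm H q1) +
      Bm H q1 q2 * Qmat M \<theta> H q1 * transpose_mat (Dm H q1))"

text \<open>A word (q1,q2)(q2,q3)...(q_{k-1},q_k) in L is represented by its state sequence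
  [q1,...,qk] (k >= 2); its length is k - 1.  A state list [q] represents the empty word
  (ending/starting in q).  Mpath gives M_w = M_{q_{k-1},q_k} ... M_{q1,q2}.\<close>
fun Mpath :: "'w gjmls \<Rightarrow> nat list \<Rightarrow> real mat" where
  "Mpath H [] = 1\<^sub>m 0"
| "Mpath H [a] = 1\<^sub>m (nst H a)"
| "Mpath H (a # b # rest) = Mpath H (b # rest) * Mm H a b"

definition state_seqs :: "nat \<Rightarrow> nat \<Rightarrow> nat list list" where
  "state_seqs d k = List.n_lists k [1..<d + 1]"

definition reach_mat ::
  "'w measure \<Rightarrow> nat \<Rightarrow> (int \<Rightarrow> 'w \<Rightarrow> nat) \<Rightarrow> (nat \<Rightarrow> nat \<Rightarrow> real) \<Rightarrow> 'w gjmls \<Rightarrow> nat \<Rightarrow> real mat" where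
  "reach_mat M d \<theta> P H q = mat_of_cols (nst H q) (concat (map cols
     [Mpath H (tl qs) * Gmat M \<theta> P H (qs ! 0) (qs ! 1).
        k \<leftarrow> [2..<dimH d H + 2], qs \<leftarrow> state_seqs d k, last qs = q]))"

definition obs_mat :: "nat \<Rightarrow> 'w gjmls \<Rightarrow> nat \<Rightarrow> real mat" where
  "obs_mat d H q = mat_of_rows (nst H q) (concat (map rows
     (Cm H q # [Cm H (last qs) * Mpath H qs.
        k \<leftarrow> [2..<dimH d H + 2], qs \<leftarrow> state_seqs d k, hd qs = q])))"

definition reachable ::
  "'w measure \<Rightarrow> nat \<Rightarrow> (int \<Rightarrow> 'w \<Rightarrow> nat) \<Rightarrow> (nat \<Rightarrow> nat \<Rightarrow> real) \<Rightarrow> 'w gjmls \<Rightarrow> bool" where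
  "reachable M d \<theta> P H \<longleftrightarrow>
     (\<forall>q \<in> Qs d. vec_space.rank (nst H q) (reach_mat M d \<theta> P H q) = nst H q)"

definition observable :: "nat \<Rightarrow> 'w gjmls \<Rightarrow> bool" where
  "observable d H \<longleftrightarrow>
     (\<forall>q \<in> Qs d. vec_space.rank (dim_row (obs_mat d H q)) (obs_mat d H q) = nst H q)"

definition isomorphic ::
  "'w measure \<Rightarrow> nat \<Rightarrow> (int \<Rightarrow> 'w \<Rightarrow> nat) \<Rightarrow> (nat \<Rightarrow> nat \<Rightarrow> real) \<Rightarrow> 'w gjmls \<Rightarrow> 'w gjmls \<Rightarrow> bool" where
  "isomorphic M d \<theta> P H H' \<longleftrightarrow>
     (\<forall>q \<in> Qs d. nst H' q = nst H q) \<and>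
     (\<exists>T. (\<forall>q \<in> Qs d. T q \<in> carrier_mat (nst H q) (nst H q) \<and> invertible_mat (T q)) \<and>
          (\<forall>q1 \<in> Qs d. \<forall>q2 \<in> Qs d.
             T q2 * Mm H q1 q2 = Mm H' q1 q2 * T q1 \<and>
             Cm H q1 = Cm H' q1 * T q1 \<and>
             T q2 * Gmat M \<theta> P H q1 q2 = Gmat M \<theta> P H' q1 q2))"

end

theory Submission
  imports Defs "Jordan_Normal_Form.Spectral_Radius"
begin

text \<open>
  The covariances of \<open>y(t) \<chi>(\<theta>(t) = q)\<close> with the delayed outputs times path indicators are
  positive multiples of the entries of the matrices \<open>C\<^sub>r M\<^sub>w G\<close>, so these Markov parameters are the
  same for all realizations. Hence the products of observability and reachability matrices, also with
  a matrix \<open>M\<close> in between, are the same: for reachable and observable \<open>H\<close> this bounds every \<open>n\<^sub>q\<close>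
  by that of any other realization, and for two such systems a left inverse of the observability
  matrix gives the isomorphism.

  Conversely, an unobservable system is reduced by projecting its state onto the orthogonal complement
  of the unobservable subspaces; the noise stays the same. The reachable subspaces (spanned by the
  \<open>M\<^sub>v G\<close>) cannot simply be restricted to, because the state itself need not lie in them; its
  projection onto the past outputs does. Driven by the innovation of the output this projection is a
  realization on the reachable subspaces, and it satisfies (G) because projections depend only on
  stationary second moments. Assumption (G5) bounds the eigenvalues of the operator
  \<open>(X\<^sub>i) \<mapsto> (\<Sum>\<^sub>i p\<^sub>i\<^sub>j M\<^sub>i\<^sub>j X\<^sub>i M\<^sub>i\<^sub>j\<^sup>T)\<close>, or equivalently of its adjoint, and an eigenvector of the reduced operator
  is transported by \<open>X \<mapsto> J X J\<^sup>T\<close> to one of the original operator.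
\<close>

subsection \<open>Square integrable functions\<close>

text \<open>The state space varies with the mode, so every process is cut into scalar components
  times mode indicators, all living in one space L2. The Markov property and (G2) are condensed into
  one rule: for adapted functions, the indicator of the next mode multiplies an inner product by a
  transition probability. Second moments of the state cannot be shown stationary by recursion, which
  has no initial time; instead (G3) makes the state its own projection onto the delayed noise.

  The projected state obeys a state equation with a Kalman gain, which exists because (G6) bounds
  the innovation covariance from below. That the innovations generate the new state rests on (G5):
  unfolding the state equation k times leaves a remainder whose covariance is the k-th iterate of an
  operator with spectral radius below 1. Whiteness survives because a finite window sees only
  finitely many paths, and (G2) because it holds for every adapted process.

  Word length dim H suffices since the total dimension of the unobservable subspaces drops at every
  step until all modes are stationary together.\<close>

definition L2 :: "'w measure \<Rightarrow> ('w \<Rightarrow> real) set" where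
  "L2 M = {f. f \<in> borel_measurable M \<and> integrable M (\<lambda>\<omega>. (f \<omega>)\<^sup>2)}"

definition ip :: "'w measure \<Rightarrow> ('w \<Rightarrow> real) \<Rightarrow> ('w \<Rightarrow> real) \<Rightarrow> real" where
  "ip M f g = integral\<^sup>L M (\<lambda>\<omega>. f \<omega> * g \<omega>)"

lemma L2_measurable [measurable_dest]: "f \<in> L2 M \<Longrightarrow> f \<in> borel_measurable M"
  by (simp add: L2_def)

lemma L2_mult_integrable:
  assumes "f \<in> L2 M" "g \<in> L2 M"
  shows "integrable M (\<lambda>\<omega>. f \<omega> * g \<omega>)"
proof (rule Bochner_Integration.integrable_bound)
  show "integrable M (\<lambda>\<omega>. (f \<omega>)\<^sup>2 + (g \<omega>)\<^sup>2)"
    using assms by (simp add: L2_def)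
  show "(\<lambda>\<omega>. f \<omega> * g \<omega>) \<in> borel_measurable M"
    using assms by (auto simp: L2_def)
  have "\<bar>a * b\<bar> \<le> a\<^sup>2 + b\<^sup>2" for a b :: real
  proof -
    have "2 * \<bar>a\<bar> * \<bar>b\<bar> \<le> \<bar>a\<bar>\<^sup>2 + \<bar>b\<bar>\<^sup>2"
      using sum_squares_bound[of "\<bar>a\<bar>" "\<bar>b\<bar>"] by simp
    then show ?thesis
      using mult_nonneg_nonneg[OF abs_ge_zero[of a] abs_ge_zero[of b]] by (simp add: abs_mult; linarith)
  qed
  then show "AE \<omega> in M. norm (f \<omega> * g \<omega>) \<le> norm ((f \<omega>)\<^sup>2 + (g \<omega>)\<^sup>2)"
    by (intro AE_I2) (simp add: abs_le_iff)
qed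

lemma L2_zero [simp, intro]: "(\<lambda>_. 0) \<in> L2 M"
  by (simp add: L2_def)

lemma L2_scale [simp, intro]: "f \<in> L2 M \<Longrightarrow> (\<lambda>\<omega>. c * f \<omega>) \<in> L2 M"
  by (auto simp: L2_def power_mult_distrib)

lemma L2_add [simp, intro]:
  assumes "f \<in> L2 M" "g \<in> L2 M"
  shows "(\<lambda>\<omega>. f \<omega> + g \<omega>) \<in> L2 M"
proof -
  have "integrable M (\<lambda>\<omega>. (f \<omega>)\<^sup>2 + (g \<omega>)\<^sup>2 + 2 * (f \<omega> * g \<omega>))"
    using assms L2_mult_integrable[OF assms] by (simp add: L2_def)
  then show ?thesis
    using assms by (auto simp: L2_def power2_sum algebra_simps)
qed

lemma L2_diff [simp, intro]: "f \<in> L2 M \<Longrightarrow> g \<in> L2 M \<Longrightarrow> (\<lambda>\<omega>. f \<omega> - g \<omega>) \<in> L2 M"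
  using L2_add[of f M "\<lambda>\<omega>. -1 * g \<omega>"] L2_scale[of g M "-1"] by simp

lemma L2_sum [simp, intro]:
  "(\<And>i. i \<in> I \<Longrightarrow> f i \<in> L2 M) \<Longrightarrow> (\<lambda>\<omega>. \<Sum>i\<in>I. f i \<omega>) \<in> L2 M"
  by (induction I rule: infinite_finite_induct) auto

lemma L2_mult_bounded:
  assumes f: "f \<in> L2 M" and b: "b \<in> borel_measurable M" "\<And>\<omega>. \<bar>b \<omega>\<bar> \<le> (1::real)"
  shows "(\<lambda>\<omega>. f \<omega> * b \<omega>) \<in> L2 M"
proof -
  have "integrable M (\<lambda>\<omega>. (f \<omega> * b \<omega>)\<^sup>2)"
  proof (rule Bochner_Integration.integrable_bound)
    show "integrable M (\<lambda>\<omega>. (f \<omega>)\<^sup>2)" using f by (simp add: L2_def)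
    show "(\<lambda>\<omega>. (f \<omega> * b \<omega>)\<^sup>2) \<in> borel_measurable M" using f b by (auto simp: L2_def)
    show "AE \<omega> in M. norm ((f \<omega> * b \<omega>)\<^sup>2) \<le> norm ((f \<omega>)\<^sup>2)"
    proof (intro AE_I2)
      fix \<omega>
      have "\<bar>f \<omega> * b \<omega>\<bar> \<le> \<bar>f \<omega>\<bar>" using b(2)[of \<omega>] by (simp add: abs_mult mult_left_le)
      then show "norm ((f \<omega> * b \<omega>)\<^sup>2) \<le> norm ((f \<omega>)\<^sup>2)"
        by (simp add: abs_le_square_iff)
    qed
  qed
  then show ?thesis using f b by (auto simp: L2_def)
qed

lemma L2_cong_AE:
  assumes "f \<in> L2 M" "g \<in> borel_measurable M" "AE \<omega> in M. f \<omega> = g \<omega>"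
  shows "g \<in> L2 M"
proof -
  have "integrable M (\<lambda>\<omega>. (g \<omega>)\<^sup>2)"
    by (rule integrable_cong_AE_imp[of M "\<lambda>\<omega>. (f \<omega>)\<^sup>2"]) (use assms in \<open>auto simp: L2_def\<close>)
  then show ?thesis using assms by (simp add: L2_def)
qed

lemma ip_commute: "ip M f g = ip M g f"
  by (simp add: ip_def mult.commute)

lemma ip_cong_AE:
  assumes "f \<in> borel_measurable M" "f' \<in> borel_measurable M" "g \<in> borel_measurable M" "g' \<in> borel_measurable M"
    "AE \<omega> in M. f \<omega> = f' \<omega>" "AE \<omega> in M. g \<omega> = g' \<omega>"
  shows "ip M f g = ip M f' g'"
  unfolding ip_def by (rule integral_cong_AE) (use assms in auto)

lemma ip_zero_left [simp]: "ip M (\<lambda>_. 0) g = 0" and ip_zero_right [simp]: "ip M f (\<lambda>_. 0) = 0"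
  by (simp_all add: ip_def)

lemma ip_scale_left [simp]: "ip M (\<lambda>\<omega>. c * f \<omega>) g = c * ip M f g"
  by (simp add: ip_def mult.assoc)

lemma ip_scale_right [simp]: "ip M f (\<lambda>\<omega>. c * g \<omega>) = c * ip M f g"
  using ip_scale_left[of M c g f] by (simp add: ip_commute[of M f])

lemma ip_add_left: "f \<in> L2 M \<Longrightarrow> g \<in> L2 M \<Longrightarrow> h \<in> L2 M \<Longrightarrow>
    ip M (\<lambda>\<omega>. f \<omega> + g \<omega>) h = ip M f h + ip M g h"
  by (simp add: ip_def distrib_right L2_mult_integrable)

lemma ip_diff_left: "f \<in> L2 M \<Longrightarrow> g \<in> L2 M \<Longrightarrow> h \<in> L2 M \<Longrightarrow>
    ip M (\<lambda>\<omega>. f \<omega> - g \<omega>) h = ip M f h - ip M g h"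
  by (simp add: ip_def left_diff_distrib L2_mult_integrable)

lemma ip_add_right: "f \<in> L2 M \<Longrightarrow> g \<in> L2 M \<Longrightarrow> h \<in> L2 M \<Longrightarrow>
    ip M h (\<lambda>\<omega>. f \<omega> + g \<omega>) = ip M h f + ip M h g"
  by (simp add: ip_def distrib_left L2_mult_integrable)

lemma ip_diff_right: "f \<in> L2 M \<Longrightarrow> g \<in> L2 M \<Longrightarrow> h \<in> L2 M \<Longrightarrow>
    ip M h (\<lambda>\<omega>. f \<omega> - g \<omega>) = ip M h f - ip M h g"
  by (simp add: ip_def right_diff_distrib L2_mult_integrable)

lemma ip_sum_left: "(\<And>i. i \<in> I \<Longrightarrow> f i \<in> L2 M) \<Longrightarrow> h \<in> L2 M \<Longrightarrow>
    ip M (\<lambda>\<omega>. \<Sum>i\<in>I. f i \<omega>) h = (\<Sum>i\<in>I. ip M (f i) h)"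
  by (induction I rule: infinite_finite_induct) (auto simp: ip_add_left)

lemma ip_sum_right: "(\<And>i. i \<in> I \<Longrightarrow> f i \<in> L2 M) \<Longrightarrow> h \<in> L2 M \<Longrightarrow>
    ip M h (\<lambda>\<omega>. \<Sum>i\<in>I. f i \<omega>) = (\<Sum>i\<in>I. ip M h (f i))"
  by (simp add: ip_commute[of M h] ip_sum_left)

lemma ip_mult_shift: "ip M (\<lambda>\<omega>. f \<omega> * b \<omega>) g = ip M f (\<lambda>\<omega>. g \<omega> * b \<omega>)"
  by (simp add: ip_def mult_ac)

lemma ip_self_nonneg: "0 \<le> ip M f f"
  unfolding ip_def by (rule Bochner_Integration.integral_nonneg) simp

lemma ip_self_eq_0:
  assumes "f \<in> L2 M" "ip M f f = 0"
  shows "AE \<omega> in M. f \<omega> = 0"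
proof -
  have "AE \<omega> in M. f \<omega> * f \<omega> = 0"
    using assms integral_nonneg_eq_0_iff_AE[of M "\<lambda>\<omega>. f \<omega> * f \<omega>"]
    by (simp add: ip_def L2_mult_integrable)
  then show ?thesis by auto
qed

lemma ip_cauchy_schwarz:
  assumes f: "f \<in> L2 M" and g: "g \<in> L2 M"
  shows "(ip M f g)\<^sup>2 \<le> ip M f f * ip M g g"
proof (cases "ip M g g = 0")
  case True
  from ip_self_eq_0[OF g this] have "ip M f g = ip M f (\<lambda>_. 0)"
    by (intro ip_cong_AE) (use f g in \<open>auto simp: L2_def\<close>)
  then show ?thesis using True by simp
next
  case False
  then have pos: "ip M g g > 0" using ip_self_nonneg[of M g] by simp
  define c where "c = ip M f g / ip M g g"
  have "0 \<le> ip M (\<lambda>\<omega>. f \<omega> - c * g \<omega>) (\<lambda>\<omega>. f \<omega> - c * g \<omega>)" by (rule ip_self_nonneg)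
  also have "\<dots> = ip M f f - c * ip M f g - c * (ip M g f - c * ip M g g)"
    using f g by (simp add: ip_diff_left ip_diff_right right_diff_distrib)
  also have "\<dots> = ip M f f - (ip M f g)\<^sup>2 / ip M g g"
    using pos by (simp add: c_def ip_commute[of M g f] field_simps power2_eq_square)
  finally show ?thesis using pos by (simp add: field_simps)
qed

lemma ip_abs_le:
  assumes "f \<in> L2 M" "g \<in> L2 M"
  shows "\<bar>ip M f g\<bar> \<le> sqrt (ip M f f) * sqrt (ip M g g)"
  using real_sqrt_le_mono[OF ip_cauchy_schwarz[OF assms]] by (simp add: real_sqrt_mult)

lemma ip_square_sum_le:
  assumes "f \<in> L2 M" "g \<in> L2 M"
  shows "ip M (\<lambda>\<omega>. f \<omega> + g \<omega>) (\<lambda>\<omega>. f \<omega> + g \<omega>) \<le> 2 * ip M f f + 2 * ip M g g"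
proof -
  have "0 \<le> ip M (\<lambda>\<omega>. f \<omega> - g \<omega>) (\<lambda>\<omega>. f \<omega> - g \<omega>)" by (rule ip_self_nonneg)
  then show ?thesis
    using assms by (simp add: ip_add_left ip_add_right ip_diff_left ip_diff_right)
qed

lemma ip_diff_triangle:
  assumes "f \<in> L2 M" "g \<in> L2 M" "h \<in> L2 M"
  shows "ip M (\<lambda>\<omega>. f \<omega> - h \<omega>) (\<lambda>\<omega>. f \<omega> - h \<omega>)
    \<le> 2 * ip M (\<lambda>\<omega>. f \<omega> - g \<omega>) (\<lambda>\<omega>. f \<omega> - g \<omega>) + 2 * ip M (\<lambda>\<omega>. g \<omega> - h \<omega>) (\<lambda>\<omega>. g \<omega> - h \<omega>)"
  using ip_square_sum_le[of "\<lambda>\<omega>. f \<omega> - g \<omega>" M "\<lambda>\<omega>. g \<omega> - h \<omega>"] assms by simp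

lemma ip_parallelogram:
  assumes "f \<in> L2 M" "g \<in> L2 M"
  shows "ip M (\<lambda>\<omega>. f \<omega> - g \<omega>) (\<lambda>\<omega>. f \<omega> - g \<omega>)
    = 2 * ip M f f + 2 * ip M g g - ip M (\<lambda>\<omega>. f \<omega> + g \<omega>) (\<lambda>\<omega>. f \<omega> + g \<omega>)"
  using assms by (simp add: ip_add_left ip_add_right ip_diff_left ip_diff_right)

section \<open>Linear spans and mean-square closures\<close>

inductive_set lspan :: "('w \<Rightarrow> real) set \<Rightarrow> ('w \<Rightarrow> real) set" for G where
  lspan_zero: "(\<lambda>_. 0) \<in> lspan G"
| lspan_step: "g \<in> G \<Longrightarrow> s \<in> lspan G \<Longrightarrow> (\<lambda>\<omega>. c * g \<omega> + s \<omega>) \<in> lspan G"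

lemma lspan_base: "g \<in> G \<Longrightarrow> g \<in> lspan G"
  using lspan_step[OF _ lspan_zero, of g G 1] by simp

lemma lspan_add: "s \<in> lspan G \<Longrightarrow> s' \<in> lspan G \<Longrightarrow> (\<lambda>\<omega>. s \<omega> + s' \<omega>) \<in> lspan G"
proof (induction rule: lspan.induct)
  case (lspan_step g s c)
  then show ?case using lspan.lspan_step[of g G "\<lambda>\<omega>. s \<omega> + s' \<omega>" c] by (simp add: add.assoc)
qed simp

lemma lspan_scale: "s \<in> lspan G \<Longrightarrow> (\<lambda>\<omega>. c * s \<omega>) \<in> lspan G"
proof (induction rule: lspan.induct)
  case lspan_zero
  then show ?case by (simp add: lspan.lspan_zero)
next
  case (lspan_step g s d)
  then show ?case using lspan.lspan_step[of g G "\<lambda>\<omega>. c * s \<omega>" "c * d"] by (simp add: algebra_simps)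
qed

lemma lspan_sum: "(\<And>i. i \<in> I \<Longrightarrow> f i \<in> lspan G) \<Longrightarrow> (\<lambda>\<omega>. \<Sum>i\<in>I. f i \<omega>) \<in> lspan G"
  by (induction I rule: infinite_finite_induct) (auto intro: lspan_add lspan_zero)

text \<open>The inductive form of \<open>lspan\<close> serves inductions over generators; the form
  given here matches the finite sums in \<open>ms_closure\<close>.\<close>

lemma lspan_eq: "lspan G = {\<lambda>\<omega>. \<Sum>g\<in>S. c g * g \<omega> | S c. finite S \<and> S \<subseteq> G}"
proof (intro equalityI subsetI)
  fix s assume "s \<in> lspan G"
  then have "\<exists>S c. finite S \<and> S \<subseteq> G \<and> s = (\<lambda>\<omega>. \<Sum>g\<in>S. c g * g \<omega>)"
  proof (induction rule: lspan.induct)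
    case lspan_zero
    then show ?case by (intro exI[of _ "{}"]) simp
  next
    case (lspan_step g s d)
    then obtain S c where S: "finite S" "S \<subseteq> G" "s = (\<lambda>\<omega>. \<Sum>g\<in>S. c g * g \<omega>)" by blast
    \<comment> \<open>\<open>g\<close> may already belong to \<open>S\<close>; its old and its new
      coefficient are then added.\<close>
    let ?c = "\<lambda>h. (if h \<in> S then c h else 0) + (if h = g then d else 0)"
    have "(\<lambda>\<omega>. d * g \<omega> + s \<omega>) = (\<lambda>\<omega>. \<Sum>h\<in>insert g S. ?c h * h \<omega>)"
    proof
      fix \<omega>
      have "(\<Sum>h\<in>insert g S. ?c h * h \<omega>) =
          (\<Sum>h\<in>insert g S. (if h \<in> S then c h * h \<omega> else 0) + (if h = g then d * h \<omega> else 0))"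
        by (intro sum.cong refl) (simp add: distrib_right)
      also have "\<dots> = (\<Sum>h\<in>insert g S. (if h \<in> S then c h * h \<omega> else 0)) + (\<Sum>h\<in>insert g S. if h = g then d * h \<omega> else 0)"
        by (rule sum.distrib)
      also have "(\<Sum>h\<in>insert g S. (if h \<in> S then c h * h \<omega> else 0)) = (\<Sum>h\<in>S. c h * h \<omega>)"
        using S(1) by (intro sum.mono_neutral_cong_right) auto
      also have "\<dots> = s \<omega>" by (simp add: S(3))
      also have "(\<Sum>h\<in>insert g S. if h = g then d * h \<omega> else 0) = d * g \<omega>"
        using S(1) by (subst sum.delta) auto
      finally show "d * g \<omega> + s \<omega> = (\<Sum>h\<in>insert g S. ?c h * h \<omega>)" by simp
    qed
    then show ?case using S lspan_step(1) by (intro exI[of _ "insert g S"] exI[of _ ?c]) blast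
  qed
  then show "s \<in> {\<lambda>\<omega>. \<Sum>g\<in>S. c g * g \<omega> | S c. finite S \<and> S \<subseteq> G}" by blast
next
  fix s assume "s \<in> {\<lambda>\<omega>. \<Sum>g\<in>S. c g * g \<omega> | S c. finite S \<and> S \<subseteq> G}"
  then obtain S c where S: "finite S" "S \<subseteq> G" and s: "s = (\<lambda>\<omega>. \<Sum>g\<in>S. c g * g \<omega>)" by blast
  show "s \<in> lspan G"
    unfolding s by (rule lspan_sum, rule lspan_scale, rule lspan_base) (use S in blast)
qed

lemma lspan_L2: "G \<subseteq> L2 M \<Longrightarrow> s \<in> lspan G \<Longrightarrow> s \<in> L2 M"
  by (rotate_tac 1, induction rule: lspan.induct) auto

definition cl :: "'w measure \<Rightarrow> ('w \<Rightarrow> real) set \<Rightarrow> ('w \<Rightarrow> real) set" where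
  "cl M G = {f \<in> L2 M. \<forall>e>0. \<exists>s\<in>lspan G. ip M (\<lambda>\<omega>. f \<omega> - s \<omega>) (\<lambda>\<omega>. f \<omega> - s \<omega>) < e}"

lemma cl_L2: "f \<in> cl M G \<Longrightarrow> f \<in> L2 M"
  by (simp add: cl_def)

text \<open>Translates (G3) into the inner product \<open>ip\<close>. The integrability of the
  squared errors, which \<open>ms_closure\<close> demands separately, is automatic for generators in
  \<open>L2\<close>.\<close>

lemma ms_closure_eq_cl:
  assumes "G \<subseteq> L2 M"
  shows "ms_closure M G = cl M G"
proof (intro equalityI subsetI)
  fix f assume f: "f \<in> ms_closure M G"
  then have "f \<in> L2 M" by (simp add: ms_closure_def L2_def)
  moreover have "\<exists>s\<in>lspan G. ip M (\<lambda>\<omega>. f \<omega> - s \<omega>) (\<lambda>\<omega>. f \<omega> - s \<omega>) < e" if "e > 0" for e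
  proof -
    from f that obtain S c where S: "finite S" "S \<subseteq> G"
      "integral\<^sup>L M (\<lambda>\<omega>. (f \<omega> - (\<Sum>g\<in>S. c g * g \<omega>))\<^sup>2) < e"
      unfolding ms_closure_def by blast
    then show ?thesis unfolding lspan_eq ip_def power2_eq_square
      by (intro bexI[of _ "\<lambda>\<omega>. \<Sum>g\<in>S. c g * g \<omega>"]) blast+
  qed
  ultimately show "f \<in> cl M G" by (simp add: cl_def)
next
  fix f assume f: "f \<in> cl M G"
  then have fL: "f \<in> L2 M" by (rule cl_L2)
  have "\<exists>S c. finite S \<and> S \<subseteq> G \<and>
        integrable M (\<lambda>\<omega>. (f \<omega> - (\<Sum>g\<in>S. c g * g \<omega>))\<^sup>2) \<and>
        integral\<^sup>L M (\<lambda>\<omega>. (f \<omega> - (\<Sum>g\<in>S. c g * g \<omega>))\<^sup>2) < e" if "e > 0" for e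
  proof -
    from f that obtain s where s: "s \<in> lspan G" "ip M (\<lambda>\<omega>. f \<omega> - s \<omega>) (\<lambda>\<omega>. f \<omega> - s \<omega>) < e"
      unfolding cl_def by blast
    from s(1) obtain S c where S: "finite S" "S \<subseteq> G" "s = (\<lambda>\<omega>. \<Sum>g\<in>S. c g * g \<omega>)"
      unfolding lspan_eq by blast
    have "(\<lambda>\<omega>. f \<omega> - s \<omega>) \<in> L2 M" using fL lspan_L2[OF assms s(1)] by simp
    then show ?thesis using S s(2) unfolding L2_def ip_def
      by (intro exI[of _ S] exI[of _ c]) (simp add: power2_eq_square)
  qed
  then show "f \<in> ms_closure M G" using fL by (simp add: ms_closure_def L2_def)
qed

context
  fixes M :: "'w measure" and G :: "('w \<Rightarrow> real) set"
  assumes G: "G \<subseteq> L2 M"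
begin

lemma lspan_cl: "s \<in> lspan G \<Longrightarrow> s \<in> cl M G"
  using lspan_L2[OF G] by (auto simp: cl_def intro!: bexI[of _ s])

lemma cl_base: "g \<in> G \<Longrightarrow> g \<in> cl M G"
  by (intro lspan_cl lspan_base)

text \<open>Closing twice adds nothing. Distances are kept squared throughout, so the triangle
  inequality \<open>ip_diff_triangle\<close> doubles each of the two errors; hence the tolerances
  \<open>e/4\<close>.\<close>

lemma cl_closed:
  assumes f: "f \<in> L2 M" and ap: "\<And>e. e > 0 \<Longrightarrow> \<exists>g\<in>cl M G. ip M (\<lambda>\<omega>. f \<omega> - g \<omega>) (\<lambda>\<omega>. f \<omega> - g \<omega>) < e"
  shows "f \<in> cl M G"
proof -
  have "\<exists>s\<in>lspan G. ip M (\<lambda>\<omega>. f \<omega> - s \<omega>) (\<lambda>\<omega>. f \<omega> - s \<omega>) < e" if e: "e > 0" for e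
  proof -
    from ap[of "e/4"] e obtain g where g: "g \<in> cl M G" "ip M (\<lambda>\<omega>. f \<omega> - g \<omega>) (\<lambda>\<omega>. f \<omega> - g \<omega>) < e/4" by auto
    then obtain s where s: "s \<in> lspan G" "ip M (\<lambda>\<omega>. g \<omega> - s \<omega>) (\<lambda>\<omega>. g \<omega> - s \<omega>) < e/4"
      using e unfolding cl_def by (auto dest!: spec[of _ "e/4"])
    show ?thesis
      using ip_diff_triangle[OF f cl_L2[OF g(1)] lspan_L2[OF G s(1)]] g(2) s by (intro bexI[of _ s]) auto
  qed
  then show ?thesis using f by (simp add: cl_def)
qed

lemma cl_add:
  assumes f: "f \<in> cl M G" and g: "g \<in> cl M G"
  shows "(\<lambda>\<omega>. f \<omega> + g \<omega>) \<in> cl M G"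
proof -
  have "\<exists>s\<in>lspan G. ip M (\<lambda>\<omega>. f \<omega> + g \<omega> - s \<omega>) (\<lambda>\<omega>. f \<omega> + g \<omega> - s \<omega>) < e" if e: "e > 0" for e
  proof -
    from f e obtain s where s: "s \<in> lspan G" "ip M (\<lambda>\<omega>. f \<omega> - s \<omega>) (\<lambda>\<omega>. f \<omega> - s \<omega>) < e/4"
      unfolding cl_def by (auto dest!: spec[of _ "e/4"])
    from g e obtain s' where s': "s' \<in> lspan G" "ip M (\<lambda>\<omega>. g \<omega> - s' \<omega>) (\<lambda>\<omega>. g \<omega> - s' \<omega>) < e/4"
      unfolding cl_def by (auto dest!: spec[of _ "e/4"])
    have "ip M (\<lambda>\<omega>. (f \<omega> - s \<omega>) + (g \<omega> - s' \<omega>)) (\<lambda>\<omega>. (f \<omega> - s \<omega>) + (g \<omega> - s' \<omega>)) < e"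
      using ip_square_sum_le[of "\<lambda>\<omega>. f \<omega> - s \<omega>" M "\<lambda>\<omega>. g \<omega> - s' \<omega>"] s s' cl_L2[OF f] cl_L2[OF g]
        lspan_L2[OF G s(1)] lspan_L2[OF G s'(1)] by simp
    then show ?thesis
      by (intro bexI[OF _ lspan_add[OF s(1) s'(1)]]) (simp add: algebra_simps)
  qed
  then show ?thesis using cl_L2[OF f] cl_L2[OF g] by (simp add: cl_def)
qed

lemma cl_scale:
  assumes f: "f \<in> cl M G"
  shows "(\<lambda>\<omega>. c * f \<omega>) \<in> cl M G"
proof (cases "c = 0")
  case True
  then show ?thesis using lspan_cl[OF lspan_zero] by simp
next
  case False
  have "\<exists>s\<in>lspan G. ip M (\<lambda>\<omega>. c * f \<omega> - s \<omega>) (\<lambda>\<omega>. c * f \<omega> - s \<omega>) < e" if e: "e > 0" for e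
  proof -
    from f e False obtain s where s: "s \<in> lspan G" "ip M (\<lambda>\<omega>. f \<omega> - s \<omega>) (\<lambda>\<omega>. f \<omega> - s \<omega>) < e / (c * c)"
      unfolding cl_def by (auto dest!: spec[of _ "e / (c * c)"] simp: zero_less_divide_iff zero_less_mult_iff)
    have "ip M (\<lambda>\<omega>. c * f \<omega> - c * s \<omega>) (\<lambda>\<omega>. c * f \<omega> - c * s \<omega>) = c * c * ip M (\<lambda>\<omega>. f \<omega> - s \<omega>) (\<lambda>\<omega>. f \<omega> - s \<omega>)"
      using ip_scale_left[of M c "\<lambda>\<omega>. f \<omega> - s \<omega>"] ip_scale_right[of M _ c "\<lambda>\<omega>. f \<omega> - s \<omega>"]
      by (simp add: right_diff_distrib)
    also have "\<dots> < e"
    proof -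
      have "c * c > 0" using False by (auto simp: zero_less_mult_iff)
      then show ?thesis using s(2) by (simp only: pos_less_divide_eq mult.commute)
    qed
    finally show ?thesis by (intro bexI[OF _ lspan_scale[OF s(1), of c]])
  qed
  then show ?thesis using cl_L2[OF f] by (simp add: cl_def)
qed

lemma cl_diff: "f \<in> cl M G \<Longrightarrow> g \<in> cl M G \<Longrightarrow> (\<lambda>\<omega>. f \<omega> - g \<omega>) \<in> cl M G"
  using cl_add[of f "\<lambda>\<omega>. -1 * g \<omega>"] cl_scale[of g "-1"] by simp

lemma cl_sum: "(\<And>i. i \<in> I \<Longrightarrow> f i \<in> cl M G) \<Longrightarrow> (\<lambda>\<omega>. \<Sum>i\<in>I. f i \<omega>) \<in> cl M G"
  by (induction I rule: infinite_finite_induct) (auto intro: cl_add lspan_cl lspan_zero)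

lemma cl_cong_AE:
  assumes f: "f \<in> cl M G" and g: "g \<in> borel_measurable M" "AE \<omega> in M. f \<omega> = g \<omega>"
  shows "g \<in> cl M G"
proof (rule cl_closed)
  show gL: "g \<in> L2 M" using L2_cong_AE[OF cl_L2[OF f] g] .
  fix e :: real assume "e > 0"
  have "ip M (\<lambda>\<omega>. g \<omega> - f \<omega>) (\<lambda>\<omega>. g \<omega> - f \<omega>) = ip M (\<lambda>_. 0) (\<lambda>_. 0)"
    by (rule ip_cong_AE) (use g cl_L2[OF f] gL in \<open>auto simp: L2_def\<close>)
  then show "\<exists>h\<in>cl M G. ip M (\<lambda>\<omega>. g \<omega> - h \<omega>) (\<lambda>\<omega>. g \<omega> - h \<omega>) < e"
    using f \<open>e > 0\<close> by (intro bexI[of _ f]) auto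
qed

text \<open>The inner product with \<open>h\<close> vanishes on the span and is continuous by
  Cauchy-Schwarz.\<close>

lemma cl_orthogonal:
  assumes h: "h \<in> L2 M" and o: "\<And>g. g \<in> G \<Longrightarrow> ip M g h = 0" and f: "f \<in> cl M G"
  shows "ip M f h = 0"
proof -
  have 0: "ip M s h = 0" if "s \<in> lspan G" for s
    using that
  proof (induction rule: lspan.induct)
    case (lspan_step g s c)
    then show ?case using G lspan_L2[OF G] h o by (subst ip_add_left) auto
  qed simp
  have "(ip M f h)\<^sup>2 \<le> e" if e: "e > 0" for e
  proof -
    \<comment> \<open>Adding 1 keeps \<open>k\<close> positive even when \<open>h\<close> vanishes,
      so that \<open>e/k\<close> is a legitimate tolerance.\<close>
    define k where "k = ip M h h + 1"
    have k: "k > 0" using ip_self_nonneg[of M h] by (simp add: k_def)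
    from f e k obtain s where s: "s \<in> lspan G" "ip M (\<lambda>\<omega>. f \<omega> - s \<omega>) (\<lambda>\<omega>. f \<omega> - s \<omega>) < e/k"
      unfolding cl_def by (auto dest!: spec[of _ "e/k"])
    have sL: "s \<in> L2 M" using lspan_L2[OF G s(1)] .
    have "(ip M f h)\<^sup>2 = (ip M (\<lambda>\<omega>. f \<omega> - s \<omega>) h)\<^sup>2"
      using 0[OF s(1)] cl_L2[OF f] sL h by (simp add: ip_diff_left)
    also have "\<dots> \<le> ip M (\<lambda>\<omega>. f \<omega> - s \<omega>) (\<lambda>\<omega>. f \<omega> - s \<omega>) * ip M h h"
      using cl_L2[OF f] sL h by (intro ip_cauchy_schwarz) auto
    also have "\<dots> \<le> e/k * k"
      using s(2) e k ip_self_nonneg[of M h] by (intro mult_mono) (auto simp: k_def)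
    finally show ?thesis using k by simp
  qed
  then have "(ip M f h)\<^sup>2 \<le> 0" by (rule field_le_epsilon) simp
  then show ?thesis by simp
qed

lemma cl_orthogonal_right:
  "h \<in> L2 M \<Longrightarrow> (\<And>g. g \<in> G \<Longrightarrow> ip M h g = 0) \<Longrightarrow> f \<in> cl M G \<Longrightarrow> ip M h f = 0"
  using cl_orthogonal by (simp add: ip_commute[of M h])

end

text \<open>Multiplication by \<open>b\<close> does not increase the mean-square norm, so it maps a
  closure into a closed set as soon as it maps the generators there. It is applied with mode
  indicators for \<open>b\<close>, and with \<open>b = 1\<close> to compare closures.\<close>

lemma cl_image:
  assumes G: "G \<subseteq> L2 M" and G': "G' \<subseteq> L2 M" and b: "b \<in> borel_measurable M" "\<And>\<omega>. \<bar>b \<omega>\<bar> \<le> (1::real)"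
    and im: "\<And>g. g \<in> G \<Longrightarrow> (\<lambda>\<omega>. g \<omega> * b \<omega>) \<in> cl M G'" and f: "f \<in> cl M G"
  shows "(\<lambda>\<omega>. f \<omega> * b \<omega>) \<in> cl M G'"
proof (rule cl_closed[OF G'])
  show "(\<lambda>\<omega>. f \<omega> * b \<omega>) \<in> L2 M" using L2_mult_bounded[OF cl_L2[OF f] b] .
  have 0: "(\<lambda>\<omega>. s \<omega> * b \<omega>) \<in> cl M G'" if "s \<in> lspan G" for s
    using that
  proof (induction rule: lspan.induct)
    case lspan_zero
    then show ?case using lspan_cl[OF G' lspan.lspan_zero] by simp
  next
    case (lspan_step g s c)
    then show ?case using cl_add[OF G' cl_scale[OF G' im[OF lspan_step(1)], of c] lspan_step(3)]
      by (simp add: algebra_simps)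
  qed
  fix e :: real assume "e > 0"
  with f obtain s where s: "s \<in> lspan G" "ip M (\<lambda>\<omega>. f \<omega> - s \<omega>) (\<lambda>\<omega>. f \<omega> - s \<omega>) < e"
    unfolding cl_def by blast
  have L: "(\<lambda>\<omega>. f \<omega> - s \<omega>) \<in> L2 M" using cl_L2[OF f] lspan_L2[OF G s(1)] by simp
  have "ip M (\<lambda>\<omega>. (f \<omega> - s \<omega>) * b \<omega>) (\<lambda>\<omega>. (f \<omega> - s \<omega>) * b \<omega>) \<le> ip M (\<lambda>\<omega>. f \<omega> - s \<omega>) (\<lambda>\<omega>. f \<omega> - s \<omega>)"
    unfolding ip_def
  proof (rule integral_mono)
    show "integrable M (\<lambda>\<omega>. (f \<omega> - s \<omega>) * (f \<omega> - s \<omega>))" using L2_mult_integrable[OF L L] .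
    show "integrable M (\<lambda>\<omega>. (f \<omega> - s \<omega>) * b \<omega> * ((f \<omega> - s \<omega>) * b \<omega>))"
      using L2_mult_integrable[OF L2_mult_bounded[OF L b] L2_mult_bounded[OF L b]] .
    fix \<omega>
    have "\<bar>b \<omega>\<bar>\<^sup>2 \<le> 1" using b(2)[of \<omega>] by (simp only: power2_eq_square mult_le_one abs_ge_zero)
    then have "b \<omega> * b \<omega> \<le> 1" by (simp add: power2_eq_square)
    then have "((f \<omega> - s \<omega>) * (f \<omega> - s \<omega>)) * (b \<omega> * b \<omega>) \<le> (f \<omega> - s \<omega>) * (f \<omega> - s \<omega>)"
      by (intro mult_left_le) auto
    then show "(f \<omega> - s \<omega>) * b \<omega> * ((f \<omega> - s \<omega>) * b \<omega>) \<le> (f \<omega> - s \<omega>) * (f \<omega> - s \<omega>)"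
      by (simp only: mult_ac)
  qed
  then show "\<exists>g\<in>cl M G'. ip M (\<lambda>\<omega>. f \<omega> * b \<omega> - g \<omega>) (\<lambda>\<omega>. f \<omega> * b \<omega> - g \<omega>) < e"
    using s(2) by (intro bexI[OF _ 0[OF s(1)]]) (simp add: left_diff_distrib)
qed

lemma cl_least:
  assumes "G \<subseteq> L2 M" "G' \<subseteq> L2 M" "G \<subseteq> cl M G'"
  shows "cl M G \<subseteq> cl M G'"
  using cl_image[OF assms(1,2), of "\<lambda>_. 1"] assms(3) by auto

lemma cl_mono: "G \<subseteq> G' \<Longrightarrow> G' \<subseteq> L2 M \<Longrightarrow> cl M G \<subseteq> cl M G'"
  by (rule cl_least) (auto intro: cl_base)

section \<open>Completeness and orthogonal projection\<close>

lemma (in finite_measure) L2_integrable: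
  assumes "f \<in> L2 M" shows "integrable M f"
proof -
  have "(\<lambda>_. 1) \<in> L2 M" by (simp add: L2_def)
  from L2_mult_integrable[OF assms this] show ?thesis by simp
qed

lemma (in prob_space) L2_abs_integral_le:
  assumes "f \<in> L2 M" shows "integral\<^sup>L M (\<lambda>\<omega>. \<bar>f \<omega>\<bar>) \<le> sqrt (ip M f f)"
proof -
  have 1: "(\<lambda>_. 1) \<in> L2 M" by (simp add: L2_def)
  have 2: "(\<lambda>\<omega>. \<bar>f \<omega>\<bar>) \<in> L2 M" using assms by (auto simp: L2_def)
  have "ip M (\<lambda>\<omega>. \<bar>f \<omega>\<bar>) (\<lambda>\<omega>. \<bar>f \<omega>\<bar>) = ip M f f" by (simp add: ip_def)
  then show ?thesis using ip_abs_le[OF 2 1] by (simp add: ip_def prob_space)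
qed

text \<open>Riesz-Fischer: on a probability space the L1 norm is at most the L2 norm, so a
  subsequence converges almost everywhere; Fatou's lemma then carries the Cauchy estimate over to
  its limit.\<close>

lemma (in prob_space) L2_complete:
  fixes s :: "nat \<Rightarrow> 'a \<Rightarrow> real"
  assumes s: "\<And>n. s n \<in> L2 M"
    and cau: "\<And>e. e > 0 \<Longrightarrow> \<exists>N. \<forall>m\<ge>N. \<forall>n\<ge>N. ip M (\<lambda>\<omega>. s m \<omega> - s n \<omega>) (\<lambda>\<omega>. s m \<omega> - s n \<omega>) < e"
  obtains f where "f \<in> L2 M"
    "\<And>e. e > 0 \<Longrightarrow> \<exists>N. \<forall>n\<ge>N. ip M (\<lambda>\<omega>. f \<omega> - s n \<omega>) (\<lambda>\<omega>. f \<omega> - s n \<omega>) \<le> e"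
proof -
  have int: "integrable M (s n)" for n using L2_integrable[OF s] .
  have c1: "\<exists>N. \<forall>i\<ge>N. \<forall>j\<ge>N. LINT x|M. norm (s i x - s j x) < e" if e: "e > 0" for e
  proof -
    from cau[of "e\<^sup>2"] e obtain N where N: "\<forall>m\<ge>N. \<forall>n\<ge>N. ip M (\<lambda>\<omega>. s m \<omega> - s n \<omega>) (\<lambda>\<omega>. s m \<omega> - s n \<omega>) < e\<^sup>2" by auto
    have "LINT x|M. norm (s i x - s j x) < e" if "i \<ge> N" "j \<ge> N" for i j
    proof -
      have "LINT x|M. norm (s i x - s j x) \<le> sqrt (ip M (\<lambda>\<omega>. s i \<omega> - s j \<omega>) (\<lambda>\<omega>. s i \<omega> - s j \<omega>))"
        using L2_abs_integral_le[of "\<lambda>\<omega>. s i \<omega> - s j \<omega>"] s by simp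
      also have "\<dots> < sqrt (e\<^sup>2)" using N that by (intro real_sqrt_less_mono) auto
      finally show ?thesis using e by simp
    qed
    then show ?thesis by blast
  qed
  from cauchy_L1_AE_cauchy_subseq[OF int c1]
  obtain r where r: "strict_mono r" "AE x in M. Cauchy (\<lambda>i. s (r i) x)" by blast
  define f where "f = (\<lambda>x. lim (\<lambda>i. s (r i) x))"
  have sm[measurable]: "s n \<in> borel_measurable M" for n using s[of n] by (simp add: L2_def)
  have fm[measurable]: "f \<in> borel_measurable M" unfolding f_def by measurable
  have fl: "AE x in M. (\<lambda>i. s (r i) x) \<longlonglongrightarrow> f x"
    using r(2) unfolding f_def by eventually_elim (simp add: Cauchy_convergent_iff convergent_LIMSEQ_iff)
  have key: "\<exists>N. \<forall>n\<ge>N. (\<lambda>\<omega>. f \<omega> - s n \<omega>) \<in> L2 M \<and> ip M (\<lambda>\<omega>. f \<omega> - s n \<omega>) (\<lambda>\<omega>. f \<omega> - s n \<omega>) \<le> e"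
    if e: "e > 0" for e
  proof -
    from cau[OF e] obtain N where N: "\<forall>m\<ge>N. \<forall>n\<ge>N. ip M (\<lambda>\<omega>. s m \<omega> - s n \<omega>) (\<lambda>\<omega>. s m \<omega> - s n \<omega>) < e" by blast
    have "(\<lambda>\<omega>. f \<omega> - s n \<omega>) \<in> L2 M \<and> ip M (\<lambda>\<omega>. f \<omega> - s n \<omega>) (\<lambda>\<omega>. f \<omega> - s n \<omega>) \<le> e" if n: "n \<ge> N" for n
    proof -
      have "(\<integral>\<^sup>+\<omega>. ennreal ((f \<omega> - s n \<omega>) * (f \<omega> - s n \<omega>)) \<partial>M)
          = (\<integral>\<^sup>+\<omega>. liminf (\<lambda>i. ennreal ((s (r i) \<omega> - s n \<omega>) * (s (r i) \<omega> - s n \<omega>))) \<partial>M)"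
      proof (rule nn_integral_cong_AE)
        show "AE \<omega> in M. ennreal ((f \<omega> - s n \<omega>) * (f \<omega> - s n \<omega>))
            = liminf (\<lambda>i. ennreal ((s (r i) \<omega> - s n \<omega>) * (s (r i) \<omega> - s n \<omega>)))"
          using fl
        proof eventually_elim
          case (elim \<omega>)
          then have "(\<lambda>i. ennreal ((s (r i) \<omega> - s n \<omega>) * (s (r i) \<omega> - s n \<omega>)))
              \<longlonglongrightarrow> ennreal ((f \<omega> - s n \<omega>) * (f \<omega> - s n \<omega>))"
            by (intro tendsto_ennrealI tendsto_intros)
          then show ?case by (simp only: lim_imp_Liminf sequentially_bot simp_thms)
        qed
      qed
      also have "\<dots> \<le> liminf (\<lambda>i. \<integral>\<^sup>+\<omega>. ennreal ((s (r i) \<omega> - s n \<omega>) * (s (r i) \<omega> - s n \<omega>)) \<partial>M)"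
        by (rule nn_integral_liminf) simp
      also have "\<dots> \<le> ennreal e"
      proof (rule Liminf_le)
        have "eventually (\<lambda>i. i \<ge> N) sequentially" by (rule eventually_ge_at_top)
        then show "eventually (\<lambda>i. (\<integral>\<^sup>+\<omega>. ennreal ((s (r i) \<omega> - s n \<omega>) * (s (r i) \<omega> - s n \<omega>)) \<partial>M) \<le> ennreal e) sequentially"
        proof eventually_elim
          case (elim i)
          then have "r i \<ge> N" using r(1) seq_suble[of r i] by linarith
          have L: "(\<lambda>\<omega>. s (r i) \<omega> - s n \<omega>) \<in> L2 M" using s by auto
          have "(\<integral>\<^sup>+\<omega>. ennreal ((s (r i) \<omega> - s n \<omega>) * (s (r i) \<omega> - s n \<omega>)) \<partial>M)
              = ennreal (ip M (\<lambda>\<omega>. s (r i) \<omega> - s n \<omega>) (\<lambda>\<omega>. s (r i) \<omega> - s n \<omega>))"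
            unfolding ip_def by (rule nn_integral_eq_integral) (use L2_mult_integrable[OF L L] in auto)
          also have "\<dots> \<le> ennreal e" using N \<open>r i \<ge> N\<close> n by (intro ennreal_leI) (simp add: less_imp_le)
          finally show ?case .
        qed
      qed simp
      finally have le: "(\<integral>\<^sup>+\<omega>. ennreal ((f \<omega> - s n \<omega>) * (f \<omega> - s n \<omega>)) \<partial>M) \<le> ennreal e" .
      have int: "integrable M (\<lambda>\<omega>. (f \<omega> - s n \<omega>) * (f \<omega> - s n \<omega>))"
        by (rule integrableI_nonneg) (use le in \<open>auto simp: less_top[symmetric] top_unique\<close>)
      have "ennreal (ip M (\<lambda>\<omega>. f \<omega> - s n \<omega>) (\<lambda>\<omega>. f \<omega> - s n \<omega>)) \<le> ennreal e"
        using le nn_integral_eq_integral[OF int] by (simp add: ip_def)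
      then show ?thesis using int e by (simp add: L2_def power2_eq_square)
    qed
    then show ?thesis by blast
  qed
  \<comment> \<open>Membership of \<open>f\<close> in \<open>L2\<close> follows from a single
    \<open>s n\<close> at finite distance.\<close>
  from key[of 1] obtain n where "(\<lambda>\<omega>. f \<omega> - s n \<omega>) \<in> L2 M" by force
  from L2_add[OF this s[of n]] have fL: "f \<in> L2 M" by simp
  have "\<exists>N. \<forall>n\<ge>N. ip M (\<lambda>\<omega>. f \<omega> - s n \<omega>) (\<lambda>\<omega>. f \<omega> - s n \<omega>) \<le> e" if "e > 0" for e
    using key[OF that] by metis
  then show thesis by (rule that[OF fL])
qed

text \<open>The distance is minimised over the span rather than its closure. A minimising sequence
  is Cauchy by the parallelogram law, because the midpoint of two of its terms is again in the span
  and so no closer to \<open>f\<close> than the infimum \<open>d\<close> allows.\<close>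

lemma (in prob_space) L2_projection_exists:
  assumes G: "G \<subseteq> L2 M" and f: "f \<in> L2 M"
  obtains g where "g \<in> cl M G" "\<And>h. h \<in> cl M G \<Longrightarrow> ip M (\<lambda>\<omega>. f \<omega> - g \<omega>) h = 0"
proof -
  let ?D = "\<lambda>s. ip M (\<lambda>\<omega>. f \<omega> - s \<omega>) (\<lambda>\<omega>. f \<omega> - s \<omega>)"
  define d where "d = (INF s\<in>lspan G. ?D s)"
  have bdd: "bdd_below (?D ` lspan G)" by (rule bdd_belowI2[of _ 0]) (rule ip_self_nonneg)
  have dle: "d \<le> ?D s" if "s \<in> lspan G" for s
    unfolding d_def using bdd that by (rule cINF_lower)
  have "\<exists>s\<in>lspan G. ?D s < d + 1 / real (Suc n)" for n
    using cINF_less_iff[OF _ bdd, of "d + 1 / real (Suc n)"] lspan_zero[of G] unfolding d_def by auto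
  then obtain s where s: "\<And>n. s n \<in> lspan G" "\<And>n. ?D (s n) < d + 1 / real (Suc n)" by metis
  have sL: "s n \<in> L2 M" for n using lspan_L2[OF G s(1)] .
  have dist: "ip M (\<lambda>\<omega>. s m \<omega> - s n \<omega>) (\<lambda>\<omega>. s m \<omega> - s n \<omega>) \<le> 2 / real (Suc m) + 2 / real (Suc n)" for m n
  proof -
    let ?mid = "\<lambda>\<omega>. (1/2) * (s m \<omega> + s n \<omega>)"
    have mid: "?mid \<in> lspan G" by (intro lspan_scale lspan_add s(1))
    have mL: "?mid \<in> L2 M" using lspan_L2[OF G mid] .
    have "ip M (\<lambda>\<omega>. (f \<omega> - s n \<omega>) - (f \<omega> - s m \<omega>)) (\<lambda>\<omega>. (f \<omega> - s n \<omega>) - (f \<omega> - s m \<omega>))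
      = 2 * ?D (s n) + 2 * ?D (s m) - ip M (\<lambda>\<omega>. (f \<omega> - s n \<omega>) + (f \<omega> - s m \<omega>)) (\<lambda>\<omega>. (f \<omega> - s n \<omega>) + (f \<omega> - s m \<omega>))"
      using f sL by (intro ip_parallelogram) auto
    also have "(\<lambda>\<omega>. (f \<omega> - s n \<omega>) + (f \<omega> - s m \<omega>)) = (\<lambda>\<omega>. 2 * (f \<omega> - ?mid \<omega>))" by (auto simp: field_simps)
    also have "ip M (\<lambda>\<omega>. 2 * (f \<omega> - ?mid \<omega>)) (\<lambda>\<omega>. 2 * (f \<omega> - ?mid \<omega>)) = 4 * ?D ?mid"
      by (subst ip_scale_left, subst ip_scale_right) simp
    finally show ?thesis using dle[OF mid] s(2)[of n] s(2)[of m] by simp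
  qed
  have cau: "\<exists>N. \<forall>m\<ge>N. \<forall>n\<ge>N. ip M (\<lambda>\<omega>. s m \<omega> - s n \<omega>) (\<lambda>\<omega>. s m \<omega> - s n \<omega>) < e" if e: "e > 0" for e
  proof -
    obtain N where N: "inverse (real (Suc N)) < e / 4" using reals_Archimedean[of "e/4"] e by auto
    have small: "2 / real (Suc m) < e / 2" if "m \<ge> N" for m
    proof -
      have "inverse (real (Suc m)) \<le> inverse (real (Suc N))" using that by (intro le_imp_inverse_le) auto
      moreover have "2 / real (Suc m) = 2 * inverse (real (Suc m))" by (simp only: divide_inverse)
      ultimately show ?thesis using N by linarith
    qed
    have "ip M (\<lambda>\<omega>. s m \<omega> - s n \<omega>) (\<lambda>\<omega>. s m \<omega> - s n \<omega>) < e" if "m \<ge> N" "n \<ge> N" for m n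
      using dist[of m n] small[OF that(1)] small[OF that(2)] by linarith
    then show ?thesis by blast
  qed
  from L2_complete[OF sL cau] obtain g where g: "g \<in> L2 M"
    "\<And>e. e > 0 \<Longrightarrow> \<exists>N. \<forall>n\<ge>N. ip M (\<lambda>\<omega>. g \<omega> - s n \<omega>) (\<lambda>\<omega>. g \<omega> - s n \<omega>) \<le> e" by blast
  have gcl: "g \<in> cl M G"
  proof -
    have "\<exists>h\<in>lspan G. ip M (\<lambda>\<omega>. g \<omega> - h \<omega>) (\<lambda>\<omega>. g \<omega> - h \<omega>) < e" if "e > 0" for e
    proof -
      from g(2)[of "e/2"] that obtain N where "ip M (\<lambda>\<omega>. g \<omega> - s N \<omega>) (\<lambda>\<omega>. g \<omega> - s N \<omega>) \<le> e/2" by auto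
      then show ?thesis using that s(1) by (intro bexI[of _ "s N"]) auto
    qed
    then show ?thesis using g(1) by (simp add: cl_def)
  qed
  have o: "ip M h (\<lambda>\<omega>. f \<omega> - g \<omega>) = 0" if hG: "h \<in> G" for h
  proof -
    have hL: "h \<in> L2 M" using hG G by auto
    let ?b = "\<lambda>n. ip M (\<lambda>\<omega>. f \<omega> - s n \<omega>) h"
    let ?k = "ip M h h + 1"
    have k: "?k > 0" using ip_self_nonneg[of M h] by simp
    \<comment> \<open>Moving \<open>s n\<close> by a suitable multiple of \<open>h\<close> lowers
      the squared distance by at least \<open>(?b n)\<^sup>2 / ?k\<close>, and the result cannot
      fall below \<open>d\<close>. The multiple is the optimal one up to the 1 added in
      \<open>?k\<close>, which avoids a division by zero.\<close>
    have bn: "(?b n)\<^sup>2 \<le> ?k * (1 / real (Suc n))" for n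
    proof -
      define c where "c = ?b n / ?k"
      have "(\<lambda>\<omega>. s n \<omega> + c * h \<omega>) \<in> lspan G"
        by (intro lspan_add[OF s(1)] lspan_scale lspan_base hG)
      then have "d \<le> ?D (\<lambda>\<omega>. s n \<omega> + c * h \<omega>)" by (rule dle)
      also have "(\<lambda>\<omega>. f \<omega> - (s n \<omega> + c * h \<omega>)) = (\<lambda>\<omega>. (f \<omega> - s n \<omega>) - c * h \<omega>)" by auto
      also have "ip M (\<lambda>\<omega>. (f \<omega> - s n \<omega>) - c * h \<omega>) (\<lambda>\<omega>. (f \<omega> - s n \<omega>) - c * h \<omega>)
          = ?D (s n) - c * ip M h (\<lambda>\<omega>. f \<omega> - s n \<omega>) - (c * ?b n - c * (c * ip M h h))"
        by (simp add: ip_diff_left[of "\<lambda>\<omega>. f \<omega> - s n \<omega>"] ip_diff_right[of "\<lambda>\<omega>. f \<omega> - s n \<omega>"] f sL hL right_diff_distrib)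
      also have "\<dots> = ?D (s n) - 2 * c * ?b n + c * c * ip M h h"
        by (simp add: ip_commute[of M h "\<lambda>\<omega>. f \<omega> - s n \<omega>"])
      also have "\<dots> \<le> ?D (s n) - 2 * c * ?b n + c * c * ?k"
        by (simp add: algebra_simps)
      also have "\<dots> = ?D (s n) - (?b n)\<^sup>2 / ?k"
      proof -
        have ck: "c * ?k = ?b n" using k by (simp add: c_def)
        have "c * c * ?k = c * ?b n" by (simp only: mult.assoc ck)
        moreover have "(?b n)\<^sup>2 / ?k = c * ?b n" by (simp add: c_def power2_eq_square)
        ultimately show ?thesis by linarith
      qed
      finally have "(?b n)\<^sup>2 / ?k \<le> 1 / real (Suc n)" using s(2)[of n] by simp
      then show ?thesis using k by (simp add: field_simps)
    qed
    have "(ip M (\<lambda>\<omega>. f \<omega> - g \<omega>) h)\<^sup>2 \<le> 0 + e" if e: "e > 0" for e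
    proof -
      from g(2)[of "e / (4 * ?k)"] e k obtain N where N:
        "\<forall>n\<ge>N. ip M (\<lambda>\<omega>. g \<omega> - s n \<omega>) (\<lambda>\<omega>. g \<omega> - s n \<omega>) \<le> e / (4 * ?k)" by auto
      obtain N' where N': "inverse (real (Suc N')) < e / (4 * ?k)"
        using reals_Archimedean[of "e / (4 * ?k)"] e k by auto
      define n where "n = max N N'"
      have "inverse (real (Suc n)) \<le> inverse (real (Suc N'))" by (intro le_imp_inverse_le) (auto simp: n_def)
      then have "1 / real (Suc n) \<le> e / (4 * ?k)" using N' by (simp only: inverse_eq_divide)
      then have "?k * (1 / real (Suc n)) \<le> ?k * (e / (4 * ?k))" using k by (intro mult_left_mono) auto
      moreover have gen: "x * (e / (4 * x)) = e / 4" "e / (4 * x) * x = e / 4" if "x > 0" for x :: real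
        using that by simp_all
      ultimately have b1: "(?b n)\<^sup>2 \<le> e / 4" using bn[of n] gen(1)[OF k] by linarith
      let ?a = "ip M (\<lambda>\<omega>. g \<omega> - s n \<omega>) h"
      have "?a\<^sup>2 \<le> ip M (\<lambda>\<omega>. g \<omega> - s n \<omega>) (\<lambda>\<omega>. g \<omega> - s n \<omega>) * ip M h h"
        using g(1) sL hL by (intro ip_cauchy_schwarz) auto
      also have "\<dots> \<le> e / (4 * ?k) * ?k"
        using N k e ip_self_nonneg[of M h] by (intro mult_mono) (auto simp: n_def)
      finally have a1: "?a\<^sup>2 \<le> e / 4" using gen(2)[OF k] by linarith
      have "ip M (\<lambda>\<omega>. f \<omega> - g \<omega>) h = ?b n - ?a"
        using f g(1) sL hL by (simp add: ip_diff_left)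
      moreover have "(?b n - ?a)\<^sup>2 \<le> 2 * (?b n)\<^sup>2 + 2 * ?a\<^sup>2"
        using zero_le_power2[of "?b n + ?a"] by (simp add: power2_eq_square algebra_simps)
      ultimately show ?thesis using a1 b1 by simp
    qed
    then have "(ip M (\<lambda>\<omega>. f \<omega> - g \<omega>) h)\<^sup>2 \<le> 0" by (rule field_le_epsilon)
    then show ?thesis by (simp add: ip_commute)
  qed
  have "ip M (\<lambda>\<omega>. f \<omega> - g \<omega>) h = 0" if "h \<in> cl M G" for h
    using cl_orthogonal[OF G _ o that] f g(1) by (simp add: ip_commute)
  then show thesis by (rule that[OF gcl])
qed

lemma L2_projection_unique:
  assumes G: "G \<subseteq> L2 M" and f: "f \<in> L2 M" and g: "g \<in> cl M G" "g' \<in> cl M G"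
    and o: "\<And>h. h \<in> G \<Longrightarrow> ip M (\<lambda>\<omega>. f \<omega> - g \<omega>) h = 0" "\<And>h. h \<in> G \<Longrightarrow> ip M (\<lambda>\<omega>. f \<omega> - g' \<omega>) h = 0"
  shows "AE \<omega> in M. g \<omega> = g' \<omega>"
proof -
  have L: "g \<in> L2 M" "g' \<in> L2 M" using g by (auto dest: cl_L2)
  have d: "(\<lambda>\<omega>. g \<omega> - g' \<omega>) \<in> cl M G" using cl_diff[OF G g] .
  have "ip M (\<lambda>\<omega>. f \<omega> - g \<omega>) (\<lambda>\<omega>. g \<omega> - g' \<omega>) = 0"
    by (rule cl_orthogonal_right[OF G _ _ d]) (use f L o in auto)
  moreover have "ip M (\<lambda>\<omega>. f \<omega> - g' \<omega>) (\<lambda>\<omega>. g \<omega> - g' \<omega>) = 0"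
    by (rule cl_orthogonal_right[OF G _ _ d]) (use f L o in auto)
  ultimately have "ip M (\<lambda>\<omega>. g \<omega> - g' \<omega>) (\<lambda>\<omega>. g \<omega> - g' \<omega>) = 0"
    using f L by (simp add: ip_diff_left)
  from ip_self_eq_0[OF _ this] L show ?thesis by auto
qed

section \<open>Projections are determined by second moments\<close>

lemma lspan_image_coeffs:
  assumes "s \<in> lspan (z ` I)"
  obtains F c where "finite F" "F \<subseteq> I" "s = (\<lambda>\<omega>. \<Sum>i\<in>F. c i * z i \<omega>)"
proof -
  from assms obtain S c where S: "finite S" "S \<subseteq> z ` I" "s = (\<lambda>\<omega>. \<Sum>g\<in>S. c g * g \<omega>)"
    unfolding lspan_eq by blast
  from subset_image_inj[of S z I] S(2) obtain F where F: "F \<subseteq> I" "inj_on z F" "S = z ` F" by blast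
  have "s = (\<lambda>\<omega>. \<Sum>i\<in>F. c (z i) * z i \<omega>)" unfolding S(3) F(3) by (subst sum.reindex[OF F(2)]) simp
  then show thesis using that[of F "c \<circ> z"] F S by (simp add: finite_image_iff)
qed

text \<open>The squared norm of a projection is the supremum of \<open>2 \<langle>f, s\<rangle> - \<parallel>s\<parallel>\<^sup>2\<close> over the span, hence
  it only depends on the Gram matrix of the generators and on the inner products \<open>\<langle>f, z i\<rangle>\<close>.\<close>
lemma projection_norm_le:
  assumes z: "z ` I \<subseteq> L2 M" "z' ` I \<subseteq> L2 M" and f: "f \<in> L2 M" "f' \<in> L2 M"
    and gram: "\<And>i j. i \<in> I \<Longrightarrow> j \<in> I \<Longrightarrow> ip M (z i) (z j) = ip M (z' i) (z' j)"
    and cross: "\<And>i. i \<in> I \<Longrightarrow> ip M f (z i) = ip M f' (z' i)"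
    and g: "g \<in> cl M (z ` I)" "\<And>h. h \<in> cl M (z ` I) \<Longrightarrow> ip M (\<lambda>\<omega>. f \<omega> - g \<omega>) h = 0"
    and g': "g' \<in> cl M (z' ` I)" "\<And>h. h \<in> cl M (z' ` I) \<Longrightarrow> ip M (\<lambda>\<omega>. f' \<omega> - g' \<omega>) h = 0"
  shows "ip M g g \<le> ip M g' g'"
proof (rule field_le_epsilon)
  fix e :: real assume "e > 0"
  with g(1) obtain s where s: "s \<in> lspan (z ` I)" "ip M (\<lambda>\<omega>. g \<omega> - s \<omega>) (\<lambda>\<omega>. g \<omega> - s \<omega>) < e"
    unfolding cl_def by blast
  have L: "g \<in> L2 M" "g' \<in> L2 M" "s \<in> L2 M" using g(1) g'(1) lspan_L2[OF z(1) s(1)] by (auto dest: cl_L2)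
  from lspan_image_coeffs[OF s(1)] obtain F c where F: "finite F" "F \<subseteq> I" "s = (\<lambda>\<omega>. \<Sum>i\<in>F. c i * z i \<omega>)" .
  define s' where "s' = (\<lambda>\<omega>. \<Sum>i\<in>F. c i * z' i \<omega>)"
  have zL: "z i \<in> L2 M" "z' i \<in> L2 M" if "i \<in> F" for i using that F z by auto
  have s'l: "s' \<in> lspan (z' ` I)" unfolding s'_def using F by (intro lspan_sum lspan_scale lspan_base) auto
  have s'L: "s' \<in> L2 M" using lspan_L2[OF z(2) s'l] .
  have "ip M s s = (\<Sum>i\<in>F. \<Sum>j\<in>F. c i * (c j * ip M (z i) (z j)))"
    unfolding F(3) using zL by (subst ip_sum_left; auto simp: ip_sum_right sum_distrib_left)
  also have "\<dots> = (\<Sum>i\<in>F. \<Sum>j\<in>F. c i * (c j * ip M (z' i) (z' j)))"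
    using F(2) by (intro sum.cong refl) (simp add: gram subset_iff)
  also have "\<dots> = ip M s' s'"
    unfolding s'_def using zL by (subst ip_sum_left; auto simp: ip_sum_right sum_distrib_left)
  finally have ss: "ip M s s = ip M s' s'" .
  have "ip M f s = (\<Sum>i\<in>F. c i * ip M f (z i))" unfolding F(3) using zL f by (subst ip_sum_right) auto
  also have "\<dots> = (\<Sum>i\<in>F. c i * ip M f' (z' i))" using F(2) by (intro sum.cong refl) (simp add: cross subset_iff)
  also have "\<dots> = ip M f' s'" unfolding s'_def using zL f by (subst ip_sum_right) auto
  finally have fs: "ip M f s = ip M f' s'" .
  have 1: "ip M f s = ip M g s" using g(2)[OF lspan_cl[OF z(1) s(1)]] L f by (simp add: ip_diff_left)
  have 2: "ip M f' s' = ip M g' s'" using g'(2)[OF lspan_cl[OF z(2) s'l]] L s'L f by (simp add: ip_diff_left)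
  have "ip M g g < 2 * ip M g s - ip M s s + e"
    using s(2) L by (simp add: ip_diff_left ip_diff_right ip_commute[of M s g])
  also have "2 * ip M g s - ip M s s = 2 * ip M g' s' - ip M s' s'" using ss fs 1 2 by simp
  also have "\<dots> \<le> ip M g' g'"
    using ip_self_nonneg[of M "\<lambda>\<omega>. g' \<omega> - s' \<omega>"] L s'L by (simp add: ip_diff_left ip_diff_right ip_commute[of M s' g'])
  finally show "ip M g g \<le> ip M g' g' + e" by simp
qed

lemma projection_norm_eq:
  assumes z: "z ` I \<subseteq> L2 M" "z' ` I \<subseteq> L2 M" and f: "f \<in> L2 M" "f' \<in> L2 M"
    and gram: "\<And>i j. i \<in> I \<Longrightarrow> j \<in> I \<Longrightarrow> ip M (z i) (z j) = ip M (z' i) (z' j)"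
    and cross: "\<And>i. i \<in> I \<Longrightarrow> ip M f (z i) = ip M f' (z' i)"
    and g: "g \<in> cl M (z ` I)" "\<And>h. h \<in> cl M (z ` I) \<Longrightarrow> ip M (\<lambda>\<omega>. f \<omega> - g \<omega>) h = 0"
    and g': "g' \<in> cl M (z' ` I)" "\<And>h. h \<in> cl M (z' ` I) \<Longrightarrow> ip M (\<lambda>\<omega>. f' \<omega> - g' \<omega>) h = 0"
  shows "ip M g g = ip M g' g'"
proof (rule antisym)
  show "ip M g g \<le> ip M g' g'" by (rule projection_norm_le[OF z f gram cross g g'])
  show "ip M g' g' \<le> ip M g g"
    by (rule projection_norm_le[OF z(2,1) f(2,1) gram[symmetric] cross[symmetric] g' g])
qed

text \<open>Polarisation: the norms of the projections of \<open>f1\<close>, \<open>f2\<close> and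
  \<open>f1 + f2\<close> determine the inner product of the first two.\<close>

lemma projection_ip_eq:
  assumes z: "z ` I \<subseteq> L2 M" "z' ` I \<subseteq> L2 M"
    and f: "f1 \<in> L2 M" "f2 \<in> L2 M" "f1' \<in> L2 M" "f2' \<in> L2 M"
    and gram: "\<And>i j. i \<in> I \<Longrightarrow> j \<in> I \<Longrightarrow> ip M (z i) (z j) = ip M (z' i) (z' j)"
    and cross: "\<And>i. i \<in> I \<Longrightarrow> ip M f1 (z i) = ip M f1' (z' i)" "\<And>i. i \<in> I \<Longrightarrow> ip M f2 (z i) = ip M f2' (z' i)"
    and g: "g1 \<in> cl M (z ` I)" "\<And>h. h \<in> cl M (z ` I) \<Longrightarrow> ip M (\<lambda>\<omega>. f1 \<omega> - g1 \<omega>) h = 0"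
      "g2 \<in> cl M (z ` I)" "\<And>h. h \<in> cl M (z ` I) \<Longrightarrow> ip M (\<lambda>\<omega>. f2 \<omega> - g2 \<omega>) h = 0"
    and g': "g1' \<in> cl M (z' ` I)" "\<And>h. h \<in> cl M (z' ` I) \<Longrightarrow> ip M (\<lambda>\<omega>. f1' \<omega> - g1' \<omega>) h = 0"
      "g2' \<in> cl M (z' ` I)" "\<And>h. h \<in> cl M (z' ` I) \<Longrightarrow> ip M (\<lambda>\<omega>. f2' \<omega> - g2' \<omega>) h = 0"
  shows "ip M g1 g2 = ip M g1' g2'"
proof -
  note L = f g(1,3)[THEN cl_L2] g'(1,3)[THEN cl_L2]
  have zL: "z i \<in> L2 M" "z' i \<in> L2 M" if "i \<in> I" for i using that z by auto
  have n1: "ip M g1 g1 = ip M g1' g1'"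
    by (rule projection_norm_eq[OF z f(1,3) gram cross(1) g(1,2) g'(1,2)])
  have n2: "ip M g2 g2 = ip M g2' g2'"
    by (rule projection_norm_eq[OF z f(2,4) gram cross(2) g(3,4) g'(3,4)])
  have d: "(\<lambda>\<omega>. f1 \<omega> + f2 \<omega> - (g1 \<omega> + g2 \<omega>)) = (\<lambda>\<omega>. (f1 \<omega> - g1 \<omega>) + (f2 \<omega> - g2 \<omega>))"
    "(\<lambda>\<omega>. f1' \<omega> + f2' \<omega> - (g1' \<omega> + g2' \<omega>)) = (\<lambda>\<omega>. (f1' \<omega> - g1' \<omega>) + (f2' \<omega> - g2' \<omega>))" by auto
  have o1: "ip M (\<lambda>\<omega>. f1 \<omega> + f2 \<omega> - (g1 \<omega> + g2 \<omega>)) h = 0" if "h \<in> cl M (z ` I)" for h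
    unfolding d using that L g cl_L2[OF that] by (subst ip_add_left) auto
  have o2: "ip M (\<lambda>\<omega>. f1' \<omega> + f2' \<omega> - (g1' \<omega> + g2' \<omega>)) h = 0" if "h \<in> cl M (z' ` I)" for h
    unfolding d using that L g' cl_L2[OF that] by (subst ip_add_left) auto
  have n3: "ip M (\<lambda>\<omega>. g1 \<omega> + g2 \<omega>) (\<lambda>\<omega>. g1 \<omega> + g2 \<omega>) = ip M (\<lambda>\<omega>. g1' \<omega> + g2' \<omega>) (\<lambda>\<omega>. g1' \<omega> + g2' \<omega>)"
  proof (rule projection_norm_eq[OF z, of "\<lambda>\<omega>. f1 \<omega> + f2 \<omega>" "\<lambda>\<omega>. f1' \<omega> + f2' \<omega>"])
    show "ip M (\<lambda>\<omega>. f1 \<omega> + f2 \<omega>) (z i) = ip M (\<lambda>\<omega>. f1' \<omega> + f2' \<omega>) (z' i)" if "i \<in> I" for i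
      using zL[OF that] cross[OF that] f by (simp add: ip_add_left)
  qed (use f gram o1 o2 cl_add[OF z(1) g(1,3)] cl_add[OF z(2) g'(1,3)] in auto)
  show ?thesis using n1 n2 n3 L by (simp add: ip_add_left ip_add_right ip_commute[of M g2 g1] ip_commute[of M g2' g1'])
qed

subsection \<open>One-sided inverses\<close>

lemma scalar_prod_self_eq_0:
  fixes v :: "real vec"
  assumes "v \<in> carrier_vec n" "scalar_prod v v = 0"
  shows "v = 0\<^sub>v n"
proof -
  have "(\<Sum>i\<in>{0..<n}. v $ i * v $ i) = 0" using assms by (auto simp: scalar_prod_def)
  then have "\<forall>i\<in>{0..<n}. v $ i * v $ i = 0" by (subst (asm) sum_nonneg_eq_0_iff) auto
  then show ?thesis using assms(1) by (intro eq_vecI) auto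
qed

lemma scalar_prod_self_nonneg: "0 \<le> scalar_prod v (v :: real vec)"
  by (auto simp: scalar_prod_def intro!: sum_nonneg)

lemma mult_mat_sum:
  assumes "A \<in> carrier_mat n m" "v \<in> carrier_vec m" "i < n"
  shows "(A *\<^sub>v v) $ i = (\<Sum>j\<in>{0..<m}. A $$ (i, j) * v $ j)"
  using assms by (auto simp: scalar_prod_def intro!: sum.cong)

lemma index_mult_mat_sum:
  assumes "A \<in> carrier_mat n m" "B \<in> carrier_mat m k" "i < n" "j < k"
  shows "(A * B) $$ (i, j) = (\<Sum>l\<in>{0..<m}. A $$ (i, l) * B $$ (l, j))"
  using assms by (auto simp: scalar_prod_def intro!: sum.cong)

text \<open>Pad both factors with zeros to square matrices of size \<open>r\<close>. A right inverse
  of a square matrix is also a left inverse, but if \<open>n < r\<close> the row \<open>n\<close> of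
  \<open>B'\<close> is zero, so \<open>B' * A'\<close> has a zero on its diagonal.\<close>

lemma wide_right_inverse_dim_le:
  fixes A B :: "real mat"
  assumes A: "A \<in> carrier_mat r n" and B: "B \<in> carrier_mat n r" and AB: "A * B = 1\<^sub>m r"
  shows "r \<le> n"
proof (rule ccontr)
  assume "\<not> r \<le> n"
  then have nr: "n < r" by simp
  define A' where "A' = mat r r (\<lambda>(i,j). if j < n then A $$ (i,j) else 0)"
  define B' where "B' = mat r r (\<lambda>(i,j). if i < n then B $$ (i,j) else 0)"
  have c: "A' \<in> carrier_mat r r" "B' \<in> carrier_mat r r" by (auto simp: A'_def B'_def)
  have "A' * B' = A * B"
  proof (rule eq_matI)
    fix i j assume "i < dim_row (A * B)" "j < dim_col (A * B)"
    then have ij: "i < r" "j < r" using A B by auto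
    have "(A' * B') $$ (i,j) = (\<Sum>l\<in>{0..<r}. A' $$ (i,l) * B' $$ (l,j))"
      by (rule index_mult_mat_sum[OF c ij])
    also have "\<dots> = (\<Sum>l\<in>{0..<n}. A $$ (i,l) * B $$ (l,j))"
      using nr ij by (intro sum.mono_neutral_cong_right) (auto simp: A'_def B'_def)
    also have "\<dots> = (A * B) $$ (i,j)" by (rule index_mult_mat_sum[OF A B ij, symmetric])
    finally show "(A' * B') $$ (i,j) = (A * B) $$ (i,j)" .
  qed (use A B c in auto)
  then have "B' * A' = 1\<^sub>m r" using mat_mult_left_right_inverse[OF c] AB by simp
  then have "(B' * A') $$ (n,n) = 1" using nr by simp
  moreover have "(B' * A') $$ (n,n) = (\<Sum>l\<in>{0..<r}. B' $$ (n,l) * A' $$ (l,n))"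
    by (rule index_mult_mat_sum[OF c(2,1) nr nr])
  ultimately show False using nr by (simp add: B'_def)
qed

lemma square_inverse_exists:
  fixes S :: "real mat"
  assumes S: "S \<in> carrier_mat n n" and inj: "\<And>v. v \<in> carrier_vec n \<Longrightarrow> S *\<^sub>v v = 0\<^sub>v n \<Longrightarrow> v = 0\<^sub>v n"
  obtains T where "T \<in> carrier_mat n n" "S * T = 1\<^sub>m n" "T * S = 1\<^sub>m n"
proof -
  have "det S \<noteq> 0" using det_0_iff_vec_prod_zero_field[OF S] inj by blast
  from det_non_zero_imp_unit[OF S this, of "()"]
  show thesis using that unfolding Units_def ring_mat_def by auto
qed

text \<open>The transpose of \<open>A\<close> is injective, hence so is \<open>A A^T\<close>, by
  definiteness of the real scalar product. The right inverse is the pseudoinverse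
  \<open>A^T (A A^T)^-1\<close>.\<close>

lemma right_inverse_exists:
  fixes A :: "real mat"
  assumes A: "A \<in> carrier_mat n c"
    and inj: "\<And>z. z \<in> carrier_vec n \<Longrightarrow> transpose_mat A *\<^sub>v z = 0\<^sub>v c \<Longrightarrow> z = 0\<^sub>v n"
  obtains B where "B \<in> carrier_mat c n" "A * B = 1\<^sub>m n"
proof -
  let ?S = "A * transpose_mat A"
  have At: "transpose_mat A \<in> carrier_mat c n" using A by simp
  have S: "?S \<in> carrier_mat n n" using A by auto
  have "v = 0\<^sub>v n" if v: "v \<in> carrier_vec n" and 0: "?S *\<^sub>v v = 0\<^sub>v n" for v
  proof (rule inj[OF v])
    let ?w = "transpose_mat A *\<^sub>v v"
    have w: "?w \<in> carrier_vec c" using At v by auto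
    have "scalar_prod ?w ?w = scalar_prod v (A *\<^sub>v ?w)"
      by (rule transpose_vec_mult_scalar[OF A w v])
    also have "A *\<^sub>v ?w = ?S *\<^sub>v v" using A At v by (simp add: assoc_mult_mat_vec)
    finally have "scalar_prod ?w ?w = 0" using 0 v by simp
    then show "?w = 0\<^sub>v c" by (rule scalar_prod_self_eq_0[OF w])
  qed
  from square_inverse_exists[OF S this] obtain T where T: "T \<in> carrier_mat n n" "?S * T = 1\<^sub>m n" by blast
  then have "A * (transpose_mat A * T) = 1\<^sub>m n" using A At by (simp add: assoc_mult_mat[OF A At T(1)])
  then show thesis using that[of "transpose_mat A * T"] At T(1) by auto
qed

lemma left_inverse_exists:
  fixes A :: "real mat"
  assumes A: "A \<in> carrier_mat r n"
    and inj: "\<And>z. z \<in> carrier_vec n \<Longrightarrow> A *\<^sub>v z = 0\<^sub>v r \<Longrightarrow> z = 0\<^sub>v n"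
  obtains B where "B \<in> carrier_mat n r" "B * A = 1\<^sub>m n"
proof -
  have At: "transpose_mat A \<in> carrier_mat n r" using A by simp
  obtain B where B: "B \<in> carrier_mat r n" "transpose_mat A * B = 1\<^sub>m n"
    using right_inverse_exists[OF At] inj by auto
  have "transpose_mat B * A = transpose_mat (transpose_mat A * B)"
    using A B(1) by (simp add: transpose_mult[OF At B(1)])
  then show thesis using that[of "transpose_mat B"] B by simp
qed

subsection \<open>Rank\<close>

text \<open>Turns the rank condition of reachability into a kernel condition. For rank
  \<open>n\<close>, a maximal independent set of columns forms an invertible square matrix;
  conversely, a right inverse of \<open>A\<close> exhibits every vector as a combination of
  columns.\<close>

lemma rank_eq_nrows_iff:
  fixes A :: "real mat"
  assumes A: "A \<in> carrier_mat n c"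
  shows "vec_space.rank n A = n \<longleftrightarrow> (\<forall>z\<in>carrier_vec n. transpose_mat A *\<^sub>v z = 0\<^sub>v c \<longrightarrow> z = 0\<^sub>v n)"
proof -
  interpret vec_space "TYPE(real)" n .
  have cc: "set (cols A) \<subseteq> carrier_vec n" using A cols_dim by blast
  show ?thesis
  proof
    assume r: "rank A = n"
    obtain S where S: "maximal S (\<lambda>T. T \<subseteq> set (cols A) \<and> lin_indpt T)"
      using maximal_exists[of "(\<lambda>T. T \<subseteq> set (cols A) \<and> lin_indpt T)" "card (set (cols A))" "{}"]
      by (meson List.finite_set card_mono empty_iff empty_subsetI finite_lin_indpt2 rev_finite_subset)
    have Sc: "card S = n" using rank_card_indpt[OF A S] r by simp
    have Ss: "S \<subseteq> set (cols A)" "lin_indpt S" using S by (auto simp: maximal_def)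
    have "finite S" using Ss(1) finite_subset by blast
    then obtain xs where xs: "set xs = S" "distinct xs" using finite_distinct_list by blast
    have lxs: "length xs = n" using xs Sc distinct_card by fastforce
    define B where "B = mat_of_cols n xs"
    have B: "B \<in> carrier_mat n n" using lxs mat_of_cols_carrier(1)[of n xs] by (simp add: B_def)
    have cB: "cols B = xs" unfolding B_def by (rule cols_mat_of_cols) (use xs(1) Ss(1) cc in auto)
    have "rank B = n" by (rule lin_indpt_full_rank[OF B]) (use xs cB Ss in auto)
    then have "det B \<noteq> 0" using det_rank_iff[OF B] by simp
    then have dB: "det (transpose_mat B) \<noteq> 0" using det_transpose[OF B] by simp
    show "\<forall>z\<in>carrier_vec n. transpose_mat A *\<^sub>v z = 0\<^sub>v c \<longrightarrow> z = 0\<^sub>v n"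
    proof (intro ballI impI)
      fix z :: "real vec" assume z: "z \<in> carrier_vec n" and 0: "transpose_mat A *\<^sub>v z = 0\<^sub>v c"
      have col0: "scalar_prod x z = 0" if "x \<in> set (cols A)" for x
      proof -
        from that obtain j where j: "j < c" "x = col A j" using A by (auto simp: cols_def)
        have "(transpose_mat A *\<^sub>v z) $ j = scalar_prod (col A j) z" using A j by simp
        then show ?thesis using 0 j by simp
      qed
      have "transpose_mat B *\<^sub>v z = 0\<^sub>v n"
      proof (rule eq_vecI)
        fix i assume "i < dim_vec (0\<^sub>v n :: real vec)"
        then have i: "i < n" by simp
        have "col B i = xs ! i" using cB i B cols_nth[of i B] by auto
        then have "col B i \<in> set (cols A)" using xs(1) Ss(1) lxs i by auto
        then show "(transpose_mat B *\<^sub>v z) $ i = 0\<^sub>v n $ i" using col0 B i by simp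
      qed (use B in simp)
      then show "z = 0\<^sub>v n" using dB det_0_iff_vec_prod_zero_field[of "transpose_mat B" n] B z by auto
    qed
  next
    assume inj: "\<forall>z\<in>carrier_vec n. transpose_mat A *\<^sub>v z = 0\<^sub>v c \<longrightarrow> z = 0\<^sub>v n"
    obtain B where B: "B \<in> carrier_mat c n" "A * B = 1\<^sub>m n" using right_inverse_exists[OF A] inj by blast
    have "span (set (cols A)) = carrier_vec n"
    proof
      show "span (set (cols A)) \<subseteq> carrier_vec n" using span_closed[OF cc] by auto
      show "carrier_vec n \<subseteq> span (set (cols A))"
      proof
        fix v :: "real vec" assume v: "v \<in> carrier_vec n"
        have "A *\<^sub>v (B *\<^sub>v v) = v" using assoc_mult_mat_vec[OF A B(1) v] B v by simp
        moreover have "B *\<^sub>v v \<in> carrier_vec c" using B v by auto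
        ultimately have "v \<in> col_space A" unfolding col_space_eq[OF A] using A v by auto
        then show "v \<in> span (set (cols A))" by (simp add: col_space_def)
      qed
    qed
    then have "span_vs (set (cols A)) = V" by (simp add: module_vec_def)
    then show "rank A = n" unfolding rank_def using dim_is_n by simp
  qed
qed

lemma rank_eq_ncols_iff:
  fixes A :: "real mat"
  assumes A: "A \<in> carrier_mat r n"
  shows "vec_space.rank r A = n \<longleftrightarrow> (\<forall>z\<in>carrier_vec n. A *\<^sub>v z = 0\<^sub>v r \<longrightarrow> z = 0\<^sub>v n)"
proof -
  interpret vec_space "TYPE(real)" r .
  show ?thesis
  proof
    assume rk: "rank A = n"
    \<comment> \<open>Rank and independence concern the set of columns, which forgets repetitions.
      Equal columns must be excluded before the coefficients of a combination can be read as a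
      vector.\<close>
    have dist: "distinct (cols A)"
    proof (rule ccontr)
      assume nd: "\<not> distinct (cols A)"
      obtain S where S: "maximal S (\<lambda>T. T \<subseteq> set (cols A) \<and> lin_indpt T)"
        using maximal_exists[of "(\<lambda>T. T \<subseteq> set (cols A) \<and> lin_indpt T)" "card (set (cols A))" "{}"]
        by (meson List.finite_set card_mono empty_iff empty_subsetI finite_lin_indpt2 rev_finite_subset)
      then have "card S \<le> card (set (cols A))" by (simp add: card_mono maximal_def)
      also have "\<dots> < length (cols A)" using nd card_distinct card_length nat_less_le by metis
      also have "\<dots> = n" using A by simp
      finally show False using rank_card_indpt[OF A S] rk by simp
    qed
    have "lin_indpt (set (cols A))" by (rule full_rank_lin_indpt[OF A rk dist])
    then show "\<forall>z\<in>carrier_vec n. A *\<^sub>v z = 0\<^sub>v r \<longrightarrow> z = 0\<^sub>v n"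
      using lin_depI[OF A _ _ _ dist] by blast
  next
    assume inj: "\<forall>z\<in>carrier_vec n. A *\<^sub>v z = 0\<^sub>v r \<longrightarrow> z = 0\<^sub>v n"
    have dist: "distinct (cols A)"
    proof (rule ccontr)
      assume "\<not> distinct (cols A)"
      then obtain i j where ij: "i < n" "j < n" "i \<noteq> j" "col A i = col A j"
        using A by (auto simp: distinct_conv_nth)
      let ?z = "unit_vec n i - unit_vec n j :: real vec"
      have e: "A *\<^sub>v unit_vec n k = col A k" if "k < n" for k
        using A that by (intro eq_vecI) (auto simp: scalar_prod_right_unit)
      have "A *\<^sub>v ?z = A *\<^sub>v unit_vec n i - A *\<^sub>v unit_vec n j"
        by (rule mult_minus_distrib_mat_vec[OF A]) auto
      also have "\<dots> = 0\<^sub>v r" using e ij A by (auto intro!: eq_vecI)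
      finally have "?z = 0\<^sub>v n" using inj by auto
      then have "?z $ i = 0" using ij by simp
      then show False using ij by simp
    qed
    have "lin_indpt (set (cols A))"
      using lin_depE[OF A _ dist] inj by blast
    then show "rank A = n" by (rule lin_indpt_full_rank[OF A dist])
  qed
qed

subsection \<open>Orthonormal bases of subspaces\<close>

text \<open>A linear subspace. Linear combinations are written as matrix-vector products because
  bases are matrices here; the case \<open>r = 0\<close> yields the zero vector.\<close>

definition lin_closed :: "nat \<Rightarrow> real vec set \<Rightarrow> bool" where
  "lin_closed n U \<longleftrightarrow> U \<subseteq> carrier_vec n \<and>
    (\<forall>r J z. J \<in> carrier_mat n r \<longrightarrow> z \<in> carrier_vec r \<longrightarrow> (\<forall>j<r. col J j \<in> U) \<longrightarrow> J *\<^sub>v z \<in> U)"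

text \<open>Only an orthonormal system inside \<open>U\<close>; that it spans \<open>U\<close> is
  carried as the separate condition
  \<open>J *\<^sub>v (transpose_mat J *\<^sub>v u) = u\<close>.\<close>

definition onb :: "nat \<Rightarrow> real vec set \<Rightarrow> nat \<Rightarrow> real mat \<Rightarrow> bool" where
  "onb n U r J \<longleftrightarrow> J \<in> carrier_mat n r \<and> transpose_mat J * J = 1\<^sub>m r \<and> (\<forall>j<r. col J j \<in> U)"

text \<open>A Gram-Schmidt step: the new column is the normalised residual of
  \<open>u\<close>.\<close>

lemma onb_extend:
  assumes U: "lin_closed n U" and J: "onb n U r J" and u: "u \<in> U" and ne: "J *\<^sub>v (transpose_mat J *\<^sub>v u) \<noteq> u"
  shows "\<exists>J'. onb n U (Suc r) J'"
proof -
  have Jc: "J \<in> carrier_mat n r" and JJ: "transpose_mat J * J = 1\<^sub>m r" and JU: "\<And>j. j < r \<Longrightarrow> col J j \<in> U"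
    using J by (auto simp: onb_def)
  have uc: "u \<in> carrier_vec n" using U u by (auto simp: lin_closed_def)
  have Jtc: "transpose_mat J \<in> carrier_mat r n" using Jc by simp
  let ?a = "transpose_mat J *\<^sub>v u"
  have ac: "?a \<in> carrier_vec r" using Jtc uc by auto
  define w where "w = u - J *\<^sub>v ?a"
  have wc: "w \<in> carrier_vec n" using uc Jc ac by (auto simp: w_def)
  have "w \<noteq> 0\<^sub>v n"
  proof
    assume "w = 0\<^sub>v n"
    then have "\<And>i. i < n \<Longrightarrow> u $ i - (J *\<^sub>v ?a) $ i = 0" using uc Jc by (auto simp: w_def vec_eq_iff)
    then have "J *\<^sub>v ?a = u" using uc Jc by (intro eq_vecI) auto
    with ne show False by simp
  qed
  then have "scalar_prod w w \<noteq> 0" using scalar_prod_self_eq_0[OF wc] by blast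
  then have pos: "scalar_prod w w > 0" using scalar_prod_self_nonneg[of w] by simp
  define s where "s = 1 / sqrt (scalar_prod w w)"
  have ss: "s * s * scalar_prod w w = 1" using pos by (simp add: s_def real_sqrt_mult_self)
  define J' where "J' = mat n (Suc r) (\<lambda>(i,j). if j < r then J $$ (i,j) else s * w $ i)"
  have J'c: "J' \<in> carrier_mat n (Suc r)" by (simp add: J'_def)
  have colJ': "col J' j = (if j < r then col J j else s \<cdot>\<^sub>v w)" if "j < Suc r" for j
    using that Jc wc by (auto intro!: eq_vecI simp: J'_def)
  have Jw: "scalar_prod (col J j) w = 0" if "j < r" for j
  proof -
    have "transpose_mat J *\<^sub>v w = ?a - transpose_mat J *\<^sub>v (J *\<^sub>v ?a)"
      unfolding w_def by (rule mult_minus_distrib_mat_vec[OF Jtc uc]) (use Jc ac in auto)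
    also have "transpose_mat J *\<^sub>v (J *\<^sub>v ?a) = ?a"
      using assoc_mult_mat_vec[OF Jtc Jc ac] JJ ac by simp
    finally have "(transpose_mat J *\<^sub>v w) $ j = 0" using that ac Jc by simp
    then show ?thesis using that Jc by simp
  qed
  have JJe: "scalar_prod (col J i) (col J j) = (if i = j then 1 else 0)" if "i < r" "j < r" for i j
  proof -
    have "(transpose_mat J * J) $$ (i,j) = scalar_prod (col J i) (col J j)" using that Jc by simp
    then show ?thesis using JJ that by simp
  qed
  have "transpose_mat J' * J' = 1\<^sub>m (Suc r)"
  proof (rule eq_matI)
    fix i j assume "i < dim_row (1\<^sub>m (Suc r) :: real mat)" "j < dim_col (1\<^sub>m (Suc r) :: real mat)"
    then have ij: "i < Suc r" "j < Suc r" by auto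
    have "(transpose_mat J' * J') $$ (i,j) = scalar_prod (col J' i) (col J' j)" using ij J'c by simp
    also have "\<dots> = (if i = j then 1 else 0)"
    proof -
      have wJ: "scalar_prod w (col J k) = 0" if "k < r" for k
        using Jw[OF that] comm_scalar_prod[of w n "col J k"] wc Jc that by auto
      show ?thesis
        using ij Jc wc JJe[of i j] Jw[of i] wJ[of j] ss
        by (auto simp: colJ' less_Suc_eq smult_scalar_prod_distrib[of _ n] scalar_prod_smult_distrib[of _ n] mult.assoc)
    qed
    finally show "(transpose_mat J' * J') $$ (i,j) = 1\<^sub>m (Suc r) $$ (i,j)" using ij by simp
  qed (use J'c in auto)
  moreover have "col J' j \<in> U" if "j < Suc r" for j
  proof (cases "j < r")
    case True then show ?thesis using colJ'[OF that] JU by simp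
  next
    case False
    \<comment> \<open>The new column is a combination of the columns of \<open>J\<close> and of
      \<open>u\<close>, hence lies in \<open>U\<close>; \<open>z\<close> holds its
      coefficients.\<close>
    define K where "K = mat n (Suc r) (\<lambda>(i,j). if j < r then J $$ (i,j) else u $ i)"
    have Kc: "K \<in> carrier_mat n (Suc r)" by (simp add: K_def)
    have "col K j = (if j < r then col J j else u)" if "j < Suc r" for j
      using that Jc uc by (auto intro!: eq_vecI simp: K_def)
    then have KU: "\<forall>j<Suc r. col K j \<in> U" using JU u by auto
    define z where "z = vec (Suc r) (\<lambda>j. if j < r then - s * ?a $ j else s)"
    have zc: "z \<in> carrier_vec (Suc r)" by (simp add: z_def)
    have "K *\<^sub>v z = s \<cdot>\<^sub>v w"
    proof (rule eq_vecI)
      fix i assume "i < dim_vec (s \<cdot>\<^sub>v w)"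
      then have i: "i < n" using wc by simp
      have "(K *\<^sub>v z) $ i = (\<Sum>j\<in>{0..<Suc r}. K $$ (i,j) * z $ j)" by (rule mult_mat_sum[OF Kc zc i])
      also have "\<dots> = (\<Sum>j\<in>{0..<r}. J $$ (i,j) * (- s * ?a $ j)) + u $ i * s"
        using i by (simp add: K_def z_def)
      also have "(\<Sum>j\<in>{0..<r}. J $$ (i,j) * (- s * ?a $ j)) = - s * (J *\<^sub>v ?a) $ i"
        unfolding mult_mat_sum[OF Jc ac i] sum_distrib_left by (intro sum.cong refl) simp
      finally show "(K *\<^sub>v z) $ i = (s \<cdot>\<^sub>v w) $ i" using i wc uc Jc by (simp add: w_def algebra_simps)
    qed (use Kc wc in auto)
    then have "s \<cdot>\<^sub>v w \<in> U" using U Kc zc KU unfolding lin_closed_def by metis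
    then show ?thesis using colJ'[OF that] False by simp
  qed
  ultimately show ?thesis using J'c by (auto simp: onb_def)
qed

lemma onb_dim_le:
  assumes "onb n U r J" shows "r \<le> n"
  using assms wide_right_inverse_dim_le[of "transpose_mat J" r n J] by (auto simp: onb_def)

text \<open>A system of maximal size spans, since otherwise it could be extended; sizes are bounded
  by \<open>n\<close>.\<close>

lemma onb_exists:
  assumes U: "lin_closed n U"
  obtains r J where "onb n U r J" "\<And>u. u \<in> U \<Longrightarrow> J *\<^sub>v (transpose_mat J *\<^sub>v u) = u"
proof -
  let ?P = "\<lambda>r. \<exists>J. onb n U r J"
  have "?P 0"
    by (intro exI[of _ "0\<^sub>m n 0"]) (auto simp: onb_def intro!: eq_matI)
  moreover have "\<forall>r. ?P r \<longrightarrow> r \<le> n" using onb_dim_le by blast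
  ultimately obtain r where r: "?P r" "\<And>r'. ?P r' \<Longrightarrow> r' \<le> r"
    using Nat.ex_has_greatest_nat[of ?P 0 n] by blast
  then obtain J where J: "onb n U r J" by blast
  have "J *\<^sub>v (transpose_mat J *\<^sub>v u) = u" if "u \<in> U" for u
    using onb_extend[OF U J that] r(2)[of "Suc r"] by force
  with J show thesis by (rule that)
qed

text \<open>The coordinates of the smaller basis in the larger one form a matrix with orthonormal
  columns. This compares dimensions through one-sided inverses alone.\<close>

lemma onb_subset_factor:
  assumes J: "onb n U r J" "\<And>u. u \<in> U \<Longrightarrow> J *\<^sub>v (transpose_mat J *\<^sub>v u) = u"
    and J': "onb n U' r' J'" and sub: "U' \<subseteq> U"
  shows "J * (transpose_mat J * J') = J'" "transpose_mat (transpose_mat J * J') * (transpose_mat J * J') = 1\<^sub>m r'" "r' \<le> r"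
proof -
  have c: "J \<in> carrier_mat n r" "J' \<in> carrier_mat n r'" "transpose_mat J \<in> carrier_mat r n"
    "transpose_mat J' \<in> carrier_mat r' n"
    and o': "transpose_mat J' * J' = 1\<^sub>m r'" using J J' by (auto simp: onb_def)
  let ?X = "transpose_mat J * J'"
  have X: "?X \<in> carrier_mat r r'" "transpose_mat ?X \<in> carrier_mat r' r" using c by auto
  show eq: "J * ?X = J'"
  proof (rule mat_col_eqI)
    fix j assume "j < dim_col J'"
    then have j: "j < r'" using c by simp
    have "col (J * ?X) j = J *\<^sub>v (transpose_mat J *\<^sub>v col J' j)"
      using c j X by (simp add: col_mult2[OF c(1) X(1) j] col_mult2[OF c(3,2) j])
    also have "\<dots> = col J' j" using J(2) J' sub j by (auto simp: onb_def)
    finally show "col (J * ?X) j = col J' j" .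
  qed (use c in auto)
  have "transpose_mat ?X * ?X = transpose_mat J' * (J * ?X)"
  proof -
    have "transpose_mat ?X = transpose_mat J' * J" using transpose_mult[OF c(3,2)] by simp
    then show ?thesis using assoc_mult_mat[OF c(4,1) X(1)] by simp
  qed
  then show "transpose_mat ?X * ?X = 1\<^sub>m r'" using eq o' by simp
  then show "r' \<le> r" by (rule wide_right_inverse_dim_le[OF X(2,1)])
qed

text \<open>Equal sizes make the coordinate matrix \<open>?X\<close> square, hence orthogonal, so
  that \<open>J\<close> is in turn expressed through \<open>J'\<close>.\<close>

lemma onb_subset_eq:
  assumes U: "lin_closed n U'" "U \<subseteq> carrier_vec n" and J: "onb n U r J" "\<And>u. u \<in> U \<Longrightarrow> J *\<^sub>v (transpose_mat J *\<^sub>v u) = u"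
    and J': "onb n U' r J'" and sub: "U' \<subseteq> U"
  shows "U \<subseteq> U'"
proof
  fix u assume u: "u \<in> U"
  have c: "J \<in> carrier_mat n r" "J' \<in> carrier_mat n r" "transpose_mat J \<in> carrier_mat r n"
    using J J' by (auto simp: onb_def)
  have uc: "u \<in> carrier_vec n" using U u by auto
  let ?X = "transpose_mat J * J'"
  have X: "?X \<in> carrier_mat r r" "transpose_mat ?X \<in> carrier_mat r r" using c by auto
  note f = onb_subset_factor[OF J J' sub]
  have XX: "?X * transpose_mat ?X = 1\<^sub>m r" by (rule mat_mult_left_right_inverse[OF X(2,1) f(2)])
  have "J' * transpose_mat ?X = J * (?X * transpose_mat ?X)"
    using f(1) assoc_mult_mat[OF c(1) X] by simp
  also have "\<dots> = J" using XX c by simp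
  finally have JX: "J = J' * transpose_mat ?X" ..
  let ?a = "transpose_mat J *\<^sub>v u"
  have a: "?a \<in> carrier_vec r" using c uc by auto
  have "u = (J' * transpose_mat ?X) *\<^sub>v ?a" using J(2)[OF u] JX by simp
  also have "\<dots> = J' *\<^sub>v (transpose_mat ?X *\<^sub>v ?a)" by (rule assoc_mult_mat_vec[OF c(2) X(2) a])
  finally have "u = J' *\<^sub>v (transpose_mat ?X *\<^sub>v ?a)" .
  moreover have "transpose_mat ?X *\<^sub>v ?a \<in> carrier_vec r" by (rule mult_mat_vec_carrier[OF X(2) a])
  ultimately show "u \<in> U'" using U(1) c(2) J' unfolding lin_closed_def onb_def by metis
qed

subsection \<open>Unobservable subspaces\<close>

text \<open>A family of maps \<open>A q' q\<close> from the space at \<open>q\<close> to the space at \<open>q'\<close> with outputs \<open>Ob q\<close>.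
  Reachability of a system is observability for the transposed data.\<close>

fun unobs :: "'q set \<Rightarrow> ('q \<Rightarrow> nat) \<Rightarrow> ('q \<Rightarrow> 'q \<Rightarrow> real mat) \<Rightarrow> ('q \<Rightarrow> real mat set) \<Rightarrow> nat \<Rightarrow> 'q \<Rightarrow> real vec set" where
  "unobs Q n A Ob 0 q = carrier_vec (n q)"
| "unobs Q n A Ob (Suc k) q = {z \<in> carrier_vec (n q). (\<forall>C\<in>Ob q. C *\<^sub>v z = 0\<^sub>v (dim_row C)) \<and>
     (\<forall>q'\<in>Q. A q' q *\<^sub>v z \<in> unobs Q n A Ob k q')}"

context
  fixes Q :: "'q set" and n :: "'q \<Rightarrow> nat" and A :: "'q \<Rightarrow> 'q \<Rightarrow> real mat" and Ob :: "'q \<Rightarrow> real mat set"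
  assumes A: "\<And>q q'. q \<in> Q \<Longrightarrow> q' \<in> Q \<Longrightarrow> A q' q \<in> carrier_mat (n q') (n q)"
    and Ob: "\<And>q C. q \<in> Q \<Longrightarrow> C \<in> Ob q \<Longrightarrow> dim_col C = n q"
    and Q: "finite Q"
begin

lemma unobs_lin_closed: "q \<in> Q \<Longrightarrow> lin_closed (n q) (unobs Q n A Ob k q)"
proof (induction k arbitrary: q)
  case 0
  then show ?case by (auto simp: lin_closed_def)
next
  case (Suc k)
  show ?case unfolding lin_closed_def
  proof (intro conjI allI impI)
    fix r J and z :: "real vec" assume J: "J \<in> carrier_mat (n q) r" and z: "z \<in> carrier_vec r"
      and cols: "\<forall>j<r. col J j \<in> unobs Q n A Ob (Suc k) q"
    have "C *\<^sub>v (J *\<^sub>v z) = 0\<^sub>v (dim_row C)" if C: "C \<in> Ob q" for C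
    proof -
      have Cc: "C \<in> carrier_mat (dim_row C) (n q)" using Ob[OF Suc.prems C] by auto
      have "C * J = 0\<^sub>m (dim_row C) r"
      proof (rule mat_col_eqI)
        fix j assume "j < dim_col (0\<^sub>m (dim_row C) r :: real mat)"
        then have j: "j < r" by simp
        then have "C *\<^sub>v col J j = 0\<^sub>v (dim_row C)" using cols C by simp
        then show "col (C * J) j = col (0\<^sub>m (dim_row C) r) j" using col_mult2[OF Cc J j] j by simp
      qed (use J in auto)
      moreover have "0\<^sub>m (dim_row C) r *\<^sub>v z = 0\<^sub>v (dim_row C)"
        using z by (intro eq_vecI) auto
      ultimately show ?thesis using assoc_mult_mat_vec[OF Cc J z] by simp
    qed
    moreover have "A q' q *\<^sub>v (J *\<^sub>v z) \<in> unobs Q n A Ob k q'" if q': "q' \<in> Q" for q'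
    proof -
      have Ac: "A q' q \<in> carrier_mat (n q') (n q)" using A Suc.prems q' by simp
      have "\<forall>j<r. col (A q' q * J) j \<in> unobs Q n A Ob k q'"
        using cols q' by (auto simp: col_mult2[OF Ac J])
      then have "(A q' q * J) *\<^sub>v z \<in> unobs Q n A Ob k q'"
        using Suc.IH[OF q'] mult_carrier_mat[OF Ac J] z unfolding lin_closed_def by blast
      then show ?thesis using assoc_mult_mat_vec[OF Ac J z] by simp
    qed
    ultimately show "J *\<^sub>v z \<in> unobs Q n A Ob (Suc k) q" using J z by auto
  qed auto
qed

lemma unobs_carrier: "unobs Q n A Ob k q \<subseteq> carrier_vec (n q)"
  by (cases k) auto

lemma unobs_antimono: "unobs Q n A Ob (Suc k) q \<subseteq> unobs Q n A Ob k q"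
proof (induction k arbitrary: q)
  case (Suc k)
  show ?case
  proof
    fix z assume "z \<in> unobs Q n A Ob (Suc (Suc k)) q"
    then have z: "z \<in> carrier_vec (n q)" "\<forall>C\<in>Ob q. C *\<^sub>v z = 0\<^sub>v (dim_row C)"
      "\<forall>q'\<in>Q. A q' q *\<^sub>v z \<in> unobs Q n A Ob (Suc k) q'" by (simp_all only: unobs.simps) blast+
    have "\<forall>q'\<in>Q. A q' q *\<^sub>v z \<in> unobs Q n A Ob k q'" using z(3) Suc.IH by blast
    then show "z \<in> unobs Q n A Ob (Suc k) q" using z(1,2) by simp
  qed
qed auto

text \<open>The dimension summed over all modes strictly drops until every mode is stationary at
  once. A single mode may pause while another one still shrinks and then drop again, which is why
  the bound is the total dimension and not \<open>n q\<close>.\<close>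

lemma unobs_stable:
  assumes q: "q \<in> Q"
  shows "unobs Q n A Ob (\<Sum>q\<in>Q. n q) q = unobs Q n A Ob (Suc (\<Sum>q\<in>Q. n q)) q"
proof -
  let ?Z = "unobs Q n A Ob"
  have "\<forall>k q. \<exists>r J. q \<in> Q \<longrightarrow> onb (n q) (?Z k q) r J \<and> (\<forall>u\<in>?Z k q. J *\<^sub>v (transpose_mat J *\<^sub>v u) = u)"
    using onb_exists[OF unobs_lin_closed] by metis
  then obtain r J where rJ: "\<And>k q. q \<in> Q \<Longrightarrow> onb (n q) (?Z k q) (r k q) (J k q)"
    "\<And>k q u. q \<in> Q \<Longrightarrow> u \<in> ?Z k q \<Longrightarrow> J k q *\<^sub>v (transpose_mat (J k q) *\<^sub>v u) = u" by metis
  have rle: "r (Suc k) q \<le> r k q" if "q \<in> Q" for k q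
    by (rule onb_subset_factor(3)[OF rJ[OF that] rJ(1)[OF that] unobs_antimono])
  have req: "?Z (Suc k) q = ?Z k q" if "q \<in> Q" "r (Suc k) q = r k q" for k q
  proof (rule antisym[OF unobs_antimono])
    have o: "onb (n q) (?Z (Suc k) q) (r k q) (J (Suc k) q)" using rJ(1)[OF that(1), of "Suc k"] that(2) by simp
    show "?Z k q \<subseteq> ?Z (Suc k) q"
      by (rule onb_subset_eq[OF unobs_lin_closed[OF that(1)] unobs_carrier rJ[OF that(1)] o unobs_antimono])
  qed
  have step: "\<forall>q\<in>Q. ?Z (Suc (Suc k)) q = ?Z (Suc k) q" if "\<forall>q\<in>Q. ?Z (Suc k) q = ?Z k q" for k
    using that by simp
  \<comment> \<open>Each unstable step costs at least one dimension in total; when \<open>k\<close>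
    is the total dimension, the second alternative is absurd.\<close>
  have *: "(\<forall>q\<in>Q. ?Z (Suc k) q = ?Z k q) \<or> (\<Sum>q\<in>Q. r (Suc k) q) + Suc k \<le> (\<Sum>q\<in>Q. n q)" for k
  proof (induction k)
    case 0
    show ?case
    proof (cases "\<forall>q\<in>Q. r (Suc 0) q = r 0 q")
      case True then show ?thesis using req by blast
    next
      case False
      then have "(\<Sum>q\<in>Q. r (Suc 0) q) < (\<Sum>q\<in>Q. r 0 q)"
        using rle Q by (intro sum_strict_mono_ex1) (auto simp: order_less_le)
      also have "\<dots> \<le> (\<Sum>q\<in>Q. n q)" using rJ(1) onb_dim_le by (intro sum_mono) blast
      finally show ?thesis by simp
    qed
  next
    case (Suc k)
    show ?case
    proof (cases "\<forall>q\<in>Q. r (Suc (Suc k)) q = r (Suc k) q")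
      case True then show ?thesis using req by blast
    next
      case False
      then have lt: "(\<Sum>q\<in>Q. r (Suc (Suc k)) q) < (\<Sum>q\<in>Q. r (Suc k) q)"
        using rle Q by (intro sum_strict_mono_ex1) (auto simp: order_less_le)
      show ?thesis using Suc.IH
      proof
        assume "\<forall>q\<in>Q. ?Z (Suc k) q = ?Z k q"
        from step[OF this] show ?thesis by blast
      qed (use lt in auto)
    qed
  qed
  show ?thesis using *[of "\<Sum>q\<in>Q. n q"] q by auto
qed

text \<open>The columns of \<open>J q\<close> are an orthonormal basis of the orthogonal complement of the unobservable
  subspace.\<close>
lemma observable_reduction:
  obtains r J where
    "\<And>q. q \<in> Q \<Longrightarrow> J q \<in> carrier_mat (n q) (r q)"
    "\<And>q. q \<in> Q \<Longrightarrow> transpose_mat (J q) * J q = 1\<^sub>m (r q)"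
    "\<And>q C. q \<in> Q \<Longrightarrow> C \<in> Ob q \<Longrightarrow> J q * transpose_mat (J q) * transpose_mat C = transpose_mat C"
    "\<And>q q'. q \<in> Q \<Longrightarrow> q' \<in> Q \<Longrightarrow>
        J q * transpose_mat (J q) * (transpose_mat (A q' q) * J q') = transpose_mat (A q' q) * J q'"
    "\<And>q. q \<in> Q \<Longrightarrow> r q \<le> n q"
    "\<And>q. q \<in> Q \<Longrightarrow> r q = n q \<Longrightarrow> unobs Q n A Ob (\<Sum>q\<in>Q. n q) q \<subseteq> {0\<^sub>v (n q)}"
proof -
  define U where "U = unobs Q n A Ob (\<Sum>q\<in>Q. n q)"
  have Uc: "U q \<subseteq> carrier_vec (n q)" for q unfolding U_def by (rule unobs_carrier)
  have UC: "C *\<^sub>v u = 0\<^sub>v (dim_row C)" if "q \<in> Q" "u \<in> U q" "C \<in> Ob q" for q u C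
    using that unobs_stable[OF that(1)] unfolding U_def by auto
  have UA: "A q' q *\<^sub>v u \<in> U q'" if "q \<in> Q" "q' \<in> Q" "u \<in> U q" for q q' u
    using that unobs_stable[OF that(1)] unfolding U_def by auto
  \<comment> \<open>\<open>U\<close> is invariant under the maps \<open>A\<close>, so its orthogonal
    complement \<open>W\<close> is invariant under their transposes. It contains the rows of the
    outputs because these annihilate \<open>U\<close>.\<close>
  define W where "W q = {w \<in> carrier_vec (n q). \<forall>u\<in>U q. scalar_prod u w = 0}" for q
  have Wl: "lin_closed (n q) (W q)" for q unfolding lin_closed_def
  proof (intro conjI allI impI)
    fix r J and z :: "real vec" assume J: "J \<in> carrier_mat (n q) r" and z: "z \<in> carrier_vec r" and c: "\<forall>j<r. col J j \<in> W q"
    have "scalar_prod u (J *\<^sub>v z) = 0" if u: "u \<in> U q" for u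
    proof -
      have uc: "u \<in> carrier_vec (n q)" using u Uc by auto
      have "transpose_mat J *\<^sub>v u = 0\<^sub>v r"
      proof (rule eq_vecI)
        fix j assume "j < dim_vec (0\<^sub>v r :: real vec)"
        then have j: "j < r" by simp
        have "scalar_prod (col J j) u = scalar_prod u (col J j)"
          using J uc j by (intro comm_scalar_prod[of _ "n q"]) auto
        then show "(transpose_mat J *\<^sub>v u) $ j = 0\<^sub>v r $ j" using c j u J by (simp add: W_def)
      qed (use J in auto)
      then show ?thesis using transpose_vec_mult_scalar[OF J z uc] z by simp
    qed
    then show "J *\<^sub>v z \<in> W q" using J z by (auto simp: W_def)
  qed (auto simp: W_def)
  have "\<forall>q. \<exists>r J. onb (n q) (W q) r J \<and> (\<forall>u\<in>W q. J *\<^sub>v (transpose_mat J *\<^sub>v u) = u)"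
    using onb_exists[OF Wl] by metis
  then obtain r J where rJ: "\<And>q. onb (n q) (W q) (r q) (J q)"
    "\<And>q u. u \<in> W q \<Longrightarrow> J q *\<^sub>v (transpose_mat (J q) *\<^sub>v u) = u" by metis
  have Jc: "J q \<in> carrier_mat (n q) (r q)" "transpose_mat (J q) \<in> carrier_mat (r q) (n q)"
    and Jo: "transpose_mat (J q) * J q = 1\<^sub>m (r q)" for q using rJ(1)[of q] by (auto simp: onb_def)
  have proj: "J q * transpose_mat (J q) * B = B" if B: "B \<in> carrier_mat (n q) k" "\<And>j. j < k \<Longrightarrow> col B j \<in> W q" for q B k
  proof (rule mat_col_eqI)
    fix j assume "j < dim_col B"
    then have j: "j < k" using B by simp
    have "col (J q * transpose_mat (J q) * B) j = (J q * transpose_mat (J q)) *\<^sub>v col B j"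
      by (rule col_mult2[OF _ B(1) j]) (use Jc[of q] in auto)
    also have "\<dots> = J q *\<^sub>v (transpose_mat (J q) *\<^sub>v col B j)"
      by (rule assoc_mult_mat_vec[OF Jc]) (use B j in auto)
    also have "\<dots> = col B j" using rJ(2) B(2)[OF j] by blast
    finally show "col (J q * transpose_mat (J q) * B) j = col B j" .
  qed (use B Jc[of q] in auto)
  show thesis
  proof (rule that[of J r])
    fix q C assume q: "q \<in> Q" and C: "C \<in> Ob q"
    define m where "m = dim_row C"
    have Cc: "C \<in> carrier_mat m (n q)" using Ob[OF q C] by (auto simp: m_def)
    show "J q * transpose_mat (J q) * transpose_mat C = transpose_mat C"
    proof (rule proj[of _ q m])
      show "transpose_mat C \<in> carrier_mat (n q) m" using Cc by simp
      fix j assume j: "j < m"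
      have "scalar_prod u (row C j) = 0" if "u \<in> U q" for u
      proof -
        have uc: "u \<in> carrier_vec (n q)" using that Uc by blast
        have "scalar_prod u (row C j) = scalar_prod (row C j) u"
          by (rule comm_scalar_prod[OF uc row_carrier_vec[OF j Cc]])
        also have "\<dots> = (C *\<^sub>v u) $ j" using j by (simp add: m_def)
        also have "\<dots> = 0" unfolding UC[OF q that C] using j by (simp add: m_def)
        finally show ?thesis .
      qed
      then show "col (transpose_mat C) j \<in> W q" using Cc j by (auto simp: W_def)
    qed
  next
    fix q q' assume q: "q \<in> Q" "q' \<in> Q"
    have Ac: "A q' q \<in> carrier_mat (n q') (n q)" using A q by simp
    show "J q * transpose_mat (J q) * (transpose_mat (A q' q) * J q') = transpose_mat (A q' q) * J q'"
    proof (rule proj[of _ q "r q'"])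
      show "transpose_mat (A q' q) * J q' \<in> carrier_mat (n q) (r q')" using Ac Jc[of q'] by auto
      fix j assume j: "j < r q'"
      have w: "col (J q') j \<in> W q'" using rJ(1) j by (auto simp: onb_def)
      have "scalar_prod u (transpose_mat (A q' q) *\<^sub>v col (J q') j) = 0" if u: "u \<in> U q" for u
      proof -
        have uc: "u \<in> carrier_vec (n q)" using u Uc by auto
        have "scalar_prod u (transpose_mat (A q' q) *\<^sub>v col (J q') j) = scalar_prod (A q' q *\<^sub>v u) (col (J q') j)"
          using transpose_vec_mult_scalar[of "transpose_mat (A q' q)" "n q" "n q'" "col (J q') j" u] Ac uc w
          by (simp add: W_def)
        then show ?thesis using w UA[OF q u] by (simp add: W_def)
      qed
      then show "col (transpose_mat (A q' q) * J q') j \<in> W q"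
        using Ac w by (subst col_mult2[OF _ Jc(1) j]) (auto simp: W_def)
    qed
  next
    fix q assume q: "q \<in> Q"
    show "r q \<le> n q" using onb_dim_le rJ(1) by blast
    \<comment> \<open>In full dimension \<open>J q\<close> is an orthogonal matrix. Its columns are
      orthogonal to the unobservable subspace, which is therefore trivial.\<close>
    assume eq: "r q = n q"
    show "unobs Q n A Ob (\<Sum>q\<in>Q. n q) q \<subseteq> {0\<^sub>v (n q)}"
    proof
      fix u assume "u \<in> unobs Q n A Ob (\<Sum>q\<in>Q. n q) q"
      then have u: "u \<in> U q" by (simp add: U_def)
      have uc: "u \<in> carrier_vec (n q)" using u Uc by auto
      have "transpose_mat (J q) *\<^sub>v u = 0\<^sub>v (n q)"
      proof (rule eq_vecI)
        fix j assume "j < dim_vec (0\<^sub>v (n q) :: real vec)"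
        then have j: "j < r q" using eq by simp
        have w: "col (J q) j \<in> W q" using rJ(1) j by (auto simp: onb_def)
        have "scalar_prod (col (J q) j) u = scalar_prod u (col (J q) j)"
          using w uc by (intro comm_scalar_prod[of _ "n q"]) (auto simp: W_def)
        then show "(transpose_mat (J q) *\<^sub>v u) $ j = 0\<^sub>v (n q) $ j"
          using w u j Jc(1)[of q] eq by (simp add: W_def)
      qed (use Jc(1)[of q] eq in auto)
      moreover have "J q * transpose_mat (J q) = 1\<^sub>m (n q)"
        using mat_mult_left_right_inverse[of "transpose_mat (J q)" "n q" "J q"] Jc(1)[of q] Jo[of q] eq by simp
      ultimately have "u = 0\<^sub>v (n q)"
        using assoc_mult_mat_vec[OF Jc(1,2) uc] uc Jc(1)[of q] eq by auto
      then show "u \<in> {0\<^sub>v (n q)}" by simp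
    qed
  qed (use Jc Jo in auto)
qed

end

subsection \<open>Decay of linear iterations\<close>

lemma smult_mat_vec_assoc:
  fixes A :: "'a :: comm_ring_1 mat"
  assumes "A \<in> carrier_mat n m" "v \<in> carrier_vec m"
  shows "(c \<cdot>\<^sub>m A) *\<^sub>v v = c \<cdot>\<^sub>v (A *\<^sub>v v)" "A *\<^sub>v (c \<cdot>\<^sub>v v) = c \<cdot>\<^sub>v (A *\<^sub>v v)"
  using assms by (auto intro!: eq_vecI sum.cong simp: scalar_prod_def sum_distrib_left mult_ac)

lemma pow_mat_Suc_vec:
  fixes B :: "'a :: comm_ring_1 mat"
  assumes B: "B \<in> carrier_mat n n" and u: "u \<in> carrier_vec n"
  shows "B ^\<^sub>m Suc k *\<^sub>v u = B *\<^sub>v (B ^\<^sub>m k *\<^sub>v u)"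
  using u
proof (induction k arbitrary: u)
  case (Suc k)
  have Bu: "B *\<^sub>v u \<in> carrier_vec n" and Bk: "B ^\<^sub>m k \<in> carrier_mat n n" "B ^\<^sub>m Suc k \<in> carrier_mat n n"
    using B Suc.prems by (auto simp del: pow_mat.simps)
  have "B ^\<^sub>m Suc (Suc k) *\<^sub>v u = B ^\<^sub>m Suc k *\<^sub>v (B *\<^sub>v u)"
    unfolding pow_mat.simps(2)[of B "Suc k"] by (rule assoc_mult_mat_vec[OF Bk(2) B Suc.prems])
  also have "\<dots> = B *\<^sub>v (B ^\<^sub>m k *\<^sub>v (B *\<^sub>v u))" by (rule Suc.IH[OF Bu])
  also have "B ^\<^sub>m k *\<^sub>v (B *\<^sub>v u) = B ^\<^sub>m Suc k *\<^sub>v u"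
    unfolding pow_mat.simps(2)[of B k] by (rule assoc_mult_mat_vec[OF Bk(1) B Suc.prems, symmetric])
  finally show ?case .
qed (use B in auto)

text \<open>Dividing by a number \<open>\<rho>\<close> strictly between the spectral radius and 1
  leaves a matrix whose spectral radius is still below 1. Its powers are bounded, so the original
  iterates are bounded by a multiple of \<open>\<rho> ^ k\<close>.\<close>

lemma linear_iteration_tendsto_0:
  fixes A :: "complex mat" and v :: "nat \<Rightarrow> complex vec"
  assumes A: "A \<in> carrier_mat n n" and ev: "\<And>ev. eigenvalue A ev \<Longrightarrow> cmod ev < 1"
    and v: "v 0 \<in> carrier_vec n" "\<And>k. v (Suc k) = A *\<^sub>v v k" and i: "i < n"
  shows "(\<lambda>k. v k $ i) \<longlonglongrightarrow> 0"
proof -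
  have vc: "v k \<in> carrier_vec n" for k by (induction k) (use A v in auto)
  have n: "n > 0" using i by simp
  have sp: "spectrum A = {ev. eigenvalue A ev}" by (auto simp: spectrum_def)
  from spectral_radius_mem_max(1)[OF A n] ev have sr: "spectral_radius A < 1" by (auto simp: sp)
  from spectral_radius_mem_max(1)[OF A n] have sr0: "0 \<le> spectral_radius A" by auto
  define \<rho> where "\<rho> = (spectral_radius A + 1) / 2"
  have \<rho>: "0 < \<rho>" "\<rho> < 1" "spectral_radius A < \<rho>" using sr sr0 by (auto simp: \<rho>_def)
  define c where "c = complex_of_real (1 / \<rho>)"
  have c0: "c \<noteq> 0" using \<rho> by (simp add: c_def)
  define B where "B = c \<cdot>\<^sub>m A"
  have B: "B \<in> carrier_mat n n" using A by (simp add: B_def)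
  have evB: "cmod e < 1" if "eigenvalue B e" for e
  proof -
    from that obtain u where u: "u \<in> carrier_vec n" "u \<noteq> 0\<^sub>v n" "B *\<^sub>v u = e \<cdot>\<^sub>v u"
      using B unfolding eigenvalue_def eigenvector_def by auto
    have cA: "c \<cdot>\<^sub>v (A *\<^sub>v u) = e \<cdot>\<^sub>v u"
      using u(3) smult_mat_vec_assoc(1)[OF A u(1)] by (simp add: B_def)
    have "A *\<^sub>v u = (e / c) \<cdot>\<^sub>v u"
    proof (rule eq_vecI)
      fix i assume "i < dim_vec ((e / c) \<cdot>\<^sub>v u)"
      then have i: "i < n" using u by simp
      have "(c \<cdot>\<^sub>v (A *\<^sub>v u)) $ i = (e \<cdot>\<^sub>v u) $ i" by (simp only: cA)
      then have "c * (A *\<^sub>v u) $ i = e * u $ i" using i A u by (simp del: index_mult_mat_vec)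
      then show "(A *\<^sub>v u) $ i = ((e / c) \<cdot>\<^sub>v u) $ i" using c0 i u by (simp add: field_simps del: index_mult_mat_vec)
    qed (use A u in auto)
    then have "eigenvalue A (e / c)" using u A unfolding eigenvalue_def eigenvector_def by auto
    then have "cmod (e / c) \<le> spectral_radius A"
      using spectral_radius_mem_max(2)[OF A n] by (auto simp: sp)
    then have "cmod e * \<rho> \<le> spectral_radius A" using \<rho> by (simp add: c_def norm_divide norm_mult)
    then have "cmod e * \<rho> < 1 * \<rho>" using \<rho>(3) by linarith
    then show ?thesis using \<rho>(1) by (simp only: mult_less_cancel_right_pos)
  qed
  have "spectral_radius B < 1"
    using spectral_radius_mem_max(1)[OF B n] evB by (auto simp: spectrum_def)
  from spectral_radius_jnf_norm_bound_less_1_upper_triangular[OF B this]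
  obtain b where b: "\<And>k. norm_bound (B ^\<^sub>m k) b" by blast
  have vk: "v k = complex_of_real (\<rho> ^ k) \<cdot>\<^sub>v (B ^\<^sub>m k *\<^sub>v v 0)" for k
  proof (induction k)
    case 0
    then show ?case using v(1) B by simp
  next
    case (Suc k)
    have Bk: "B ^\<^sub>m k *\<^sub>v v 0 \<in> carrier_vec n" using B v(1) by (intro mult_mat_vec_carrier[of _ n n]) auto
    have "v (Suc k) = complex_of_real (\<rho> ^ k) \<cdot>\<^sub>v (A *\<^sub>v (B ^\<^sub>m k *\<^sub>v v 0))"
      using v(2)[of k] Suc smult_mat_vec_assoc(2)[OF A Bk] by simp
    also have "A *\<^sub>v (B ^\<^sub>m k *\<^sub>v v 0) = complex_of_real \<rho> \<cdot>\<^sub>v (B *\<^sub>v (B ^\<^sub>m k *\<^sub>v v 0))"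
      unfolding B_def smult_mat_vec_assoc(1)[OF A Bk[unfolded B_def]]
      using \<rho> by (simp add: c_def smult_smult_assoc flip: of_real_mult)
    also have "B *\<^sub>v (B ^\<^sub>m k *\<^sub>v v 0) = B ^\<^sub>m Suc k *\<^sub>v v 0" by (rule pow_mat_Suc_vec[OF B v(1), symmetric])
    finally show ?case by (simp only: smult_smult_assoc power_Suc of_real_mult mult.commute[of "complex_of_real \<rho>"])
  qed
  have bd: "cmod (v k $ i) \<le> \<rho> ^ k * (\<Sum>j\<in>{0..<n}. b * cmod (v 0 $ j))" for k
  proof -
    have Bk: "B ^\<^sub>m k \<in> carrier_mat n n" using B by simp
    have "cmod ((B ^\<^sub>m k *\<^sub>v v 0) $ i) = cmod (\<Sum>j\<in>{0..<n}. (B ^\<^sub>m k) $$ (i,j) * v 0 $ j)"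
      by (simp only: mult_mat_sum[OF Bk v(1) i])
    also have "\<dots> \<le> (\<Sum>j\<in>{0..<n}. cmod ((B ^\<^sub>m k) $$ (i,j) * v 0 $ j))" by (rule norm_sum)
    also have "\<dots> \<le> (\<Sum>j\<in>{0..<n}. b * cmod (v 0 $ j))"
      using b[of k, unfolded norm_bound_def, rule_format, of i] carrier_matD[OF Bk] i
      by (intro sum_mono) (simp add: norm_mult mult_right_mono)
    finally have le: "cmod ((B ^\<^sub>m k *\<^sub>v v 0) $ i) \<le> (\<Sum>j\<in>{0..<n}. b * cmod (v 0 $ j))" .
    have "B ^\<^sub>m k *\<^sub>v v 0 \<in> carrier_vec n" by (rule mult_mat_vec_carrier[OF Bk v(1)])
    then have "i < dim_vec (B ^\<^sub>m k *\<^sub>v v 0)" using i by (simp only: carrier_vecD)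
    then have "v k $ i = complex_of_real (\<rho> ^ k) * (B ^\<^sub>m k *\<^sub>v v 0) $ i"
      by (subst vk[of k]) (rule index_smult_vec(1))
    then have "cmod (v k $ i) = \<rho> ^ k * cmod ((B ^\<^sub>m k *\<^sub>v v 0) $ i)"
      using \<rho> by (simp only: norm_mult norm_of_real) simp
    then show ?thesis using le \<rho> by (simp only:) (rule mult_left_mono, auto)
  qed
  have "(\<lambda>k. \<rho> ^ k * (\<Sum>j\<in>{0..<n}. b * cmod (v 0 $ j))) \<longlonglongrightarrow> 0 * (\<Sum>j\<in>{0..<n}. b * cmod (v 0 $ j))"
    using \<rho> by (intro tendsto_intros LIMSEQ_power_zero) simp
  then show ?thesis using bd by (intro Lim_null_comparison[of "\<lambda>k. v k $ i"]) auto
qed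

subsection \<open>Congruence sums\<close>

text \<open>Entry \<open>(c, e)\<close> of the congruence \<open>A S A^T\<close>, on entry
  functions, so that real covariances and complex eigenvectors obey the same lemmas.\<close>

definition sand :: "nat \<Rightarrow> (nat \<Rightarrow> nat \<Rightarrow> 'a::comm_ring_1) \<Rightarrow> (nat \<Rightarrow> nat \<Rightarrow> 'a) \<Rightarrow> nat \<Rightarrow> nat \<Rightarrow> 'a" where
  "sand n A S c e = (\<Sum>a\<in>{0..<n}. \<Sum>b\<in>{0..<n}. A c a * A e b * S a b)"

lemma sand_cong:
  "(\<And>a. a < n \<Longrightarrow> A c a = A' c a) \<Longrightarrow> (\<And>a. a < n \<Longrightarrow> A e a = A' e a) \<Longrightarrow>
   (\<And>a b. a < n \<Longrightarrow> b < n \<Longrightarrow> S a b = S' a b) \<Longrightarrow> sand n A S c e = sand n A' S' c e"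
  unfolding sand_def by (intro sum.cong refl) simp

lemma sum4_swap: "(\<Sum>a\<in>I. \<Sum>b\<in>J. \<Sum>k\<in>K. \<Sum>l\<in>L. f a b k l) = (\<Sum>k\<in>K. \<Sum>l\<in>L. \<Sum>a\<in>I. \<Sum>b\<in>J. f a b k l)"
  (is "?l = ?r")
proof -
  have "?l = (\<Sum>a\<in>I. \<Sum>k\<in>K. \<Sum>l\<in>L. \<Sum>b\<in>J. f a b k l)"
    by (intro sum.cong refl, subst sum.swap, intro sum.cong refl, rule sum.swap)
  also have "\<dots> = ?r"
    by (subst sum.swap, intro sum.cong refl, rule sum.swap)
  finally show ?thesis .
qed

text \<open>Associativity in the form \<open>A (J S J^T) A^T = (A J) S (A J)^T\<close>.\<close>

lemma sand_sand:
  "sand n A (sand r J S) c e = sand r (\<lambda>c k. \<Sum>a\<in>{0..<n}. A c a * J a k) S c e"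
proof -
  have "sand n A (sand r J S) c e =
     (\<Sum>a\<in>{0..<n}. \<Sum>b\<in>{0..<n}. \<Sum>k\<in>{0..<r}. \<Sum>l\<in>{0..<r}. (A c a * J a k) * (A e b * J b l) * S k l)"
    unfolding sand_def sum_distrib_left by (intro sum.cong refl) (simp add: mult_ac)
  also have "\<dots> = (\<Sum>k\<in>{0..<r}. \<Sum>l\<in>{0..<r}. \<Sum>a\<in>{0..<n}. \<Sum>b\<in>{0..<n}. (A c a * J a k) * (A e b * J b l) * S k l)"
    by (rule sum4_swap)
  also have "\<dots> = sand r (\<lambda>c k. \<Sum>a\<in>{0..<n}. A c a * J a k) S c e"
    unfolding sand_def sum_product by (simp only: sum_distrib_right)
  finally show ?thesis .
qed

lemma sand_sum: "sand n A (\<lambda>a b. \<Sum>i\<in>I. k i * S i a b) c e = (\<Sum>i\<in>I. k i * sand n A (S i) c e)"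
proof -
  have "sand n A (\<lambda>a b. \<Sum>i\<in>I. k i * S i a b) c e
      = (\<Sum>a\<in>{0..<n}. \<Sum>b\<in>{0..<n}. \<Sum>i\<in>I. k i * (A c a * A e b * S i a b))"
    unfolding sand_def sum_distrib_left by (intro sum.cong refl) (simp add: mult_ac)
  also have "\<dots> = (\<Sum>a\<in>{0..<n}. \<Sum>i\<in>I. \<Sum>b\<in>{0..<n}. k i * (A c a * A e b * S i a b))"
    by (intro sum.cong refl) (rule sum.swap)
  also have "\<dots> = (\<Sum>i\<in>I. \<Sum>a\<in>{0..<n}. \<Sum>b\<in>{0..<n}. k i * (A c a * A e b * S i a b))"
    by (rule sum.swap)
  finally show ?thesis by (simp add: sand_def sum_distrib_left)
qed

text \<open>All eigenvalues of the operator that sends the family \<open>X\<close> to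
  \<open>\<Sum>i. K i j * A i j X_i (A i j)^T\<close> lie in the open unit disc. It is phrased with
  families of entries instead of one large matrix, so that a change of basis in each mode does not
  interfere with the numbering of blocks.\<close>

definition contractive :: "nat set \<Rightarrow> (nat \<Rightarrow> nat) \<Rightarrow> (nat \<Rightarrow> nat \<Rightarrow> real) \<Rightarrow> (nat \<Rightarrow> nat \<Rightarrow> nat \<Rightarrow> nat \<Rightarrow> real) \<Rightarrow> bool" where
  "contractive Q n K A \<longleftrightarrow> (\<forall>X ev. (\<exists>i\<in>Q. \<exists>a<n i. \<exists>b<n i. X i a b \<noteq> 0) \<longrightarrow>
     (\<forall>j\<in>Q. \<forall>c<n j. \<forall>e<n j.
        (\<Sum>i\<in>Q. complex_of_real (K i j) * sand (n i) (\<lambda>c a. complex_of_real (A i j c a)) (X i) c e) = ev * X j c e) \<longrightarrow>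
     cmod ev < 1)"

lemma contractive_restrict:
  assumes ct: "contractive Q n K A"
    and LJ: "\<And>i k l. i \<in> Q \<Longrightarrow> k < r i \<Longrightarrow> l < r i \<Longrightarrow> (\<Sum>a\<in>{0..<n i}. L i k a * J i a l) = (if k = l then 1 else 0)"
    and AJ: "\<And>i j c k. i \<in> Q \<Longrightarrow> j \<in> Q \<Longrightarrow> c < n j \<Longrightarrow> k < r i \<Longrightarrow>
        (\<Sum>a\<in>{0..<n i}. A i j c a * J i a k) = (\<Sum>l\<in>{0..<r j}. J j c l * A' i j l k)"
  shows "contractive Q r K A'"
  unfolding contractive_def
proof (intro allI impI)
  fix X :: "nat \<Rightarrow> nat \<Rightarrow> nat \<Rightarrow> complex" and ev
  assume ne: "\<exists>i\<in>Q. \<exists>a<r i. \<exists>b<r i. X i a b \<noteq> 0"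
    and eig: "\<forall>j\<in>Q. \<forall>c<r j. \<forall>e<r j.
        (\<Sum>i\<in>Q. complex_of_real (K i j) * sand (r i) (\<lambda>c a. complex_of_real (A' i j c a)) (X i) c e) = ev * X j c e"
  let ?J = "\<lambda>i a k. complex_of_real (J i a k)"
  define Y where "Y i = sand (r i) (?J i) (X i)" for i
  have id: "sand (r i) (\<lambda>k l. if k = l then 1 else 0) S k l = S k l" if "k < r i" "l < r i" for i k l and S :: "nat \<Rightarrow> nat \<Rightarrow> complex"
  proof -
    have "sand (r i) (\<lambda>k l. if k = l then 1 else 0) S k l = (\<Sum>a\<in>{0..<r i}. if k = a then (\<Sum>b\<in>{0..<r i}. if l = b then S a b else 0) else 0)"
    proof (unfold sand_def, intro sum.cong refl)
      fix a
      have "(\<Sum>b\<in>{0..<r i}. (if k = a then 1 else 0) * (if l = b then 1 else 0) * S a b) =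
          (\<Sum>b\<in>{0..<r i}. if k = a then (if l = b then S a b else 0) else 0)"
        by (intro sum.cong refl) simp
      then show "(\<Sum>b\<in>{0..<r i}. (if k = a then 1 else 0) * (if l = b then 1 else 0) * S a b) =
          (if k = a then (\<Sum>b\<in>{0..<r i}. if l = b then S a b else 0) else 0)" by simp
    qed
    then show ?thesis using that by simp
  qed
  \<comment> \<open>The left inverse \<open>L\<close> recovers \<open>X\<close> from
    \<open>Y = J X J^T\<close>; so \<open>Y\<close> does not vanish, as an eigenvector must
    not.\<close>
  have LY: "sand (n i) (\<lambda>k a. complex_of_real (L i k a)) (Y i) k l = X i k l" if "i \<in> Q" "k < r i" "l < r i" for i k l
  proof -
    have "sand (n i) (\<lambda>k a. complex_of_real (L i k a)) (Y i) k l
        = sand (r i) (\<lambda>c k. \<Sum>a\<in>{0..<n i}. complex_of_real (L i c a) * ?J i a k) (X i) k l"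
      unfolding Y_def by (rule sand_sand)
    also have "\<dots> = sand (r i) (\<lambda>k l. if k = l then 1 else 0) (X i) k l"
    proof (rule sand_cong)
      fix a assume a: "a < r i"
      show "(\<Sum>b\<in>{0..<n i}. complex_of_real (L i k b) * ?J i b a) = (if k = a then 1 else 0)"
        using arg_cong[OF LJ[OF that(1,2) a], of complex_of_real] by (simp cong: if_cong)
      show "(\<Sum>b\<in>{0..<n i}. complex_of_real (L i l b) * ?J i b a) = (if l = a then 1 else 0)"
        using arg_cong[OF LJ[OF that(1,3) a], of complex_of_real] by (simp cong: if_cong)
    qed simp
    finally show ?thesis using id[OF that(2,3)] by simp
  qed
  have "\<exists>i\<in>Q. \<exists>a<n i. \<exists>b<n i. Y i a b \<noteq> 0"
  proof (rule ccontr)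
    assume "\<not> ?thesis"
    then have z: "\<And>i a b. i \<in> Q \<Longrightarrow> a < n i \<Longrightarrow> b < n i \<Longrightarrow> Y i a b = 0" by blast
    from ne obtain i a b where iab: "i \<in> Q" "a < r i" "b < r i" "X i a b \<noteq> 0" by blast
    have "sand (n i) (\<lambda>k a. complex_of_real (L i k a)) (Y i) a b = 0"
      unfolding sand_def using z[OF iab(1)] by simp
    then show False using LY[OF iab(1-3)] iab(4) by simp
  qed
  moreover have "(\<Sum>i\<in>Q. complex_of_real (K i j) * sand (n i) (\<lambda>c a. complex_of_real (A i j c a)) (Y i) c e) = ev * Y j c e"
    if j: "j \<in> Q" and c: "c < n j" and e: "e < n j" for j c e
  proof -
    have "sand (n i) (\<lambda>c a. complex_of_real (A i j c a)) (Y i) c e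
        = sand (r j) (?J j) (sand (r i) (\<lambda>c a. complex_of_real (A' i j c a)) (X i)) c e" if i: "i \<in> Q" for i
    proof -
      have "sand (n i) (\<lambda>c a. complex_of_real (A i j c a)) (Y i) c e
          = sand (r i) (\<lambda>c k. \<Sum>a\<in>{0..<n i}. complex_of_real (A i j c a) * ?J i a k) (X i) c e"
        unfolding Y_def by (rule sand_sand)
      also have "\<dots> = sand (r i) (\<lambda>c k. \<Sum>l\<in>{0..<r j}. ?J j c l * complex_of_real (A' i j l k)) (X i) c e"
      proof (rule sand_cong)
        fix k assume k: "k < r i"
        show "(\<Sum>a\<in>{0..<n i}. complex_of_real (A i j c a) * ?J i a k) = (\<Sum>l\<in>{0..<r j}. ?J j c l * complex_of_real (A' i j l k))"
          using arg_cong[OF AJ[OF i j c k], of complex_of_real] by simp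
        show "(\<Sum>a\<in>{0..<n i}. complex_of_real (A i j e a) * ?J i a k) = (\<Sum>l\<in>{0..<r j}. ?J j e l * complex_of_real (A' i j l k))"
          using arg_cong[OF AJ[OF i j e k], of complex_of_real] by simp
      qed simp
      also have "\<dots> = sand (r j) (?J j) (sand (r i) (\<lambda>c a. complex_of_real (A' i j c a)) (X i)) c e"
        by (rule sand_sand[symmetric])
      finally show ?thesis .
    qed
    then have "(\<Sum>i\<in>Q. complex_of_real (K i j) * sand (n i) (\<lambda>c a. complex_of_real (A i j c a)) (Y i) c e)
        = (\<Sum>i\<in>Q. complex_of_real (K i j) * sand (r j) (?J j) (sand (r i) (\<lambda>c a. complex_of_real (A' i j c a)) (X i)) c e)"
      by simp
    also have "\<dots> = sand (r j) (?J j) (\<lambda>a b. \<Sum>i\<in>Q. complex_of_real (K i j) * sand (r i) (\<lambda>c a. complex_of_real (A' i j c a)) (X i) a b) c e"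
      by (rule sand_sum[symmetric])
    also have "\<dots> = sand (r j) (?J j) (\<lambda>a b. ev * X j a b) c e"
      using eig j by (intro sand_cong) auto
    also have "\<dots> = ev * Y j c e"
      unfolding Y_def sand_def sum_distrib_left by (intro sum.cong refl) (simp add: mult_ac)
    finally show ?thesis .
  qed
  ultimately show "cmod ev < 1" using ct unfolding contractive_def by blast
qed

subsection \<open>Block matrices indexed by pairs\<close>

definition boff :: "(nat \<Rightarrow> nat) \<Rightarrow> nat \<Rightarrow> nat" where
  "boff s i = (\<Sum>r\<in>{1..<i}. s r)"

lemma boff_Suc: "i \<ge> 1 \<Longrightarrow> boff s (Suc i) = boff s i + s i"
  by (simp add: boff_def)

lemma boff_mono: "i \<le> j \<Longrightarrow> boff s i \<le> boff s j"
  unfolding boff_def by (rule sum_mono2) auto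

lemma boff_less: "1 \<le> i \<Longrightarrow> i < j \<Longrightarrow> boff s i + s i \<le> boff s j"
  using boff_mono[of "Suc i" j s] boff_Suc[of i s] by simp

lemma boff_total: "(\<Sum>r\<in>{1..d}. s r) = boff s (Suc d)"
  by (simp add: boff_def atLeastLessThanSuc_atLeastAtMost)

lemma boff_unique:
  assumes "1 \<le> i" "1 \<le> j" "boff s i \<le> x" "x < boff s i + s i" "boff s j \<le> x" "x < boff s j + s j"
  shows "i = j"
  using assms boff_less[of i j s] boff_less[of j i s] by (cases i j rule: linorder_cases) auto

lemma boff_exists: "x < boff s (Suc d) \<Longrightarrow> \<exists>i\<in>{1..d}. boff s i \<le> x \<and> x < boff s i + s i"
proof (induction d)
  case (Suc d)
  show ?case
  proof (cases "x < boff s (Suc d)")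
    case True with Suc.IH show ?thesis by fastforce
  next
    case False
    with Suc.prems show ?thesis by (intro bexI[of _ "Suc d"]) (auto simp: boff_Suc)
  qed
qed (simp add: boff_def)

lemma sum_boff: "(\<Sum>x\<in>{0..<boff s (Suc d)}. f x) = (\<Sum>i\<in>{1..d}. \<Sum>k\<in>{0..<s i}. f (boff s i + k))"
proof (induction d)
  case (Suc d)
  have "(\<Sum>x\<in>{0..<boff s (Suc (Suc d))}. f x) = (\<Sum>x\<in>{0..<boff s (Suc d)}. f x) + (\<Sum>x\<in>{boff s (Suc d)..<boff s (Suc d) + s (Suc d)}. f x)"
    by (simp add: boff_Suc sum.atLeastLessThan_concat)
  also have "(\<Sum>x\<in>{boff s (Suc d)..<boff s (Suc d) + s (Suc d)}. f x) = (\<Sum>k\<in>{0..<s (Suc d)}. f (boff s (Suc d) + k))"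
    using sum.shift_bounds_nat_ivl[of f 0 "boff s (Suc d)" "s (Suc d)"] by (simp add: add.commute)
  finally show ?case using Suc.IH by simp
qed (simp add: boff_def)

lemma sum_square: "(\<Sum>k\<in>{0..<n * n}. g k) = (\<Sum>a\<in>{0..<n}. \<Sum>b\<in>{0..<n}. g (a * n + b :: nat))"
proof -
  have "(\<Sum>k\<in>{0..<n * n}. g k) = (\<Sum>a\<in>{..<n}. \<Sum>k\<in>{a * n..<a * n + n}. g k)"
    using sum.nat_group[of g n n] by (simp add: lessThan_atLeast0)
  also have "\<dots> = (\<Sum>a\<in>{0..<n}. \<Sum>b\<in>{0..<n}. g (a * n + b))"
    using sum.shift_bounds_nat_ivl[of g 0 "_ * n" n] by (simp add: add.commute lessThan_atLeast0)
  finally show ?thesis .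
qed

definition bsz :: "(nat \<Rightarrow> nat) \<Rightarrow> nat \<Rightarrow> nat" where "bsz n i = n i * n i"

text \<open>The position of entry \<open>(a, b)\<close> of block \<open>i\<close> in the stacked
  vector: row-major inside the block, which is the order in which \<open>kron\<close> numbers pairs
  of indices.\<close>

definition bix :: "(nat \<Rightarrow> nat) \<Rightarrow> nat \<Rightarrow> nat \<Rightarrow> nat \<Rightarrow> nat" where
  "bix n i a b = boff (bsz n) i + (a * n i + b)"

lemma sq_index_less: "a < n \<Longrightarrow> b < n \<Longrightarrow> a * n + b < n * (n::nat)"
  by (metis add.commute add_less_cancel_left less_le_trans mult_Suc mult_le_mono1 Suc_leI mult.commute)

lemma bix_less: "i \<in> {1..d} \<Longrightarrow> a < n i \<Longrightarrow> b < n i \<Longrightarrow> bix n i a b < boff (bsz n) (Suc d)"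
  using sq_index_less[of a "n i" b] boff_less[of i "Suc d" "bsz n"] by (auto simp: bix_def bsz_def)

lemma sum_bix:
  "(\<Sum>x\<in>{0..<boff (bsz n) (Suc d)}. f x) = (\<Sum>i\<in>{1..d}. \<Sum>a\<in>{0..<n i}. \<Sum>b\<in>{0..<n i}. f (bix n i a b))"
  unfolding sum_boff bix_def by (simp add: bsz_def sum_square)

lemma bix_exists:
  assumes "x < boff (bsz n) (Suc d)"
  shows "\<exists>i a b. i \<in> {1..d} \<and> a < n i \<and> b < n i \<and> x = bix n i a b"
proof -
  from boff_exists[OF assms] obtain i where i: "i \<in> {1..d}" "boff (bsz n) i \<le> x" "x < boff (bsz n) i + bsz n i" by blast
  define k where "k = x - boff (bsz n) i"
  have k: "k < n i * n i" "x = boff (bsz n) i + k" using i by (auto simp: k_def bsz_def)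
  then have "n i > 0" by (cases "n i") auto
  then have "k div n i < n i" "k mod n i < n i" "k = k div n i * n i + k mod n i"
    using k(1) by (auto simp: less_mult_imp_div_less)
  then show ?thesis using i(1) k(2) unfolding bix_def by metis
qed

lemma bix_inject:
  assumes "1 \<le> i" "1 \<le> j" "a < n i" "b < n i" "c < n j" "e < n j" "bix n i a b = bix n j c e"
  shows "i = j \<and> a = c \<and> b = e"
proof -
  have ij: "i = j"
    by (rule boff_unique[of i j "bsz n" "bix n i a b"])
      (use assms sq_index_less[of a "n i" b] sq_index_less[of c "n j" e] in \<open>auto simp: bix_def bsz_def\<close>)
  then have e: "a * n i + b = c * n i + e" using assms(7) by (simp add: bix_def)
  have "(a * n i + b) div n i = (c * n i + e) div n i" "(a * n i + b) mod n i = (c * n i + e) mod n i" using e by simp_all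
  then show ?thesis using assms ij by simp
qed

text \<open>Block order of the stability matrix; at \<open>bix n i a b\<close> the \<open>SOME\<close> term is \<open>X i a b\<close>, by injectivity.\<close>
definition bvec :: "nat \<Rightarrow> (nat \<Rightarrow> nat) \<Rightarrow> (nat \<Rightarrow> nat \<Rightarrow> nat \<Rightarrow> 'a) \<Rightarrow> 'a vec" where
  "bvec d n X = vec (boff (bsz n) (Suc d)) (\<lambda>x. SOME y. \<exists>i a b. i \<in> {1..d} \<and> a < n i \<and> b < n i \<and> x = bix n i a b \<and> y = X i a b)"

lemma bvec_index:
  assumes "i \<in> {1..d}" "a < n i" "b < n i"
  shows "bvec d n X $ bix n i a b = X i a b"
proof -
  have "(SOME y. \<exists>j c e. j \<in> {1..d} \<and> c < n j \<and> e < n j \<and> bix n i a b = bix n j c e \<and> y = X j c e) = X i a b"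
    by (rule some_equality) (use assms bix_inject[of i _ a n b] in \<open>auto dest!: bix_inject[of i _ a n b, rotated -1]\<close>)
  then show ?thesis using bix_less[where n=n, OF assms] by (simp add: bvec_def)
qed

text \<open>The rule \<open>(A \<otimes> A) vec X = vec (A X A^T)\<close>, block by block.\<close>

lemma block_mult:
  fixes B :: "complex mat"
  assumes B: "B \<in> carrier_mat (boff (bsz n) (Suc d)) (boff (bsz n) (Suc d))"
    and Be: "\<And>i j a b c e. i \<in> {1..d} \<Longrightarrow> j \<in> {1..d} \<Longrightarrow> a < n i \<Longrightarrow> b < n i \<Longrightarrow> c < n j \<Longrightarrow> e < n j \<Longrightarrow>
      B $$ (bix n j c e, bix n i a b) = complex_of_real (K i j * (A i j c a * A i j e b))"
    and v: "v \<in> carrier_vec (boff (bsz n) (Suc d))" and j: "j \<in> {1..d}" "c < n j" "e < n j"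
  shows "(B *\<^sub>v v) $ bix n j c e =
    (\<Sum>i\<in>{1..d}. complex_of_real (K i j) * sand (n i) (\<lambda>c a. complex_of_real (A i j c a)) (\<lambda>a b. v $ bix n i a b) c e)"
proof -
  have "(B *\<^sub>v v) $ bix n j c e = (\<Sum>x\<in>{0..<boff (bsz n) (Suc d)}. B $$ (bix n j c e, x) * v $ x)"
    using B v bix_less[of j d c n e] j by (auto simp: scalar_prod_def intro!: sum.cong)
  also have "\<dots> = (\<Sum>i\<in>{1..d}. \<Sum>a\<in>{0..<n i}. \<Sum>b\<in>{0..<n i}. B $$ (bix n j c e, bix n i a b) * v $ bix n i a b)"
    by (rule sum_bix)
  also have "\<dots> = (\<Sum>i\<in>{1..d}. complex_of_real (K i j) * sand (n i) (\<lambda>c a. complex_of_real (A i j c a)) (\<lambda>a b. v $ bix n i a b) c e)"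
    unfolding sand_def sum_distrib_left
  proof (intro sum.cong refl)
    fix i a b assume "i \<in> {1..d}" "a \<in> {0..<n i}" "b \<in> {0..<n i}"
    then show "B $$ (bix n j c e, bix n i a b) * v $ bix n i a b =
        complex_of_real (K i j) * (complex_of_real (A i j c a) * complex_of_real (A i j e b) * v $ bix n i a b)"
      using Be[of i j a b c e] j by simp
  qed
  finally show ?thesis .
qed

lemma contractive_iff_eigenvalues:
  fixes B :: "complex mat"
  assumes B: "B \<in> carrier_mat (boff (bsz n) (Suc d)) (boff (bsz n) (Suc d))"
    and Be: "\<And>i j a b c e. i \<in> {1..d} \<Longrightarrow> j \<in> {1..d} \<Longrightarrow> a < n i \<Longrightarrow> b < n i \<Longrightarrow> c < n j \<Longrightarrow> e < n j \<Longrightarrow>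
      B $$ (bix n j c e, bix n i a b) = complex_of_real (K i j * (A i j c a * A i j e b))"
  shows "(\<forall>ev. eigenvalue B ev \<longrightarrow> cmod ev < 1) \<longleftrightarrow> contractive {1..d} n K A"
proof
  let ?N = "boff (bsz n) (Suc d)"
  assume ev: "\<forall>ev. eigenvalue B ev \<longrightarrow> cmod ev < 1"
  show "contractive {1..d} n K A" unfolding contractive_def
  proof (intro allI impI)
    fix X and ev :: complex
    assume ne: "\<exists>i\<in>{1..d}. \<exists>a<n i. \<exists>b<n i. X i a b \<noteq> 0"
      and eig: "\<forall>j\<in>{1..d}. \<forall>c<n j. \<forall>e<n j.
        (\<Sum>i\<in>{1..d}. complex_of_real (K i j) * sand (n i) (\<lambda>c a. complex_of_real (A i j c a)) (X i) c e) = ev * X j c e"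
    let ?v = "bvec d n X"
    have v: "?v \<in> carrier_vec ?N" by (simp add: bvec_def)
    from ne obtain i a b where iab: "i \<in> {1..d}" "a < n i" "b < n i" "X i a b \<noteq> 0" by blast
    then have "?v $ bix n i a b \<noteq> 0\<^sub>v ?N $ bix n i a b" using bix_less[where n=n, OF iab(1-3)] by (simp add: bvec_index)
    then have v0: "?v \<noteq> 0\<^sub>v ?N" by metis
    have "B *\<^sub>v ?v = ev \<cdot>\<^sub>v ?v"
    proof (rule eq_vecI)
      fix x assume "x < dim_vec (ev \<cdot>\<^sub>v ?v)"
      then have x: "x < ?N" using v by simp
      from bix_exists[OF x] obtain j c e where j: "j \<in> {1..d}" "c < n j" "e < n j" and xe: "x = bix n j c e" by blast
      have "(B *\<^sub>v ?v) $ x = (\<Sum>i\<in>{1..d}. complex_of_real (K i j) * sand (n i) (\<lambda>c a. complex_of_real (A i j c a)) (\<lambda>a b. ?v $ bix n i a b) c e)"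
        unfolding xe by (rule block_mult[OF B Be v j])
      also have "\<dots> = (\<Sum>i\<in>{1..d}. complex_of_real (K i j) * sand (n i) (\<lambda>c a. complex_of_real (A i j c a)) (X i) c e)"
        by (intro sum.cong refl arg_cong2[of _ _ _ _ "(*)"] sand_cong) (simp_all add: bvec_index)
      also have "\<dots> = ev * X j c e" using eig j by blast
      finally show "(B *\<^sub>v ?v) $ x = (ev \<cdot>\<^sub>v ?v) $ x" using x v j by (simp add: xe bvec_index)
    qed (use B v in auto)
    then have "eigenvalue B ev" using v v0 B unfolding eigenvalue_def eigenvector_def by auto
    then show "cmod ev < 1" using ev by blast
  qed
next
  let ?N = "boff (bsz n) (Suc d)"
  assume ct: "contractive {1..d} n K A"
  show "\<forall>ev. eigenvalue B ev \<longrightarrow> cmod ev < 1"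
  proof (intro allI impI)
    fix ev assume "eigenvalue B ev"
    then obtain v where v: "v \<in> carrier_vec ?N" "v \<noteq> 0\<^sub>v ?N" "B *\<^sub>v v = ev \<cdot>\<^sub>v v"
      using B unfolding eigenvalue_def eigenvector_def by auto
    let ?X = "\<lambda>i a b. v $ bix n i a b"
    from v obtain x where x: "x < ?N" "v $ x \<noteq> 0" by (auto simp: vec_eq_iff)
    from bix_exists[OF x(1)] x(2) have "\<exists>i\<in>{1..d}. \<exists>a<n i. \<exists>b<n i. ?X i a b \<noteq> 0" by metis
    moreover have "(\<Sum>i\<in>{1..d}. complex_of_real (K i j) * sand (n i) (\<lambda>c a. complex_of_real (A i j c a)) (?X i) c e) = ev * ?X j c e"
      if "j \<in> {1..d}" "c < n j" "e < n j" for j c e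
    proof -
      have "(B *\<^sub>v v) $ bix n j c e = ev * ?X j c e" using v bix_less[where n=n, OF that] by simp
      then show ?thesis using block_mult[OF B Be v(1) that] by simp
    qed
    ultimately show "cmod ev < 1"
      using ct[unfolded contractive_def, THEN spec, of ?X, THEN spec, of ev] by blast
  qed
qed

lemma contractive_iteration_tendsto_0:
  fixes S :: "nat \<Rightarrow> nat \<Rightarrow> nat \<Rightarrow> nat \<Rightarrow> real"
  assumes ct: "contractive {1..d} n K A"
    and S: "\<And>k j c e. j \<in> {1..d} \<Longrightarrow> c < n j \<Longrightarrow> e < n j \<Longrightarrow>
       S (Suc k) j c e = (\<Sum>i\<in>{1..d}. K i j * sand (n i) (A i j) (S k i) c e)"
    and j: "j \<in> {1..d}" "c < n j" "e < n j"
  shows "(\<lambda>k. S k j c e) \<longlonglongrightarrow> 0"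
proof -
  let ?N = "boff (bsz n) (Suc d)"
  \<comment> \<open>The matrix of the operator in the block order. At valid positions the
    \<open>SOME\<close> term is determined, because by \<open>bix_inject\<close> the two positions
    determine all indices.\<close>
  define B where "B = mat ?N ?N (\<lambda>(x, y). SOME z. \<exists>i j a b c e. i \<in> {1..d} \<and> j \<in> {1..d} \<and> a < n i \<and> b < n i \<and> c < n j \<and> e < n j \<and>
     x = bix n j c e \<and> y = bix n i a b \<and> z = complex_of_real (K i j * (A i j c a * A i j e b)))"
  have B: "B \<in> carrier_mat ?N ?N" by (simp add: B_def)
  have Be: "B $$ (bix n j c e, bix n i a b) = complex_of_real (K i j * (A i j c a * A i j e b))"
    if h: "i \<in> {1..d}" "j \<in> {1..d}" "a < n i" "b < n i" "c < n j" "e < n j" for i j a b c e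
  proof -
    have "(SOME z. \<exists>i' j' a' b' c' e'. i' \<in> {1..d} \<and> j' \<in> {1..d} \<and> a' < n i' \<and> b' < n i' \<and> c' < n j' \<and> e' < n j' \<and>
     bix n j c e = bix n j' c' e' \<and> bix n i a b = bix n i' a' b' \<and> z = complex_of_real (K i' j' * (A i' j' c' a' * A i' j' e' b')))
       = complex_of_real (K i j * (A i j c a * A i j e b))"
    proof (rule some_equality, goal_cases)
      case 1 show ?case using h by blast
    next
      case (2 z)
      then obtain i' j' a' b' c' e' where z: "i' \<in> {1..d}" "j' \<in> {1..d}" "a' < n i'" "b' < n i'" "c' < n j'" "e' < n j'"
        "bix n j c e = bix n j' c' e'" "bix n i a b = bix n i' a' b'" "z = complex_of_real (K i' j' * (A i' j' c' a' * A i' j' e' b'))" by blast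
      have "j = j' \<and> c = c' \<and> e = e'" by (rule bix_inject[OF _ _ _ _ _ _ z(7)]) (use h z in auto)
      moreover have "i = i' \<and> a = a' \<and> b = b'" by (rule bix_inject[OF _ _ _ _ _ _ z(8)]) (use h z in auto)
      ultimately show ?case using z(9) by simp
    qed
    then show ?thesis using bix_less[where n=n, OF h(1,3,4)] bix_less[where n=n, OF h(2,5,6)] by (simp add: B_def)
  qed
  have ev: "cmod ev < 1" if "eigenvalue B ev" for ev
    using contractive_iff_eigenvalues[of B n d K A, OF B Be] ct that by blast
  let ?v = "\<lambda>k. bvec d n (\<lambda>i a b. complex_of_real (S k i a b))"
  have v: "?v k \<in> carrier_vec ?N" for k by (simp add: bvec_def)
  have "?v (Suc k) = B *\<^sub>v ?v k" for k
  proof (rule eq_vecI)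
    fix x assume "x < dim_vec (B *\<^sub>v ?v k)"
    then have x: "x < ?N" using B by simp
    from bix_exists[OF x] obtain j c e where j: "j \<in> {1..d}" "c < n j" "e < n j" and xe: "x = bix n j c e" by blast
    have "(B *\<^sub>v ?v k) $ x = (\<Sum>i\<in>{1..d}. complex_of_real (K i j) * sand (n i) (\<lambda>c a. complex_of_real (A i j c a)) (\<lambda>a b. ?v k $ bix n i a b) c e)"
      unfolding xe by (rule block_mult[OF B Be v j])
    also have "\<dots> = (\<Sum>i\<in>{1..d}. complex_of_real (K i j) * sand (n i) (\<lambda>c a. complex_of_real (A i j c a)) (\<lambda>a b. complex_of_real (S k i a b)) c e)"
      by (intro sum.cong refl arg_cong2[of _ _ _ _ "(*)"] sand_cong) (simp_all add: bvec_index)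
    also have "\<dots> = complex_of_real (S (Suc k) j c e)"
      unfolding S[OF j] by (simp add: sand_def)
    finally show "?v (Suc k) $ x = (B *\<^sub>v ?v k) $ x" using j by (simp add: xe bvec_index)
  qed (use B in \<open>auto simp: bvec_def\<close>)
  from linear_iteration_tendsto_0[where v="?v", OF B ev v this bix_less[where n=n, OF j]]
  have "(\<lambda>k. complex_of_real (S k j c e)) \<longlonglongrightarrow> complex_of_real 0" using j by (simp add: bvec_index)
  then show ?thesis by (simp only: tendsto_of_real_iff)
qed

subsection \<open>The stability condition\<close>

lemma stab_mat_carrier: "stab_mat d P H \<in> carrier_mat (boff (bsz (nst H)) (Suc d)) (boff (bsz (nst H)) (Suc d))"
  by (simp add: stab_mat_def Qs_def boff_total[symmetric] bsz_def power2_eq_square)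

lemma blk_off_eq: "blk_off H = boff (bsz (nst H))"
  by (rule ext) (simp add: blk_off_def boff_def bsz_def power2_eq_square)

text \<open>The blocks do not overlap, so exactly one summand of the definition survives. Row and
  column of \<open>Mm\<close> appear exchanged because the blocks are built from transposes.\<close>

lemma stab_mat_entry:
  assumes i: "i \<in> {1..d}" "a < nst H i" "b < nst H i" and j: "j \<in> {1..d}" "c < nst H j" "e < nst H j"
    and M: "Mm H i j \<in> carrier_mat (nst H j) (nst H i)"
  shows "stab_mat d P H $$ (bix (nst H) i a b, bix (nst H) j c e) = P i j * (Mm H i j $$ (c, a) * Mm H i j $$ (e, b))"
proof -
  let ?n = "nst H" and ?B = "boff (bsz (nst H))"
  let ?x = "bix ?n i a b" and ?y = "bix ?n j c e"
  let ?t = "\<lambda>i' j'. (P i' j' \<cdot>\<^sub>m kron (transpose_mat (Mm H i' j')) (transpose_mat (Mm H i' j'))) $$ (?x - ?B i', ?y - ?B j')"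
  have blk: "(?B i' \<le> bix ?n i a b \<and> bix ?n i a b < ?B i' + (?n i')\<^sup>2) \<longleftrightarrow> i' = i"
    if "i' \<in> {1..d}" "i \<in> {1..d}" "a < ?n i" "b < ?n i" for i' i a b
  proof
    assume "?B i' \<le> bix ?n i a b \<and> bix ?n i a b < ?B i' + (?n i')\<^sup>2"
    then show "i' = i"
      by (intro boff_unique[of i' i "bsz ?n" "bix ?n i a b"])
        (use that sq_index_less[of a "?n i" b] in \<open>auto simp: bix_def bsz_def power2_eq_square\<close>)
  next
    assume "i' = i"
    then show "?B i' \<le> bix ?n i a b \<and> bix ?n i a b < ?B i' + (?n i')\<^sup>2"
      using that sq_index_less[of a "?n i" b] by (auto simp: bix_def power2_eq_square)
  qed
  have "stab_mat d P H $$ (?x, ?y) = (\<Sum>i'\<in>{1..d}. \<Sum>j'\<in>{1..d}.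
      if ?B i' \<le> ?x \<and> ?x < ?B i' + (?n i')\<^sup>2 \<and> ?B j' \<le> ?y \<and> ?y < ?B j' + (?n j')\<^sup>2 then ?t i' j' else 0)"
    using bix_less[where n="nst H", OF i] bix_less[where n="nst H", OF j]
    by (simp add: stab_mat_def Qs_def boff_total[symmetric] bsz_def power2_eq_square blk_off_eq cong: if_cong)
  also have "\<dots> = (\<Sum>i'\<in>{1..d}. if i' = i then (\<Sum>j'\<in>{1..d}. if j' = j then ?t i' j' else 0) else 0)"
    using blk[OF _ i] blk[OF _ j] by (intro sum.cong refl) (auto intro!: sum.cong simp: conj_assoc[symmetric])
  also have "\<dots> = ?t i j" using i(1) j(1) by simp
  also have "\<dots> = P i j * (Mm H i j $$ (c, a) * Mm H i j $$ (e, b))"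
    using i j M sq_index_less[of a "?n i" b] sq_index_less[of c "?n j" e] by (simp add: bix_def kron_def)
  finally show ?thesis .
qed

text \<open>As it stands, the stability matrix acts with the transposes \<open>M^T\<close>; its
  transpose acts with the \<open>M\<close> and propagates covariances. Both have the same
  characteristic polynomial. The first form can be restricted to subspaces invariant under the
  \<open>M^T\<close>, the second to subspaces invariant under the \<open>M\<close>.\<close>

lemma stable_iff_contractive:
  assumes M: "\<And>i j. i \<in> {1..d} \<Longrightarrow> j \<in> {1..d} \<Longrightarrow> Mm H i j \<in> carrier_mat (nst H j) (nst H i)"
  shows "(\<forall>ev. eigenvalue (map_mat complex_of_real (stab_mat d P H)) ev \<longrightarrow> cmod ev < 1)
      \<longleftrightarrow> contractive {1..d} (nst H) (\<lambda>i j. P j i) (\<lambda>i j c a. Mm H j i $$ (a, c))" (is ?a)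
    and "(\<forall>ev. eigenvalue (map_mat complex_of_real (stab_mat d P H)) ev \<longrightarrow> cmod ev < 1)
      \<longleftrightarrow> contractive {1..d} (nst H) P (\<lambda>i j c a. Mm H i j $$ (c, a))" (is ?b)
proof -
  let ?S = "map_mat complex_of_real (stab_mat d P H)"
  let ?N = "boff (bsz (nst H)) (Suc d)"
  have S: "?S \<in> carrier_mat ?N ?N" using stab_mat_carrier by simp
  have ent: "?S $$ (bix (nst H) i a b, bix (nst H) j c e) = complex_of_real (P i j * (Mm H i j $$ (c, a) * Mm H i j $$ (e, b)))"
    if "i \<in> {1..d}" "a < nst H i" "b < nst H i" "j \<in> {1..d}" "c < nst H j" "e < nst H j" for i j a b c e
    using stab_mat_entry[OF that M[OF that(1,4)], of P] stab_mat_carrier[of d P H]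
      bix_less[where n="nst H", OF that(1-3)] bix_less[where n="nst H", OF that(4-6)] by simp
  show ?a by (rule contractive_iff_eigenvalues[OF S]) (rule ent)
  have St: "transpose_mat ?S \<in> carrier_mat ?N ?N" using S by simp
  have entt: "transpose_mat ?S $$ (bix (nst H) j c e, bix (nst H) i a b) = complex_of_real (P i j * (Mm H i j $$ (c, a) * Mm H i j $$ (e, b)))"
    if "i \<in> {1..d}" "j \<in> {1..d}" "a < nst H i" "b < nst H i" "c < nst H j" "e < nst H j" for i j a b c e
    using ent[OF that(1,3,4,2,5,6)] S bix_less[where n="nst H", OF that(1,3,4)] bix_less[where n="nst H", OF that(2,5,6)]
    by (simp add: carrier_matD[OF stab_mat_carrier[of d P H]])
  have "eigenvalue ?S ev \<longleftrightarrow> eigenvalue (transpose_mat ?S) ev" for ev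
    using eigenvalue_root_char_poly[OF S] eigenvalue_root_char_poly[OF St] char_poly_transpose_mat[OF S] by simp
  then show ?b
    using contractive_iff_eigenvalues[OF St entt] by simp
qed

subsection \<open>Delayed processes along paths of the chain\<close>

locale markov_chain = prob_space M for M :: "'w measure" +
  fixes d :: nat and \<theta> :: "int \<Rightarrow> 'w \<Rightarrow> nat" and P :: "nat \<Rightarrow> nat \<Rightarrow> real"
  assumes chain: "stat_markov_chain M d \<theta> P"
begin

abbreviation "\<eta> q t \<equiv> ind M \<theta> q t"

lemma theta_measurable [measurable]: "\<theta> t \<in> measurable M (count_space UNIV)"
  and theta_range: "\<omega> \<in> space M \<Longrightarrow> \<theta> t \<omega> \<in> Qs d"
  and P_pos: "i \<in> Qs d \<Longrightarrow> j \<in> Qs d \<Longrightarrow> 0 < P i j"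
  and transition: "j \<in> Qs d \<Longrightarrow> AE \<omega> in M.
        real_cond_exp M (sig_past M \<theta> t) (indicator {\<omega> \<in> space M. \<theta> (t + 1) \<omega> = j}) \<omega> = P (\<theta> t \<omega>) j"
  using chain by (auto simp: stat_markov_chain_def)

lemma theta_preimage [measurable]: "\<theta> s -` {q} \<inter> space M \<in> sets M"
  by (rule measurable_sets[OF theta_measurable]) simp

lemma theta_event: "{\<omega> \<in> space M. \<theta> s \<omega> = q} = \<theta> s -` {q} \<inter> space M"
  by auto

lemma chi_measurable [measurable]: "\<eta> q t \<in> borel_measurable M"
  unfolding ind_def theta_event by measurable

lemma chi_abs: "\<bar>\<eta> q t \<omega>\<bar> \<le> 1"
  by (auto simp: ind_def indicator_def)

lemma chi_idem: "\<eta> q t \<omega> * \<eta> q t \<omega> = \<eta> q t \<omega>"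
  by (auto simp: ind_def indicator_def)

lemma chi_disjoint: "q \<noteq> q' \<Longrightarrow> \<eta> q t \<omega> * \<eta> q' t \<omega> = 0"
  by (auto simp: ind_def indicator_def)

lemma chi_space: "\<omega> \<in> space M \<Longrightarrow> \<eta> q t \<omega> = (if \<theta> t \<omega> = q then 1 else 0)"
  by (auto simp: ind_def indicator_def)

lemma chi_outside: "\<omega> \<notin> space M \<Longrightarrow> \<eta> q t \<omega> = 0"
  by (auto simp: ind_def indicator_def)

lemma finite_Qs [simp]: "finite (Qs d)"
  by (simp add: Qs_def)

lemma chi_sum: "\<omega> \<in> space M \<Longrightarrow> (\<Sum>q\<in>Qs d. f q * \<eta> q t \<omega>) = f (\<theta> t \<omega>)"
  using theta_range[of \<omega> t] by (simp add: chi_space if_distrib[of "\<lambda>x. _ * x"] cong: if_cong)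

lemma subalgebra_sigma: "S \<subseteq> sets M \<Longrightarrow> subalgebra M (sigma (space M) S)"
  using sets.sets_into_space sets.sigma_sets_subset[of S M]
  by (auto simp: subalgebra_def sets_measure_of_conv space_measure_of_conv)

lemma subalgebra_past: "subalgebra M (sig_past M \<theta> t)"
  unfolding sig_past_def by (rule subalgebra_sigma) auto

lemma subalgebra_window: "subalgebra M (sig_window M \<theta> t l)"
  unfolding sig_window_def by (rule subalgebra_sigma) auto

lemma subalgebra_future: "subalgebra M (sig_future M \<theta> t)"
  unfolding sig_future_def by (rule subalgebra_sigma) auto

lemma sigma_finite_sub: "subalgebra M F \<Longrightarrow> sigma_finite_subalgebra M F"
  by (intro finite_measure_subalgebra_is_sigma_finite) (simp add: finite_measure_subalgebra_def finite_measure_subalgebra_axioms_def finite_measure_axioms)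

lemma past_mono: "s \<le> t \<Longrightarrow> sets (sig_past M \<theta> s) \<subseteq> sets (sig_past M \<theta> t)"
  unfolding sig_past_def
  by (subst (1 2) sets_measure_of; (intro sigma_sets_mono')?; force)

lemma chi_past: "s \<le> t \<Longrightarrow> \<eta> q s \<in> borel_measurable (sig_past M \<theta> t)"
  unfolding ind_def theta_event
  by (intro borel_measurable_indicator) (auto simp: sig_past_def sets_measure_of_conv intro!: sigma_sets.Basic)

lemma chi_window: "t - l \<le> s \<Longrightarrow> s \<le> t \<Longrightarrow> \<eta> q s \<in> borel_measurable (sig_window M \<theta> t l)"
  unfolding ind_def theta_event
  by (intro borel_measurable_indicator) (auto simp: sig_window_def sets_measure_of_conv intro!: sigma_sets.Basic)

text \<open>Together with its converse \<open>cond_exp_0I\<close>, this translates the conditional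
  expectations in (G1) into orthogonality relations and back.\<close>

lemma cond_exp_0_integral:
  assumes F: "subalgebra M F" and f: "integrable M f" "AE \<omega> in M. real_cond_exp M F f \<omega> = 0"
    and h: "h \<in> borel_measurable F" "integrable M (\<lambda>\<omega>. h \<omega> * f \<omega>)"
  shows "integral\<^sup>L M (\<lambda>\<omega>. h \<omega> * f \<omega>) = 0"
proof -
  interpret sigma_finite_subalgebra M F by (rule sigma_finite_sub[OF F])
  have "integral\<^sup>L M (\<lambda>\<omega>. h \<omega> * f \<omega>) = integral\<^sup>L M (\<lambda>\<omega>. h \<omega> * real_cond_exp M F f \<omega>)"
    using real_cond_exp_intg(2)[OF h(2,1)] f by simp
  also have "\<dots> = integral\<^sup>L M (\<lambda>_. 0)"
    by (rule integral_cong_AE) (use f h in \<open>auto simp: measurable_from_subalg[OF F]\<close>)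
  finally show ?thesis by simp
qed

lemma cond_exp_0I:
  assumes F: "subalgebra M F" and f: "integrable M f"
    and 0: "\<And>A. A \<in> sets F \<Longrightarrow> integral\<^sup>L M (\<lambda>\<omega>. indicator A \<omega> * f \<omega>) = 0"
  shows "AE \<omega> in M. real_cond_exp M F f \<omega> = 0"
proof -
  interpret sigma_finite_subalgebra M F by (rule sigma_finite_sub[OF F])
  show ?thesis
    by (rule real_cond_exp_charact) (use f 0 in \<open>auto simp: set_lebesgue_integral_def\<close>)
qed

text \<open>The word runs backwards in time, so that extending a path to the present is a
  \<open>Cons\<close>. The empty product is 1 even outside \<open>space M\<close>, hence the
  condition \<open>w \<noteq> []\<close> in the comparison with an indicator.\<close>

fun cyl :: "nat list \<Rightarrow> int \<Rightarrow> 'w \<Rightarrow> real" where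
  "cyl [] t \<omega> = 1"
| "cyl (q # w) t \<omega> = \<eta> q t \<omega> * cyl w (t - 1) \<omega>"

lemma cyl_eq_indicator:
  "w \<noteq> [] \<Longrightarrow> cyl w t \<omega> = indicator {\<omega> \<in> space M. \<forall>r<length w. \<theta> (t - int r) \<omega> = w ! r} \<omega>"
proof (induction w arbitrary: t)
  case (Cons q w)
  show ?case
  proof (cases "w = []")
    case True
    then show ?thesis by (simp add: ind_def indicator_def)
  next
    case False
    have *: "(\<forall>r<length (q # w). \<theta> (t - int r) \<omega> = (q # w) ! r) \<longleftrightarrow>
        \<theta> t \<omega> = q \<and> (\<forall>r<length w. \<theta> (t - 1 - int r) \<omega> = w ! r)"
      by (auto simp: less_Suc_eq_0_disj algebra_simps)
    show ?thesis unfolding cyl.simps Cons.IH[OF False] mem_Collect_eq * indicator_def ind_def by auto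
  qed
qed simp

lemma cyl_measurable_sub:
  assumes "\<And>q s. t - int (length w) < s \<Longrightarrow> s \<le> t \<Longrightarrow> \<eta> q s \<in> borel_measurable F"
  shows "cyl w t \<in> borel_measurable F"
  using assms
proof (induction w arbitrary: t)
  case (Cons q w)
  have "cyl w (t - 1) \<in> borel_measurable F" by (rule Cons.IH, rule Cons.prems) auto
  moreover have "\<eta> q t \<in> borel_measurable F" by (rule Cons.prems) auto
  ultimately show ?case by simp
next
  case Nil
  have "cyl [] t = (\<lambda>_. 1)" by (rule ext) simp
  then show ?case by simp
qed

text \<open>\<open>Zg a w t\<close> is the delayed process \<open>a\<close> times the indicator of a path of \<open>\<theta>\<close> ending at time \<open>t\<close>;
  the path \<open>w\<close> is listed backwards in time, so its head is the state at time \<open>t\<close>.\<close>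
fun Zg :: "(nat \<Rightarrow> int \<Rightarrow> 'w \<Rightarrow> real) \<Rightarrow> nat list \<Rightarrow> int \<Rightarrow> 'w \<Rightarrow> real" where
  "Zg a [] t = (\<lambda>_. 0)"
| "Zg a [q] t = a q t"
| "Zg a (q # q1 # w) t = (\<lambda>\<omega>. Zg a (q1 # w) (t - 1) \<omega> * \<eta> q t \<omega>)"

lemma Zg_Cons: "w \<noteq> [] \<Longrightarrow> Zg a (q # w) t = (\<lambda>\<omega>. Zg a w (t - 1) \<omega> * \<eta> q t \<omega>)"
  by (cases w) auto

lemma Zg_cyl:
  "w \<noteq> [] \<Longrightarrow> Zg (\<lambda>q t \<omega>. u t \<omega> * \<eta> q t \<omega>) w t \<omega> = u (t - int (length w - 1)) \<omega> * cyl w t \<omega>"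
proof (induction w arbitrary: t)
  case (Cons q w)
  show ?case
  proof (cases "w = []")
    case False
    obtain n where "length w = Suc n" using False by (cases w) auto
    then have "t - 1 - int (length w - 1) = t - int (length (q # w) - 1)" by simp
    then show ?thesis using Cons.IH[OF False, of "t - 1"] by (simp only: Zg_Cons[OF False] cyl.simps mult_ac)
  qed simp
qed simp

definition WI :: "nat \<Rightarrow> nat \<Rightarrow> (nat \<times> nat list) set" where
  "WI k m = {(j, w). j < m \<and> k \<le> length w \<and> set w \<subseteq> Qs d}"

text \<open>With \<open>k = 1\<close> the value at time \<open>t\<close> itself is allowed;
  \<open>k = 2\<close> leaves only values delayed by at least one step, still multiplied by
  indicators of paths up to time \<open>t\<close>. The latter are the generators of (G3).\<close>

definition Gen :: "nat \<Rightarrow> (nat \<Rightarrow> nat \<Rightarrow> int \<Rightarrow> 'w \<Rightarrow> real) \<Rightarrow> nat \<Rightarrow> int \<Rightarrow> ('w \<Rightarrow> real) set" where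
  "Gen k a m t = (\<lambda>(j, w). Zg (a j) w t) ` WI k m"

lemma GenI: "j < m \<Longrightarrow> k \<le> length w \<Longrightarrow> set w \<subseteq> Qs d \<Longrightarrow> Zg (a j) w t \<in> Gen k a m t"
  by (force simp: Gen_def WI_def)

lemma GenE:
  assumes "g \<in> Gen k a m t"
  obtains j w where "j < m" "k \<le> length w" "set w \<subseteq> Qs d" "g = Zg (a j) w t"
  using assms by (auto simp: Gen_def WI_def)

lemma Gen_mono: "k \<le> l \<Longrightarrow> Gen l a m t \<subseteq> Gen k a m t"
  by (auto simp: Gen_def WI_def)

text \<open>Support on the mode is demanded pointwise, not almost everywhere, so that products with
  indicators can be rewritten as equal functions.\<close>

definition family :: "(nat \<Rightarrow> nat \<Rightarrow> int \<Rightarrow> 'w \<Rightarrow> real) \<Rightarrow> nat \<Rightarrow> bool" where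
  "family a m \<longleftrightarrow> (\<forall>j<m. \<forall>q\<in>Qs d. \<forall>t. a j q t \<in> L2 M \<and> (\<forall>\<omega>. a j q t \<omega> * \<eta> q t \<omega> = a j q t \<omega>))"

lemma familyD:
  assumes "family a m" "j < m" "q \<in> Qs d"
  shows "a j q t \<in> L2 M" "a j q t \<omega> * \<eta> q t \<omega> = a j q t \<omega>"
  using assms by (auto simp: family_def)

lemma L2_chi: "f \<in> L2 M \<Longrightarrow> (\<lambda>\<omega>. f \<omega> * \<eta> q t \<omega>) \<in> L2 M"
  by (rule L2_mult_bounded) (auto simp: chi_abs)

lemma Zg_L2: "family a m \<Longrightarrow> j < m \<Longrightarrow> set w \<subseteq> Qs d \<Longrightarrow> Zg (a j) w t \<in> L2 M"
proof (induction w arbitrary: t)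
  case (Cons q w)
  then show ?case by (cases "w = []") (auto simp: Zg_Cons familyD L2_chi)
qed simp

lemma Zg_supp: "family a m \<Longrightarrow> j < m \<Longrightarrow> set (q # w) \<subseteq> Qs d \<Longrightarrow> Zg (a j) (q # w) t \<omega> * \<eta> q t \<omega> = Zg (a j) (q # w) t \<omega>"
  by (cases "w = []") (auto simp: Zg_Cons familyD mult.assoc chi_idem)

lemma Gen_L2: "family a m \<Longrightarrow> Gen k a m t \<subseteq> L2 M"
  by (auto simp: Gen_def WI_def Zg_L2)

text \<open>The indicator of the next mode prepends a letter to every generator: the present at time
  \<open>t\<close> becomes the strict past at time \<open>t + 1\<close>.\<close>

lemma cl_shift:
  assumes a: "family a m" and f: "f \<in> cl M (Gen 1 a m t)" and q: "q \<in> Qs d"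
  shows "(\<lambda>\<omega>. f \<omega> * \<eta> q (t + 1) \<omega>) \<in> cl M (Gen 2 a m (t + 1))"
proof (rule cl_image[OF Gen_L2[OF a] Gen_L2[OF a] _ _ _ f])
  fix g assume "g \<in> Gen 1 a m t"
  then obtain j w where g: "j < m" "1 \<le> length w" "set w \<subseteq> Qs d" "g = Zg (a j) w t" by (rule GenE)
  then have "(\<lambda>\<omega>. g \<omega> * \<eta> q (t + 1) \<omega>) = Zg (a j) (q # w) (t + 1)" by (subst Zg_Cons) auto
  then show "(\<lambda>\<omega>. g \<omega> * \<eta> q (t + 1) \<omega>) \<in> cl M (Gen 2 a m (t + 1))"
    using g q by (auto intro!: cl_base[OF Gen_L2[OF a]] GenI)
qed (auto simp: chi_abs)

lemma cl_Gen_2_1: "family a m \<Longrightarrow> cl M (Gen 2 a m t) \<subseteq> cl M (Gen 1 a m t)"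
  by (intro cl_mono Gen_mono Gen_L2) auto

text \<open>If \<open>b\<close> is generated by \<open>a\<close> up to the present, then delayed
  versions of \<open>b\<close> are generated by the strict past of \<open>a\<close>, since each
  letter of the word shifts time by one. This leads from the noise to the output and from the output
  to the innovations.\<close>

lemma cl_shift_Zg:
  assumes a: "family a m" and b: "\<And>q t. q \<in> Qs d \<Longrightarrow> b q t \<in> cl M (Gen 1 a m t)"
    and w: "2 \<le> length w" "set w \<subseteq> Qs d"
  shows "Zg b w t \<in> cl M (Gen 2 a m t)"
  using w
proof (induction w arbitrary: t)
  case (Cons q w)
  have w: "w \<noteq> []" using Cons.prems by auto
  have "Zg b w (t - 1) \<in> cl M (Gen 1 a m (t - 1))"
  proof (cases "2 \<le> length w")
    case True
    then show ?thesis using Cons.IH[of "t - 1"] Cons.prems cl_Gen_2_1[OF a] by auto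
  next
    case False
    then obtain q1 where "w = [q1]" using w by (cases w) (auto simp: Suc_le_eq)
    then show ?thesis using b Cons.prems by simp
  qed
  from cl_shift[OF a this, of q] Cons.prems show ?case by (simp add: Zg_Cons[OF w])
qed simp

text \<open>Every generator is supported on one mode at time \<open>t\<close>, so the indicator
  either fixes it or annihilates it.\<close>

lemma cl_chi:
  assumes a: "family a m" and f: "f \<in> cl M (Gen k a m t)" and q: "q \<in> Qs d" and k: "1 \<le> k"
  shows "(\<lambda>\<omega>. f \<omega> * \<eta> q t \<omega>) \<in> cl M (Gen k a m t)"
proof (rule cl_image[OF Gen_L2[OF a] Gen_L2[OF a] _ _ _ f])
  fix g assume "g \<in> Gen k a m t"
  then obtain j w where g: "j < m" "k \<le> length w" "set w \<subseteq> Qs d" "g = Zg (a j) w t" by (rule GenE)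
  with k obtain q1 w' where w: "w = q1 # w'" by (cases w) auto
  have supp: "g \<omega> * \<eta> q1 t \<omega> = g \<omega>" for \<omega> using Zg_supp[OF a g(1), of q1 w'] g w by simp
  show "(\<lambda>\<omega>. g \<omega> * \<eta> q t \<omega>) \<in> cl M (Gen k a m t)"
  proof (cases "q1 = q")
    case True
    then have "(\<lambda>\<omega>. g \<omega> * \<eta> q t \<omega>) = g" using supp by auto
    then show ?thesis using g by (auto intro!: cl_base[OF Gen_L2[OF a]] GenI)
  next
    case False
    have "g \<omega> * \<eta> q t \<omega> = 0" for \<omega>
      using chi_disjoint[OF False, of t \<omega>] supp[of \<omega>] by (metis mult.assoc mult_zero_right)
    then have "(\<lambda>\<omega>. g \<omega> * \<eta> q t \<omega>) = (\<lambda>_. 0)" by auto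
    then show ?thesis using lspan_cl[OF Gen_L2[OF a] lspan_zero] by simp
  qed
qed (auto simp: chi_abs)

end

section \<open>Noise and mode indicators under Assumption (G)\<close>

locale gsys = markov_chain M d \<theta> P for M :: "'w measure" and d :: nat and \<theta> :: "int \<Rightarrow> 'w \<Rightarrow> nat" and P :: "nat \<Rightarrow> nat \<Rightarrow> real" +
  fixes p :: nat and H :: "'w gjmls"
  assumes gj: "is_gjmls M d \<theta> p H" and G: "assumptionG M d \<theta> P p H"
begin

abbreviation "v \<equiv> vp H"
abbreviation "m \<equiv> mdim H"

lemma v_measurable [measurable]: "i < m \<Longrightarrow> (\<lambda>\<omega>. v t \<omega> $ i) \<in> borel_measurable M"
  and v_sq: "i < m \<Longrightarrow> integrable M (\<lambda>\<omega>. (v t \<omega> $ i)\<^sup>2)"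
  and v_mean: "k \<ge> 0 \<Longrightarrow> i < m \<Longrightarrow> AE \<omega> in M. real_cond_exp M (sig_past M \<theta> (t + k)) (\<lambda>\<omega>. v t \<omega> $ i) \<omega> = 0"
  and v_white: "l > 0 \<Longrightarrow> i < m \<Longrightarrow> j < m \<Longrightarrow>
        AE \<omega> in M. real_cond_exp M (sig_window M \<theta> t l) (\<lambda>\<omega>. v t \<omega> $ i * v (t - l) \<omega> $ j) \<omega> = 0"
  and v_Q: "q \<in> Qs d \<Longrightarrow> i < m \<Longrightarrow> j < m \<Longrightarrow>
        integral\<^sup>L M (\<lambda>\<omega>. v t \<omega> $ i * v t \<omega> $ j * ind M \<theta> q t \<omega>) = Qmat M \<theta> H q $$ (i, j)"
  and v_indep: "cond_indep M (sig_vpast M v m t) (sig_future M \<theta> t) (sig_past M \<theta> t)"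
  using G unfolding assumptionG_def by blast+

lemma v_L2: "i < m \<Longrightarrow> (\<lambda>\<omega>. v t \<omega> $ i) \<in> L2 M"
  by (simp add: L2_def v_sq v_measurable)

definition "V j q t = (\<lambda>\<omega>. v t \<omega> $ j * \<eta> q t \<omega>)"

lemma V_family: "family V m"
  unfolding family_def V_def by (auto intro!: L2_chi v_L2 simp: mult.assoc chi_idem)

text \<open>The path indicator of a delayed generator reaches back exactly to the time of its noise
  factor, so it is measurable for the window in the whiteness condition of (G1).\<close>

lemma V_orthogonal_past:
  assumes q: "q \<in> Qs d" and j: "j < m" and f: "f \<in> cl M (Gen 2 V m t)"
  shows "ip M (V j q t) f = 0"
proof (rule cl_orthogonal_right[OF Gen_L2[OF V_family] familyD(1)[OF V_family j q] _ f])
  fix g assume "g \<in> Gen 2 V m t"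
  then obtain i w where g: "i < m" "2 \<le> length w" "set w \<subseteq> Qs d" "g = Zg (V i) w t" by (rule GenE)
  define l where "l = int (length w - 1)"
  have w: "w \<noteq> []" and l: "l > 0" using g(2) by (auto simp: l_def)
  have gc: "g = (\<lambda>\<omega>. v (t - l) \<omega> $ i * cyl w t \<omega>)"
    unfolding g(4) l_def V_def[abs_def] by (rule ext) (rule Zg_cyl[OF w])
  let ?h = "\<lambda>\<omega>. \<eta> q t \<omega> * cyl w t \<omega>"
  have h: "?h \<in> borel_measurable (sig_window M \<theta> t l)"
    by (intro borel_measurable_times cyl_measurable_sub chi_window) (use l w in \<open>auto simp: l_def of_nat_diff Suc_le_eq\<close>)
  have e: "?h \<omega> * (v t \<omega> $ j * v (t - l) \<omega> $ i) = V j q t \<omega> * g \<omega>" for \<omega>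
    by (simp add: V_def gc)
  have gL: "g \<in> L2 M" using g Zg_L2[OF V_family] by simp
  have "integral\<^sup>L M (\<lambda>\<omega>. ?h \<omega> * (v t \<omega> $ j * v (t - l) \<omega> $ i)) = 0"
  proof (rule cond_exp_0_integral[OF subalgebra_window _ v_white[OF l j g(1)] h])
    show "integrable M (\<lambda>\<omega>. v t \<omega> $ j * v (t - l) \<omega> $ i)" by (rule L2_mult_integrable) (auto intro: v_L2 j g)
    show "integrable M (\<lambda>\<omega>. ?h \<omega> * (v t \<omega> $ j * v (t - l) \<omega> $ i))"
      unfolding e by (rule L2_mult_integrable[OF familyD(1)[OF V_family j q] gL])
  qed
  then show "ip M (V j q t) g = 0" unfolding e ip_def .
qed

text \<open>The noise factor of a generator is centred given the chain up to any later time, and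
  both the path indicator and \<open>C\<close> are known at time \<open>t + k\<close>. It is needed
  for the conditional mean of the innovations.\<close>

lemma cl_V_mean:
  assumes f: "f \<in> cl M (Gen 1 V m t)" and k: "k \<ge> 0" and C: "C \<in> sets (sig_past M \<theta> (t + k))"
  shows "ip M f (indicator C) = 0"
proof (rule cl_orthogonal[OF Gen_L2[OF V_family] _ _ f])
  have CM[measurable]: "C \<in> sets M" using C subalgebra_past by (auto simp: subalgebra_def)
  show "indicator C \<in> L2 M"
  proof -
    have "(\<lambda>\<omega>. (indicator C \<omega> :: real)\<^sup>2) = indicator C" by (auto simp: indicator_def)
    then show ?thesis by (simp add: L2_def emeasure_eq_measure)
  qed
  fix g assume "g \<in> Gen 1 V m t"
  then obtain i w where g: "i < m" "1 \<le> length w" "set w \<subseteq> Qs d" "g = Zg (V i) w t" by (rule GenE)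
  define l where "l = int (length w - 1)"
  have w: "w \<noteq> []" and l: "l \<ge> 0" using g(2) by (auto simp: l_def)
  have gc: "g = (\<lambda>\<omega>. v (t - l) \<omega> $ i * cyl w t \<omega>)"
    unfolding g(4) l_def V_def[abs_def] by (rule ext) (rule Zg_cyl[OF w])
  let ?h = "\<lambda>\<omega>. cyl w t \<omega> * indicator C \<omega>"
  \<comment> \<open>Time \<open>t + k\<close> is written as the delay \<open>l + k\<close> after the
    noise factor, the form in which (G1) applies.\<close>
  have h: "?h \<in> borel_measurable (sig_past M \<theta> ((t - l) + (l + k)))"
    by (intro borel_measurable_times cyl_measurable_sub chi_past borel_measurable_indicator) (use C k in auto)
  have gL: "g \<in> L2 M" using g Zg_L2[OF V_family] by simp
  have e: "?h \<omega> * (v (t - l) \<omega> $ i) = g \<omega> * indicator C \<omega>" for \<omega> by (simp add: gc)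
  have "integral\<^sup>L M (\<lambda>\<omega>. ?h \<omega> * (v (t - l) \<omega> $ i)) = 0"
  proof (rule cond_exp_0_integral[OF subalgebra_past _ v_mean[of "l + k" i "t - l"] h])
    show "integrable M (\<lambda>\<omega>. v (t - l) \<omega> $ i)" by (intro L2_integrable v_L2 g)
    show "integrable M (\<lambda>\<omega>. ?h \<omega> * v (t - l) \<omega> $ i)"
      unfolding e using integrable_mult_indicator[OF CM L2_integrable[OF gL]] by (simp add: mult.commute)
  qed (use k l g in auto)
  then show "ip M g (indicator C) = 0" unfolding e ip_def .
qed

subsection \<open>Adapted processes and the Markov property\<close>

definition Filt :: "int \<Rightarrow> 'w measure" where
  "Filt t = sigma (space M) (sets (sig_vpast M v m t) \<union> sets (sig_past M \<theta> t))"

lemma vpast_gen: "{(\<lambda>\<omega>. v s \<omega> $ i) -` U \<inter> space M | s i U. s \<le> t \<and> i < m \<and> U \<in> sets borel} \<subseteq> sets M"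
  by (auto intro!: measurable_sets[OF v_measurable])

lemma subalgebra_vpast: "subalgebra M (sig_vpast M v m t)"
  unfolding sig_vpast_def by (rule subalgebra_sigma[OF vpast_gen])

lemma Filt_gen: "sets (sig_vpast M v m t) \<union> sets (sig_past M \<theta> t) \<subseteq> sets M"
  using subalgebra_vpast subalgebra_past by (auto simp: subalgebra_def)

lemma space_Filt [simp]: "space (Filt t) = space M"
  unfolding Filt_def by (rule space_measure_of) (use Filt_gen sets.sets_into_space in blast)

lemma sets_Filt: "sets (Filt t) = sigma_sets (space M) (sets (sig_vpast M v m t) \<union> sets (sig_past M \<theta> t))"
  unfolding Filt_def by (rule sets_measure_of) (use Filt_gen sets.sets_into_space in blast)

lemma subalgebra_Filt: "subalgebra M (Filt t)"
  unfolding Filt_def by (rule subalgebra_sigma[OF Filt_gen])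

lemma past_Filt: "sets (sig_past M \<theta> t) \<subseteq> sets (Filt t)"
  by (auto simp: sets_Filt)

lemma Filt_mono:
  assumes "s \<le> t" shows "sets (Filt s) \<subseteq> sets (Filt t)"
proof -
  have "sets (sig_vpast M v m s) \<subseteq> sets (sig_vpast M v m t)"
    unfolding sig_vpast_def using assms
    by (subst (1 2) sets_measure_of; (intro sigma_sets_mono')?; force)
  then show ?thesis unfolding sets_Filt using past_mono[OF assms] by (intro sigma_sets_mono') auto
qed

text \<open>Only up to null sets: a mean-square limit of \<open>Filt t\<close>-measurable functions
  is determined only almost everywhere, and \<open>Filt t\<close> is not completed.\<close>

definition adapted :: "int \<Rightarrow> ('w \<Rightarrow> real) \<Rightarrow> bool" where
  "adapted t f \<longleftrightarrow> f \<in> borel_measurable M \<and> (\<exists>g\<in>borel_measurable (Filt t). AE \<omega> in M. f \<omega> = g \<omega>)"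

lemma adaptedI: "f \<in> borel_measurable (Filt t) \<Longrightarrow> adapted t f"
  unfolding adapted_def using measurable_from_subalg[OF subalgebra_Filt] by auto

lemma adapted_mult: "adapted t f \<Longrightarrow> adapted t g \<Longrightarrow> adapted t (\<lambda>\<omega>. f \<omega> * g \<omega>)"
  unfolding adapted_def
  by safe (auto intro!: bexI[OF _ borel_measurable_times])

lemma adapted_add: "adapted t f \<Longrightarrow> adapted t g \<Longrightarrow> adapted t (\<lambda>\<omega>. f \<omega> + g \<omega>)"
  unfolding adapted_def
  by safe (auto intro!: bexI[OF _ borel_measurable_add])

lemma adapted_const: "adapted t (\<lambda>_. c)"
  by (rule adaptedI) simp

lemma adapted_scale: "adapted t f \<Longrightarrow> adapted t (\<lambda>\<omega>. c * f \<omega>)"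
  by (rule adapted_mult[OF adapted_const])

lemma adapted_sum: "(\<And>i. i \<in> I \<Longrightarrow> adapted t (f i)) \<Longrightarrow> adapted t (\<lambda>\<omega>. \<Sum>i\<in>I. f i \<omega>)"
  by (induction I rule: infinite_finite_induct) (auto intro: adapted_add adapted_const)

lemma adapted_cong_AE:
  assumes "adapted t f" "g \<in> borel_measurable M" "AE \<omega> in M. f \<omega> = g \<omega>"
  shows "adapted t g"
proof -
  from assms(1) obtain h where h: "h \<in> borel_measurable (Filt t)" "AE \<omega> in M. f \<omega> = h \<omega>"
    by (auto simp: adapted_def)
  have "AE \<omega> in M. g \<omega> = h \<omega>" using assms(3) h(2) by eventually_elim simp
  with h(1) assms(2) show ?thesis unfolding adapted_def by blast
qed

lemma adapted_mono:
  assumes "adapted s f" "s \<le> t" shows "adapted t f"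
proof -
  have "borel_measurable (Filt s) \<subseteq> borel_measurable (Filt t)"
    using Filt_mono[OF assms(2)] by (auto simp: measurable_def)
  then show ?thesis using assms(1) by (auto simp: adapted_def)
qed

lemma adapted_chi: "s \<le> t \<Longrightarrow> adapted t (\<eta> q s)"
  using chi_past[of s t q] past_Filt[of t]
  by (intro adaptedI) (auto simp: measurable_def sig_past_def space_measure_of_conv)

lemma adapted_v: "s \<le> t \<Longrightarrow> i < m \<Longrightarrow> adapted t (\<lambda>\<omega>. v s \<omega> $ i)"
proof (rule adaptedI, rule measurableI)
  fix U :: "real set" assume a: "s \<le> t" "i < m" "U \<in> sets borel"
  have "(\<lambda>\<omega>. v s \<omega> $ i) -` U \<inter> space M \<in> sets (sig_vpast M v m t)"
    unfolding sig_vpast_def using a by (subst sets_measure_of) (auto intro!: sigma_sets.Basic)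
  then show "(\<lambda>\<omega>. v s \<omega> $ i) -` U \<inter> space (Filt t) \<in> sets (Filt t)" by (auto simp: sets_Filt)
qed auto

text \<open>A mean-square limit is an almost everywhere limit of a subsequence, and pointwise limits
  of measurable functions are measurable.\<close>

lemma adapted_cl:
  assumes G: "G \<subseteq> L2 M" and a: "\<And>g. g \<in> G \<Longrightarrow> adapted t g" and f: "f \<in> cl M G"
  shows "adapted t f"
proof -
  have fL: "f \<in> L2 M" using f by (rule cl_L2)
  have as: "adapted t s" if "s \<in> lspan G" for s
    using that
  proof induction
    case lspan_zero
    show ?case by (rule adapted_const)
  next
    case (lspan_step g s c)
    show ?case by (rule adapted_add[OF adapted_scale[OF a[OF lspan_step(1)]] lspan_step(3)])
  qed
  \<comment> \<open>The tolerance is squared so that the L1 distances are at most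
    \<open>inverse (real (Suc n))\<close>.\<close>
  have "\<exists>s\<in>lspan G. ip M (\<lambda>\<omega>. f \<omega> - s \<omega>) (\<lambda>\<omega>. f \<omega> - s \<omega>) < (inverse (real (Suc n)))\<^sup>2" for n
    using f unfolding cl_def by auto
  then obtain s where s: "\<And>n. s n \<in> lspan G"
    "\<And>n. ip M (\<lambda>\<omega>. f \<omega> - s n \<omega>) (\<lambda>\<omega>. f \<omega> - s n \<omega>) < (inverse (real (Suc n)))\<^sup>2" by metis
  have sL: "s n \<in> L2 M" for n using lspan_L2[OF G s(1)] .
  have L1: "(LINT \<omega>|M. norm (f \<omega> - s n \<omega>)) \<le> inverse (real (Suc n))" for n
  proof -
    have "(LINT \<omega>|M. norm (f \<omega> - s n \<omega>)) \<le> sqrt (ip M (\<lambda>\<omega>. f \<omega> - s n \<omega>) (\<lambda>\<omega>. f \<omega> - s n \<omega>))"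
      using L2_abs_integral_le[of "\<lambda>\<omega>. f \<omega> - s n \<omega>"] fL sL by simp
    also have "\<dots> \<le> sqrt ((inverse (real (Suc n)))\<^sup>2)"
      using s(2)[of n] by (intro real_sqrt_le_mono) simp
    also have "\<dots> = inverse (real (Suc n))" by (subst real_sqrt_abs) simp
    finally show ?thesis .
  qed
  have "(\<lambda>n. LINT \<omega>|M. norm (f \<omega> - s n \<omega>)) \<longlonglongrightarrow> 0"
    by (rule tendsto_sandwich[OF _ _ tendsto_const LIMSEQ_inverse_real_of_nat]) (use L1 in auto)
  from tendsto_L1_AE_subseq[OF _ this] obtain r where r: "AE \<omega> in M. (\<lambda>n. f \<omega> - s (r n) \<omega>) \<longlonglongrightarrow> 0"
    using fL sL by (auto intro!: L2_integrable)
  have "\<forall>n. \<exists>g\<in>borel_measurable (Filt t). AE \<omega> in M. s (r n) \<omega> = g \<omega>" using as[OF s(1)] by (auto simp: adapted_def)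
  then obtain g where g: "\<And>n. g n \<in> borel_measurable (Filt t)" "\<And>n. AE \<omega> in M. s (r n) \<omega> = g n \<omega>" by metis
  have "AE \<omega> in M. \<forall>n. s (r n) \<omega> = g n \<omega>" using g(2) by (simp add: AE_all_countable)
  then have "AE \<omega> in M. f \<omega> = lim (\<lambda>n. g n \<omega>)"
    using r
  proof eventually_elim
    case (elim \<omega>)
    then have "(\<lambda>n. f \<omega> - (f \<omega> - g n \<omega>)) \<longlonglongrightarrow> f \<omega> - 0" by (intro tendsto_intros) simp
    then show ?case by (simp add: limI)
  qed
  moreover have "(\<lambda>\<omega>. lim (\<lambda>n. g n \<omega>)) \<in> borel_measurable (Filt t)"
    using g(1) by (rule borel_measurable_lim_metric)
  ultimately show ?thesis using fL unfolding adapted_def by (auto simp: L2_def)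
qed

lemma adapted_V: "j < m \<Longrightarrow> adapted t (V j q t)"
  unfolding V_def by (intro adapted_mult adapted_v adapted_chi) auto

lemma adapted_Zg: "(\<And>q t. q \<in> Qs d \<Longrightarrow> adapted t (b q t)) \<Longrightarrow> set w \<subseteq> Qs d \<Longrightarrow> adapted t (Zg b w t)"
proof (induction w arbitrary: t)
  case (Cons q w)
  show ?case
  proof (cases "w = []")
    case False
    have "adapted t (Zg b w (t - 1))" using Cons by (intro adapted_mono[of "t - 1" _ t]) auto
    then show ?thesis unfolding Zg_Cons[OF False] by (rule adapted_mult) (simp add: adapted_chi)
  qed (use Cons in simp)
qed (simp add: adapted_const)

lemma adapted_cl_V: "f \<in> cl M (Gen 1 V m t) \<Longrightarrow> adapted t f"
  by (rule adapted_cl[OF Gen_L2[OF V_family]]) (auto elim!: GenE intro!: adapted_Zg adapted_V)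

lemma future_sets: "B \<in> sets (sig_future M \<theta> t) \<Longrightarrow> B \<in> sets M"
  using subalgebra_future by (auto simp: subalgebra_def)

lemma past_cond_exp_bounded:
  assumes B: "B \<in> sets M"
  shows "AE \<omega> in M. \<bar>real_cond_exp M (sig_past M \<theta> t) (indicator B) \<omega>\<bar> \<le> 1"
proof -
  interpret D: sigma_finite_subalgebra M "sig_past M \<theta> t" by (rule sigma_finite_sub[OF subalgebra_past])
  have i: "integrable M (indicator B :: 'w \<Rightarrow> real)" using B by (simp add: emeasure_eq_measure)
  have "AE \<omega> in M. real_cond_exp M (sig_past M \<theta> t) (indicator B) \<omega> \<le> 1"
    by (rule D.real_cond_exp_le_c[OF i]) (auto simp: indicator_def)
  moreover have "AE \<omega> in M. 0 \<le> real_cond_exp M (sig_past M \<theta> t) (indicator B) \<omega>"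
    by (rule D.real_cond_exp_ge_c[OF i]) auto
  ultimately show ?thesis by eventually_elim simp
qed

text \<open>By (G2) the joint past of noise and chain predicts the future of the chain no better
  than the past of the chain alone. So the conditional expectation of a future event given
  \<open>sig_past\<close> may stand for the one given \<open>Filt t\<close>.\<close>

lemma adapted_future:
  assumes f: "adapted t f" "integrable M f" and B: "B \<in> sets (sig_future M \<theta> t)"
  shows "integral\<^sup>L M (\<lambda>\<omega>. f \<omega> * indicator B \<omega>)
    = integral\<^sup>L M (\<lambda>\<omega>. f \<omega> * real_cond_exp M (sig_past M \<theta> t) (indicator B) \<omega>)" (is "_ = integral\<^sup>L M (\<lambda>\<omega>. f \<omega> * ?h \<omega>)")
    and "integrable M (\<lambda>\<omega>. f \<omega> * real_cond_exp M (sig_past M \<theta> t) (indicator B) \<omega>)"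
proof -
  interpret D: sigma_finite_subalgebra M "sig_past M \<theta> t" by (rule sigma_finite_sub[OF subalgebra_past])
  interpret F: sigma_finite_subalgebra M "Filt t" by (rule sigma_finite_sub[OF subalgebra_Filt])
  have BM[measurable]: "B \<in> sets M" using future_sets[OF B] .
  have iB: "integrable M (indicator B :: 'w \<Rightarrow> real)" by (simp add: emeasure_eq_measure)
  have ih: "integrable M ?h" by (rule D.real_cond_exp_int(1)[OF iB])
  have hm[measurable]: "?h \<in> borel_measurable M" by simp
  have hD: "?h \<in> borel_measurable (sig_past M \<theta> t)" by simp
  \<comment> \<open>The aim is that this defect has conditional expectation zero given
    \<open>Filt t\<close>; an adapted factor may then be multiplied onto it.\<close>
  let ?\<psi> = "\<lambda>\<omega>. indicator B \<omega> - ?h \<omega>"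
  have i\<psi>: "integrable M ?\<psi>" using iB ih by simp
  have iA: "integrable M (\<lambda>\<omega>. indicator A \<omega> * ?\<psi> \<omega>)" if "A \<in> sets M" for A
    using integrable_mult_indicator[OF that i\<psi>] by simp
  have bd: "integrable M (\<lambda>\<omega>. g \<omega> * ?h \<omega>)" if g: "integrable M g" for g
  proof (rule Bochner_Integration.integrable_bound[OF g])
    show "(\<lambda>\<omega>. g \<omega> * ?h \<omega>) \<in> borel_measurable M" using g by simp
    show "AE \<omega> in M. norm (g \<omega> * ?h \<omega>) \<le> norm (g \<omega>)"
      using past_cond_exp_bounded[OF BM, of t] by eventually_elim (simp add: abs_mult mult_left_le)
  qed
  \<comment> \<open>Intersections of a noise event with a chain event: they generate
    \<open>Filt t\<close>, are stable under intersection, and (G2) factorises on them. A Dynkin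
    argument extends the identity to all of \<open>Filt t\<close>.\<close>
  define GG where "GG = {A1 \<inter> A2 | A1 A2. A1 \<in> sets (sig_vpast M v m t) \<and> A2 \<in> sets (sig_past M \<theta> t)}"
  have gen: "integral\<^sup>L M (\<lambda>\<omega>. indicator A \<omega> * ?\<psi> \<omega>) = 0" if A: "A \<in> GG" for A
  proof -
    from A obtain A1 A2 where A12: "A1 \<in> sets (sig_vpast M v m t)" "A2 \<in> sets (sig_past M \<theta> t)" "A = A1 \<inter> A2" by (auto simp: GG_def)
    have m[measurable]: "A1 \<in> sets M" "A2 \<in> sets M" using A12 Filt_gen by auto
    let ?h1 = "real_cond_exp M (sig_past M \<theta> t) (indicator A1)"
    have i1: "integrable M (indicator A1 :: 'w \<Rightarrow> real)" by (simp add: emeasure_eq_measure)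
    have i1B: "integrable M (indicator (A1 \<inter> B) :: 'w \<Rightarrow> real)" by (simp add: emeasure_eq_measure)
    have "integral\<^sup>L M (\<lambda>\<omega>. indicator A \<omega> * indicator B \<omega>) = integral\<^sup>L M (\<lambda>\<omega>. indicator A2 \<omega> * indicator (A1 \<inter> B) \<omega> :: real)"
      by (intro Bochner_Integration.integral_cong refl) (auto simp: A12 indicator_def)
    also have "\<dots> = integral\<^sup>L M (\<lambda>\<omega>. indicator A2 \<omega> * real_cond_exp M (sig_past M \<theta> t) (indicator (A1 \<inter> B)) \<omega>)"
      by (rule D.real_cond_exp_intg(2)[symmetric]) (use A12 integrable_mult_indicator[OF m(2) i1B] in auto)
    also have "\<dots> = integral\<^sup>L M (\<lambda>\<omega>. (indicator A2 \<omega> * ?h \<omega>) * ?h1 \<omega>)"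
    proof (rule integral_cong_AE)
      have "AE \<omega> in M. real_cond_exp M (sig_past M \<theta> t) (indicator (A1 \<inter> B)) \<omega> = ?h1 \<omega> * ?h \<omega>"
        using v_indep[of t] A12(1) B unfolding cond_indep_def by blast
      then show "AE \<omega> in M. indicator A2 \<omega> * real_cond_exp M (sig_past M \<theta> t) (indicator (A1 \<inter> B)) \<omega> = (indicator A2 \<omega> * ?h \<omega>) * ?h1 \<omega>"
        by eventually_elim (simp add: mult_ac)
    qed simp_all
    also have "\<dots> = integral\<^sup>L M (\<lambda>\<omega>. (indicator A2 \<omega> * ?h \<omega>) * indicator A1 \<omega>)"
    proof (rule D.real_cond_exp_intg(2))
      show "integrable M (\<lambda>\<omega>. indicator A2 \<omega> * ?h \<omega> * indicator A1 \<omega>)"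
        using integrable_mult_indicator[OF sets.Int[OF m] ih] by (simp add: indicator_inter_arith mult_ac)
      show "(\<lambda>\<omega>. indicator A2 \<omega> * ?h \<omega>) \<in> borel_measurable (sig_past M \<theta> t)"
        using A12 by (intro borel_measurable_times borel_measurable_indicator hD)
    qed simp
    also have "\<dots> = integral\<^sup>L M (\<lambda>\<omega>. indicator A \<omega> * ?h \<omega>)"
      by (intro Bochner_Integration.integral_cong refl) (auto simp: A12 indicator_def)
    finally have "integral\<^sup>L M (\<lambda>\<omega>. indicator A \<omega> * indicator B \<omega>) = integral\<^sup>L M (\<lambda>\<omega>. indicator A \<omega> * ?h \<omega>)" .
    moreover have "integrable M (\<lambda>\<omega>. indicator A \<omega> * indicator B \<omega> :: real)" "integrable M (\<lambda>\<omega>. indicator A \<omega> * ?h \<omega>)"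
      using integrable_mult_indicator[OF _ iB, of A] integrable_mult_indicator[OF _ ih, of A] A12 by auto
    ultimately show ?thesis by (simp add: right_diff_distrib)
  qed
  have GGM: "GG \<subseteq> sets M" using Filt_gen[of t] by (auto simp: GG_def)
  have GGs: "sets (Filt t) = sigma_sets (space M) GG"
  proof
    have "sets (sig_vpast M v m t) \<union> sets (sig_past M \<theta> t) \<subseteq> GG"
    proof
      fix A assume "A \<in> sets (sig_vpast M v m t) \<union> sets (sig_past M \<theta> t)"
      moreover have "space M \<in> sets (sig_vpast M v m t)" "space M \<in> sets (sig_past M \<theta> t)"
        using subalgebra_vpast[of t] subalgebra_past[of t] sets.top[of "sig_vpast M v m t"] sets.top[of "sig_past M \<theta> t"]
        by (auto simp: subalgebra_def)
      moreover have "A \<subseteq> space M" using calculation(1) Filt_gen[of t] sets.sets_into_space by blast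
      ultimately show "A \<in> GG" unfolding GG_def by (metis (mono_tags, lifting) Int_absorb1 Int_absorb2 UnE mem_Collect_eq)
    qed
    then show "sets (Filt t) \<subseteq> sigma_sets (space M) GG" unfolding sets_Filt by (rule sigma_sets_mono')
    have "GG \<subseteq> sets (Filt t)" unfolding GG_def sets_Filt
      by (auto simp: sets_Filt[symmetric] intro!: sets.Int) (auto simp: sets_Filt)
    then show "sigma_sets (space M) GG \<subseteq> sets (Filt t)" using sets.sigma_sets_subset[of GG "Filt t"] by simp
  qed
  have all: "integral\<^sup>L M (\<lambda>\<omega>. indicator A \<omega> * ?\<psi> \<omega>) = 0" if "A \<in> sets (Filt t)" for A
  proof -
    have "Int_stable GG"
    proof (rule Int_stableI)
      fix a b assume "a \<in> GG" "b \<in> GG"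
      then obtain A1 A2 B1 B2 where "A1 \<in> sets (sig_vpast M v m t)" "A2 \<in> sets (sig_past M \<theta> t)" "a = A1 \<inter> A2"
        "B1 \<in> sets (sig_vpast M v m t)" "B2 \<in> sets (sig_past M \<theta> t)" "b = B1 \<inter> B2" unfolding GG_def by blast
      then show "a \<inter> b \<in> GG" unfolding GG_def by (intro CollectI exI[of _ "A1 \<inter> B1"] exI[of _ "A2 \<inter> B2"]) auto
    qed
    moreover have "GG \<subseteq> Pow (space M)" using GGM sets.sets_into_space by blast
    moreover have "A \<in> sigma_sets (space M) GG" using that GGs by simp
    ultimately show ?thesis
    proof (induction rule: sigma_sets_induct_disjoint)
      case (basic A)
      then show ?case by (rule gen)
    next
      case empty
      then show ?case by simp
    next
      case (compl A)
      have AM: "A \<in> sets M" using compl(1) GGM sets.sigma_sets_subset[of GG M] by auto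
      have sp: "space M \<in> GG"
        using subalgebra_vpast[of t] subalgebra_past[of t] sets.top[of "sig_vpast M v m t"] sets.top[of "sig_past M \<theta> t"]
        unfolding GG_def subalgebra_def by (intro CollectI exI[of _ "space M"]) auto
      have "integral\<^sup>L M (\<lambda>\<omega>. indicator (space M - A) \<omega> * ?\<psi> \<omega>)
          = integral\<^sup>L M (\<lambda>\<omega>. indicator (space M) \<omega> * ?\<psi> \<omega> - indicator A \<omega> * ?\<psi> \<omega>)"
        using sets.sets_into_space[OF AM]
        by (intro Bochner_Integration.integral_cong refl) (auto simp: indicator_def)
      also have "\<dots> = 0" using gen[OF sp] compl(2) iA[OF AM] iA[OF sets.top] by (subst Bochner_Integration.integral_diff) auto
      finally show ?case .
    next
      case (union A)
      have AM: "A i \<in> sets M" for i using union(2) GGM sets.sigma_sets_subset[of GG M] by auto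
      have UM: "(\<Union>i. A i) \<in> sets M" using AM by auto
      have "(LINT \<omega>:(\<Union>i. A i)|M. ?\<psi> \<omega>) = (\<Sum>i. LINT \<omega>:A i|M. ?\<psi> \<omega>)"
        by (rule lebesgue_integral_countable_add)
          (use AM union(1) iA[OF UM] in \<open>auto simp: disjoint_family_on_def set_integrable_def\<close>)
      also have "\<dots> = 0" using union(3) by (simp add: set_lebesgue_integral_def)
      finally show ?case by (simp add: set_lebesgue_integral_def)
    qed
  qed
  have ce0: "AE \<omega> in M. real_cond_exp M (Filt t) ?\<psi> \<omega> = 0"
    by (rule cond_exp_0I[OF subalgebra_Filt i\<psi> all])
  from f(1) obtain g where g: "g \<in> borel_measurable (Filt t)" "AE \<omega> in M. f \<omega> = g \<omega>" by (auto simp: adapted_def)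
  have gM[measurable]: "g \<in> borel_measurable M" using measurable_from_subalg[OF subalgebra_Filt g(1)] .
  have fM[measurable]: "f \<in> borel_measurable M" using f by simp
  have ig: "integrable M g" by (rule integrable_cong_AE_imp[OF f(2) gM]) (use g(2) in auto)
  have igB: "integrable M (\<lambda>\<omega>. g \<omega> * indicator B \<omega>)" using integrable_mult_indicator[OF BM ig] by (simp add: mult.commute)
  have "integral\<^sup>L M (\<lambda>\<omega>. g \<omega> * ?\<psi> \<omega>) = 0"
    by (rule cond_exp_0_integral[OF subalgebra_Filt i\<psi> ce0 g(1)]) (use igB bd[OF ig] in \<open>simp add: right_diff_distrib\<close>)
  then have eq: "integral\<^sup>L M (\<lambda>\<omega>. g \<omega> * indicator B \<omega>) = integral\<^sup>L M (\<lambda>\<omega>. g \<omega> * ?h \<omega>)"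
    using igB bd[OF ig] by (simp add: right_diff_distrib)
  have "integral\<^sup>L M (\<lambda>\<omega>. f \<omega> * indicator B \<omega>) = integral\<^sup>L M (\<lambda>\<omega>. g \<omega> * indicator B \<omega>)"
    by (rule integral_cong_AE) (use g(2) in auto)
  moreover have "integral\<^sup>L M (\<lambda>\<omega>. f \<omega> * ?h \<omega>) = integral\<^sup>L M (\<lambda>\<omega>. g \<omega> * ?h \<omega>)"
    by (rule integral_cong_AE) (use g(2) in auto)
  ultimately show "integral\<^sup>L M (\<lambda>\<omega>. f \<omega> * indicator B \<omega>) = integral\<^sup>L M (\<lambda>\<omega>. f \<omega> * ?h \<omega>)" using eq by simp
  show "integrable M (\<lambda>\<omega>. f \<omega> * ?h \<omega>)" by (rule bd[OF f(2)])
qed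

text \<open>The support of \<open>g\<close> fixes the mode at time \<open>t\<close>, which turns the
  conditional probability of the next mode into the constant \<open>P q q'\<close>. All transition
  probabilities in the covariances arise from this identity.\<close>

lemma markov_ip:
  assumes f: "f \<in> L2 M" "adapted t f" and g: "g \<in> L2 M" "adapted t g" "\<And>\<omega>. g \<omega> * \<eta> q t \<omega> = g \<omega>"
    and q: "q \<in> Qs d" "q' \<in> Qs d"
  shows "ip M f (\<lambda>\<omega>. g \<omega> * \<eta> q' (t + 1) \<omega>) = P q q' * ip M f g"
proof -
  let ?B = "{\<omega> \<in> space M. \<theta> (t + 1) \<omega> = q'}"
  let ?h = "real_cond_exp M (sig_past M \<theta> t) (indicator ?B)"
  have B: "?B \<in> sets (sig_future M \<theta> t)"
    unfolding theta_event sig_future_def by (subst sets_measure_of) (auto intro!: sigma_sets.Basic exI[of _ "t + 1"])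
  have i: "integrable M (\<lambda>\<omega>. f \<omega> * g \<omega>)" using L2_mult_integrable[OF f(1) g(1)] .
  have [measurable]: "f \<in> borel_measurable M" "g \<in> borel_measurable M" using f g by (auto simp: L2_def)
  have "ip M f (\<lambda>\<omega>. g \<omega> * \<eta> q' (t + 1) \<omega>) = integral\<^sup>L M (\<lambda>\<omega>. (f \<omega> * g \<omega>) * indicator ?B \<omega>)"
    by (simp add: ip_def ind_def mult.assoc)
  also have "\<dots> = integral\<^sup>L M (\<lambda>\<omega>. (f \<omega> * g \<omega>) * ?h \<omega>)"
    by (rule adapted_future(1)[OF adapted_mult[OF f(2) g(2)] i B])
  also have "\<dots> = integral\<^sup>L M (\<lambda>\<omega>. P q q' * (f \<omega> * g \<omega>))"
  proof (rule integral_cong_AE)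
    show "AE \<omega> in M. f \<omega> * g \<omega> * ?h \<omega> = P q q' * (f \<omega> * g \<omega>)"
      using transition[OF q(2), of t] AE_space
    proof eventually_elim
      case (elim \<omega>)
      show ?case
      proof (cases "\<theta> t \<omega> = q")
        case True then show ?thesis using elim by simp
      next
        case False
        then have "g \<omega> = 0" using g(3)[of \<omega>] elim by (simp add: chi_space)
        then show ?thesis by simp
      qed
    qed
  qed simp_all
  finally show ?thesis by (simp add: ip_def)
qed

text \<open>Events generated by an adapted process agree up to null sets with events of
  \<open>Filt t\<close>, a property that passes through complements and countable unions. Hence (G2)
  carries over to any noise built causally from the old noise and the chain, such as the
  innovations.\<close>

lemma cond_indep_adapted:
  fixes u :: "int \<Rightarrow> 'w \<Rightarrow> real vec"
  assumes u: "\<And>s i. s \<le> t \<Longrightarrow> i < k \<Longrightarrow> adapted t (\<lambda>\<omega>. u s \<omega> $ i)"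
  shows "cond_indep M (sig_vpast M u k t) (sig_future M \<theta> t) (sig_past M \<theta> t)"
  unfolding cond_indep_def
proof (intro ballI)
  fix A B assume A: "A \<in> sets (sig_vpast M u k t)" and B: "B \<in> sets (sig_future M \<theta> t)"
  interpret D: sigma_finite_subalgebra M "sig_past M \<theta> t" by (rule sigma_finite_sub[OF subalgebra_past])
  let ?S = "{(\<lambda>\<omega>. u s \<omega> $ i) -` U \<inter> space M | s i U. s \<le> t \<and> i < k \<and> U \<in> sets borel}"
  have "A \<in> sigma_sets (space M) ?S"
    using A unfolding sig_vpast_def by (subst (asm) sets_measure_of) auto
  then have "A \<in> sets M \<and> (\<exists>A'\<in>sets (Filt t). AE \<omega> in M. \<omega> \<in> A \<longleftrightarrow> \<omega> \<in> A')"
  proof induction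
    case (Basic a)
    then obtain s i U where a: "a = (\<lambda>\<omega>. u s \<omega> $ i) -` U \<inter> space M" "s \<le> t" "i < k" "U \<in> sets borel" by blast
    from u[OF a(2,3)] obtain g where g: "(\<lambda>\<omega>. u s \<omega> $ i) \<in> borel_measurable M" "g \<in> borel_measurable (Filt t)" "AE \<omega> in M. u s \<omega> $ i = g \<omega>"
      by (auto simp: adapted_def)
    have "AE \<omega> in M. \<omega> \<in> a \<longleftrightarrow> \<omega> \<in> g -` U \<inter> space (Filt t)"
      using g(3) AE_space by eventually_elim (auto simp: a)
    then show ?case using measurable_sets[OF g(2) a(4)] measurable_sets[OF g(1) a(4)] a(1) by blast
  next
    case Empty
    then show ?case by (auto intro!: bexI[of _ "{}"])
  next
    case (Compl a)
    then obtain A' where A': "A' \<in> sets (Filt t)" "AE \<omega> in M. \<omega> \<in> a \<longleftrightarrow> \<omega> \<in> A'" by blast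
    have "AE \<omega> in M. \<omega> \<in> space M - a \<longleftrightarrow> \<omega> \<in> space (Filt t) - A'"
      using A'(2) by eventually_elim auto
    then show ?case using Compl A'(1) by (intro conjI bexI[OF _ sets.compl_sets[OF A'(1)]]) auto
  next
    case (Union a)
    then have "\<forall>i. \<exists>A'\<in>sets (Filt t). AE \<omega> in M. \<omega> \<in> a i \<longleftrightarrow> \<omega> \<in> A'" by blast
    then obtain A' where A': "\<And>i. A' i \<in> sets (Filt t)" "\<And>i::nat. AE \<omega> in M. \<omega> \<in> a i \<longleftrightarrow> \<omega> \<in> A' i" by metis
    have "AE \<omega> in M. \<forall>i. \<omega> \<in> a i \<longleftrightarrow> \<omega> \<in> A' i" using A'(2) by (simp add: AE_all_countable)
    then have "AE \<omega> in M. \<omega> \<in> (\<Union>i. a i) \<longleftrightarrow> \<omega> \<in> (\<Union>i. A' i)" by eventually_elim auto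
    moreover have "(\<Union>i. A' i) \<in> sets (Filt t)" using A'(1) by auto
    moreover have "(\<Union>i. a i) \<in> sets M" using Union by auto
    ultimately show ?case by blast
  qed
  then obtain A' where AM[measurable]: "A \<in> sets M" and A': "A' \<in> sets (Filt t)" "AE \<omega> in M. \<omega> \<in> A \<longleftrightarrow> \<omega> \<in> A'" by blast
  have adA: "adapted t (indicator A)"
    unfolding adapted_def
    by (intro conjI bexI[of _ "indicator A'"]) (use A' in \<open>auto elim!: eventually_mono simp: indicator_def\<close>)
  have BM[measurable]: "B \<in> sets M" using future_sets[OF B] .
  let ?h = "real_cond_exp M (sig_past M \<theta> t) (indicator B)" and ?hA = "real_cond_exp M (sig_past M \<theta> t) (indicator A)"
  have iA: "integrable M (indicator A :: 'w \<Rightarrow> real)" by (simp add: emeasure_eq_measure)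
  have ihA: "integrable M (\<lambda>\<omega>. ?h \<omega> * indicator A \<omega>)"
    using adapted_future(2)[OF adA iA B] by (simp add: mult.commute)
  have hm: "?h \<in> borel_measurable (sig_past M \<theta> t)" by simp
  show "AE \<omega> in M. real_cond_exp M (sig_past M \<theta> t) (indicator (A \<inter> B)) \<omega> = ?hA \<omega> * ?h \<omega>"
  proof (rule D.real_cond_exp_charact)
    show "integrable M (\<lambda>\<omega>. ?hA \<omega> * ?h \<omega>)"
      using D.real_cond_exp_intg(1)[OF ihA hm] by (simp add: mult.commute)
    show "integrable M (indicator (A \<inter> B) :: 'w \<Rightarrow> real)" by (simp add: emeasure_eq_measure)
    show "(\<lambda>\<omega>. ?hA \<omega> * ?h \<omega>) \<in> borel_measurable (sig_past M \<theta> t)" by simp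
    fix C assume C: "C \<in> sets (sig_past M \<theta> t)"
    have CM[measurable]: "C \<in> sets M" using C subalgebra_past by (auto simp: subalgebra_def)
    have adC: "adapted t (indicator C)" using C past_Filt by (intro adaptedI borel_measurable_indicator) auto
    have iCA: "integrable M (\<lambda>\<omega>. indicator C \<omega> * indicator A \<omega> :: real)"
      using integrable_mult_indicator[OF CM iA] by simp
    have "(LINT \<omega>:C|M. indicator (A \<inter> B) \<omega>) = integral\<^sup>L M (\<lambda>\<omega>. (indicator C \<omega> * indicator A \<omega>) * indicator B \<omega> :: real)"
      unfolding set_lebesgue_integral_def by (intro Bochner_Integration.integral_cong refl) (auto simp: indicator_def)
    also have "\<dots> = integral\<^sup>L M (\<lambda>\<omega>. (indicator C \<omega> * indicator A \<omega>) * ?h \<omega>)"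
      by (rule adapted_future(1)[OF adapted_mult[OF adC adA] iCA B])
    also have "\<dots> = integral\<^sup>L M (\<lambda>\<omega>. (indicator C \<omega> * ?h \<omega>) * indicator A \<omega>)"
      by (intro Bochner_Integration.integral_cong refl) (simp add: mult_ac)
    also have "\<dots> = integral\<^sup>L M (\<lambda>\<omega>. (indicator C \<omega> * ?h \<omega>) * ?hA \<omega>)"
    proof (rule D.real_cond_exp_intg(2)[symmetric])
      show "integrable M (\<lambda>\<omega>. indicator C \<omega> * ?h \<omega> * indicator A \<omega>)"
        using integrable_mult_indicator[OF CM ihA] by (simp add: mult.assoc)
      show "(\<lambda>\<omega>. indicator C \<omega> * ?h \<omega>) \<in> borel_measurable (sig_past M \<theta> t)"
        using C by (intro borel_measurable_times borel_measurable_indicator hm)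
    qed simp
    also have "\<dots> = (LINT \<omega>:C|M. ?hA \<omega> * ?h \<omega>)"
      unfolding set_lebesgue_integral_def by (intro Bochner_Integration.integral_cong refl) (simp add: mult_ac)
    finally show "(LINT \<omega>:C|M. indicator (A \<inter> B) \<omega>) = (LINT \<omega>:C|M. ?hA \<omega> * ?h \<omega>)" .
  qed
qed

end

lemma ip_lincomb_left:
  assumes "\<And>i. i \<in> I \<Longrightarrow> f i \<in> L2 M" "\<And>j. j \<in> K \<Longrightarrow> g j \<in> L2 M" "h \<in> L2 M"
  shows "ip M (\<lambda>\<omega>. (\<Sum>i\<in>I. c i * f i \<omega>) + (\<Sum>j\<in>K. e j * g j \<omega>)) h
    = (\<Sum>i\<in>I. c i * ip M (f i) h) + (\<Sum>j\<in>K. e j * ip M (g j) h)"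
proof -
  have 1: "(\<lambda>\<omega>. \<Sum>i\<in>I. c i * f i \<omega>) \<in> L2 M" "(\<lambda>\<omega>. \<Sum>j\<in>K. e j * g j \<omega>) \<in> L2 M"
    using assms by (intro L2_sum L2_scale; blast)+
  have 2: "ip M (\<lambda>\<omega>. \<Sum>i\<in>I. c i * f i \<omega>) h = (\<Sum>i\<in>I. c i * ip M (f i) h)"
    by (subst ip_sum_left) (use assms in auto)
  have 3: "ip M (\<lambda>\<omega>. \<Sum>j\<in>K. e j * g j \<omega>) h = (\<Sum>j\<in>K. e j * ip M (g j) h)"
    by (subst ip_sum_left) (use assms in auto)
  show ?thesis unfolding ip_add_left[OF 1 assms(3)] 2 3 ..
qed

context markov_chain
begin

lemma Zg_cong_AE:
  assumes "\<And>q t. q \<in> Qs d \<Longrightarrow> AE \<omega> in M. a q t \<omega> = b q t \<omega>" "set w \<subseteq> Qs d"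
  shows "AE \<omega> in M. Zg a w t \<omega> = Zg b w t \<omega>"
  using assms(2)
proof (induction w arbitrary: t)
  case (Cons q w)
  show ?case
  proof (cases "w = []")
    case False
    have "AE \<omega> in M. Zg a w (t - 1) \<omega> = Zg b w (t - 1) \<omega>" using Cons by auto
    then show ?thesis unfolding Zg_Cons[OF False] by eventually_elim simp
  qed (use assms(1) Cons in simp)
qed simp

text \<open>(G3) lists paths forwards in time and \<open>Gen\<close> backwards, hence the reversal;
  a delay \<open>k > 0\<close> corresponds to at least two letters.\<close>

lemma delayed_generators:
  "{(\<lambda>\<omega>. u (t - int k) \<omega> $ j *
       indicator {\<omega> \<in> space M. \<forall>r \<le> k. \<theta> (t - int k + int r) \<omega> = qs ! r} \<omega>)
     | k qs j. k > 0 \<and> length qs = k + 1 \<and> set qs \<subseteq> Qs d \<and> j < m} = Gen 2 (\<lambda>j q t \<omega>. u t \<omega> $ j * \<eta> q t \<omega>) m t"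
  (is "{?g k qs j | k qs j. ?c k qs j} = Gen 2 ?a m t")
proof -
  have eq: "Zg (?a j) w t = ?g k qs j" if "qs = rev w" "length w = k + 1" for j w k qs
  proof
    fix \<omega>
    have w: "w \<noteq> []" using that by auto
    have nth: "w ! r = qs ! (k - r)" if "r < k + 1" for r
      using that \<open>length w = k + 1\<close> \<open>qs = rev w\<close> by (simp add: rev_nth)
    have "(\<forall>r<length w. \<theta> (t - int r) \<omega> = w ! r) \<longleftrightarrow> (\<forall>r\<le>k. \<theta> (t - int k + int r) \<omega> = qs ! r)" for \<omega>
    proof safe
      fix r assume *: "\<forall>r<length w. \<theta> (t - int r) \<omega> = w ! r" "r \<le> k"
      have "k - r < length w" using that by simp
      then have "\<theta> (t - int (k - r)) \<omega> = w ! (k - r)" using *(1) by blast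
      then show "\<theta> (t - int k + int r) \<omega> = qs ! r" using *(2) nth[of "k - r"] by (simp add: of_nat_diff algebra_simps)
    next
      fix r assume *: "\<forall>r\<le>k. \<theta> (t - int k + int r) \<omega> = qs ! r" "r < length w"
      then have "\<theta> (t - int k + int (k - r)) \<omega> = qs ! (k - r)" by auto
      then show "\<theta> (t - int r) \<omega> = w ! r" using *(2) nth[of r] that(2) by (simp add: of_nat_diff)
    qed
    then show "Zg (?a j) w t \<omega> = ?g k qs j \<omega>"
      unfolding Zg_cyl[OF w] cyl_eq_indicator[OF w] using that(2) by simp
  qed
  show ?thesis
  proof (intro equalityI subsetI)
    fix g assume "g \<in> {?g k qs j | k qs j. ?c k qs j}"
    then obtain k qs j where g: "g = ?g k qs j" and c: "?c k qs j" by blast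
    have "g = Zg (?a j) (rev qs) t" unfolding g by (rule eq[symmetric]) (use c in auto)
    then show "g \<in> Gen 2 ?a m t" using c by (auto intro!: GenI)
  next
    fix g assume "g \<in> Gen 2 ?a m t"
    then obtain j w where g: "j < m" "2 \<le> length w" "set w \<subseteq> Qs d" "g = Zg (?a j) w t" by (rule GenE)
    have "g = ?g (length w - 1) (rev w) j" unfolding g(4) by (rule eq) (use g in auto)
    moreover have "?c (length w - 1) (rev w) j" using g by auto
    ultimately show "g \<in> {?g k qs j | k qs j. ?c k qs j}" by blast
  qed
qed

lemma ip_disjoint:
  assumes "q \<noteq> q'" "\<And>\<omega>. f \<omega> * \<eta> q t \<omega> = f \<omega>" "\<And>\<omega>. g \<omega> * \<eta> q' t \<omega> = g \<omega>"
  shows "ip M f g = 0"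
proof -
  have "f \<omega> * g \<omega> = 0" for \<omega>
  proof -
    have "f \<omega> * g \<omega> = (f \<omega> * g \<omega>) * (\<eta> q t \<omega> * \<eta> q' t \<omega>)"
      using assms(2,3)[of \<omega>] by (metis mult.assoc mult.left_commute)
    then show ?thesis using chi_disjoint[OF assms(1)] by simp
  qed
  then have "(\<lambda>\<omega>. f \<omega> * g \<omega>) = (\<lambda>_. 0)" by blast
  then show ?thesis by (simp only: ip_def) simp
qed

end

text \<open>The earliest transition of the path carries no factor, because its probability is
  already contained in \<open>Gmat\<close>. As the word runs backwards, this is the transition
  between its last two letters.\<close>

fun path_weight :: "(nat \<Rightarrow> nat \<Rightarrow> real) \<Rightarrow> nat list \<Rightarrow> real" where
  "path_weight P (q # q1 # q2 # w) = P q1 q * path_weight P (q1 # q2 # w)"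
| "path_weight P _ = 1"

text \<open>\<open>Mpath\<close> peels off the earliest letter, whereas the state equation appends
  the latest one.\<close>

lemma Mpath_snoc:
  assumes "w \<noteq> []" and "\<And>a b. a \<in> set (w @ [q]) \<Longrightarrow> b \<in> set (w @ [q]) \<Longrightarrow> Mm H a b \<in> carrier_mat (nst H b) (nst H a)"
  shows "Mpath H (w @ [q]) = Mm H (last w) q * Mpath H w" "Mpath H w \<in> carrier_mat (nst H (last w)) (nst H (hd w))"
proof -
  have "Mpath H (w @ [q]) = Mm H (last w) q * Mpath H w \<and> Mpath H w \<in> carrier_mat (nst H (last w)) (nst H (hd w))"
    using assms
  proof (induction w rule: Mpath.induct)
    case (2 H a)
    have "Mm H a q \<in> carrier_mat (nst H q) (nst H a)" by (rule 2) auto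
    then show ?case by simp
  next
    case (3 H a b r)
    have ab: "Mm H a b \<in> carrier_mat (nst H b) (nst H a)" by (rule 3) auto
    have lq: "Mm H (last (b # r)) q \<in> carrier_mat (nst H q) (nst H (last (b # r)))"
      by (rule 3) (use last_in_set[of "b # r"] in auto)
    have IH: "Mpath H ((b # r) @ [q]) = Mm H (last (b # r)) q * Mpath H (b # r)"
      "Mpath H (b # r) \<in> carrier_mat (nst H (last (b # r))) (nst H b)"
      using "3.IH" "3.prems" by auto
    show ?case using IH ab assoc_mult_mat[OF lq IH(2) ab] by auto
  qed simp
  then show "Mpath H (w @ [q]) = Mm H (last w) q * Mpath H w" "Mpath H w \<in> carrier_mat (nst H (last w)) (nst H (hd w))" by auto
qed

section \<open>The state process\<close>

context gsys
begin

abbreviation "n q \<equiv> nst H q"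

lemma Mm_carrier: "q \<in> Qs d \<Longrightarrow> q' \<in> Qs d \<Longrightarrow> Mm H q q' \<in> carrier_mat (n q') (n q)"
  and Bm_carrier: "q \<in> Qs d \<Longrightarrow> q' \<in> Qs d \<Longrightarrow> Bm H q q' \<in> carrier_mat (n q') m"
  and Cm_carrier: "q \<in> Qs d \<Longrightarrow> Cm H q \<in> carrier_mat p (n q)"
  and Dm_carrier: "q \<in> Qs d \<Longrightarrow> Dm H q \<in> carrier_mat p m"
  and x_carrier: "\<omega> \<in> space M \<Longrightarrow> xp H t \<omega> \<in> carrier_vec (n (\<theta> t \<omega>))"
  and v_carrier: "\<omega> \<in> space M \<Longrightarrow> v t \<omega> \<in> carrier_vec m"
  and state_eq: "AE \<omega> in M. xp H (t + 1) \<omega> =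
            Mm H (\<theta> t \<omega>) (\<theta> (t + 1) \<omega>) *\<^sub>v xp H t \<omega> + Bm H (\<theta> t \<omega>) (\<theta> (t + 1) \<omega>) *\<^sub>v v t \<omega>"
  using gj unfolding is_gjmls_def by blast+

definition "X i q t = (\<lambda>\<omega>. xp H t \<omega> $ i * \<eta> q t \<omega>)"

lemma X_cl: "q \<in> Qs d \<Longrightarrow> i < n q \<Longrightarrow> X i q t \<in> cl M (Gen 2 V m t)"
proof -
  assume "q \<in> Qs d" "i < n q"
  then have "X i q t \<in> ms_closure M (Gen 2 V m t)"
    using G unfolding assumptionG_def X_def V_def[abs_def] delayed_generators[symmetric] by blast
  then show ?thesis by (simp add: ms_closure_eq_cl[OF Gen_L2[OF V_family]])
qed

lemma X_L2: "q \<in> Qs d \<Longrightarrow> i < n q \<Longrightarrow> X i q t \<in> L2 M"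
  by (rule cl_L2[OF X_cl])

lemma X_supp: "X i q t \<omega> * \<eta> q t \<omega> = X i q t \<omega>"
  by (simp add: X_def mult.assoc chi_idem)

lemma X_cl_1: "q \<in> Qs d \<Longrightarrow> i < n q \<Longrightarrow> X i q t \<in> cl M (Gen 1 V m t)"
  using X_cl cl_Gen_2_1[OF V_family] by blast

lemma X_adapted: "q \<in> Qs d \<Longrightarrow> i < n q \<Longrightarrow> adapted t (X i q t)"
  using X_cl cl_Gen_2_1[OF V_family] adapted_cl_V by blast

lemma V_L2: "q \<in> Qs d \<Longrightarrow> j < m \<Longrightarrow> V j q t \<in> L2 M"
  using familyD(1)[OF V_family] by blast

lemma V_cl: "q \<in> Qs d \<Longrightarrow> j < m \<Longrightarrow> V j q t \<in> cl M (Gen 1 V m t)"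
  using GenI[of j m 1 "[q]" V t] by (auto intro!: cl_base[OF Gen_L2[OF V_family]])

lemma V_supp: "V j q t \<omega> * \<eta> q t \<omega> = V j q t \<omega>"
  by (simp add: V_def mult.assoc chi_idem)

lemma V_X_orthogonal: "q \<in> Qs d \<Longrightarrow> q' \<in> Qs d \<Longrightarrow> j < m \<Longrightarrow> i < n q' \<Longrightarrow> ip M (V j q t) (X i q' t) = 0"
  by (rule V_orthogonal_past) (auto intro: X_cl)

lemma V_V_ip: "q \<in> Qs d \<Longrightarrow> i < m \<Longrightarrow> j < m \<Longrightarrow> ip M (V i q t) (V j q t) = Qmat M \<theta> H q $$ (i, j)"
proof -
  assume a: "q \<in> Qs d" "i < m" "j < m"
  have "V i q t \<omega> * V j q t \<omega> = v t \<omega> $ i * v t \<omega> $ j * \<eta> q t \<omega>" for \<omega>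
    unfolding V_def using chi_idem[of q t \<omega>] by (metis mult.assoc mult.left_commute)
  then show ?thesis using v_Q[OF a, of t] by (simp add: ip_def)
qed

lemma X_step:
  assumes q: "q \<in> Qs d" "q' \<in> Qs d" and i: "i < n q'"
  shows "AE \<omega> in M. X i q' (t + 1) \<omega> * \<eta> q t \<omega> =
     ((\<Sum>l\<in>{0..<n q}. Mm H q q' $$ (i, l) * X l q t \<omega>) + (\<Sum>j\<in>{0..<m}. Bm H q q' $$ (i, j) * V j q t \<omega>)) * \<eta> q' (t + 1) \<omega>"
  using state_eq[of t] AE_space
proof eventually_elim
  case (elim \<omega>)
  show ?case
  proof (cases "\<theta> t \<omega> = q \<and> \<theta> (t + 1) \<omega> = q'")
    case True
    have x: "xp H t \<omega> \<in> carrier_vec (n q)" and vv: "v t \<omega> \<in> carrier_vec m" using x_carrier[OF elim(2), of t] v_carrier[OF elim(2)] True by auto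
    have "xp H (t + 1) \<omega> $ i = (Mm H q q' *\<^sub>v xp H t \<omega>) $ i + (Bm H q q' *\<^sub>v v t \<omega>) $ i"
      using elim(1) True Bm_carrier[OF q] i by simp
    then show ?thesis using elim(2) True
      by (simp add: X_def V_def chi_space mult_mat_sum[OF Mm_carrier[OF q] x i] mult_mat_sum[OF Bm_carrier[OF q] vv i])
  next
    case False
    then show ?thesis using elim(2) by (auto simp: X_def V_def chi_space)
  qed
qed

lemma X_step_ip:
  assumes q: "q \<in> Qs d" "q' \<in> Qs d" and i: "i < n q'"
    and g: "g \<in> L2 M" "adapted t g" "\<And>\<omega>. g \<omega> * \<eta> q t \<omega> = g \<omega>"
  shows "ip M (X i q' (t + 1)) (\<lambda>\<omega>. g \<omega> * \<eta> q' (t + 1) \<omega>) =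
    P q q' * ((\<Sum>l\<in>{0..<n q}. Mm H q q' $$ (i, l) * ip M (X l q t) g) + (\<Sum>j\<in>{0..<m}. Bm H q q' $$ (i, j) * ip M (V j q t) g))"
proof -
  let ?S = "\<lambda>\<omega>. (\<Sum>l\<in>{0..<n q}. Mm H q q' $$ (i, l) * X l q t \<omega>) + (\<Sum>j\<in>{0..<m}. Bm H q q' $$ (i, j) * V j q t \<omega>)"
  have S: "?S \<in> L2 M" using q by (intro L2_add L2_sum L2_scale X_L2 V_L2) auto
  have ad: "adapted t ?S" using q by (intro adapted_add adapted_sum adapted_scale X_adapted adapted_V) auto
  \<comment> \<open>The support of \<open>g\<close> supplies the indicator of \<open>q\<close> at
    time \<open>t\<close>, which selects one branch of the state equation.\<close>
  have gE: "(\<lambda>\<omega>. g \<omega> * \<eta> q' (t + 1) \<omega>) = (\<lambda>\<omega>. (g \<omega> * \<eta> q' (t + 1) \<omega>) * \<eta> q t \<omega>)"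
    using g(3) by (metis mult.assoc mult.commute)
  have gL: "(\<lambda>\<omega>. g \<omega> * \<eta> q' (t + 1) \<omega>) \<in> L2 M" using L2_chi[OF g(1)] .
  have "ip M (X i q' (t + 1)) (\<lambda>\<omega>. g \<omega> * \<eta> q' (t + 1) \<omega>) = ip M (\<lambda>\<omega>. X i q' (t + 1) \<omega> * \<eta> q t \<omega>) (\<lambda>\<omega>. g \<omega> * \<eta> q' (t + 1) \<omega>)"
    by (subst gE) (rule ip_mult_shift[symmetric])
  also have "\<dots> = ip M (\<lambda>\<omega>. ?S \<omega> * \<eta> q' (t + 1) \<omega>) (\<lambda>\<omega>. g \<omega> * \<eta> q' (t + 1) \<omega>)"
    by (rule ip_cong_AE)
      (use X_step[OF q i, of t] L2_chi[OF X_L2[OF q(2) i]] L2_chi[OF S] gL in \<open>auto simp: L2_measurable\<close>)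
  also have "\<dots> = ip M ?S (\<lambda>\<omega>. g \<omega> * \<eta> q' (t + 1) \<omega>)"
    unfolding ip_mult_shift by (simp add: mult.assoc chi_idem)
  also have "\<dots> = P q q' * ip M ?S g" by (rule markov_ip[OF S ad g q])
  also have "ip M ?S g = (\<Sum>l\<in>{0..<n q}. Mm H q q' $$ (i, l) * ip M (X l q t) g) + (\<Sum>j\<in>{0..<m}. Bm H q q' $$ (i, j) * ip M (V j q t) g)"
    by (rule ip_lincomb_left) (use q g(1) in \<open>auto intro: X_L2 V_L2\<close>)
  finally show ?thesis .
qed

subsection \<open>Stationarity of second moments\<close>

text \<open>Two words with the same first letter, the mode at the present time, both lose it at the
  cost of a factor \<open>P\<close> that does not depend on time; words with different first letters
  are orthogonal. The recursion stops when one word is a single letter, the case covered by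
  \<open>base\<close> and \<open>cross\<close>.\<close>

lemma gram_stationary:
  assumes fam: "family a k" and ad: "\<And>j q t. j < k \<Longrightarrow> q \<in> Qs d \<Longrightarrow> adapted t (a j q t)"
    and base: "\<And>i j q t s. i < k \<Longrightarrow> j < k \<Longrightarrow> q \<in> Qs d \<Longrightarrow> ip M (a i q t) (a j q t) = ip M (a i q s) (a j q s)"
    and cross: "\<And>i j q w t s. i < k \<Longrightarrow> j < k \<Longrightarrow> q \<in> Qs d \<Longrightarrow> set w \<subseteq> Qs d \<Longrightarrow> 2 \<le> length w \<Longrightarrow>
       ip M (a i q t) (Zg (a j) w t) = ip M (a i q s) (Zg (a j) w s)"
    and ij: "i < k" "j < k" and w: "set w \<subseteq> Qs d" "w \<noteq> []" and w': "set w' \<subseteq> Qs d" "w' \<noteq> []"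
  shows "ip M (Zg (a i) w t) (Zg (a j) w' t) = ip M (Zg (a i) w s) (Zg (a j) w' s)"
  using w w'
proof (induction w arbitrary: w' t s)
  case (Cons q w)
  from Cons.prems(4) obtain q' w1 where w': "w' = q' # w1" by (cases w') auto
  have q: "q \<in> Qs d" "q' \<in> Qs d" using Cons.prems w' by auto
  show ?case
  proof (cases "q = q'")
    case False
    have "ip M (Zg (a i) (q # w) t) (Zg (a j) (q' # w1) t) = 0" for t
      by (rule ip_disjoint[OF False Zg_supp[OF fam ij(1)] Zg_supp[OF fam ij(2)]]) (use Cons.prems w' in auto)
    then show ?thesis by (simp add: w')
  next
    case qq: True
    show ?thesis
    proof (cases "w = []")
      case True
      show ?thesis
      proof (cases "w1 = []")
        case True
        then show ?thesis using \<open>w = []\<close> base ij q qq w' by simp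
      next
        case False
        then have "2 \<le> length w'" using w' by (cases w1) auto
        then show ?thesis using \<open>w = []\<close> cross[of i j q w'] ij q Cons.prems by simp
      qed
    next
      case False
      show ?thesis
      proof (cases "w1 = []")
        case True
        have "2 \<le> length (q # w)" using False by (cases w) auto
        then have "ip M (a j q' t) (Zg (a i) (q # w) t) = ip M (a j q' s) (Zg (a i) (q # w) s)"
          using cross[of j i q' "q # w"] ij q Cons.prems by blast
        then show ?thesis using True w' by (simp add: ip_commute[of M "Zg (a i) (q # w) _"])
      next
        case w1: False
        then obtain q1 w2 where w1e: "w1 = q1 # w2" by (cases w1) auto
        have q1: "q1 \<in> Qs d" "set w1 \<subseteq> Qs d" "set w \<subseteq> Qs d" using Cons.prems w' w1e by auto
        have *: "ip M (Zg (a i) (q # w) t) (Zg (a j) w' t) = P q1 q * ip M (Zg (a i) w (t - 1)) (Zg (a j) w1 (t - 1))" for t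
        proof -
          have "ip M (Zg (a i) (q # w) t) (Zg (a j) w' t) =
              ip M (Zg (a i) w (t - 1)) (\<lambda>\<omega>. Zg (a j) w1 (t - 1) \<omega> * \<eta> q t \<omega>)"
            unfolding w' Zg_Cons[OF False] Zg_Cons[OF w1] qq[symmetric] ip_mult_shift by (simp add: mult.assoc chi_idem)
          also have "\<dots> = P q1 q * ip M (Zg (a i) w (t - 1)) (Zg (a j) w1 (t - 1))"
            using markov_ip[of "Zg (a i) w (t - 1)" "t - 1" "Zg (a j) w1 (t - 1)" q1 q] Zg_L2[OF fam] q q1 ij ad
              Zg_supp[OF fam ij(2), of q1 w2 "t - 1"]
            by (simp add: w1e adapted_Zg)
          finally show ?thesis .
        qed
        show ?thesis unfolding * using Cons.IH[OF q1(3) False q1(2) w1, of "t - 1" "s - 1"] by simp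
      qed
    qed
  qed
qed simp

lemma X_cross_step:
  assumes fam: "family a k" and ad: "\<And>j q t. j < k \<Longrightarrow> q \<in> Qs d \<Longrightarrow> adapted t (a j q t)"
    and q: "q \<in> Qs d" "q1 \<in> Qs d" "set w \<subseteq> Qs d" and i: "i < n q" "j < k"
  shows "ip M (X i q t) (Zg (a j) (q # q1 # w) t) =
    P q1 q * ((\<Sum>l\<in>{0..<n q1}. Mm H q1 q $$ (i, l) * ip M (X l q1 (t - 1)) (Zg (a j) (q1 # w) (t - 1)))
      + (\<Sum>l\<in>{0..<m}. Bm H q1 q $$ (i, l) * ip M (V l q1 (t - 1)) (Zg (a j) (q1 # w) (t - 1))))"
  using X_step_ip[OF q(2,1) i(1), of "Zg (a j) (q1 # w) (t - 1)" "t - 1"] q i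
    Zg_L2[OF fam i(2), of "q1 # w" "t - 1"] adapted_Zg[of "a j" "q1 # w" "t - 1"] ad Zg_supp[OF fam i(2), of q1 w "t - 1"]
  by simp

text \<open>The state equation removes one letter with coefficients independent of time. While two
  letters remain, the noise term vanishes by \<open>V0\<close>; at a single letter \<open>Xa\<close>
  and \<open>Va\<close> take over.\<close>

lemma X_cross_stationary:
  assumes fam: "family a k" and ad: "\<And>j q t. j < k \<Longrightarrow> q \<in> Qs d \<Longrightarrow> adapted t (a j q t)"
    and Xa: "\<And>i j q t s. q \<in> Qs d \<Longrightarrow> i < n q \<Longrightarrow> j < k \<Longrightarrow> ip M (X i q t) (a j q t) = ip M (X i q s) (a j q s)"
    and Va: "\<And>i j q t s. q \<in> Qs d \<Longrightarrow> i < m \<Longrightarrow> j < k \<Longrightarrow> ip M (V i q t) (a j q t) = ip M (V i q s) (a j q s)"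
    and V0: "\<And>i j q w t. q \<in> Qs d \<Longrightarrow> i < m \<Longrightarrow> j < k \<Longrightarrow> set w \<subseteq> Qs d \<Longrightarrow> 2 \<le> length w \<Longrightarrow> ip M (V i q t) (Zg (a j) w t) = 0"
    and w: "set w \<subseteq> Qs d" "2 \<le> length w" and i: "q \<in> Qs d" "i < n q" "j < k"
  shows "ip M (X i q t) (Zg (a j) w t) = ip M (X i q s) (Zg (a j) w s)"
  using w i(1,2)
proof (induction w arbitrary: i q t s)
  case (Cons q0 w)
  from Cons.prems(2) obtain q1 w1 where w: "w = q1 # w1" by (cases w) auto
  have Q: "q0 \<in> Qs d" "q1 \<in> Qs d" "set w1 \<subseteq> Qs d" using Cons.prems w by auto
  show ?case
  proof (cases "q = q0")
    case False
    have "ip M (X i q t) (Zg (a j) (q0 # w) t) = 0" for t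
      by (rule ip_disjoint[OF False X_supp Zg_supp[OF fam i(3)]]) (use Cons.prems in auto)
    then show ?thesis by simp
  next
    case True
    have "ip M (X l q1 (t - 1)) (Zg (a j) w (t - 1)) = ip M (X l q1 (s - 1)) (Zg (a j) w (s - 1))" if "l < n q1" for l
    proof (cases "w1 = []")
      case True
      then show ?thesis using Xa[OF Q(2) that i(3)] w by simp
    next
      case False
      then have "2 \<le> length w" using w by (cases w1) auto
      then show ?thesis using Cons.IH[of q1 l] Q that w by simp
    qed
    moreover have "ip M (V l q1 (t - 1)) (Zg (a j) w (t - 1)) = ip M (V l q1 (s - 1)) (Zg (a j) w (s - 1))" if "l < m" for l
    proof (cases "w1 = []")
      case True
      then show ?thesis using Va[OF Q(2) that i(3)] w by simp
    next
      case False
      then have "2 \<le> length w" using w by (cases w1) auto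
      then show ?thesis using V0[OF Q(2) that i(3)] Q w by simp
    qed
    ultimately show ?thesis
      using X_cross_step[OF fam ad Q(1,2,3) _ i(3), of i] Cons.prems w True by simp
  qed
qed simp

lemma V_gram_stationary:
  assumes "i < m" "j < m" "set w \<subseteq> Qs d" "w \<noteq> []" "set w' \<subseteq> Qs d" "w' \<noteq> []"
  shows "ip M (Zg (V i) w t) (Zg (V j) w' t) = ip M (Zg (V i) w s) (Zg (V j) w' s)"
proof (rule gram_stationary[OF V_family _ _ _ assms])
  fix i j q w and t :: int assume *: "i < m" "j < m" "q \<in> Qs d" "set w \<subseteq> Qs d" "2 \<le> length w"
  have "ip M (V i q t) (Zg (V j) w t) = 0" for t
    by (rule V_orthogonal_past[OF *(3,1)]) (use * in \<open>auto intro!: cl_base[OF Gen_L2[OF V_family]] GenI\<close>)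
  then show "ip M (V i q t) (Zg (V j) w t) = ip M (V i q s) (Zg (V j) w s)" for s by simp
qed (auto simp: V_V_ip adapted_V)

lemma X_V_cross_stationary:
  assumes "q \<in> Qs d" "i < n q" "j < m" "set w \<subseteq> Qs d" "2 \<le> length w"
  shows "ip M (X i q t) (Zg (V j) w t) = ip M (X i q s) (Zg (V j) w s)"
proof (rule X_cross_stationary[OF V_family _ _ _ _ assms(4,5,1,2,3)])
  fix i j q w and t :: int assume *: "q \<in> Qs d" "i < m" "j < m" "set w \<subseteq> Qs d" "2 \<le> length w"
  show "ip M (V i q t) (Zg (V j) w t) = 0"
    by (rule V_orthogonal_past[OF *(1,2)]) (use * in \<open>auto intro!: cl_base[OF Gen_L2[OF V_family]] GenI\<close>)
qed (auto simp: V_V_ip adapted_V ip_commute[of M "X _ _ _"] V_X_orthogonal)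

text \<open>The covariance recursion has no initial time to start from. Instead, (G3) makes the
  state its own projection onto the delayed noise, so its inner products are determined by the Gram
  matrix of the delayed noise and the cross moments with it, all independent of time.\<close>

lemma X_X_stationary:
  assumes q: "q \<in> Qs d" and i: "i < n q" and j: "j < n q"
  shows "ip M (X i q t) (X j q t) = Pmat M \<theta> H q $$ (i, j)"
proof -
  have st: "ip M (X i q t) (X j q t) = ip M (X i q s) (X j q s)" for s
  proof (rule projection_ip_eq[where z="\<lambda>(j, w). Zg (V j) w t" and z'="\<lambda>(j, w). Zg (V j) w s" and I="WI 2 m"
        and ?f1.0="X i q t" and ?f1'.0="X i q s" and ?f2.0="X j q t" and ?f2'.0="X j q s"])
    show "ip M (case a of (j, w) \<Rightarrow> Zg (V j) w t) (case b of (j, w) \<Rightarrow> Zg (V j) w t)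
       = ip M (case a of (j, w) \<Rightarrow> Zg (V j) w s) (case b of (j, w) \<Rightarrow> Zg (V j) w s)" if "a \<in> WI 2 m" "b \<in> WI 2 m" for a b
      using that V_gram_stationary by (auto simp: WI_def) (metis list.size(3) not_numeral_le_zero)
    show "ip M (X i q t) (case a of (j, w) \<Rightarrow> Zg (V j) w t) = ip M (X i q s) (case a of (j, w) \<Rightarrow> Zg (V j) w s)" if "a \<in> WI 2 m" for a
      using that X_V_cross_stationary[OF q i] by (auto simp: WI_def)
    show "ip M (X j q t) (case a of (j, w) \<Rightarrow> Zg (V j) w t) = ip M (X j q s) (case a of (j, w) \<Rightarrow> Zg (V j) w s)" if "a \<in> WI 2 m" for a
      using that X_V_cross_stationary[OF q j] by (auto simp: WI_def)
  qed (use Gen_L2[OF V_family, of 2] X_L2[OF q] X_cl[OF q] i j in \<open>auto simp: Gen_def[symmetric]\<close>)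
  have "X i q 0 \<omega> * X j q 0 \<omega> = xp H 0 \<omega> $ i * xp H 0 \<omega> $ j * \<eta> q 0 \<omega>" for \<omega>
    unfolding X_def using chi_idem[of q 0 \<omega>] by (metis mult.assoc mult.left_commute)
  then have "ip M (X i q 0) (X j q 0) = Pmat M \<theta> H q $$ (i, j)"
    using i j by (simp add: ip_def Pmat_def)
  then show ?thesis using st[of 0] by simp
qed

subsection \<open>The output process and its covariances\<close>

definition "Y i q t = (\<lambda>\<omega>. (\<Sum>l\<in>{0..<n q}. Cm H q $$ (i, l) * X l q t \<omega>) + (\<Sum>j\<in>{0..<m}. Dm H q $$ (i, j) * V j q t \<omega>))"

lemma Y_output:
  assumes "\<omega> \<in> space M" "i < p" "q \<in> Qs d"
  shows "Y i q t \<omega> = (Cm H (\<theta> t \<omega>) *\<^sub>v xp H t \<omega> + Dm H (\<theta> t \<omega>) *\<^sub>v v t \<omega>) $ i * \<eta> q t \<omega>"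
proof (cases "\<theta> t \<omega> = q")
  case True
  have x: "xp H t \<omega> \<in> carrier_vec (n q)" using x_carrier[OF assms(1), of t] True by simp
  show ?thesis using assms True Dm_carrier[OF assms(3)]
    by (simp add: Y_def X_def V_def chi_space mult_mat_sum[OF Cm_carrier[OF assms(3)] x assms(2)]
        mult_mat_sum[OF Dm_carrier[OF assms(3)] v_carrier[OF assms(1)] assms(2)])
next
  case False
  then show ?thesis using assms by (simp add: Y_def X_def V_def chi_space)
qed

lemma Y_family: "family Y p"
  unfolding family_def Y_def
proof (intro allI impI ballI conjI)
  fix j q t \<omega> assume "q \<in> Qs d"
  then show "(\<lambda>\<omega>. (\<Sum>l\<in>{0..<n q}. Cm H q $$ (j, l) * X l q t \<omega>) + (\<Sum>k\<in>{0..<m}. Dm H q $$ (j, k) * V k q t \<omega>)) \<in> L2 M"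
    by (intro L2_add L2_sum L2_scale X_L2 V_L2) auto
  show "((\<Sum>l\<in>{0..<n q}. Cm H q $$ (j, l) * X l q t \<omega>) + (\<Sum>k\<in>{0..<m}. Dm H q $$ (j, k) * V k q t \<omega>)) * \<eta> q t \<omega> =
      (\<Sum>l\<in>{0..<n q}. Cm H q $$ (j, l) * X l q t \<omega>) + (\<Sum>k\<in>{0..<m}. Dm H q $$ (j, k) * V k q t \<omega>)"
    unfolding distrib_right sum_distrib_right by (simp only: mult.assoc X_supp V_supp)
qed

lemma Y_L2: "q \<in> Qs d \<Longrightarrow> i < p \<Longrightarrow> Y i q t \<in> L2 M"
  using familyD(1)[OF Y_family] by blast

lemma Y_supp: "q \<in> Qs d \<Longrightarrow> i < p \<Longrightarrow> Y i q t \<omega> * \<eta> q t \<omega> = Y i q t \<omega>"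
  using familyD(2)[OF Y_family] by blast

lemma Y_cl: "q \<in> Qs d \<Longrightarrow> Y i q t \<in> cl M (Gen 1 V m t)"
  unfolding Y_def
  by (intro cl_add[OF Gen_L2[OF V_family]] cl_sum[OF Gen_L2[OF V_family]] cl_scale[OF Gen_L2[OF V_family]] V_cl X_cl_1) auto

lemma Y_adapted: "q \<in> Qs d \<Longrightarrow> adapted t (Y i q t)"
  by (rule adapted_cl_V[OF Y_cl])

lemma Y_past_V: "cl M (Gen 2 Y p t) \<subseteq> cl M (Gen 2 V m t)"
  by (rule cl_least[OF Gen_L2[OF Y_family] Gen_L2[OF V_family]])
    (auto elim!: GenE intro!: cl_shift_Zg[OF V_family Y_cl])

lemma Zg_Y_cl: "j < p \<Longrightarrow> set w \<subseteq> Qs d \<Longrightarrow> 2 \<le> length w \<Longrightarrow> Zg (Y j) w t \<in> cl M (Gen 2 Y p t)"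
  by (intro cl_base[OF Gen_L2[OF Y_family]] GenI)

lemma V_Y_past: "q \<in> Qs d \<Longrightarrow> i < m \<Longrightarrow> f \<in> cl M (Gen 2 Y p t) \<Longrightarrow> ip M (V i q t) f = 0"
  using V_orthogonal_past Y_past_V by blast

lemma Y_ip_right:
  assumes "q \<in> Qs d" "j < p" "f \<in> L2 M"
  shows "ip M f (Y j q t) = (\<Sum>l\<in>{0..<n q}. Cm H q $$ (j, l) * ip M f (X l q t)) + (\<Sum>k\<in>{0..<m}. Dm H q $$ (j, k) * ip M f (V k q t))"
  unfolding Y_def ip_commute[of M f] by (rule ip_lincomb_left) (use assms in \<open>auto intro: X_L2 V_L2\<close>)

lemma X_Y_ip:
  assumes "q \<in> Qs d" "i < n q" "j < p"
  shows "ip M (X i q t) (Y j q t) = (\<Sum>l\<in>{0..<n q}. Cm H q $$ (j, l) * Pmat M \<theta> H q $$ (i, l))"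
  using assms by (simp add: Y_ip_right X_L2 X_X_stationary ip_commute[of M "X i q t" "V _ q t"] V_X_orthogonal)

lemma V_Y_ip:
  assumes "q \<in> Qs d" "i < m" "j < p"
  shows "ip M (V i q t) (Y j q t) = (\<Sum>l\<in>{0..<m}. Dm H q $$ (j, l) * Qmat M \<theta> H q $$ (i, l))"
  using assms by (simp add: Y_ip_right V_L2 V_X_orthogonal V_V_ip)

lemma X_Y_cross_stationary:
  assumes "q \<in> Qs d" "i < n q" "j < p" "set w \<subseteq> Qs d" "2 \<le> length w"
  shows "ip M (X i q t) (Zg (Y j) w t) = ip M (X i q s) (Zg (Y j) w s)"
  by (rule X_cross_stationary[OF Y_family _ _ _ _ assms(4,5,1,2,3)])
    (auto simp: X_Y_ip V_Y_ip Y_adapted V_Y_past Zg_Y_cl)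

lemma Y_Y_ip:
  assumes "q \<in> Qs d" "i < p" "f \<in> L2 M"
  shows "ip M (Y i q t) f = (\<Sum>l\<in>{0..<n q}. Cm H q $$ (i, l) * ip M (X l q t) f) + (\<Sum>k\<in>{0..<m}. Dm H q $$ (i, k) * ip M (V k q t) f)"
  using Y_ip_right[OF assms] by (simp add: ip_commute[of M f])

lemma Y_gram_stationary:
  assumes "i < p" "j < p" "set w \<subseteq> Qs d" "w \<noteq> []" "set w' \<subseteq> Qs d" "w' \<noteq> []"
  shows "ip M (Zg (Y i) w t) (Zg (Y j) w' t) = ip M (Zg (Y i) w s) (Zg (Y j) w' s)"
proof (rule gram_stationary[OF Y_family _ _ _ assms])
  fix i j q w and t s :: int assume *: "i < p" "j < p" "q \<in> Qs d" "set w \<subseteq> Qs d" "2 \<le> length w"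
  have L: "Zg (Y j) w t \<in> L2 M" for t using Zg_L2[OF Y_family] * by blast
  have "ip M (X l q t) (Zg (Y j) w t) = ip M (X l q s) (Zg (Y j) w s)" if "l < n q" for l
    by (rule X_Y_cross_stationary) (use * that in auto)
  then show "ip M (Y i q t) (Zg (Y j) w t) = ip M (Y i q s) (Zg (Y j) w s)"
    using * L by (simp add: Y_Y_ip V_Y_past Zg_Y_cl)
qed (auto simp: Y_adapted Y_Y_ip Y_L2 X_Y_ip V_Y_ip)

lemma Gmat_carrier: "q \<in> Qs d \<Longrightarrow> q' \<in> Qs d \<Longrightarrow> Gmat M \<theta> P H q q' \<in> carrier_mat (n q') p"
proof -
  assume q: "q \<in> Qs d" "q' \<in> Qs d"
  have c: "Pmat M \<theta> H q \<in> carrier_mat (n q) (n q)" "Qmat M \<theta> H q \<in> carrier_mat m m"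
    by (simp_all add: Pmat_def Qmat_def)
  have ct: "transpose_mat (Cm H q) \<in> carrier_mat (n q) p" "transpose_mat (Dm H q) \<in> carrier_mat m p"
    using Cm_carrier[OF q(1)] Dm_carrier[OF q(1)] by auto
  show ?thesis unfolding Gmat_def
    by (rule smult_carrier_mat, rule add_carrier_mat, rule mult_carrier_mat[OF mult_carrier_mat[OF Bm_carrier[OF q] c(2)] ct(2)])
qed

lemma Gmat_index:
  assumes q: "q \<in> Qs d" "q' \<in> Qs d" and i: "i < n q'" and j: "j < p"
  shows "Gmat M \<theta> P H q q' $$ (i, j) = P q q' *
    ((\<Sum>l\<in>{0..<n q}. Mm H q q' $$ (i, l) * (\<Sum>k\<in>{0..<n q}. Cm H q $$ (j, k) * Pmat M \<theta> H q $$ (l, k)))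
     + (\<Sum>l\<in>{0..<m}. Bm H q q' $$ (i, l) * (\<Sum>k\<in>{0..<m}. Dm H q $$ (j, k) * Qmat M \<theta> H q $$ (l, k))))"
proof -
  have c: "Pmat M \<theta> H q \<in> carrier_mat (n q) (n q)" "Qmat M \<theta> H q \<in> carrier_mat m m"
    by (simp_all add: Pmat_def Qmat_def)
  note cc = Mm_carrier[OF q] Bm_carrier[OF q] Cm_carrier[OF q(1)] Dm_carrier[OF q(1)]
  have ct: "transpose_mat (Cm H q) \<in> carrier_mat (n q) p" "transpose_mat (Dm H q) \<in> carrier_mat m p" using cc by auto
  have c1: "Pmat M \<theta> H q * transpose_mat (Cm H q) \<in> carrier_mat (n q) p"
    "Qmat M \<theta> H q * transpose_mat (Dm H q) \<in> carrier_mat m p" using c ct by auto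
  define A where "A = Mm H q q' * (Pmat M \<theta> H q * transpose_mat (Cm H q))"
  define B where "B = Bm H q q' * (Qmat M \<theta> H q * transpose_mat (Dm H q))"
  have c2: "A \<in> carrier_mat (n q') p" "B \<in> carrier_mat (n q') p"
    unfolding A_def B_def by (rule mult_carrier_mat[OF cc(1) c1(1)], rule mult_carrier_mat[OF cc(2) c1(2)])
  have "Gmat M \<theta> P H q q' = P q q' \<cdot>\<^sub>m (A + B)"
    unfolding Gmat_def A_def B_def using assoc_mult_mat[OF cc(1) c(1) ct(1)] assoc_mult_mat[OF cc(2) c(2) ct(2)] by simp
  then have "Gmat M \<theta> P H q q' $$ (i, j) = P q q' * (A $$ (i, j) + B $$ (i, j))"
    using c2 i j by simp
  also have "A $$ (i, j) =
     (\<Sum>l\<in>{0..<n q}. Mm H q q' $$ (i, l) * (\<Sum>k\<in>{0..<n q}. Cm H q $$ (j, k) * Pmat M \<theta> H q $$ (l, k)))"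
    unfolding A_def index_mult_mat_sum[OF cc(1) c1(1) i j]
  proof (intro sum.cong refl arg_cong2[of _ _ _ _ "(*)"])
    fix l assume "l \<in> {0..<n q}"
    then have l: "l < n q" by simp
    show "(Pmat M \<theta> H q * transpose_mat (Cm H q)) $$ (l, j) = (\<Sum>k\<in>{0..<n q}. Cm H q $$ (j, k) * Pmat M \<theta> H q $$ (l, k))"
      unfolding index_mult_mat_sum[OF c(1) ct(1) l j] using cc j by (intro sum.cong refl) (simp add: mult.commute)
  qed
  also have "B $$ (i, j) =
     (\<Sum>l\<in>{0..<m}. Bm H q q' $$ (i, l) * (\<Sum>k\<in>{0..<m}. Dm H q $$ (j, k) * Qmat M \<theta> H q $$ (l, k)))"
    unfolding B_def index_mult_mat_sum[OF cc(2) c1(2) i j]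
  proof (intro sum.cong refl arg_cong2[of _ _ _ _ "(*)"])
    fix l assume "l \<in> {0..<m}"
    then have l: "l < m" by simp
    show "(Qmat M \<theta> H q * transpose_mat (Dm H q)) $$ (l, j) = (\<Sum>k\<in>{0..<m}. Dm H q $$ (j, k) * Qmat M \<theta> H q $$ (l, k))"
      unfolding index_mult_mat_sum[OF c(2) ct(2) l j] using cc j by (intro sum.cong refl) (simp add: mult.commute)
  qed
  finally show ?thesis .
qed

lemma word_mat_carrier:
  assumes "set qs \<subseteq> Qs d" "2 \<le> length qs"
  shows "Mpath H (tl qs) \<in> carrier_mat (n (last qs)) (n (qs ! 1))"
    "Mpath H (tl qs) * Gmat M \<theta> P H (qs ! 0) (qs ! 1) \<in> carrier_mat (n (last qs)) p"
proof -
  obtain a b r where abr: "qs = a # b # r" using assms(2) by (metis Suc_le_length_iff numeral_2_eq_2)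
  have Q: "set (b # r) \<subseteq> Qs d" "a \<in> Qs d" "b \<in> Qs d" using assms abr by auto
  have "Mpath H (b # r) \<in> carrier_mat (n (last (b # r))) (n (hd (b # r)))"
    by (rule Mpath_snoc(2)[of _ b]) (use Q in \<open>auto intro: Mm_carrier\<close>)
  then show 1: "Mpath H (tl qs) \<in> carrier_mat (n (last qs)) (n (qs ! 1))" using abr by simp
  show "Mpath H (tl qs) * Gmat M \<theta> P H (qs ! 0) (qs ! 1) \<in> carrier_mat (n (last qs)) p"
    by (rule mult_carrier_mat[OF 1]) (use Gmat_carrier[OF Q(2,3)] abr in simp)
qed

text \<open>The lists \<open>w\<close> indexing the past of the output run backwards in time, hence the reversals.\<close>
lemma X_Y_cross:
  assumes "set (q # w) \<subseteq> Qs d" "w \<noteq> []" "i < n q" "j < p"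
  shows "ip M (X i q t) (Zg (Y j) (q # w) t) = path_weight P (q # w) *
     (Mpath H (tl (rev (q # w))) * Gmat M \<theta> P H (rev (q # w) ! 0) (rev (q # w) ! 1)) $$ (i, j)"
  using assms
proof (induction w arbitrary: q i t)
  case (Cons q1 w)
  have Q: "q \<in> Qs d" "q1 \<in> Qs d" "set w \<subseteq> Qs d" using Cons.prems by auto
  have step: "ip M (X i q t) (Zg (Y j) (q # q1 # w) t) =
    P q1 q * ((\<Sum>l\<in>{0..<n q1}. Mm H q1 q $$ (i, l) * ip M (X l q1 (t - 1)) (Zg (Y j) (q1 # w) (t - 1)))
      + (\<Sum>l\<in>{0..<m}. Bm H q1 q $$ (i, l) * ip M (V l q1 (t - 1)) (Zg (Y j) (q1 # w) (t - 1))))"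
    by (rule X_cross_step[OF Y_family _ Q Cons.prems(3,4)]) (rule Y_adapted)
  show ?case
  proof (cases "w = []")
    case True
    have Gc: "Gmat M \<theta> P H q1 q \<in> carrier_mat (n q) p" by (rule Gmat_carrier[OF Q(2,1)])
    \<comment> \<open>With a delay of one step the moments of the output are \<open>P C^T\<close>
      with the state and \<open>Q D^T\<close> with the noise; the state equation assembles them into
      \<open>G\<close>.\<close>
    have "ip M (X i q t) (Zg (Y j) (q # q1 # w) t) = Gmat M \<theta> P H q1 q $$ (i, j)"
      unfolding step Gmat_index[OF Q(2,1) Cons.prems(3,4)] using True Q Cons.prems by (simp add: X_Y_ip V_Y_ip)
    then show ?thesis using True Gc by simp
  next
    case False
    then obtain q2 w2 where w: "w = q2 # w2" by (cases w) auto
    let ?qs = "rev (q1 # w)"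
    let ?B = "Mpath H (tl ?qs) * Gmat M \<theta> P H (?qs ! 0) (?qs ! 1)"
    have IH: "ip M (X l q1 (t - 1)) (Zg (Y j) (q1 # w) (t - 1)) = path_weight P (q1 # w) * ?B $$ (l, j)"
      if "l < n q1" for l
      using Cons.IH[of q1 l "t - 1"] Cons.prems Q False that by auto
    have qs: "?qs \<noteq> []" "tl ?qs \<noteq> []" "last (tl ?qs) = q1" "length ?qs \<ge> 2"
    proof -
      have "?qs = rev w2 @ [q2, q1]" using w by simp
      then show "?qs \<noteq> []" "tl ?qs \<noteq> []" "last (tl ?qs) = q1" "length ?qs \<ge> 2"
        by (simp_all only:) (cases "rev w2"; simp)+
    qed
    have ne: "\<exists>a b r. ?qs = a # b # r"
      using qs(4) by (metis Suc_le_length_iff numeral_2_eq_2)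
    then obtain a b r where abr: "?qs = a # b # r" by blast
    have Qab: "set (a # b # r) \<subseteq> Qs d" unfolding abr[symmetric] using Q by auto
    have lastbr: "last (b # r) = q1" using qs(3) abr by simp
    have Mp: "Mpath H ((b # r) @ [q]) = Mm H q1 q * Mpath H (b # r)" "Mpath H (b # r) \<in> carrier_mat (n q1) (n b)"
      using Mpath_snoc[of "b # r" q H] Mm_carrier Qab Q lastbr by auto
    have Gc: "Gmat M \<theta> P H a b \<in> carrier_mat (n b) p" using Qab by (intro Gmat_carrier) auto
    have Mc: "Mm H q1 q \<in> carrier_mat (n q) (n q1)" by (rule Mm_carrier[OF Q(2,1)])
    have Bc: "?B \<in> carrier_mat (n q1) p" using abr Mp(2) Gc by simp
    have full: "Mpath H (tl (rev (q # q1 # w))) * Gmat M \<theta> P H (rev (q # q1 # w) ! 0) (rev (q # q1 # w) ! 1) = Mm H q1 q * ?B"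
    proof -
      have "rev (q # q1 # w) = a # (b # r) @ [q]" using abr by simp
      then show ?thesis unfolding abr using Mp(1) assoc_mult_mat[OF Mc Mp(2) Gc] by simp
    qed
    \<comment> \<open>The shortened word still has at least two letters, so the noise is orthogonal
      to it and only \<open>M\<close> acts.\<close>
    have "ip M (V l q1 (t - 1)) (Zg (Y j) (q1 # w) (t - 1)) = 0" if "l < m" for l
      by (rule V_Y_past[OF Q(2) that], rule Zg_Y_cl) (use Cons.prems w in auto)
    then have "ip M (X i q t) (Zg (Y j) (q # q1 # w) t) = P q1 q * (\<Sum>l\<in>{0..<n q1}. Mm H q1 q $$ (i, l) * (path_weight P (q1 # w) * ?B $$ (l, j)))"
      unfolding step using IH by simp
    also have "\<dots> = (P q1 q * path_weight P (q1 # w)) * (\<Sum>l\<in>{0..<n q1}. Mm H q1 q $$ (i, l) * ?B $$ (l, j))"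
      by (simp add: sum_distrib_left mult_ac)
    also have "(\<Sum>l\<in>{0..<n q1}. Mm H q1 q $$ (i, l) * ?B $$ (l, j)) = (Mm H q1 q * ?B) $$ (i, j)"
      by (rule index_mult_mat_sum[OF Mc Bc Cons.prems(3,4), symmetric])
    finally show ?thesis unfolding full using w by simp
  qed
qed simp

lemma path_weight_pos: "set w \<subseteq> Qs d \<Longrightarrow> 0 < path_weight P w"
proof (induction w)
  case (Cons q w)
  then have IH: "0 < path_weight P w" by simp
  show ?case
  proof (cases "\<exists>q1 q2 w'. w = q1 # q2 # w'")
    case True
    then obtain q1 q2 w' where "w = q1 # q2 # w'" by blast
    then show ?thesis using IH Cons.prems P_pos by simp
  next
    case False
    then have "path_weight P (q # w) = 1" by (metis neq_Nil_conv path_weight.simps(3,4))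
    then show ?thesis by simp
  qed
qed simp

lemma Y_Y_cross:
  assumes "set (q # w) \<subseteq> Qs d" "w \<noteq> []" "i < p" "j < p"
  shows "ip M (Y i q t) (Zg (Y j) (q # w) t) = path_weight P (q # w) *
     (Cm H q * (Mpath H (tl (rev (q # w))) * Gmat M \<theta> P H (rev (q # w) ! 0) (rev (q # w) ! 1))) $$ (i, j)"
proof -
  let ?B = "Mpath H (tl (rev (q # w))) * Gmat M \<theta> P H (rev (q # w) ! 0) (rev (q # w) ! 1)"
  have q: "q \<in> Qs d" using assms by simp
  have L: "Zg (Y j) (q # w) t \<in> L2 M" using Zg_L2[OF Y_family] assms by blast
  have c: "Zg (Y j) (q # w) t \<in> cl M (Gen 2 Y p t)" by (rule Zg_Y_cl) (use assms in \<open>auto simp: Suc_le_eq\<close>)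
  have "ip M (Y i q t) (Zg (Y j) (q # w) t) = (\<Sum>l\<in>{0..<n q}. Cm H q $$ (i, l) * (path_weight P (q # w) * ?B $$ (l, j)))"
    using Y_Y_ip[OF q assms(3) L] V_Y_past[OF q _ c] X_Y_cross[OF assms(1,2) _ assms(4)] by simp
  also have "\<dots> = path_weight P (q # w) * (\<Sum>l\<in>{0..<n q}. Cm H q $$ (i, l) * ?B $$ (l, j))"
    by (simp add: sum_distrib_left mult_ac)
  also have "(\<Sum>l\<in>{0..<n q}. Cm H q $$ (i, l) * ?B $$ (l, j)) = (Cm H q * ?B) $$ (i, j)"
  proof (rule index_mult_mat_sum[OF Cm_carrier[OF q] _ assms(3,4), symmetric])
    have "last (rev (q # w)) = q" "2 \<le> length (rev (q # w))" using assms(2) by (cases w; simp)+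
    then show "?B \<in> carrier_mat (n q) p" using word_mat_carrier(2)[of "rev (q # w)"] assms(1) by auto
  qed
  finally show ?thesis .
qed

end

section \<open>The past of the output and the columns of \<open>M_v G\<close>\<close>

context gsys
begin

lemma cl_Y_V: "cl M (Gen 1 Y p t) \<subseteq> cl M (Gen 1 V m t)"
proof (rule cl_least[OF Gen_L2[OF Y_family] Gen_L2[OF V_family]], rule subsetI)
  fix g assume "g \<in> Gen 1 Y p t"
  then obtain j w where g: "j < p" "1 \<le> length w" "set w \<subseteq> Qs d" "g = Zg (Y j) w t" by (rule GenE)
  show "g \<in> cl M (Gen 1 V m t)"
  proof (cases "2 \<le> length w")
    case True
    have "Zg (Y j) w t \<in> cl M (Gen 2 V m t)"
      by (rule cl_shift_Zg[OF V_family Y_cl]) (use g True in auto)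
    then show ?thesis unfolding g(4) using cl_Gen_2_1[OF V_family] by blast
  next
    case False
    then obtain q where "w = [q]" using g(2) by (cases w) (auto simp: Suc_le_eq)
    then show ?thesis using g Y_cl by simp
  qed
qed

lemma Gen_Y_adapted: "f \<in> cl M (Gen 1 Y p t) \<Longrightarrow> adapted t f"
  using cl_Y_V adapted_cl_V by blast

text \<open>Different modes at time \<open>t\<close> are disjoint, so only the summand with the mode
  of \<open>g\<close> contributes.\<close>

lemma markov_sum_ip:
  assumes a: "\<And>q. q \<in> Qs d \<Longrightarrow> a q \<in> L2 M" "\<And>q. q \<in> Qs d \<Longrightarrow> adapted t (a q)" "\<And>q \<omega>. q \<in> Qs d \<Longrightarrow> a q \<omega> * \<eta> q t \<omega> = a q \<omega>"
    and g: "g \<in> L2 M" "adapted t g" "\<And>\<omega>. g \<omega> * \<eta> q t \<omega> = g \<omega>" and q: "q \<in> Qs d" "q' \<in> Qs d"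
  shows "ip M (\<lambda>\<omega>. (\<Sum>q\<in>Qs d. a q \<omega>) * \<eta> q' (t + 1) \<omega>) (\<lambda>\<omega>. g \<omega> * \<eta> q' (t + 1) \<omega>) = P q q' * ip M (a q) g"
proof -
  have "ip M (\<lambda>\<omega>. (\<Sum>q\<in>Qs d. a q \<omega>) * \<eta> q' (t + 1) \<omega>) (\<lambda>\<omega>. g \<omega> * \<eta> q' (t + 1) \<omega>)
      = ip M (\<lambda>\<omega>. \<Sum>q\<in>Qs d. a q \<omega>) (\<lambda>\<omega>. g \<omega> * \<eta> q' (t + 1) \<omega>)"
    unfolding ip_mult_shift by (simp add: mult.assoc chi_idem)
  also have "\<dots> = P q q' * ip M (\<lambda>\<omega>. \<Sum>q\<in>Qs d. a q \<omega>) g"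
    by (rule markov_ip) (use a g q in \<open>auto intro!: L2_sum adapted_sum\<close>)
  also have "ip M (\<lambda>\<omega>. \<Sum>q\<in>Qs d. a q \<omega>) g = (\<Sum>q2\<in>Qs d. ip M (a q2) g)"
    by (rule ip_sum_left) (use a g in auto)
  also have "\<dots> = (\<Sum>q2\<in>Qs d. if q2 = q then ip M (a q) g else 0)"
  proof (rule sum.cong[OF refl])
    fix q2 assume "q2 \<in> Qs d"
    then show "ip M (a q2) g = (if q2 = q then ip M (a q) g else 0)"
      using ip_disjoint[of q2 q "a q2" t g] a(3) g(3) by auto
  qed
  also have "\<dots> = ip M (a q) g" using q by simp
  finally show ?thesis .
qed

text \<open>The range of \<open>J\<close> contains the columns of every \<open>G\<close> and is
  invariant under the \<open>M\<close>; appending letters one at a time, it contains the columns of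
  every \<open>M_v G\<close>.\<close>

lemma Gmat_path_invariant:
  assumes Jc: "\<And>q. q \<in> Qs d \<Longrightarrow> J q \<in> carrier_mat (n q) (r q)"
    and JG: "\<And>q q'. q \<in> Qs d \<Longrightarrow> q' \<in> Qs d \<Longrightarrow> J q' * transpose_mat (J q') * Gmat M \<theta> P H q q' = Gmat M \<theta> P H q q'"
    and JM: "\<And>q q'. q \<in> Qs d \<Longrightarrow> q' \<in> Qs d \<Longrightarrow>
        J q' * transpose_mat (J q') * (Mm H q q' * J q) = Mm H q q' * J q"
    and qs: "set qs \<subseteq> Qs d" "2 \<le> length qs"
  shows "J (last qs) * transpose_mat (J (last qs)) * (Mpath H (tl qs) * Gmat M \<theta> P H (qs ! 0) (qs ! 1)) =
    Mpath H (tl qs) * Gmat M \<theta> P H (qs ! 0) (qs ! 1)"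
  using qs
proof (induction qs rule: rev_induct)
  case (snoc q qs)
  have q: "q \<in> Qs d" using snoc.prems by simp
  show ?case
  proof (cases "2 \<le> length qs")
    case False
    then obtain a where "qs = [a]" using snoc.prems by (cases qs) (auto simp: Suc_le_eq)
    moreover have "Gmat M \<theta> P H a q \<in> carrier_mat (n q) p" using calculation snoc.prems by (intro Gmat_carrier) auto
    ultimately show ?thesis using JG[of a q] snoc.prems by simp
  next
    case True
    then obtain a b rr where abr: "qs = a # b # rr" by (metis Suc_le_length_iff numeral_2_eq_2)
    define q1 where "q1 = last qs"
    have q1: "q1 \<in> Qs d" using snoc.prems abr last_in_set[of qs] unfolding q1_def by auto
    let ?E = "Mpath H (tl qs) * Gmat M \<theta> P H (qs ! 0) (qs ! 1)"
    have Ec: "?E \<in> carrier_mat (n q1) p" and Mpc: "Mpath H (tl qs) \<in> carrier_mat (n q1) (n (qs ! 1))"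
      using word_mat_carrier[of qs] snoc.prems True by (auto simp: q1_def)
    have E: "J q1 * transpose_mat (J q1) * ?E = ?E" using snoc.IH snoc.prems True by (simp add: q1_def)
    have Gc: "Gmat M \<theta> P H (qs ! 0) (qs ! 1) \<in> carrier_mat (n (qs ! 1)) p"
      using abr snoc.prems by (intro Gmat_carrier) auto
    have Mc: "Mm H q1 q \<in> carrier_mat (n q) (n q1)" by (rule Mm_carrier[OF q1 q])
    have full: "Mpath H (tl (qs @ [q])) * Gmat M \<theta> P H ((qs @ [q]) ! 0) ((qs @ [q]) ! 1) = Mm H q1 q * ?E"
    proof -
      have "Mpath H ((b # rr) @ [q]) = Mm H (last (b # rr)) q * Mpath H (b # rr)"
        by (rule Mpath_snoc(1)) (use snoc.prems abr in \<open>auto intro!: Mm_carrier\<close>)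
      then have "Mpath H (tl (qs @ [q])) = Mm H q1 q * Mpath H (tl qs)" by (simp add: abr q1_def)
      then show ?thesis using assoc_mult_mat[OF Mc Mpc Gc] abr by simp
    qed
    have Jt: "transpose_mat (J q1) \<in> carrier_mat (r q1) (n q1)" using Jc[OF q1] by simp
    have JtE: "transpose_mat (J q1) * ?E \<in> carrier_mat (r q1) p" by (rule mult_carrier_mat[OF Jt Ec])
    have MJ: "Mm H q1 q * J q1 \<in> carrier_mat (n q) (r q1)" by (rule mult_carrier_mat[OF Mc Jc[OF q1]])
    have JJ: "J q * transpose_mat (J q) \<in> carrier_mat (n q) (n q)" using Jc[OF q] by auto
    have "Mm H q1 q * ?E = Mm H q1 q * (J q1 * (transpose_mat (J q1) * ?E))"
      using E assoc_mult_mat[OF Jc[OF q1] Jt Ec] by simp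
    also have "\<dots> = (Mm H q1 q * J q1) * (transpose_mat (J q1) * ?E)"
      by (rule assoc_mult_mat[OF Mc Jc[OF q1] JtE, symmetric])
    finally have ME: "Mm H q1 q * ?E = (Mm H q1 q * J q1) * (transpose_mat (J q1) * ?E)" .
    have "J q * transpose_mat (J q) * (Mm H q1 q * ?E) = (J q * transpose_mat (J q) * (Mm H q1 q * J q1)) * (transpose_mat (J q1) * ?E)"
      unfolding ME by (rule assoc_mult_mat[OF JJ MJ JtE, symmetric])
    also have "\<dots> = Mm H q1 q * ?E" unfolding JM[OF q1 q] ME ..
    finally show ?thesis unfolding full by simp
  qed
qed simp

end

text \<open>\<open>J q\<close> is an orthonormal basis of a subspace that contains the columns of the matrices \<open>G\<close> and is
  invariant under the matrices \<open>M\<close>; the innovation representation lives on this subspace.\<close>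
locale reduction = gsys +
  fixes J :: "nat \<Rightarrow> real mat" and r :: "nat \<Rightarrow> nat"
  assumes Jc: "\<And>q. q \<in> Qs d \<Longrightarrow> J q \<in> carrier_mat (n q) (r q)"
    and JJ1: "\<And>q. q \<in> Qs d \<Longrightarrow> transpose_mat (J q) * J q = 1\<^sub>m (r q)"
    and JG: "\<And>q q'. q \<in> Qs d \<Longrightarrow> q' \<in> Qs d \<Longrightarrow> J q' * transpose_mat (J q') * Gmat M \<theta> P H q q' = Gmat M \<theta> P H q q'"
    and JM: "\<And>q q'. q \<in> Qs d \<Longrightarrow> q' \<in> Qs d \<Longrightarrow>
        J q' * transpose_mat (J q') * (Mm H q q' * J q) = Mm H q q' * J q"
begin

section \<open>Projection of the state onto the past output\<close>

definition "f i q t = (\<lambda>\<omega>. \<Sum>l\<in>{0..<n q}. J q $$ (l, i) * X l q t \<omega>)"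

text \<open>The projection of \<open>J^T x\<close> onto the strict past of the output. The choice
  fixes it only up to null sets; the factor \<open>\<eta> q t\<close> makes its support exact at
  every point.\<close>

definition "xi i q t = (\<lambda>\<omega>. (SOME g. g \<in> cl M (Gen 2 Y p t) \<and>
    (\<forall>h\<in>cl M (Gen 2 Y p t). ip M (\<lambda>\<omega>. f i q t \<omega> - g \<omega>) h = 0)) \<omega> * \<eta> q t \<omega>)"

lemma f_L2: "q \<in> Qs d \<Longrightarrow> f i q t \<in> L2 M"
  unfolding f_def by (intro L2_sum L2_scale X_L2) auto

lemma f_supp: "f i q t \<omega> * \<eta> q t \<omega> = f i q t \<omega>"
  unfolding f_def sum_distrib_right by (simp only: mult.assoc X_supp)

lemma f_ip: "q \<in> Qs d \<Longrightarrow> h \<in> L2 M \<Longrightarrow> ip M (f i q t) h = (\<Sum>l\<in>{0..<n q}. J q $$ (l, i) * ip M (X l q t) h)"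
  unfolding f_def by (subst ip_sum_left) (auto intro: X_L2)

lemma xi_supp: "xi i q t \<omega> * \<eta> q t \<omega> = xi i q t \<omega>"
  unfolding xi_def by (simp add: mult.assoc chi_idem)

lemma xi_projection:
  assumes q: "q \<in> Qs d"
  shows "xi i q t \<in> cl M (Gen 2 Y p t)" "h \<in> cl M (Gen 2 Y p t) \<Longrightarrow> ip M (\<lambda>\<omega>. f i q t \<omega> - xi i q t \<omega>) h = 0"
proof -
  define g where "g = (SOME g. g \<in> cl M (Gen 2 Y p t) \<and> (\<forall>h\<in>cl M (Gen 2 Y p t). ip M (\<lambda>\<omega>. f i q t \<omega> - g \<omega>) h = 0))"
  obtain g0 where g0: "g0 \<in> cl M (Gen 2 Y p t)" "\<And>h. h \<in> cl M (Gen 2 Y p t) \<Longrightarrow> ip M (\<lambda>\<omega>. f i q t \<omega> - g0 \<omega>) h = 0"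
    by (rule L2_projection_exists[OF Gen_L2[OF Y_family, of 2 t] f_L2[OF q, of i t]], rule that)
  have "\<exists>g. g \<in> cl M (Gen 2 Y p t) \<and> (\<forall>h\<in>cl M (Gen 2 Y p t). ip M (\<lambda>\<omega>. f i q t \<omega> - g \<omega>) h = 0)"
    by (intro exI[of _ g0] conjI ballI g0)
  then have g: "g \<in> cl M (Gen 2 Y p t) \<and> (\<forall>h\<in>cl M (Gen 2 Y p t). ip M (\<lambda>\<omega>. f i q t \<omega> - g \<omega>) h = 0)"
    unfolding g_def by (rule someI_ex)
  have xg: "xi i q t = (\<lambda>\<omega>. g \<omega> * \<eta> q t \<omega>)" by (simp add: xi_def g_def)
  show "xi i q t \<in> cl M (Gen 2 Y p t)" unfolding xg using g by (intro cl_chi[OF Y_family _ q]) auto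
  assume h: "h \<in> cl M (Gen 2 Y p t)"
  \<comment> \<open>The indicator can be moved from the residual to \<open>h\<close>, and the closed
    past of the output is stable under multiplication by it; so the indicator does not spoil the
    projection.\<close>
  have "(\<lambda>\<omega>. f i q t \<omega> - xi i q t \<omega>) = (\<lambda>\<omega>. (f i q t \<omega> - g \<omega>) * \<eta> q t \<omega>)"
    unfolding xg by (simp add: left_diff_distrib f_supp)
  then have "ip M (\<lambda>\<omega>. f i q t \<omega> - xi i q t \<omega>) h = ip M (\<lambda>\<omega>. f i q t \<omega> - g \<omega>) (\<lambda>\<omega>. h \<omega> * \<eta> q t \<omega>)"
    by (simp add: ip_mult_shift)
  also have "\<dots> = 0" using g cl_chi[OF Y_family h q] by auto
  finally show "ip M (\<lambda>\<omega>. f i q t \<omega> - xi i q t \<omega>) h = 0" .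
qed

lemma xi_L2: "q \<in> Qs d \<Longrightarrow> xi i q t \<in> L2 M"
  by (rule cl_L2[OF xi_projection(1)])

lemma xi_ip: "q \<in> Qs d \<Longrightarrow> h \<in> cl M (Gen 2 Y p t) \<Longrightarrow> ip M (xi i q t) h = ip M (f i q t) h"
  using xi_projection(2)[of q h t i] ip_diff_left[OF f_L2[of q i t] xi_L2[of q i t] cl_L2[of h M "Gen 2 Y p t"]] by simp

text \<open>The projected state in the coordinates of the original system, that is \<open>J\<close>
  applied to \<open>xi\<close>.\<close>

definition "xh l q t = (\<lambda>\<omega>. \<Sum>i\<in>{0..<r q}. J q $$ (l, i) * xi i q t \<omega>)"

lemma xh_cl: "q \<in> Qs d \<Longrightarrow> xh l q t \<in> cl M (Gen 2 Y p t)"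
  unfolding xh_def by (intro cl_sum[OF Gen_L2[OF Y_family]] cl_scale[OF Gen_L2[OF Y_family]] xi_projection(1))

lemma xh_L2: "q \<in> Qs d \<Longrightarrow> xh l q t \<in> L2 M"
  by (rule cl_L2[OF xh_cl])

lemma xh_supp: "xh l q t \<omega> * \<eta> q t \<omega> = xh l q t \<omega>"
  unfolding xh_def sum_distrib_right by (simp only: mult.assoc xi_supp)

lemma xh_ip_xi: "q \<in> Qs d \<Longrightarrow> h \<in> L2 M \<Longrightarrow> ip M (xh l q t) h = (\<Sum>i\<in>{0..<r q}. J q $$ (l, i) * ip M (xi i q t) h)"
  unfolding xh_def by (subst ip_sum_left) (auto intro: xi_L2)

text \<open>The covariances of the state with past outputs are multiples of entries of
  \<open>M_v G\<close>, on which \<open>J J^T\<close> acts as the identity. So projecting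
  \<open>J^T x\<close> loses nothing compared with projecting \<open>x\<close>, although the state
  itself may leave the range of \<open>J\<close>.\<close>

lemma X_ip_xh:
  assumes q: "q \<in> Qs d" and l: "l < n q" and h: "h \<in> cl M (Gen 2 Y p t)"
  shows "ip M (X l q t) h = ip M (xh l q t) h"
proof -
  have "ip M (\<lambda>\<omega>. X l q t \<omega> - xh l q t \<omega>) h = 0"
  proof (rule cl_orthogonal_right[OF Gen_L2[OF Y_family] _ _ h])
    show "(\<lambda>\<omega>. X l q t \<omega> - xh l q t \<omega>) \<in> L2 M" using X_L2[OF q l] xh_L2[OF q] by simp
    fix g assume g0: "g \<in> Gen 2 Y p t"
    then obtain j w where g: "j < p" "2 \<le> length w" "set w \<subseteq> Qs d" "g = Zg (Y j) w t" by (rule GenE)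
    have gL: "g \<in> L2 M" and gc: "g \<in> cl M (Gen 2 Y p t)"
      using g0 Gen_L2[OF Y_family] cl_base[OF Gen_L2[OF Y_family]] by blast+
    obtain q0 q1 w2 where "w = q0 # q1 # w2" using g(2) by (metis Suc_le_length_iff numeral_2_eq_2)
    then obtain w1 where w: "w = q0 # w1" "w1 \<noteq> []" by blast
    show "ip M (\<lambda>\<omega>. X l q t \<omega> - xh l q t \<omega>) g = 0"
    proof (cases "q = q0")
      case False
      show ?thesis
      proof (rule ip_disjoint[OF False])
        show "(X l q t \<omega> - xh l q t \<omega>) * \<eta> q t \<omega> = X l q t \<omega> - xh l q t \<omega>" for \<omega>
          by (simp only: left_diff_distrib X_supp xh_supp)
        show "g \<omega> * \<eta> q0 t \<omega> = g \<omega>" for \<omega>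
          unfolding g(4) w(1) by (rule Zg_supp[OF Y_family g(1)]) (use g w in auto)
      qed
    next
      case True
      let ?qs = "rev w"
      have lq: "last ?qs = q" "2 \<le> length ?qs" "set ?qs \<subseteq> Qs d" using w True g by auto
      let ?E = "Mpath H (tl ?qs) * Gmat M \<theta> P H (?qs ! 0) (?qs ! 1)"
      have Ec: "?E \<in> carrier_mat (n q) p" using word_mat_carrier(2)[OF lq(3,2)] lq by simp
      have Jt: "transpose_mat (J q) \<in> carrier_mat (r q) (n q)" using Jc[OF q] by simp
      have JtE: "transpose_mat (J q) * ?E \<in> carrier_mat (r q) p" by (rule mult_carrier_mat[OF Jt Ec])
      have XE: "ip M (X k q t) g = path_weight P w * ?E $$ (k, j)" if "k < n q" for k
        unfolding g(4) w(1) True[symmetric] by (rule X_Y_cross) (use g w True that in auto)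
      have "J q * (transpose_mat (J q) * ?E) = ?E"
        using Gmat_path_invariant[OF Jc JG JM lq(3,2)] assoc_mult_mat[OF Jc[OF q] Jt Ec] unfolding lq(1) by simp
      then have "?E $$ (l, j) = (J q * (transpose_mat (J q) * ?E)) $$ (l, j)" by simp
      also have "\<dots> = (\<Sum>i\<in>{0..<r q}. J q $$ (l, i) * (transpose_mat (J q) * ?E) $$ (i, j))"
        by (rule index_mult_mat_sum[OF Jc[OF q] JtE l g(1)])
      also have "\<dots> = (\<Sum>i\<in>{0..<r q}. J q $$ (l, i) * (\<Sum>k\<in>{0..<n q}. J q $$ (k, i) * ?E $$ (k, j)))"
      proof (intro sum.cong refl arg_cong2[of _ _ _ _ "(*)"])
        fix i assume "i \<in> {0..<r q}"
        then have i: "i < r q" by simp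
        show "(transpose_mat (J q) * ?E) $$ (i, j) = (\<Sum>k\<in>{0..<n q}. J q $$ (k, i) * ?E $$ (k, j))"
          unfolding index_mult_mat_sum[OF Jt Ec i g(1)] using Jc[OF q] i by (intro sum.cong refl) simp
      qed
      finally have E: "?E $$ (l, j) = (\<Sum>i\<in>{0..<r q}. J q $$ (l, i) * (\<Sum>k\<in>{0..<n q}. J q $$ (k, i) * ?E $$ (k, j)))" .
      have "ip M (xh l q t) g = (\<Sum>i\<in>{0..<r q}. J q $$ (l, i) * (\<Sum>k\<in>{0..<n q}. J q $$ (k, i) * (path_weight P w * ?E $$ (k, j))))"
        using XE by (simp add: xh_ip_xi[OF q gL] xi_ip[OF q gc] f_ip[OF q gL])
      also have "\<dots> = path_weight P w * (\<Sum>i\<in>{0..<r q}. J q $$ (l, i) * (\<Sum>k\<in>{0..<n q}. J q $$ (k, i) * ?E $$ (k, j)))"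
        by (simp add: sum_distrib_left mult_ac)
      also have "\<dots> = ip M (X l q t) g" unfolding E[symmetric] XE[OF l] ..
      finally show ?thesis using X_L2[OF q l] xh_L2[OF q] gL by (simp add: ip_diff_left)
    qed
  qed
  then show ?thesis using X_L2[OF q l] xh_L2[OF q] cl_L2[OF h] by (simp add: ip_diff_left)
qed

subsection \<open>Innovations\<close>

text \<open>The subtracted sum is the projection of the output onto its own strict past, the noise
  part of the output being orthogonal to that past.\<close>

definition "inn j q t = (\<lambda>\<omega>. Y j q t \<omega> - (\<Sum>l\<in>{0..<n q}. Cm H q $$ (j, l) * xh l q t \<omega>))"

lemma Cxh_cl: "q \<in> Qs d \<Longrightarrow> (\<lambda>\<omega>. \<Sum>l\<in>{0..<n q}. Cm H q $$ (j, l) * xh l q t \<omega>) \<in> cl M (Gen 2 Y p t)"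
  by (intro cl_sum[OF Gen_L2[OF Y_family]] cl_scale[OF Gen_L2[OF Y_family]] xh_cl)

lemma Y_in_Gen: "q \<in> Qs d \<Longrightarrow> j < p \<Longrightarrow> Y j q t \<in> cl M (Gen 1 Y p t)"
  using GenI[of j p 1 "[q]" Y t] by (auto intro!: cl_base[OF Gen_L2[OF Y_family]])

lemma inn_cl: "q \<in> Qs d \<Longrightarrow> j < p \<Longrightarrow> inn j q t \<in> cl M (Gen 1 Y p t)"
  unfolding inn_def using Cxh_cl cl_Gen_2_1[OF Y_family]
  by (intro cl_diff[OF Gen_L2[OF Y_family]] Y_in_Gen) blast+

lemma inn_L2: "q \<in> Qs d \<Longrightarrow> j < p \<Longrightarrow> inn j q t \<in> L2 M"
  by (rule cl_L2[OF inn_cl])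

lemma inn_supp: "q \<in> Qs d \<Longrightarrow> j < p \<Longrightarrow> inn j q t \<omega> * \<eta> q t \<omega> = inn j q t \<omega>"
  unfolding inn_def left_diff_distrib sum_distrib_right by (simp only: mult.assoc Y_supp xh_supp)

lemma inn_family: "family inn p"
  unfolding family_def using inn_L2 inn_supp by blast

lemma inn_adapted: "q \<in> Qs d \<Longrightarrow> j < p \<Longrightarrow> adapted t (inn j q t)"
  by (rule Gen_Y_adapted[OF inn_cl])

lemma xi_cl_1: "q \<in> Qs d \<Longrightarrow> xi i q t \<in> cl M (Gen 1 Y p t)"
  using xi_projection(1) cl_Gen_2_1[OF Y_family] by blast

lemma inn_ip: "q \<in> Qs d \<Longrightarrow> j < p \<Longrightarrow> h \<in> L2 M \<Longrightarrow>
   ip M (inn j q t) h = ip M (Y j q t) h - (\<Sum>l\<in>{0..<n q}. Cm H q $$ (j, l) * ip M (xh l q t) h)"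
proof -
  assume a: "q \<in> Qs d" "j < p" "h \<in> L2 M"
  have "ip M (inn j q t) h = ip M (Y j q t) h - ip M (\<lambda>\<omega>. \<Sum>l\<in>{0..<n q}. Cm H q $$ (j, l) * xh l q t \<omega>) h"
    unfolding inn_def using a by (intro ip_diff_left Y_L2 cl_L2[OF Cxh_cl])
  also have "ip M (\<lambda>\<omega>. \<Sum>l\<in>{0..<n q}. Cm H q $$ (j, l) * xh l q t \<omega>) h = (\<Sum>l\<in>{0..<n q}. Cm H q $$ (j, l) * ip M (xh l q t) h)"
    by (subst ip_sum_left) (use a xh_L2 in auto)
  finally show ?thesis .
qed

lemma inn_ip_right: "q \<in> Qs d \<Longrightarrow> j < p \<Longrightarrow> h \<in> L2 M \<Longrightarrow>
   ip M h (inn j q t) = ip M h (Y j q t) - (\<Sum>l\<in>{0..<n q}. Cm H q $$ (j, l) * ip M h (xh l q t))"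
  unfolding ip_commute[of M h] by (rule inn_ip)

lemma inn_orthogonal:
  assumes q: "q \<in> Qs d" "j < p" and h: "h \<in> cl M (Gen 2 Y p t)"
  shows "ip M (inn j q t) h = 0"
  using q cl_L2[OF h] by (simp add: inn_ip Y_Y_ip V_Y_past[OF q(1) _ h] X_ip_xh[OF q(1) _ h])

lemma inn_orthogonal_right: "q \<in> Qs d \<Longrightarrow> j < p \<Longrightarrow> h \<in> cl M (Gen 2 Y p t) \<Longrightarrow> ip M h (inn j q t) = 0"
  by (subst ip_commute) (rule inn_orthogonal)

lemma f_Y_cross_stationary:
  assumes "q \<in> Qs d" "j < p" "set w \<subseteq> Qs d" "2 \<le> length w"
  shows "ip M (f i q t) (Zg (Y j) w t) = ip M (f i q s) (Zg (Y j) w s)"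
proof -
  have L: "Zg (Y j) w t \<in> L2 M" for t using Zg_L2[OF Y_family] assms by blast
  show ?thesis unfolding f_ip[OF assms(1) L]
    by (intro sum.cong refl arg_cong2[of _ _ _ _ "(*)"] X_Y_cross_stationary) (use assms in auto)
qed

text \<open>The Gram matrix of the delayed outputs and their moments with \<open>f\<close> do not
  depend on time; hence neither do the inner products of the projections.\<close>

lemma xi_xi_stationary:
  assumes q: "q \<in> Qs d"
  shows "ip M (xi i q t) (xi j q t) = ip M (xi i q s) (xi j q s)"
proof (rule projection_ip_eq[where z="\<lambda>(j, w). Zg (Y j) w t" and z'="\<lambda>(j, w). Zg (Y j) w s" and I="WI 2 p"
        and ?f1.0="f i q t" and ?f1'.0="f i q s" and ?f2.0="f j q t" and ?f2'.0="f j q s"])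
  show "ip M (case a of (j, w) \<Rightarrow> Zg (Y j) w t) (case b of (j, w) \<Rightarrow> Zg (Y j) w t)
     = ip M (case a of (j, w) \<Rightarrow> Zg (Y j) w s) (case b of (j, w) \<Rightarrow> Zg (Y j) w s)" if "a \<in> WI 2 p" "b \<in> WI 2 p" for a b
  proof -
    obtain i w j w' where "a = (i, w)" "b = (j, w')" by fastforce
    then show ?thesis using that Y_gram_stationary[of i j w w' t s] by (force simp: WI_def)
  qed
  show "ip M (f i q t) (case a of (j, w) \<Rightarrow> Zg (Y j) w t) = ip M (f i q s) (case a of (j, w) \<Rightarrow> Zg (Y j) w s)" if "a \<in> WI 2 p" for a i
    using that f_Y_cross_stationary[OF q] by (auto simp: WI_def)
  then show "ip M (f j q t) (case a of (j, w) \<Rightarrow> Zg (Y j) w t) = ip M (f j q s) (case a of (j, w) \<Rightarrow> Zg (Y j) w s)" if "a \<in> WI 2 p" for a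
    using that by blast
qed (use Gen_L2[OF Y_family, of 2] f_L2[OF q] xi_projection[OF q] in \<open>auto simp: Gen_def[symmetric]\<close>)

lemma xh_xh_stationary:
  assumes q: "q \<in> Qs d"
  shows "ip M (xh k q t) (xh l q t) = ip M (xh k q s) (xh l q s)"
proof -
  have "ip M (xh k q t) (xh l q t) = (\<Sum>i\<in>{0..<r q}. J q $$ (k, i) * (\<Sum>j\<in>{0..<r q}. J q $$ (l, j) * ip M (xi j q t) (xi i q t)))" for t
    by (simp add: xh_ip_xi[OF q xh_L2[OF q]] ip_commute[of M "xi _ q t" "xh l q t"] xh_ip_xi[OF q xi_L2[OF q]])
  then show ?thesis by (simp add: xi_xi_stationary[OF q, of _ t _ s])
qed

lemma Y_xh_ip:
  assumes q: "q \<in> Qs d" "j < p"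
  shows "ip M (Y j q t) (xh l q t) = (\<Sum>k\<in>{0..<n q}. Cm H q $$ (j, k) * ip M (xh k q t) (xh l q t))"
  using inn_orthogonal[OF q xh_cl[OF q(1), where l=l and t=t]] q by (simp add: inn_ip xh_L2)

lemma inn_inn_stationary:
  assumes q: "q \<in> Qs d" and ij: "i < p" "j < p"
  shows "ip M (inn i q t) (inn j q t) = ip M (inn i q s) (inn j q s)"
proof -
  have e: "ip M (inn i q t) (inn j q t) = ip M (Y i q t) (Y j q t) - (\<Sum>l\<in>{0..<n q}. Cm H q $$ (i, l) *
      (\<Sum>k\<in>{0..<n q}. Cm H q $$ (j, k) * ip M (xh k q t) (xh l q t)))" for t
  proof -
    have "ip M (inn i q t) (inn j q t) = ip M (inn j q t) (inn i q t)" by (rule ip_commute)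
    \<comment> \<open>The prediction inside \<open>inn j\<close> is orthogonal to
      \<open>inn i\<close>, so only \<open>Y j\<close> remains. Expanding \<open>inn i\<close>
      afterwards gives the covariance of the output minus that of its prediction.\<close>
    also have "\<dots> = ip M (Y j q t) (inn i q t)"
      using q ij by (simp add: inn_ip[OF q ij(2)] inn_L2 inn_orthogonal_right xh_cl)
    also have "\<dots> = ip M (inn i q t) (Y j q t)" by (rule ip_commute)
    also have "\<dots> = ip M (Y i q t) (Y j q t) - (\<Sum>l\<in>{0..<n q}. Cm H q $$ (i, l) * ip M (Y j q t) (xh l q t))"
      using q ij by (simp add: inn_ip Y_L2 ip_commute[of M "Y j q t"])
    finally show ?thesis by (simp add: Y_xh_ip[OF q ij(2)])
  qed
  have YY: "ip M (Y i q t) (Y j q t) = ip M (Y i q s) (Y j q s)"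
    using Y_gram_stationary[of i j "[q]" "[q]" t s] q ij by simp
  show ?thesis unfolding e YY by (simp add: xh_xh_stationary[OF q, of _ t _ s])
qed

definition "Qe q i j = ip M (inn i q 0) (inn j q 0)"

lemma inn_inn: "q \<in> Qs d \<Longrightarrow> i < p \<Longrightarrow> j < p \<Longrightarrow> ip M (inn i q t) (inn j q t) = Qe q i j"
  unfolding Qe_def by (rule inn_inn_stationary)

text \<open>The combination of innovations with coefficients \<open>z\<close> splits into a term
  \<open>a\<close> from the estimation error of the state and the noise term \<open>b\<close>, which
  are orthogonal. So its variance is at least that of \<open>b\<close>, which is
  \<open>z^T D Q D^T z\<close>, and (G6) makes this positive.\<close>

lemma Qe_positive:
  assumes q: "q \<in> Qs d" and z: "z \<in> carrier_vec p" "z \<noteq> 0\<^sub>v p"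
  shows "0 < (\<Sum>i\<in>{0..<p}. \<Sum>j\<in>{0..<p}. z $ i * z $ j * Qe q i j)"
proof -
  define w where "w = transpose_mat (Dm H q) *\<^sub>v z"
  define a where "a = (\<lambda>\<omega>. \<Sum>l\<in>{0..<n q}. (\<Sum>i\<in>{0..<p}. z $ i * Cm H q $$ (i, l)) * (X l q 0 \<omega> - xh l q 0 \<omega>))"
  define b where "b = (\<lambda>\<omega>. \<Sum>k\<in>{0..<m}. w $ k * V k q 0 \<omega>)"
  have Dt: "transpose_mat (Dm H q) \<in> carrier_mat m p" using Dm_carrier[OF q] by simp
  have wc: "w \<in> carrier_vec m" unfolding w_def by (rule mult_mat_vec_carrier[OF Dt z(1)])
  have wk: "w $ k = (\<Sum>i\<in>{0..<p}. z $ i * Dm H q $$ (i, k))" if "k < m" for k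
    unfolding w_def mult_mat_sum[OF Dt z(1) that] using Dm_carrier[OF q] that by (intro sum.cong refl) (simp add: mult.commute)
  have aL: "a \<in> L2 M" unfolding a_def by (intro L2_sum L2_scale L2_diff X_L2 xh_L2 q) auto
  have bL: "b \<in> L2 M" unfolding b_def by (intro L2_sum L2_scale V_L2 q) auto
  have sum: "(\<lambda>\<omega>. \<Sum>i\<in>{0..<p}. z $ i * inn i q 0 \<omega>) = (\<lambda>\<omega>. a \<omega> + b \<omega>)"
  proof
    fix \<omega>
    have "inn i q 0 \<omega> = (\<Sum>l\<in>{0..<n q}. Cm H q $$ (i, l) * (X l q 0 \<omega> - xh l q 0 \<omega>)) + (\<Sum>k\<in>{0..<m}. Dm H q $$ (i, k) * V k q 0 \<omega>)" for i
      unfolding inn_def Y_def by (simp add: right_diff_distrib sum_subtractf)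
    then have "(\<Sum>i\<in>{0..<p}. z $ i * inn i q 0 \<omega>) =
      (\<Sum>i\<in>{0..<p}. \<Sum>l\<in>{0..<n q}. z $ i * Cm H q $$ (i, l) * (X l q 0 \<omega> - xh l q 0 \<omega>))
      + (\<Sum>i\<in>{0..<p}. \<Sum>k\<in>{0..<m}. z $ i * Dm H q $$ (i, k) * V k q 0 \<omega>)"
      by (simp add: distrib_left sum.distrib sum_distrib_left mult.assoc)
    also have "(\<Sum>i\<in>{0..<p}. \<Sum>l\<in>{0..<n q}. z $ i * Cm H q $$ (i, l) * (X l q 0 \<omega> - xh l q 0 \<omega>)) = a \<omega>"
      unfolding a_def sum_distrib_right by (rule sum.swap)
    also have "(\<Sum>i\<in>{0..<p}. \<Sum>k\<in>{0..<m}. z $ i * Dm H q $$ (i, k) * V k q 0 \<omega>) = b \<omega>"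
    proof -
      have "(\<Sum>i\<in>{0..<p}. \<Sum>k\<in>{0..<m}. z $ i * Dm H q $$ (i, k) * V k q 0 \<omega>) = (\<Sum>k\<in>{0..<m}. (\<Sum>i\<in>{0..<p}. z $ i * Dm H q $$ (i, k)) * V k q 0 \<omega>)"
        unfolding sum_distrib_right by (rule sum.swap)
      then show ?thesis unfolding b_def by (simp add: wk)
    qed
    finally show "(\<Sum>i\<in>{0..<p}. z $ i * inn i q 0 \<omega>) = a \<omega> + b \<omega>" .
  qed
  have Va: "ip M (V k q 0) a = 0" if "k < m" for k
  proof -
    have "ip M (V k q 0) a = (\<Sum>l\<in>{0..<n q}. (\<Sum>i\<in>{0..<p}. z $ i * Cm H q $$ (i, l)) * ip M (V k q 0) (\<lambda>\<omega>. X l q 0 \<omega> - xh l q 0 \<omega>))"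
      unfolding a_def by (subst ip_sum_right) (use q that V_L2 X_L2 xh_L2 in auto)
    also have "\<dots> = 0"
    proof (intro sum.neutral ballI)
      fix l assume "l \<in> {0..<n q}"
      then have "ip M (V k q 0) (\<lambda>\<omega>. X l q 0 \<omega> - xh l q 0 \<omega>) = 0"
        using q that by (subst ip_diff_right) (auto simp: V_L2 X_L2 xh_L2 V_X_orthogonal V_Y_past xh_cl)
      then show "(\<Sum>i\<in>{0..<p}. z $ i * Cm H q $$ (i, l)) * ip M (V k q 0) (\<lambda>\<omega>. X l q 0 \<omega> - xh l q 0 \<omega>) = 0" by simp
    qed
    finally show ?thesis .
  qed
  have ba: "ip M b a = 0" unfolding b_def using Va aL q by (subst ip_sum_left) (auto intro: V_L2)
  have bb: "ip M b b = (\<Sum>k\<in>{0..<m}. w $ k * (\<Sum>l\<in>{0..<m}. w $ l * Qmat M \<theta> H q $$ (k, l)))"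
  proof -
    have "ip M b b = (\<Sum>k\<in>{0..<m}. w $ k * ip M (V k q 0) b)"
      using bL q unfolding b_def by (subst ip_sum_left) (auto intro: V_L2)
    also have "\<dots> = (\<Sum>k\<in>{0..<m}. w $ k * (\<Sum>l\<in>{0..<m}. w $ l * Qmat M \<theta> H q $$ (k, l)))"
    proof (intro sum.cong refl arg_cong2[of _ _ _ _ "(*)"])
      fix k assume "k \<in> {0..<m}"
      then show "ip M (V k q 0) b = (\<Sum>l\<in>{0..<m}. w $ l * Qmat M \<theta> H q $$ (k, l))"
        unfolding b_def using q by (subst ip_sum_right) (auto intro: V_L2 simp: V_V_ip)
    qed
    finally show ?thesis .
  qed
  have Qc: "Qmat M \<theta> H q \<in> carrier_mat m m" by (simp add: Qmat_def)
  have Qw: "Qmat M \<theta> H q *\<^sub>v w \<in> carrier_vec m" by (rule mult_mat_vec_carrier[OF Qc wc])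
  have DQ: "Dm H q * Qmat M \<theta> H q \<in> carrier_mat p m" by (rule mult_carrier_mat[OF Dm_carrier[OF q] Qc])
  have "0 < scalar_prod z ((Dm H q * Qmat M \<theta> H q * transpose_mat (Dm H q)) *\<^sub>v z)"
    using G q z unfolding assumptionG_def by blast
  also have "(Dm H q * Qmat M \<theta> H q * transpose_mat (Dm H q)) *\<^sub>v z = Dm H q *\<^sub>v (Qmat M \<theta> H q *\<^sub>v w)"
    unfolding w_def using assoc_mult_mat_vec[OF DQ Dt z(1)] assoc_mult_mat_vec[OF Dm_carrier[OF q] Qc wc] by (simp add: w_def)
  also have "scalar_prod z (Dm H q *\<^sub>v (Qmat M \<theta> H q *\<^sub>v w)) = scalar_prod w (Qmat M \<theta> H q *\<^sub>v w)"
    unfolding w_def by (rule transpose_vec_mult_scalar[OF Dm_carrier[OF q] Qw[unfolded w_def] z(1), symmetric])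
  also have "\<dots> = (\<Sum>k\<in>{0..<m}. w $ k * (Qmat M \<theta> H q *\<^sub>v w) $ k)"
    using carrier_vecD[OF Qw] by (simp add: scalar_prod_def del: index_mult_mat_vec)
  also have "\<dots> = ip M b b" unfolding bb
    by (intro sum.cong refl arg_cong2[of _ _ _ _ "(*)"]) (auto simp: mult_mat_sum[OF Qc wc] mult.commute simp del: index_mult_mat_vec)
  finally have pos: "0 < ip M b b" .
  have "(\<Sum>i\<in>{0..<p}. \<Sum>j\<in>{0..<p}. z $ i * z $ j * Qe q i j)
      = ip M (\<lambda>\<omega>. \<Sum>i\<in>{0..<p}. z $ i * inn i q 0 \<omega>) (\<lambda>\<omega>. \<Sum>i\<in>{0..<p}. z $ i * inn i q 0 \<omega>)"
  proof -
    have L: "(\<lambda>\<omega>. \<Sum>i\<in>{0..<p}. z $ i * inn i q 0 \<omega>) \<in> L2 M" by (intro L2_sum L2_scale inn_L2 q) auto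
    have "ip M (\<lambda>\<omega>. \<Sum>i\<in>{0..<p}. z $ i * inn i q 0 \<omega>) (\<lambda>\<omega>. \<Sum>i\<in>{0..<p}. z $ i * inn i q 0 \<omega>)
        = (\<Sum>i\<in>{0..<p}. z $ i * ip M (inn i q 0) (\<lambda>\<omega>. \<Sum>i\<in>{0..<p}. z $ i * inn i q 0 \<omega>))"
      using L q by (subst ip_sum_left) (auto intro: inn_L2)
    also have "\<dots> = (\<Sum>i\<in>{0..<p}. z $ i * (\<Sum>j\<in>{0..<p}. z $ j * Qe q i j))"
    proof (intro sum.cong refl arg_cong2[of _ _ _ _ "(*)"])
      fix i assume "i \<in> {0..<p}"
      then show "ip M (inn i q 0) (\<lambda>\<omega>. \<Sum>i\<in>{0..<p}. z $ i * inn i q 0 \<omega>) = (\<Sum>j\<in>{0..<p}. z $ j * Qe q i j)"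
        using q by (subst ip_sum_right) (auto intro: inn_L2 simp: inn_inn)
    qed
    finally show ?thesis by (simp add: sum_distrib_left mult.assoc)
  qed
  also have "\<dots> = ip M a a + ip M b b"
    unfolding sum using aL bL ba by (simp add: ip_add_left ip_add_right ip_commute[of M a b])
  finally show ?thesis using pos ip_self_nonneg[of M a] by linarith
qed

subsection \<open>The state equation of the innovation representation\<close>

definition "cross q q' i j = ip M (f i q' 1) (\<lambda>\<omega>. inn j q 0 \<omega> * \<eta> q' 1 \<omega>)"

lemma f_step_ip:
  assumes q: "q \<in> Qs d" "q' \<in> Qs d" and h: "h \<in> L2 M" "adapted t h" "\<And>\<omega>. h \<omega> * \<eta> q t \<omega> = h \<omega>"
  shows "ip M (f i q' (t + 1)) (\<lambda>\<omega>. h \<omega> * \<eta> q' (t + 1) \<omega>) =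
    (\<Sum>l\<in>{0..<n q'}. J q' $$ (l, i) * (P q q' * ((\<Sum>k\<in>{0..<n q}. Mm H q q' $$ (l, k) * ip M (X k q t) h)
       + (\<Sum>k\<in>{0..<m}. Bm H q q' $$ (l, k) * ip M (V k q t) h))))"
  unfolding f_ip[OF q(2) L2_chi[OF h(1)]]
  by (intro sum.cong refl arg_cong2[of _ _ _ _ "(*)"] X_step_ip[OF q _ h]) auto

text \<open>The state equation reduces the claim to the moments of state and noise with the current
  innovation, which are expressible through stationary ones.\<close>

lemma cross_stationary:
  assumes q: "q \<in> Qs d" "q' \<in> Qs d" and j: "j < p"
  shows "ip M (f i q' (t + 1)) (\<lambda>\<omega>. inn j q t \<omega> * \<eta> q' (t + 1) \<omega>) = cross q q' i j"
proof -
  have X: "ip M (X k q t) (inn j q t) = ip M (X k q s) (inn j q s)" if k: "k < n q" for k t s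
  proof -
    have "ip M (X k q t) (inn j q t) = ip M (X k q t) (Y j q t) - (\<Sum>l\<in>{0..<n q}. Cm H q $$ (j, l) * ip M (xh k q t) (xh l q t))" for t
      using q j k by (simp add: inn_ip_right X_L2 X_ip_xh xh_cl)
    then show ?thesis using X_Y_ip[OF q(1) k j] by (simp add: xh_xh_stationary[OF q(1), of _ t _ s])
  qed
  have V: "ip M (V k q t) (inn j q t) = ip M (V k q s) (inn j q s)" if k: "k < m" for k t s
  proof -
    have "ip M (V k q t) (inn j q t) = ip M (V k q t) (Y j q t)" for t
      using q j k by (simp add: inn_ip_right V_L2 V_Y_past xh_cl)
    then show ?thesis using V_Y_ip[OF q(1) k j] by simp
  qed
  have s: "ip M (f i q' (t + 1)) (\<lambda>\<omega>. inn j q t \<omega> * \<eta> q' (t + 1) \<omega>) =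
    (\<Sum>l\<in>{0..<n q'}. J q' $$ (l, i) * (P q q' * ((\<Sum>k\<in>{0..<n q}. Mm H q q' $$ (l, k) * ip M (X k q t) (inn j q t))
       + (\<Sum>k\<in>{0..<m}. Bm H q q' $$ (l, k) * ip M (V k q t) (inn j q t)))))" for t
    by (rule f_step_ip[OF q inn_L2[OF q(1) j] inn_adapted[OF q(1) j] inn_supp[OF q(1) j]])
  have "cross q q' i j = ip M (f i q' (0 + 1)) (\<lambda>\<omega>. inn j q 0 \<omega> * \<eta> q' (0 + 1) \<omega>)"
    by (simp add: cross_def)
  then show ?thesis unfolding s by (simp add: X[of _ t 0] V[of _ t 0])
qed

text \<open>The Kalman gain. The equations are the normal equations for projecting the next value of
  \<open>J^T x\<close> onto the current innovation along the transition from \<open>q\<close> to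
  \<open>q'\<close>.\<close>

definition "gain q q' = (SOME K. K \<in> carrier_mat (r q') p \<and>
   (\<forall>i<r q'. \<forall>j<p. P q q' * (\<Sum>k\<in>{0..<p}. K $$ (i, k) * Qe q k j) = cross q q' i j))"

lemma gain:
  assumes q: "q \<in> Qs d" "q' \<in> Qs d"
  shows "gain q q' \<in> carrier_mat (r q') p"
    and "i < r q' \<Longrightarrow> j < p \<Longrightarrow> P q q' * (\<Sum>k\<in>{0..<p}. gain q q' $$ (i, k) * Qe q k j) = cross q q' i j"
proof -
  define S where "S = mat p p (\<lambda>(i, j). Qe q i j)"
  have Sc: "S \<in> carrier_mat p p" by (simp add: S_def)
  \<comment> \<open>The innovation covariance is positive definite, hence invertible, and the normal
    equations can be solved.\<close>
  have "u = 0\<^sub>v p" if u: "u \<in> carrier_vec p" "S *\<^sub>v u = 0\<^sub>v p" for u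
  proof (rule ccontr)
    assume "u \<noteq> 0\<^sub>v p"
    from Qe_positive[OF q(1) u(1) this]
    have "0 < (\<Sum>i\<in>{0..<p}. u $ i * (\<Sum>j\<in>{0..<p}. S $$ (i, j) * u $ j))"
      by (simp add: S_def sum_distrib_left mult_ac)
    also have "\<dots> = (\<Sum>i\<in>{0..<p}. u $ i * (S *\<^sub>v u) $ i)"
      by (intro sum.cong refl arg_cong2[of _ _ _ _ "(*)"]) (auto simp: mult_mat_sum[OF Sc u(1)] simp del: index_mult_mat_vec)
    also have "\<dots> = 0" unfolding u(2) by simp
    finally show False by simp
  qed
  from square_inverse_exists[OF Sc this] obtain T where T: "T \<in> carrier_mat p p" "T * S = 1\<^sub>m p" by blast
  define N where "N = mat (r q') p (\<lambda>(i, j). cross q q' i j / P q q')"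
  have Nc: "N \<in> carrier_mat (r q') p" by (simp add: N_def)
  have Kc: "N * T \<in> carrier_mat (r q') p" by (rule mult_carrier_mat[OF Nc T(1)])
  have KS: "N * T * S = N" using assoc_mult_mat[OF Nc T(1) Sc] T(2) Nc by simp
  have "P q q' * (\<Sum>k\<in>{0..<p}. (N * T) $$ (i, k) * Qe q k j) = cross q q' i j" if "i < r q'" "j < p" for i j
  proof -
    have "(\<Sum>k\<in>{0..<p}. (N * T) $$ (i, k) * Qe q k j) = (N * T * S) $$ (i, j)"
      unfolding index_mult_mat_sum[OF Kc Sc that] using that by (intro sum.cong refl) (simp add: S_def)
    then show ?thesis unfolding KS using that P_pos[OF q] by (simp add: N_def)
  qed
  with Kc have ex: "\<exists>K. K \<in> carrier_mat (r q') p \<and>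
   (\<forall>i<r q'. \<forall>j<p. P q q' * (\<Sum>k\<in>{0..<p}. K $$ (i, k) * Qe q k j) = cross q q' i j)" by blast
  from someI_ex[OF ex] show "gain q q' \<in> carrier_mat (r q') p"
    "i < r q' \<Longrightarrow> j < p \<Longrightarrow> P q q' * (\<Sum>k\<in>{0..<p}. gain q q' $$ (i, k) * Qe q k j) = cross q q' i j"
    unfolding gain_def[symmetric] by blast+
qed

definition "Mr q q' = transpose_mat (J q') * (Mm H q q' * J q)"

lemma Mr_carrier: "q \<in> Qs d \<Longrightarrow> q' \<in> Qs d \<Longrightarrow> Mr q q' \<in> carrier_mat (r q') (r q)"
proof -
  assume q: "q \<in> Qs d" "q' \<in> Qs d"
  have "transpose_mat (J q') \<in> carrier_mat (r q') (n q')" using Jc[OF q(2)] by simp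
  then show ?thesis unfolding Mr_def
    by (rule mult_carrier_mat[OF _ mult_carrier_mat[OF Mm_carrier[OF q] Jc[OF q(1)]]])
qed

lemma Mr_index:
  assumes q: "q \<in> Qs d" "q' \<in> Qs d" and i: "i < r q'" "k < r q"
  shows "Mr q q' $$ (i, k) = (\<Sum>l\<in>{0..<n q'}. J q' $$ (l, i) * (\<Sum>c\<in>{0..<n q}. Mm H q q' $$ (l, c) * J q $$ (c, k)))"
proof -
  have Jt: "transpose_mat (J q') \<in> carrier_mat (r q') (n q')" using Jc[OF q(2)] by simp
  have MJ: "Mm H q q' * J q \<in> carrier_mat (n q') (r q)" by (rule mult_carrier_mat[OF Mm_carrier[OF q] Jc[OF q(1)]])
  show ?thesis unfolding Mr_def index_mult_mat_sum[OF Jt MJ i]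
  proof (intro sum.cong refl arg_cong2[of _ _ _ _ "(*)"])
    fix l assume l: "l \<in> {0..<n q'}"
    then show "transpose_mat (J q') $$ (i, l) = J q' $$ (l, i)" using Jc[OF q(2)] i by simp
    show "(Mm H q q' * J q) $$ (l, k) = (\<Sum>c\<in>{0..<n q}. Mm H q q' $$ (l, c) * J q $$ (c, k))"
      by (rule index_mult_mat_sum[OF Mm_carrier[OF q] Jc[OF q(1)]]) (use l i in auto)
  qed
qed

text \<open>The one-step prediction along the transition from \<open>q\<close> to \<open>q'\<close>,
  before the indicator of the new mode is applied.\<close>

definition "upd i q q' t = (\<lambda>\<omega>. (\<Sum>k\<in>{0..<r q}. Mr q q' $$ (i, k) * xi k q t \<omega>) + (\<Sum>j\<in>{0..<p}. gain q q' $$ (i, j) * inn j q t \<omega>))"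

lemma upd_cl: "q \<in> Qs d \<Longrightarrow> upd i q q' t \<in> cl M (Gen 1 Y p t)"
  unfolding upd_def
  by (intro cl_add[OF Gen_L2[OF Y_family]] cl_sum[OF Gen_L2[OF Y_family]] cl_scale[OF Gen_L2[OF Y_family]] xi_cl_1 inn_cl) auto

lemma upd_L2: "q \<in> Qs d \<Longrightarrow> upd i q q' t \<in> L2 M"
  by (rule cl_L2[OF upd_cl])

lemma upd_adapted: "q \<in> Qs d \<Longrightarrow> adapted t (upd i q q' t)"
  by (rule Gen_Y_adapted[OF upd_cl])

lemma upd_supp: "q \<in> Qs d \<Longrightarrow> upd i q q' t \<omega> * \<eta> q t \<omega> = upd i q q' t \<omega>"
proof -
  assume q: "q \<in> Qs d"
  have "(\<Sum>j\<in>{0..<p}. gain q q' $$ (i, j) * inn j q t \<omega>) * \<eta> q t \<omega> = (\<Sum>j\<in>{0..<p}. gain q q' $$ (i, j) * inn j q t \<omega>)"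
    unfolding sum_distrib_right by (intro sum.cong refl) (simp add: mult.assoc inn_supp[OF q])
  moreover have "(\<Sum>k\<in>{0..<r q}. Mr q q' $$ (i, k) * xi k q t \<omega>) * \<eta> q t \<omega> = (\<Sum>k\<in>{0..<r q}. Mr q q' $$ (i, k) * xi k q t \<omega>)"
    unfolding sum_distrib_right by (simp only: mult.assoc xi_supp)
  ultimately show ?thesis unfolding upd_def by (simp only: distrib_right)
qed

lemma upd_ip: "q \<in> Qs d \<Longrightarrow> h \<in> L2 M \<Longrightarrow> ip M (upd i q q' t) h =
   (\<Sum>k\<in>{0..<r q}. Mr q q' $$ (i, k) * ip M (xi k q t) h) + (\<Sum>j\<in>{0..<p}. gain q q' $$ (i, j) * ip M (inn j q t) h)"
  unfolding upd_def by (rule ip_lincomb_left) (auto intro: xi_L2 inn_L2)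

text \<open>Against the strict past the innovation contributes nothing and the state may be replaced
  by \<open>J\<close> applied to \<open>xi\<close>; the coefficient that remains is
  \<open>J^T M J\<close>.\<close>

lemma upd_past:
  assumes q: "q \<in> Qs d" "q' \<in> Qs d" and i: "i < r q'" and h: "h \<in> cl M (Gen 2 Y p t)" "\<And>\<omega>. h \<omega> * \<eta> q t \<omega> = h \<omega>"
  shows "ip M (f i q' (t + 1)) (\<lambda>\<omega>. h \<omega> * \<eta> q' (t + 1) \<omega>) = P q q' * ip M (upd i q q' t) h"
proof -
  have hL: "h \<in> L2 M" by (rule cl_L2[OF h(1)])
  have had: "adapted t h" using Gen_Y_adapted cl_Gen_2_1[OF Y_family] h(1) by blast
  have "ip M (f i q' (t + 1)) (\<lambda>\<omega>. h \<omega> * \<eta> q' (t + 1) \<omega>) =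
    (\<Sum>l\<in>{0..<n q'}. J q' $$ (l, i) * (P q q' * (\<Sum>c\<in>{0..<n q}. Mm H q q' $$ (l, c) * (\<Sum>k\<in>{0..<r q}. J q $$ (c, k) * ip M (xi k q t) h))))"
    using f_step_ip[OF q hL had h(2), of i] q by (simp add: V_Y_past[OF q(1) _ h(1)] X_ip_xh[OF q(1) _ h(1)] xh_ip_xi[OF q(1) hL])
  also have "\<dots> = (\<Sum>l\<in>{0..<n q'}. \<Sum>k\<in>{0..<r q}. P q q' * (J q' $$ (l, i) * (\<Sum>c\<in>{0..<n q}. Mm H q q' $$ (l, c) * J q $$ (c, k)) * ip M (xi k q t) h))"
  proof (rule sum.cong[OF refl])
    fix l
    have "(\<Sum>c\<in>{0..<n q}. Mm H q q' $$ (l, c) * (\<Sum>k\<in>{0..<r q}. J q $$ (c, k) * ip M (xi k q t) h))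
        = (\<Sum>c\<in>{0..<n q}. \<Sum>k\<in>{0..<r q}. Mm H q q' $$ (l, c) * J q $$ (c, k) * ip M (xi k q t) h)"
      by (simp add: sum_distrib_left mult.assoc)
    also have "\<dots> = (\<Sum>k\<in>{0..<r q}. (\<Sum>c\<in>{0..<n q}. Mm H q q' $$ (l, c) * J q $$ (c, k)) * ip M (xi k q t) h)"
      unfolding sum_distrib_right by (rule sum.swap)
    finally show "J q' $$ (l, i) * (P q q' * (\<Sum>c\<in>{0..<n q}. Mm H q q' $$ (l, c) * (\<Sum>k\<in>{0..<r q}. J q $$ (c, k) * ip M (xi k q t) h))) =
       (\<Sum>k\<in>{0..<r q}. P q q' * (J q' $$ (l, i) * (\<Sum>c\<in>{0..<n q}. Mm H q q' $$ (l, c) * J q $$ (c, k)) * ip M (xi k q t) h))"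
      by (simp only: sum_distrib_left mult_ac)
  qed
  also have "\<dots> = (\<Sum>k\<in>{0..<r q}. \<Sum>l\<in>{0..<n q'}. P q q' * (J q' $$ (l, i) * (\<Sum>c\<in>{0..<n q}. Mm H q q' $$ (l, c) * J q $$ (c, k)) * ip M (xi k q t) h))"
    by (rule sum.swap)
  also have "\<dots> = (\<Sum>k\<in>{0..<r q}. P q q' * (Mr q q' $$ (i, k) * ip M (xi k q t) h))"
  proof (rule sum.cong[OF refl])
    fix k assume "k \<in> {0..<r q}"
    then have k: "k < r q" by simp
    show "(\<Sum>l\<in>{0..<n q'}. P q q' * (J q' $$ (l, i) * (\<Sum>c\<in>{0..<n q}. Mm H q q' $$ (l, c) * J q $$ (c, k)) * ip M (xi k q t) h)) =
        P q q' * (Mr q q' $$ (i, k) * ip M (xi k q t) h)"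
      unfolding Mr_index[OF q i k] sum_distrib_right by (rule sum_distrib_left[symmetric])
  qed
  also have "\<dots> = P q q' * (\<Sum>k\<in>{0..<r q}. Mr q q' $$ (i, k) * ip M (xi k q t) h)"
    by (rule sum_distrib_left[symmetric])
  also have "\<dots> = P q q' * ip M (upd i q q' t) h"
    using q hL by (simp add: upd_ip inn_orthogonal[OF q(1) _ h(1)])
  finally show ?thesis .
qed

text \<open>Against the current innovation the projected state contributes nothing, and the rest is
  the equation that defines the gain.\<close>

lemma upd_inn:
  assumes q: "q \<in> Qs d" "q' \<in> Qs d" and i: "i < r q'" and j: "j < p"
  shows "ip M (f i q' (t + 1)) (\<lambda>\<omega>. inn j q t \<omega> * \<eta> q' (t + 1) \<omega>) = P q q' * ip M (upd i q q' t) (inn j q t)"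
  unfolding cross_stationary[OF q j]
  using q j gain(2)[OF q i j] by (simp add: upd_ip inn_L2 inn_orthogonal_right xi_projection(1) inn_inn)

definition "stp i q' t = (\<lambda>\<omega>. (\<Sum>q\<in>Qs d. upd i q q' t \<omega>) * \<eta> q' (t + 1) \<omega>)"

text \<open>By uniqueness of projections it suffices that \<open>stp\<close> lies in the past of the
  output at \<open>t + 1\<close> and leaves a residual orthogonal to its generators. Outputs older
  than \<open>t\<close> are covered by \<open>upd_past\<close>; the output at time \<open>t\<close>
  splits into its prediction and the innovation, the latter being covered by
  \<open>upd_inn\<close>.\<close>

lemma xi_step:
  assumes q': "q' \<in> Qs d" and i: "i < r q'"
  shows "AE \<omega> in M. xi i q' (t + 1) \<omega> = stp i q' t \<omega>"
proof (rule L2_projection_unique[OF Gen_L2[OF Y_family] f_L2[OF q', of i "t + 1"] xi_projection(1)[OF q']])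
  show nc: "stp i q' t \<in> cl M (Gen 2 Y p (t + 1))"
    unfolding stp_def by (intro cl_shift[OF Y_family _ q'] cl_sum[OF Gen_L2[OF Y_family]] upd_cl)
  have nL: "stp i q' t \<in> L2 M" by (rule cl_L2[OF nc])
  fix h assume h: "h \<in> Gen 2 Y p (t + 1)"
  then show "ip M (\<lambda>\<omega>. f i q' (t + 1) \<omega> - xi i q' (t + 1) \<omega>) h = 0"
    by (intro xi_projection(2)[OF q'] cl_base[OF Gen_L2[OF Y_family]])
  from h obtain j w where w: "j < p" "2 \<le> length w" "set w \<subseteq> Qs d" "h = Zg (Y j) w (t + 1)" by (rule GenE)
  obtain q0 q w1 where w1: "w = q0 # q # w1" using w(2) by (metis Suc_le_length_iff numeral_2_eq_2)
  have q: "q0 \<in> Qs d" "q \<in> Qs d" "set w1 \<subseteq> Qs d" using w w1 by auto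
  let ?h = "Zg (Y j) (q # w1) t"
  have he: "h = (\<lambda>\<omega>. ?h \<omega> * \<eta> q0 (t + 1) \<omega>)" using w w1 by simp
  have hs: "?h \<omega> * \<eta> q t \<omega> = ?h \<omega>" for \<omega> by (rule Zg_supp[OF Y_family w(1)]) (use q in auto)
  have hL: "?h \<in> L2 M" by (rule Zg_L2[OF Y_family w(1)]) (use q in auto)
  have ns: "stp i q' t \<omega> * \<eta> q' (t + 1) \<omega> = stp i q' t \<omega>" for \<omega>
    unfolding stp_def by (simp add: mult.assoc chi_idem)
  show "ip M (\<lambda>\<omega>. f i q' (t + 1) \<omega> - stp i q' t \<omega>) h = 0"
  proof (cases "q' = q0")
    case False
    show ?thesis
      by (rule ip_disjoint[OF False, where t="t + 1"]) (simp_all only: he left_diff_distrib f_supp ns mult.assoc chi_idem)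
  next
    case True
    have nip: "ip M (stp i q' t) (\<lambda>\<omega>. g \<omega> * \<eta> q' (t + 1) \<omega>) = P q q' * ip M (upd i q q' t) g"
      if "g \<in> L2 M" "adapted t g" "\<And>\<omega>. g \<omega> * \<eta> q t \<omega> = g \<omega>" for g
      unfolding stp_def by (rule markov_sum_ip[OF upd_L2 upd_adapted upd_supp that q(2) q'])
    have past: "ip M (\<lambda>\<omega>. f i q' (t + 1) \<omega> - stp i q' t \<omega>) (\<lambda>\<omega>. g \<omega> * \<eta> q' (t + 1) \<omega>) = 0"
      if g: "g \<in> cl M (Gen 2 Y p t)" "\<And>\<omega>. g \<omega> * \<eta> q t \<omega> = g \<omega>" for g
    proof -
      have gL: "g \<in> L2 M" by (rule cl_L2[OF g(1)])
      have gad: "adapted t g" using Gen_Y_adapted cl_Gen_2_1[OF Y_family] g(1) by blast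
      show ?thesis using upd_past[OF q(2) q' i g] nip[OF gL gad g(2)] f_L2[OF q'] nL L2_chi[OF gL] by (simp add: ip_diff_left)
    qed
    show ?thesis
    proof (cases "w1 = []")
      case False
      then have "2 \<le> length (q # w1)" by (cases w1) auto
      then have "?h \<in> cl M (Gen 2 Y p t)" using q w(1) by (intro Zg_Y_cl) auto
      then show ?thesis unfolding he True[symmetric] using hs by (rule past)
    next
      case w1: True
      let ?c = "\<lambda>\<omega>. \<Sum>l\<in>{0..<n q}. Cm H q $$ (j, l) * xh l q t \<omega>"
      have cs: "?c \<omega> * \<eta> q t \<omega> = ?c \<omega>" for \<omega>
        unfolding sum_distrib_right by (simp only: mult.assoc xh_supp)
      have hY: "h = (\<lambda>\<omega>. inn j q t \<omega> * \<eta> q' (t + 1) \<omega> + ?c \<omega> * \<eta> q' (t + 1) \<omega>)"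
        unfolding he w1 True by (simp add: inn_def distrib_right[symmetric])
      have "ip M (\<lambda>\<omega>. f i q' (t + 1) \<omega> - stp i q' t \<omega>) (\<lambda>\<omega>. inn j q t \<omega> * \<eta> q' (t + 1) \<omega>) = 0"
        using upd_inn[OF q(2) q' i w(1)] nip[OF inn_L2[OF q(2) w(1)] inn_adapted[OF q(2) w(1)] inn_supp[OF q(2) w(1)]]
          f_L2[OF q'] nL L2_chi[OF inn_L2[OF q(2) w(1)]] by (simp add: ip_diff_left)
      moreover have "ip M (\<lambda>\<omega>. f i q' (t + 1) \<omega> - stp i q' t \<omega>) (\<lambda>\<omega>. ?c \<omega> * \<eta> q' (t + 1) \<omega>) = 0"
        by (rule past[OF Cxh_cl[OF q(2)] cs])
      ultimately show ?thesis unfolding hY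
        using f_L2[OF q', of i "t + 1"] nL L2_chi[OF inn_L2[OF q(2) w(1)]] L2_chi[OF cl_L2[OF Cxh_cl[OF q(2)]]]
        by (subst ip_add_right) auto
    qed
  qed
qed

end

section \<open>Events of a finite window\<close>

context markov_chain
begin

lemma window_set:
  assumes "A \<in> sets (sig_window M \<theta> t l)" "0 \<le> l"
  shows "\<exists>T. A = {\<omega> \<in> space M. map (\<lambda>k. \<theta> (t - int k) \<omega>) [0..<nat l + 1] \<in> T}"
proof -
  let ?S = "{\<theta> s -` {q} \<inter> space M | s q. t - l \<le> s \<and> s \<le> t}"
  let ?m = "\<lambda>\<omega>. map (\<lambda>k. \<theta> (t - int k) \<omega>) [0..<nat l + 1]"
  have "A \<in> sigma_sets (space M) ?S"
    using assms(1) unfolding sig_window_def by (subst (asm) sets_measure_of) auto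
  then show ?thesis
  proof induction
    case (Basic a)
    then obtain s q where a: "a = \<theta> s -` {q} \<inter> space M" "t - l \<le> s" "s \<le> t" by blast
    define k where "k = nat (t - s)"
    have k: "k < nat l + 1" "t - int k = s" using a assms(2) by (auto simp: k_def)
    have "?m \<omega> ! k = \<theta> s \<omega>" for \<omega> using k by (simp del: upt_Suc)
    then have "a = {\<omega> \<in> space M. ?m \<omega> \<in> {w. w ! k = q}}" by (auto simp: a)
    then show ?case by blast
  next
    case Empty
    show ?case by (intro exI[of _ "{}"]) simp
  next
    case (Compl a)
    then obtain T where T: "a = {\<omega> \<in> space M. ?m \<omega> \<in> T}" by blast
    have "space M - a = {\<omega> \<in> space M. ?m \<omega> \<in> - T}" unfolding T by blast
    then show ?case by (rule exI)
  next
    case (Union a)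
    from Union(2) have "\<forall>i. \<exists>T. a i = {\<omega> \<in> space M. ?m \<omega> \<in> T}" by (rule allI)
    from choice[OF this] obtain T where T: "\<forall>i. a i = {\<omega> \<in> space M. ?m \<omega> \<in> T i}" ..
    have "(\<Union>i. a i) = (\<Union>i. {\<omega> \<in> space M. ?m \<omega> \<in> T i})" using T by (intro SUP_cong refl) blast
    also have "\<dots> = {\<omega> \<in> space M. ?m \<omega> \<in> (\<Union>i. T i)}" by blast
    finally show ?case by (rule exI)
  qed
qed

lemma finite_words: "finite {w. length w = k \<and> set w \<subseteq> Qs d}"
  using finite_lists_length_eq[OF finite_Qs, of k] by (simp add: conj_commute)

text \<open>An event of a finite window depends only on the modes seen in it, and there are finitely
  many such paths; so its indicator is a finite combination of path indicators.\<close>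

lemma window_indicator:
  assumes A: "A \<in> sets (sig_window M \<theta> t l)" and l: "0 \<le> l"
  obtains c :: "nat list \<Rightarrow> real" where
    "\<And>\<omega>. \<omega> \<in> space M \<Longrightarrow> indicator A \<omega> = (\<Sum>w | length w = nat l + 1 \<and> set w \<subseteq> Qs d. c w * cyl w t \<omega>)"
proof -
  let ?m = "\<lambda>\<omega>. map (\<lambda>k. \<theta> (t - int k) \<omega>) [0..<nat l + 1]"
  from window_set[OF A l] obtain T where T: "A = {\<omega> \<in> space M. ?m \<omega> \<in> T}" by blast
  have "indicator A \<omega> = (\<Sum>w | length w = nat l + 1 \<and> set w \<subseteq> Qs d. (if w \<in> T then 1 else 0 :: real) * cyl w t \<omega>)"
    if w: "\<omega> \<in> space M" for \<omega>
  proof -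
    have mW: "?m \<omega> \<in> {w. length w = nat l + 1 \<and> set w \<subseteq> Qs d}" using theta_range[OF w] by auto
    have c: "cyl u t \<omega> = (if u = ?m \<omega> then 1 else 0)" if "length u = nat l + 1" for u
    proof -
      have "u \<noteq> []" using that by auto
      moreover have "(\<forall>k<length u. \<theta> (t - int k) \<omega> = u ! k) \<longleftrightarrow> u = ?m \<omega>"
      proof
        assume *: "\<forall>k<length u. \<theta> (t - int k) \<omega> = u ! k"
        show "u = ?m \<omega>" by (rule nth_equalityI) (use * that in \<open>auto simp del: upt_Suc\<close>)
      next
        assume *: "u = ?m \<omega>"
        show "\<forall>k<length u. \<theta> (t - int k) \<omega> = u ! k"
        proof (intro allI impI)
          fix k assume "k < length u"
          then have "k < nat l + 1" using that by simp
          then show "\<theta> (t - int k) \<omega> = u ! k" unfolding * by (simp del: upt_Suc)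
        qed
      qed
      ultimately show ?thesis using w by (simp add: cyl_eq_indicator indicator_def)
    qed
    have "(\<Sum>u | length u = nat l + 1 \<and> set u \<subseteq> Qs d. (if u \<in> T then 1 else 0 :: real) * cyl u t \<omega>)
        = (\<Sum>u | length u = nat l + 1 \<and> set u \<subseteq> Qs d. if u = ?m \<omega> then (if ?m \<omega> \<in> T then 1 else 0) else 0)"
      using c by (intro sum.cong refl) auto
    also have "\<dots> = (if ?m \<omega> \<in> T then 1 else 0)"
      using mW by (subst sum.delta[OF finite_words]) simp
    finally show ?thesis using w by (simp add: T indicator_def)
  qed
  then show thesis by (rule that)
qed

end

section \<open>The innovation representation as a system\<close>

context reduction
begin

text \<open>The noise is the innovation, so it has the dimension of the output and enters it through
  the identity. Evaluation at the current mode glues the modewise processes together;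
  \<open>xr\<close> and \<open>vr\<close> undo this.\<close>

definition Hr :: "'a gjmls" where
  "Hr = \<lparr>nst = r, mdim = p, Mm = Mr, Bm = gain, Cm = (\<lambda>q. Cm H q * J q), Dm = (\<lambda>q. 1\<^sub>m p),
     xp = (\<lambda>t \<omega>. vec (r (\<theta> t \<omega>)) (\<lambda>i. xi i (\<theta> t \<omega>) t \<omega>)),
     vp = (\<lambda>t \<omega>. vec p (\<lambda>j. inn j (\<theta> t \<omega>) t \<omega>))\<rparr>"

lemma Hr_simps [simp]:
  "nst Hr = r" "mdim Hr = p" "Mm Hr = Mr" "Bm Hr = gain" "Cm Hr = (\<lambda>q. Cm H q * J q)" "Dm Hr = (\<lambda>q. 1\<^sub>m p)"
  by (simp_all add: Hr_def)

lemma xi_zero: "\<eta> q t \<omega> = 0 \<Longrightarrow> xi i q t \<omega> = 0"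
  using xi_supp[of i q t \<omega>] by simp

lemma inn_zero: "q \<in> Qs d \<Longrightarrow> j < p \<Longrightarrow> \<eta> q t \<omega> = 0 \<Longrightarrow> inn j q t \<omega> = 0"
  using inn_supp[of q j t \<omega>] by simp

lemma xr: "i < r q \<Longrightarrow> xp Hr t \<omega> $ i * \<eta> q t \<omega> = xi i q t \<omega>"
  by (cases "\<omega> \<in> space M"; cases "\<theta> t \<omega> = q") (auto simp: Hr_def chi_space chi_outside xi_zero)

lemma vr: "q \<in> Qs d \<Longrightarrow> j < p \<Longrightarrow> vp Hr t \<omega> $ j * \<eta> q t \<omega> = inn j q t \<omega>"
  by (cases "\<omega> \<in> space M"; cases "\<theta> t \<omega> = q") (auto simp: Hr_def chi_space chi_outside inn_zero)

lemma vr_sum: "\<omega> \<in> space M \<Longrightarrow> j < p \<Longrightarrow> vp Hr t \<omega> $ j = (\<Sum>q\<in>Qs d. inn j q t \<omega>)"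
proof -
  assume a: "\<omega> \<in> space M" "j < p"
  have "(\<Sum>q\<in>Qs d. inn j q t \<omega>) = (\<Sum>q\<in>Qs d. vp Hr t \<omega> $ j * \<eta> q t \<omega>)"
    using a by (intro sum.cong refl) (simp add: vr)
  also have "\<dots> = vp Hr t \<omega> $ j" using chi_sum[OF a(1), of "\<lambda>_. vp Hr t \<omega> $ j" t] by simp
  finally show ?thesis ..
qed

lemma Hr_state_eq:
  "AE \<omega> in M. xp Hr (t + 1) \<omega> = Mm Hr (\<theta> t \<omega>) (\<theta> (t + 1) \<omega>) *\<^sub>v xp Hr t \<omega> + Bm Hr (\<theta> t \<omega>) (\<theta> (t + 1) \<omega>) *\<^sub>v vp Hr t \<omega>"
proof -
  have "AE \<omega> in M. \<forall>q'\<in>Qs d. \<forall>i\<in>{0..<r q'}. xi i q' (t + 1) \<omega> = stp i q' t \<omega>"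
    by (intro AE_finite_allI) (auto intro: xi_step)
  then show ?thesis using AE_space
  proof eventually_elim
    case (elim \<omega>)
    define q where "q = \<theta> t \<omega>"
    define q' where "q' = \<theta> (t + 1) \<omega>"
    have Q: "q \<in> Qs d" "q' \<in> Qs d" using theta_range[OF elim(2)] by (auto simp: q_def q'_def)
    have x: "xp Hr t \<omega> = vec (r q) (\<lambda>i. xi i q t \<omega>)" "vp Hr t \<omega> = vec p (\<lambda>j. inn j q t \<omega>)"
      "xp Hr (t + 1) \<omega> = vec (r q') (\<lambda>i. xi i q' (t + 1) \<omega>)" by (simp_all add: Hr_def q_def q'_def)
    have xc: "xp Hr t \<omega> \<in> carrier_vec (r q)" "vp Hr t \<omega> \<in> carrier_vec p" by (simp_all add: x)
    have "xp Hr (t + 1) \<omega> = Mr q q' *\<^sub>v xp Hr t \<omega> + gain q q' *\<^sub>v vp Hr t \<omega>"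
    proof (rule eq_vecI)
      fix i assume "i < dim_vec (Mr q q' *\<^sub>v xp Hr t \<omega> + gain q q' *\<^sub>v vp Hr t \<omega>)"
      then have i: "i < r q'" using gain(1)[OF Q] by simp
      have "xp Hr (t + 1) \<omega> $ i = stp i q' t \<omega>" using elim(1) Q i by (simp add: x)
      also have "\<dots> = (\<Sum>q2\<in>Qs d. upd i q2 q' t \<omega>)"
        unfolding stp_def using elim(2) by (simp add: chi_space q'_def)
      also have "\<dots> = (\<Sum>q2\<in>Qs d. upd i q2 q' t \<omega> * \<eta> q2 t \<omega>)"
        by (intro sum.cong refl) (simp add: upd_supp)
      also have "\<dots> = upd i q q' t \<omega>" unfolding q_def by (rule chi_sum[OF elim(2)])
      also have "\<dots> = (Mr q q' *\<^sub>v xp Hr t \<omega>) $ i + (gain q q' *\<^sub>v vp Hr t \<omega>) $ i"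
        unfolding upd_def mult_mat_sum[OF Mr_carrier[OF Q] xc(1) i] mult_mat_sum[OF gain(1)[OF Q] xc(2) i]
        by (simp add: x)
      finally show "xp Hr (t + 1) \<omega> $ i = (Mr q q' *\<^sub>v xp Hr t \<omega> + gain q q' *\<^sub>v vp Hr t \<omega>) $ i"
        using i gain(1)[OF Q] by simp
    qed (use gain(1)[OF Q] in \<open>simp add: x\<close>)
    then show ?case by (simp add: q_def q'_def)
  qed
qed

lemma CJ_carrier: "q \<in> Qs d \<Longrightarrow> Cm H q * J q \<in> carrier_mat p (r q)"
  by (rule mult_carrier_mat[OF Cm_carrier Jc])

lemma Hr_gjmls: "is_gjmls M d \<theta> p Hr"
  unfolding is_gjmls_def
proof (intro conjI ballI allI)
  show "Mm Hr q q' \<in> carrier_mat (nst Hr q') (nst Hr q)" "Bm Hr q q' \<in> carrier_mat (nst Hr q') (mdim Hr)"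
    if "q \<in> Qs d" "q' \<in> Qs d" for q q'
    using Mr_carrier[OF that] gain(1)[OF that] by simp_all
  show "Cm Hr q \<in> carrier_mat p (nst Hr q)" "Dm Hr q \<in> carrier_mat p (mdim Hr)" if "q \<in> Qs d" for q
    using CJ_carrier[OF that] by simp_all
qed (use Hr_state_eq in \<open>auto simp: Hr_def\<close>)

lemma Hr_realizes:
  assumes "realizes M \<theta> H y" shows "realizes M \<theta> Hr y"
  unfolding realizes_def
proof
  fix t
  have "AE \<omega> in M. y t \<omega> = Cm H (\<theta> t \<omega>) *\<^sub>v xp H t \<omega> + Dm H (\<theta> t \<omega>) *\<^sub>v vp H t \<omega>"
    using assms unfolding realizes_def by blast
  then show "AE \<omega> in M. y t \<omega> = Cm Hr (\<theta> t \<omega>) *\<^sub>v xp Hr t \<omega> + Dm Hr (\<theta> t \<omega>) *\<^sub>v vp Hr t \<omega>"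
    using AE_space
  proof eventually_elim
    case (elim \<omega>)
    define q where "q = \<theta> t \<omega>"
    have q: "q \<in> Qs d" using theta_range[OF elim(2)] by (simp add: q_def)
    have x: "xp Hr t \<omega> = vec (r q) (\<lambda>i. xi i q t \<omega>)" "vp Hr t \<omega> = vec p (\<lambda>j. inn j q t \<omega>)" by (simp_all add: Hr_def q_def)
    have xc: "xp Hr t \<omega> \<in> carrier_vec (r q)" "vp Hr t \<omega> \<in> carrier_vec p" by (simp_all add: x)
    have "Cm H q *\<^sub>v xp H t \<omega> + Dm H q *\<^sub>v vp H t \<omega> = Cm H q * J q *\<^sub>v xp Hr t \<omega> + 1\<^sub>m p *\<^sub>v vp Hr t \<omega>"
    proof (rule eq_vecI)
      fix i assume "i < dim_vec (Cm H q * J q *\<^sub>v xp Hr t \<omega> + 1\<^sub>m p *\<^sub>v vp Hr t \<omega>)"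
      then have i: "i < p" by simp
      have "(Cm H q *\<^sub>v xp H t \<omega> + Dm H q *\<^sub>v vp H t \<omega>) $ i = Y i q t \<omega>"
        using Y_output[OF elim(2) i q, of t] elim(2) by (simp add: chi_space q_def)
      also have "\<dots> = (\<Sum>l\<in>{0..<n q}. Cm H q $$ (i, l) * xh l q t \<omega>) + inn i q t \<omega>" by (simp add: inn_def)
      also have "(\<Sum>l\<in>{0..<n q}. Cm H q $$ (i, l) * xh l q t \<omega>) = (Cm H q * J q *\<^sub>v xp Hr t \<omega>) $ i"
      proof -
        have "(Cm H q * J q *\<^sub>v xp Hr t \<omega>) $ i = (\<Sum>k\<in>{0..<r q}. (\<Sum>l\<in>{0..<n q}. Cm H q $$ (i, l) * J q $$ (l, k)) * xi k q t \<omega>)"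
          unfolding mult_mat_sum[OF CJ_carrier[OF q] xc(1) i]
          by (intro sum.cong refl) (simp add: x index_mult_mat_sum[OF Cm_carrier[OF q] Jc[OF q] i] del: index_mult_mat(1))
        also have "\<dots> = (\<Sum>k\<in>{0..<r q}. \<Sum>l\<in>{0..<n q}. Cm H q $$ (i, l) * (J q $$ (l, k) * xi k q t \<omega>))"
          by (simp add: sum_distrib_right mult.assoc)
        also have "\<dots> = (\<Sum>l\<in>{0..<n q}. Cm H q $$ (i, l) * xh l q t \<omega>)"
          unfolding xh_def sum_distrib_left by (rule sum.swap)
        finally show ?thesis ..
      qed
      also have "inn i q t \<omega> = (1\<^sub>m p *\<^sub>v vp Hr t \<omega>) $ i" using i xc(2) by (simp add: x)
      finally show "(Cm H q *\<^sub>v xp H t \<omega> + Dm H q *\<^sub>v vp H t \<omega>) $ i = (Cm H q * J q *\<^sub>v xp Hr t \<omega> + 1\<^sub>m p *\<^sub>v vp Hr t \<omega>) $ i"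
        using i by simp
    qed (use Dm_carrier[OF q] in simp)
    then show ?case using elim(1) by (simp add: q_def)
  qed
qed

lemma J_intertwines:
  assumes "q \<in> Qs d" "q' \<in> Qs d"
  shows "Mm H q q' * J q = J q' * Mr q q'"
proof -
  have "transpose_mat (J q') \<in> carrier_mat (r q') (n q')" using Jc[OF assms(2)] by simp
  then show ?thesis
    unfolding Mr_def using JM[OF assms] assoc_mult_mat[OF Jc[OF assms(2)] _ mult_carrier_mat[OF Mm_carrier[OF assms] Jc[OF assms(1)]]]
    by simp
qed

lemma Hr_contractive: "contractive {1..d} r P (\<lambda>i j c a. Mr i j $$ (c, a))"
proof (rule contractive_restrict[where n=n and A="\<lambda>i j c a. Mm H i j $$ (c, a)" and L="\<lambda>i k a. J i $$ (a, k)" and J="\<lambda>i a k. J i $$ (a, k)"])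
  show "contractive {1..d} n P (\<lambda>i j c a. Mm H i j $$ (c, a))"
    using stable_iff_contractive(2)[of d H P] Mm_carrier G unfolding assumptionG_def Qs_def by blast
next
  fix i k l assume i: "i \<in> {1..d}" and kl: "k < r i" "l < r i"
  have i': "i \<in> Qs d" using i by (simp add: Qs_def)
  have Jt: "transpose_mat (J i) \<in> carrier_mat (r i) (n i)" using Jc[OF i'] by simp
  have "(\<Sum>a\<in>{0..<n i}. J i $$ (a, k) * J i $$ (a, l)) = (transpose_mat (J i) * J i) $$ (k, l)"
    unfolding index_mult_mat_sum[OF Jt Jc[OF i'] kl] using Jc[OF i'] kl by (intro sum.cong refl) simp
  then show "(\<Sum>a\<in>{0..<n i}. J i $$ (a, k) * J i $$ (a, l)) = (if k = l then 1 else 0)"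
    using JJ1[OF i'] kl by simp
next
  fix i j c k assume ij: "i \<in> {1..d}" "j \<in> {1..d}" and ck: "c < n j" "k < r i"
  have ij': "i \<in> Qs d" "j \<in> Qs d" using ij by (auto simp: Qs_def)
  show "(\<Sum>a\<in>{0..<n i}. Mm H i j $$ (c, a) * J i $$ (a, k)) = (\<Sum>l\<in>{0..<r j}. J j $$ (c, l) * Mr i j $$ (l, k))"
    unfolding index_mult_mat_sum[OF Mm_carrier[OF ij'] Jc[OF ij'(1)] ck, symmetric]
      index_mult_mat_sum[OF Jc[OF ij'(2)] Mr_carrier[OF ij'] ck, symmetric] J_intertwines[OF ij'] ..
qed

subsection \<open>The innovations generate the state\<close>

text \<open>The part of \<open>xi\<close> at time \<open>t\<close> that stems from \<open>xi\<close>
  at time \<open>t - k\<close> when the state equation is unfolded \<open>k\<close> times.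
  Everything else is a combination of innovations of the last \<open>k\<close> steps, weighted by
  path indicators.\<close>

primrec rem :: "nat \<Rightarrow> nat \<Rightarrow> nat \<Rightarrow> int \<Rightarrow> 'a \<Rightarrow> real" where
  "rem 0 = xi"
| "rem (Suc k) = (\<lambda>i q' t \<omega>. (\<Sum>q\<in>Qs d. \<Sum>l\<in>{0..<r q}. Mr q q' $$ (i, l) * rem k l q (t - 1) \<omega>) * \<eta> q' t \<omega>)"

lemma rem_supp: "rem k i q t \<omega> * \<eta> q t \<omega> = rem k i q t \<omega>"
  by (cases k) (simp_all add: xi_supp mult.assoc chi_idem)

lemma rem_cl: "q \<in> Qs d \<Longrightarrow> rem k i q t \<in> cl M (Gen 2 Y p t)"
proof (induction k arbitrary: i q t)
  case 0
  then show ?case by (simp add: xi_projection(1))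
next
  case (Suc k)
  have 1: "rem k l q (t - 1) \<in> cl M (Gen 1 Y p (t - 1))" if "q \<in> Qs d" for l q
    using Suc.IH[OF that] cl_Gen_2_1[OF Y_family] by blast
  have "(\<lambda>\<omega>. \<Sum>q2\<in>Qs d. \<Sum>l\<in>{0..<r q2}. Mr q2 q $$ (i, l) * rem k l q2 (t - 1) \<omega>) \<in> cl M (Gen 1 Y p (t - 1))"
    by (intro cl_sum[OF Gen_L2[OF Y_family]] cl_scale[OF Gen_L2[OF Y_family]] 1)
  from cl_shift[OF Y_family this Suc.prems] show ?case by simp
qed

lemma rem_L2: "q \<in> Qs d \<Longrightarrow> rem k i q t \<in> L2 M"
  by (rule cl_L2[OF rem_cl])

lemma rem_adapted: "q \<in> Qs d \<Longrightarrow> adapted t (rem k i q t)"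
  using rem_cl cl_Gen_2_1[OF Y_family] Gen_Y_adapted by blast

text \<open>The iterates of the covariance operator bounded by (G5), started from the covariance of
  \<open>xi\<close>. Time 0 serves as a representative, by stationarity.\<close>

primrec remcov :: "nat \<Rightarrow> nat \<Rightarrow> nat \<Rightarrow> nat \<Rightarrow> real" where
  "remcov 0 = (\<lambda>q i j. ip M (xi i q 0) (xi j q 0))"
| "remcov (Suc k) = (\<lambda>q' i j. \<Sum>q\<in>Qs d. P q q' * sand (r q) (\<lambda>c a. Mr q q' $$ (c, a)) (remcov k q) i j)"

text \<open>Cross terms between different modes vanish and the new mode contributes the factor
  \<open>P q q'\<close>, so the covariance of the remainder propagates by the congruence
  sum.\<close>

lemma rem_ip: "q \<in> Qs d \<Longrightarrow> ip M (rem k i q t) (rem k j q t) = remcov k q i j"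
proof (induction k arbitrary: q i j t)
  case 0
  then show ?case by (simp add: xi_xi_stationary[of q i t j 0])
next
  case (Suc k q')
  define a where "a i q = (\<lambda>\<omega>. \<Sum>l\<in>{0..<r q}. Mr q q' $$ (i, l) * rem k l q (t - 1) \<omega>)" for i q
  have aL: "a i q \<in> L2 M" if "q \<in> Qs d" for i q unfolding a_def using that by (intro L2_sum L2_scale rem_L2)
  have aA: "adapted (t - 1) (a i q)" if "q \<in> Qs d" for i q unfolding a_def using that by (intro adapted_sum adapted_scale rem_adapted)
  have aS: "a i q \<omega> * \<eta> q (t - 1) \<omega> = a i q \<omega>" for i q \<omega> unfolding a_def sum_distrib_right by (simp only: mult.assoc rem_supp)
  have rS: "rem (Suc k) i q' t = (\<lambda>\<omega>. (\<Sum>q\<in>Qs d. a i q \<omega>) * \<eta> q' (t - 1 + 1) \<omega>)" for i by (simp add: a_def)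
  have rS': "rem (Suc k) i q' t = (\<lambda>\<omega>. \<Sum>q\<in>Qs d. a i q \<omega> * \<eta> q' (t - 1 + 1) \<omega>)" for i
    unfolding rS by (simp add: sum_distrib_right)
  have rL: "rem (Suc k) i q' t \<in> L2 M" for i by (rule rem_L2[OF Suc.prems])
  have "ip M (rem (Suc k) i q' t) (rem (Suc k) j q' t) = (\<Sum>q\<in>Qs d. ip M (rem (Suc k) i q' t) (\<lambda>\<omega>. a j q \<omega> * \<eta> q' (t - 1 + 1) \<omega>))"
    by (subst (2) rS') (intro ip_sum_right L2_chi aL rL)
  also have "\<dots> = (\<Sum>q\<in>Qs d. P q q' * ip M (a i q) (a j q))"
  proof (rule sum.cong[OF refl])
    fix q assume q: "q \<in> Qs d"
    show "ip M (rem (Suc k) i q' t) (\<lambda>\<omega>. a j q \<omega> * \<eta> q' (t - 1 + 1) \<omega>) = P q q' * ip M (a i q) (a j q)"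
      unfolding rS by (rule markov_sum_ip[where a="a i", OF aL aA aS aL[OF q] aA[OF q] aS q Suc.prems])
  qed
  also have "\<dots> = (\<Sum>q\<in>Qs d. P q q' * sand (r q) (\<lambda>c a. Mr q q' $$ (c, a)) (remcov k q) i j)"
  proof (rule sum.cong[OF refl])
    fix q assume q: "q \<in> Qs d"
    have "ip M (a i q) (a j q) = (\<Sum>l\<in>{0..<r q}. Mr q q' $$ (i, l) * ip M (rem k l q (t - 1)) (a j q))"
      unfolding a_def[of i] using q aL by (subst ip_sum_left) (auto intro: rem_L2)
    also have "\<dots> = (\<Sum>l\<in>{0..<r q}. Mr q q' $$ (i, l) * (\<Sum>l'\<in>{0..<r q}. Mr q q' $$ (j, l') * remcov k q l l'))"
    proof (intro sum.cong refl arg_cong2[of _ _ _ _ "(*)"])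
      fix l
      show "ip M (rem k l q (t - 1)) (a j q) = (\<Sum>l'\<in>{0..<r q}. Mr q q' $$ (j, l') * remcov k q l l')"
        unfolding a_def[of j] using q Suc.IH[OF q] by (subst ip_sum_right) (auto intro: rem_L2)
    qed
    also have "\<dots> = sand (r q) (\<lambda>c a. Mr q q' $$ (c, a)) (remcov k q) i j"
      by (simp add: sand_def sum_distrib_left mult.assoc)
    finally show "P q q' * ip M (a i q) (a j q) = P q q' * sand (r q) (\<lambda>c a. Mr q q' $$ (c, a)) (remcov k q) i j" by simp
  qed
  finally show ?case by simp
qed

lemma remcov_tendsto_0:
  assumes q: "q \<in> Qs d" and i: "i < r q"
  shows "(\<lambda>k. remcov k q i i) \<longlonglongrightarrow> 0"
  by (rule contractive_iteration_tendsto_0[OF Hr_contractive]) (use q i in \<open>auto simp: Qs_def\<close>)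

lemma inn_in_Gen: "q \<in> Qs d \<Longrightarrow> j < p \<Longrightarrow> inn j q t \<in> cl M (Gen 1 inn p t)"
  using GenI[of j p 1 "[q]" inn t] by (auto intro!: cl_base[OF Gen_L2[OF inn_family]])

lemma xi_minus_rem_cl:
  assumes "q \<in> Qs d" "i < r q"
  shows "(\<lambda>\<omega>. xi i q t \<omega> - rem k i q t \<omega>) \<in> cl M (Gen 2 inn p t)"
  using assms
proof (induction k arbitrary: i q t)
  case 0
  then show ?case using lspan_cl[OF Gen_L2[OF inn_family] lspan_zero] by simp
next
  case (Suc k i q')
  note L = Gen_L2[OF inn_family]
  let ?s = "\<lambda>\<omega>. \<Sum>q\<in>Qs d. (\<Sum>l\<in>{0..<r q}. Mr q q' $$ (i, l) * (xi l q (t - 1) \<omega> - rem k l q (t - 1) \<omega>))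
      + (\<Sum>j\<in>{0..<p}. gain q q' $$ (i, j) * inn j q (t - 1) \<omega>)"
  have 1: "(\<lambda>\<omega>. xi l q (t - 1) \<omega> - rem k l q (t - 1) \<omega>) \<in> cl M (Gen 1 inn p (t - 1))" if "q \<in> Qs d" "l < r q" for l q
    using Suc.IH[OF that] cl_Gen_2_1[OF inn_family] by blast
  have "?s \<in> cl M (Gen 1 inn p (t - 1))"
    by (intro cl_sum[OF L] cl_add[OF L] cl_scale[OF L] 1 inn_in_Gen) auto
  from cl_shift[OF inn_family this Suc.prems(1)]
  have c: "(\<lambda>\<omega>. ?s \<omega> * \<eta> q' t \<omega>) \<in> cl M (Gen 2 inn p t)" by simp
  show ?case
  proof (rule cl_cong_AE[OF L c])
    show "(\<lambda>\<omega>. xi i q' t \<omega> - rem (Suc k) i q' t \<omega>) \<in> borel_measurable M"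
      using xi_L2[OF Suc.prems(1), of i t] rem_L2[OF Suc.prems(1), of "Suc k" i t] by (auto simp: L2_measurable simp del: rem.simps)
    have "AE \<omega> in M. xi i q' (t - 1 + 1) \<omega> = stp i q' (t - 1) \<omega>" by (rule xi_step[OF Suc.prems])
    then show "AE \<omega> in M. ?s \<omega> * \<eta> q' t \<omega> = xi i q' t \<omega> - rem (Suc k) i q' t \<omega>"
    proof eventually_elim
      case (elim \<omega>)
      then show ?case
        by (simp add: stp_def upd_def left_diff_distrib[symmetric] sum_subtractf[symmetric] right_diff_distrib)
    qed
  qed
qed

text \<open>The core of (G3) for the new system: \<open>xi\<close> minus the remainder is built from
  delayed innovations, and the remainder tends to 0 in mean square.\<close>

lemma xi_innovation_cl:
  assumes q: "q \<in> Qs d" and i: "i < r q"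
  shows "xi i q t \<in> cl M (Gen 2 inn p t)"
proof (rule cl_closed[OF Gen_L2[OF inn_family] xi_L2[OF q]])
  fix e :: real assume "e > 0"
  from order_tendstoD(2)[OF remcov_tendsto_0[OF q i] this] obtain k where k: "remcov k q i i < e"
    unfolding eventually_sequentially by blast
  show "\<exists>g\<in>cl M (Gen 2 inn p t). ip M (\<lambda>\<omega>. xi i q t \<omega> - g \<omega>) (\<lambda>\<omega>. xi i q t \<omega> - g \<omega>) < e"
    by (rule bexI[OF _ xi_minus_rem_cl[OF q i, of t k]]) (use k rem_ip[OF q, of k i t i] in simp)
qed

subsection \<open>The innovation representation satisfies Assumption (G)\<close>

lemma vr_measurable: "j < p \<Longrightarrow> (\<lambda>\<omega>. vp Hr t \<omega> $ j) \<in> borel_measurable M"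
proof -
  assume j: "j < p"
  have "(\<lambda>\<omega>. \<Sum>q\<in>Qs d. inn j q t \<omega>) \<in> L2 M" using j by (intro L2_sum inn_L2)
  then have "(\<lambda>\<omega>. \<Sum>q\<in>Qs d. inn j q t \<omega>) \<in> borel_measurable M" by (rule L2_measurable)
  then show ?thesis using vr_sum[OF _ j] by (simp cong: measurable_cong)
qed

lemma vr_L2: "j < p \<Longrightarrow> (\<lambda>\<omega>. vp Hr t \<omega> $ j) \<in> L2 M"
  by (rule L2_cong_AE[of "\<lambda>\<omega>. \<Sum>q\<in>Qs d. inn j q t \<omega>"]) (auto intro!: L2_sum inn_L2 vr_measurable simp: vr_sum)

lemma vr_ip: "j < p \<Longrightarrow> h \<in> L2 M \<Longrightarrow> ip M (\<lambda>\<omega>. vp Hr t \<omega> $ j) h = (\<Sum>q\<in>Qs d. ip M (inn j q t) h)"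
proof -
  assume a: "j < p" "h \<in> L2 M"
  have "ip M (\<lambda>\<omega>. vp Hr t \<omega> $ j) h = ip M (\<lambda>\<omega>. \<Sum>q\<in>Qs d. inn j q t \<omega>) h"
    using a vr_sum by (intro ip_cong_AE L2_measurable L2_sum inn_L2 vr_L2 AE_I2) auto
  then show ?thesis using a by (simp add: ip_sum_left inn_L2)
qed

text \<open>The innovations lie in the closed span of the noise up to time \<open>t\<close>, where
  \<open>cl_V_mean\<close> gives zero mean on every event of the chain up to time
  \<open>t + k\<close>.\<close>

lemma Hr_mean:
  assumes "0 \<le> k" "j < p"
  shows "AE \<omega> in M. real_cond_exp M (sig_past M \<theta> (t + k)) (\<lambda>\<omega>. vp Hr t \<omega> $ j) \<omega> = 0"
proof (rule cond_exp_0I[OF subalgebra_past L2_integrable[OF vr_L2[OF assms(2)]]])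
  fix A assume A: "A \<in> sets (sig_past M \<theta> (t + k))"
  then have AM: "A \<in> sets M" using subalgebra_past by (auto simp: subalgebra_def)
  have "(\<lambda>\<omega>. (indicator A \<omega> :: real)\<^sup>2) = indicator A" by (auto simp: indicator_def)
  then have L: "indicator A \<in> L2 M" using AM by (simp add: L2_def emeasure_eq_measure)
  have "integral\<^sup>L M (\<lambda>\<omega>. indicator A \<omega> * vp Hr t \<omega> $ j) = ip M (\<lambda>\<omega>. vp Hr t \<omega> $ j) (indicator A)"
    by (simp add: ip_def mult.commute)
  also have "\<dots> = 0"
    unfolding vr_ip[OF assms(2) L]
    by (intro sum.neutral ballI cl_V_mean[OF _ assms(1) A]) (use inn_cl[OF _ assms(2)] cl_Y_V in blast)
  finally show "integral\<^sup>L M (\<lambda>\<omega>. indicator A \<omega> * vp Hr t \<omega> $ j) = 0" .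
qed

lemma inn_past: "j < p \<Longrightarrow> set w \<subseteq> Qs d \<Longrightarrow> 2 \<le> length w \<Longrightarrow> Zg (inn j) w t \<in> cl M (Gen 2 Y p t)"
  by (rule cl_shift_Zg[OF Y_family inn_cl])

lemma Zg_vr: "j < p \<Longrightarrow> set w \<subseteq> Qs d \<Longrightarrow> Zg (\<lambda>q t \<omega>. vp Hr t \<omega> $ j * \<eta> q t \<omega>) w t = Zg (inn j) w t"
proof (induction w arbitrary: t)
  case (Cons q w)
  then show ?case by (cases "w = []") (auto simp: Zg_Cons vr)
qed simp

text \<open>Restricted to an event of the window, the older innovation becomes a combination of
  delayed path processes in the strict past of the output, and the newer innovation is orthogonal to
  those.\<close>

lemma Hr_white:
  assumes l: "0 < l" and ij: "i < p" "j < p"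
  shows "AE \<omega> in M. real_cond_exp M (sig_window M \<theta> t l) (\<lambda>\<omega>. vp Hr t \<omega> $ i * vp Hr (t - l) \<omega> $ j) \<omega> = 0"
proof (rule cond_exp_0I[OF subalgebra_window L2_mult_integrable[OF vr_L2[OF ij(1)] vr_L2[OF ij(2)]]])
  fix A assume A: "A \<in> sets (sig_window M \<theta> t l)"
  obtain c :: "nat list \<Rightarrow> real" where c:
    "\<And>\<omega>. \<omega> \<in> space M \<Longrightarrow> indicator A \<omega> = (\<Sum>w | length w = nat l + 1 \<and> set w \<subseteq> Qs d. c w * cyl w t \<omega>)"
    by (rule window_indicator[OF A], use l in simp, rule that)
  let ?W = "{w. length w = nat l + 1 \<and> set w \<subseteq> Qs d}"
  have W: "w \<noteq> []" "2 \<le> length w" "set w \<subseteq> Qs d" "int (length w - 1) = l" if "w \<in> ?W" for w using that l by auto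
  have Z: "Zg (inn j) w t \<omega> = vp Hr (t - l) \<omega> $ j * cyl w t \<omega>" if "w \<in> ?W" for w \<omega>
    using Zg_cyl[OF W(1)[OF that], of "\<lambda>t \<omega>. vp Hr t \<omega> $ j" t \<omega>] W(4)[OF that] Zg_vr[OF ij(2) W(3)[OF that]] by simp
  have ZL: "Zg (inn j) w t \<in> L2 M" if "w \<in> ?W" for w by (rule cl_L2[OF inn_past[OF ij(2) W(3,2)[OF that]]])
  have sL: "(\<lambda>\<omega>. \<Sum>w\<in>?W. c w * Zg (inn j) w t \<omega>) \<in> L2 M" by (intro L2_sum L2_scale ZL)
  have "integral\<^sup>L M (\<lambda>\<omega>. indicator A \<omega> * (vp Hr t \<omega> $ i * vp Hr (t - l) \<omega> $ j))
      = ip M (\<lambda>\<omega>. vp Hr t \<omega> $ i) (\<lambda>\<omega>. \<Sum>w\<in>?W. c w * Zg (inn j) w t \<omega>)"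
    unfolding ip_def
  proof (rule Bochner_Integration.integral_cong[OF refl])
    fix \<omega> assume w: "\<omega> \<in> space M"
    have "(\<Sum>w\<in>?W. c w * Zg (inn j) w t \<omega>) = vp Hr (t - l) \<omega> $ j * indicator A \<omega>"
      unfolding c[OF w] sum_distrib_left by (intro sum.cong refl) (simp add: Z)
    then show "indicator A \<omega> * (vp Hr t \<omega> $ i * vp Hr (t - l) \<omega> $ j) = vp Hr t \<omega> $ i * (\<Sum>w\<in>?W. c w * Zg (inn j) w t \<omega>)"
      by (simp only: mult_ac)
  qed
  also have "\<dots> = (\<Sum>q\<in>Qs d. ip M (inn i q t) (\<lambda>\<omega>. \<Sum>w\<in>?W. c w * Zg (inn j) w t \<omega>))"
    by (rule vr_ip[OF ij(1) sL])
  also have "\<dots> = 0"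
    by (intro sum.neutral ballI inn_orthogonal[OF _ ij(1)] cl_sum[OF Gen_L2[OF Y_family]] cl_scale[OF Gen_L2[OF Y_family]] inn_past[OF ij(2)] W)
  finally show "integral\<^sup>L M (\<lambda>\<omega>. indicator A \<omega> * (vp Hr t \<omega> $ i * vp Hr (t - l) \<omega> $ j)) = 0" .
qed

lemma vr_vr: "q \<in> Qs d \<Longrightarrow> i < p \<Longrightarrow> j < p \<Longrightarrow> integral\<^sup>L M (\<lambda>\<omega>. vp Hr t \<omega> $ i * vp Hr t \<omega> $ j * \<eta> q t \<omega>) = Qe q i j"
proof -
  assume a: "q \<in> Qs d" "i < p" "j < p"
  have "inn i q t \<omega> * inn j q t \<omega> = vp Hr t \<omega> $ i * vp Hr t \<omega> $ j * \<eta> q t \<omega>" for \<omega>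
  proof -
    have "inn i q t \<omega> * inn j q t \<omega> = vp Hr t \<omega> $ i * vp Hr t \<omega> $ j * (\<eta> q t \<omega> * \<eta> q t \<omega>)"
      by (subst vr[OF a(1,2), symmetric], subst vr[OF a(1,3), symmetric]) (simp only: mult_ac)
    then show ?thesis by (simp only: chi_idem)
  qed
  then show ?thesis using inn_inn[OF a, of t] by (simp add: ip_def)
qed

lemma vr_adapted:
  assumes "s \<le> t" "j < p" shows "adapted t (\<lambda>\<omega>. vp Hr s \<omega> $ j)"
proof (rule adapted_cong_AE)
  show "adapted t (\<lambda>\<omega>. \<Sum>q\<in>Qs d. inn j q s \<omega>)"
    using assms by (intro adapted_sum adapted_mono[OF inn_adapted])
  show "AE \<omega> in M. (\<Sum>q\<in>Qs d. inn j q s \<omega>) = vp Hr s \<omega> $ j"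
    using assms by (intro AE_I2) (simp add: vr_sum)
qed (rule vr_measurable[OF assms(2)])

lemma Hr_G3:
  assumes q: "q \<in> Qs d" and i: "i < r q"
  shows "(\<lambda>\<omega>. xp Hr t \<omega> $ i * \<eta> q t \<omega>) \<in> ms_closure M (Gen 2 (\<lambda>j q t \<omega>. vp Hr t \<omega> $ j * \<eta> q t \<omega>) p t)"
proof -
  have "Gen 2 (\<lambda>j q t \<omega>. vp Hr t \<omega> $ j * \<eta> q t \<omega>) p t = Gen 2 inn p t"
    unfolding Gen_def by (rule image_cong) (auto simp: WI_def Zg_vr)
  then show ?thesis
    using xi_innovation_cl[OF q i] ms_closure_eq_cl[OF Gen_L2[OF inn_family]] xr[OF i] by simp
qed

lemma Hr_assumptionG: "assumptionG M d \<theta> P p Hr"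
  unfolding assumptionG_def
proof (intro conjI allI impI ballI)
  fix t i assume "i < mdim Hr"
  then have i: "i < p" by simp
  show "(\<lambda>\<omega>. vp Hr t \<omega> $ i) \<in> borel_measurable M" "integrable M (\<lambda>\<omega>. (vp Hr t \<omega> $ i)\<^sup>2)"
    using vr_L2[OF i, of t] by (auto simp: L2_def)
next
  fix t k i assume "i < mdim Hr" "(0::int) \<le> k"
  then show "AE \<omega> in M. real_cond_exp M (sig_past M \<theta> (t + k)) (\<lambda>\<omega>. vp Hr t \<omega> $ i) \<omega> = 0"
    using Hr_mean by simp
next
  fix t l i j assume "i < mdim Hr" "j < mdim Hr" "(0::int) < l"
  then show "AE \<omega> in M. real_cond_exp M (sig_window M \<theta> t l) (\<lambda>\<omega>. vp Hr t \<omega> $ i * vp Hr (t - l) \<omega> $ j) \<omega> = 0"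
    using Hr_white by simp
next
  fix t q i j assume "q \<in> Qs d" "i < mdim Hr" "j < mdim Hr"
  then show "integral\<^sup>L M (\<lambda>\<omega>. vp Hr t \<omega> $ i * vp Hr t \<omega> $ j * \<eta> q t \<omega>) = Qmat M \<theta> Hr q $$ (i, j)"
    by (simp add: Qmat_def vr_vr)
next
  fix t
  show "cond_indep M (sig_vpast M (vp Hr) (mdim Hr) t) (sig_future M \<theta> t) (sig_past M \<theta> t)"
    using vr_adapted by (intro cond_indep_adapted) simp
next
  fix t q i assume q: "q \<in> Qs d" and "i < nst Hr q"
  then have i: "i < r q" by simp
  show "(\<lambda>\<omega>. xp Hr t \<omega> $ i * \<eta> q t \<omega>) \<in> ms_closure M
          {(\<lambda>\<omega>. vp Hr (t - int k) \<omega> $ j *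
                  indicator {\<omega> \<in> space M. \<forall>r \<le> k. \<theta> (t - int k + int r) \<omega> = qs ! r} \<omega>)
           | k qs j. k > 0 \<and> length qs = k + 1 \<and> set qs \<subseteq> Qs d \<and> j < mdim Hr}"
    unfolding delayed_generators using Hr_G3[OF q i] by simp
next
  fix ev assume ev: "eigenvalue (map_mat complex_of_real (stab_mat d P Hr)) ev"
  have c: "Mm Hr i j \<in> carrier_mat (nst Hr j) (nst Hr i)" if "i \<in> {1..d}" "j \<in> {1..d}" for i j
    using Mr_carrier[of i j] that by (simp add: Qs_def)
  have "contractive {1..d} (nst Hr) P (\<lambda>i j c a. Mm Hr i j $$ (c, a))" using Hr_contractive by simp
  then show "cmod ev < 1" using stable_iff_contractive(2)[of d Hr P, OF c] ev by blast
next
  fix q and z :: "real vec" assume q: "q \<in> Qs d" and z: "z \<in> carrier_vec p" "z \<noteq> 0\<^sub>v p"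
  have Qc: "Qmat M \<theta> Hr q \<in> carrier_mat p p" by (simp add: Qmat_def)
  have "Dm Hr q * Qmat M \<theta> Hr q * transpose_mat (Dm Hr q) = Qmat M \<theta> Hr q" using Qc by simp
  moreover have "scalar_prod z (Qmat M \<theta> Hr q *\<^sub>v z) = (\<Sum>i\<in>{0..<p}. \<Sum>j\<in>{0..<p}. z $ i * z $ j * Qe q i j)"
  proof -
    have "scalar_prod z (Qmat M \<theta> Hr q *\<^sub>v z) = (\<Sum>i\<in>{0..<p}. z $ i * (Qmat M \<theta> Hr q *\<^sub>v z) $ i)"
      using carrier_vecD[OF mult_mat_vec_carrier[OF Qc z(1)]] by (simp add: scalar_prod_def del: index_mult_mat_vec dim_mult_mat_vec)
    also have "\<dots> = (\<Sum>i\<in>{0..<p}. z $ i * (\<Sum>j\<in>{0..<p}. Qe q i j * z $ j))"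
    proof (intro sum.cong refl arg_cong2[of _ _ _ _ "(*)"])
      fix i assume "i \<in> {0..<p}"
      then have i: "i < p" by simp
      show "(Qmat M \<theta> Hr q *\<^sub>v z) $ i = (\<Sum>j\<in>{0..<p}. Qe q i j * z $ j)"
        unfolding mult_mat_sum[OF Qc z(1) i] by (intro sum.cong refl) (simp add: Qmat_def vr_vr[OF q] i)
    qed
    finally show ?thesis by (simp add: sum_distrib_left mult_ac)
  qed
  ultimately show "scalar_prod z ((Dm Hr q * Qmat M \<theta> Hr q * transpose_mat (Dm Hr q)) *\<^sub>v z) > 0"
    using Qe_positive[OF q z] by simp
qed

end

subsection \<open>Factoring out the unobservable subspace\<close>

text \<open>\<open>J q\<close> is an orthonormal basis of a subspace that contains the columns of
  \<open>C^T\<close> and is invariant under the \<open>M^T\<close>. Dually, its transpose is a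
  quotient map that commutes with the dynamics and through which \<open>C\<close> factors.\<close>

locale quotient = gsys +
  fixes J :: "nat \<Rightarrow> real mat" and r :: "nat \<Rightarrow> nat"
  assumes Jc: "\<And>q. q \<in> Qs d \<Longrightarrow> J q \<in> carrier_mat (n q) (r q)"
    and JJ1: "\<And>q. q \<in> Qs d \<Longrightarrow> transpose_mat (J q) * J q = 1\<^sub>m (r q)"
    and JC: "\<And>q. q \<in> Qs d \<Longrightarrow> J q * transpose_mat (J q) * transpose_mat (Cm H q) = transpose_mat (Cm H q)"
    and JM: "\<And>q q'. q \<in> Qs d \<Longrightarrow> q' \<in> Qs d \<Longrightarrow>
        J q * transpose_mat (J q) * (transpose_mat (Mm H q q') * J q') = transpose_mat (Mm H q q') * J q'"
begin

lemma Jt: "q \<in> Qs d \<Longrightarrow> transpose_mat (J q) \<in> carrier_mat (r q) (n q)"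
  using Jc by simp

definition "Mq q q' = transpose_mat (J q') * Mm H q q' * J q"

lemma Mq_carrier: "q \<in> Qs d \<Longrightarrow> q' \<in> Qs d \<Longrightarrow> Mq q q' \<in> carrier_mat (r q') (r q)"
  unfolding Mq_def by (rule mult_carrier_mat[OF mult_carrier_mat[OF Jt Mm_carrier] Jc])

text \<open>The first identity expresses the invariance of the range of \<open>J\<close> under
  \<open>M^T\<close>; the second is its transpose.\<close>

lemma Mq_intertwines:
  assumes q: "q \<in> Qs d" "q' \<in> Qs d"
  shows "transpose_mat (Mm H q q') * J q' = J q * transpose_mat (Mq q q')"
    and "Mq q q' * transpose_mat (J q) = transpose_mat (J q') * Mm H q q'"
proof -
  have Mt: "transpose_mat (Mm H q q') \<in> carrier_mat (n q) (n q')" using Mm_carrier[OF q] by simp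
  have JM': "transpose_mat (J q') * Mm H q q' \<in> carrier_mat (r q') (n q)" by (rule mult_carrier_mat[OF Jt[OF q(2)] Mm_carrier[OF q]])
  have tr: "transpose_mat (transpose_mat (J q') * Mm H q q') = transpose_mat (Mm H q q') * J q'"
    using transpose_mult[OF Jt[OF q(2)] Mm_carrier[OF q]] by simp
  have "transpose_mat (Mq q q') = transpose_mat (J q) * (transpose_mat (Mm H q q') * J q')"
    unfolding Mq_def transpose_mult[OF JM' Jc[OF q(1)]] tr ..
  then have "J q * transpose_mat (Mq q q') = J q * transpose_mat (J q) * (transpose_mat (Mm H q q') * J q')"
    using assoc_mult_mat[OF Jc[OF q(1)] Jt[OF q(1)] mult_carrier_mat[OF Mt Jc[OF q(2)]]] by simp
  then show 1: "transpose_mat (Mm H q q') * J q' = J q * transpose_mat (Mq q q')" using JM[OF q] by simp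
  have "transpose_mat (transpose_mat (J q') * Mm H q q') = transpose_mat (Mq q q' * transpose_mat (J q))"
    unfolding tr 1 transpose_mult[OF Mq_carrier[OF q] Jt[OF q(1)]] by simp
  then show "Mq q q' * transpose_mat (J q) = transpose_mat (J q') * Mm H q q'" by simp
qed

lemma CJJ:
  assumes q: "q \<in> Qs d"
  shows "Cm H q * J q * transpose_mat (J q) = Cm H q"
proof -
  have Ct: "transpose_mat (Cm H q) \<in> carrier_mat (n q) p" using Cm_carrier[OF q] by simp
  have "transpose_mat (Cm H q * J q * transpose_mat (J q)) = J q * (transpose_mat (J q) * transpose_mat (Cm H q))"
    unfolding transpose_mult[OF mult_carrier_mat[OF Cm_carrier[OF q] Jc[OF q]] Jt[OF q]] transpose_mult[OF Cm_carrier[OF q] Jc[OF q]] by simp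
  also have "\<dots> = transpose_mat (Cm H q)" using JC[OF q] assoc_mult_mat[OF Jc[OF q] Jt[OF q] Ct] by simp
  finally show ?thesis by simp
qed

definition Hq :: "'a gjmls" where
  "Hq = \<lparr>nst = r, mdim = m, Mm = Mq, Bm = (\<lambda>q q'. transpose_mat (J q') * Bm H q q'), Cm = (\<lambda>q. Cm H q * J q),
     Dm = Dm H, xp = (\<lambda>t \<omega>. transpose_mat (J (\<theta> t \<omega>)) *\<^sub>v xp H t \<omega>), vp = v\<rparr>"

lemma Hq_simps [simp]:
  "nst Hq = r" "mdim Hq = m" "Mm Hq = Mq" "Bm Hq = (\<lambda>q q'. transpose_mat (J q') * Bm H q q')"
  "Cm Hq = (\<lambda>q. Cm H q * J q)" "Dm Hq = Dm H" "vp Hq = v"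
  "xp Hq = (\<lambda>t \<omega>. transpose_mat (J (\<theta> t \<omega>)) *\<^sub>v xp H t \<omega>)"
  by (simp_all add: Hq_def)

lemma Hq_gjmls: "is_gjmls M d \<theta> p Hq"
  unfolding is_gjmls_def
proof (intro conjI ballI allI)
  show "Mm Hq q q' \<in> carrier_mat (nst Hq q') (nst Hq q)" "Bm Hq q q' \<in> carrier_mat (nst Hq q') (mdim Hq)"
    if "q \<in> Qs d" "q' \<in> Qs d" for q q'
    using Mq_carrier[OF that] mult_carrier_mat[OF Jt[OF that(2)] Bm_carrier[OF that]] by simp_all
  show "Cm Hq q \<in> carrier_mat p (nst Hq q)" "Dm Hq q \<in> carrier_mat p (mdim Hq)" if "q \<in> Qs d" for q
    using mult_carrier_mat[OF Cm_carrier[OF that] Jc[OF that]] Dm_carrier[OF that] by simp_all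
  show "xp Hq t \<omega> \<in> carrier_vec (nst Hq (\<theta> t \<omega>))" "vp Hq t \<omega> \<in> carrier_vec (mdim Hq)" if "\<omega> \<in> space M" for t \<omega>
    using mult_mat_vec_carrier[OF Jt[OF theta_range[OF that, of t]] x_carrier[OF that]] v_carrier[OF that] by simp_all
  fix t
  show "AE \<omega> in M. xp Hq (t + 1) \<omega> = Mm Hq (\<theta> t \<omega>) (\<theta> (t + 1) \<omega>) *\<^sub>v xp Hq t \<omega> + Bm Hq (\<theta> t \<omega>) (\<theta> (t + 1) \<omega>) *\<^sub>v vp Hq t \<omega>"
    using state_eq[of t] AE_space
  proof eventually_elim
    case (elim \<omega>)
    define q where "q = \<theta> t \<omega>"
    define q' where "q' = \<theta> (t + 1) \<omega>"
    have Q: "q \<in> Qs d" "q' \<in> Qs d" using theta_range[OF elim(2)] by (auto simp: q_def q'_def)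
    have x: "xp H t \<omega> \<in> carrier_vec (n q)" and vc: "v t \<omega> \<in> carrier_vec m" using x_carrier[OF elim(2)] v_carrier[OF elim(2)] by (auto simp: q_def)
    have "transpose_mat (J q') *\<^sub>v (Mm H q q' *\<^sub>v xp H t \<omega> + Bm H q q' *\<^sub>v v t \<omega>)
      = transpose_mat (J q') *\<^sub>v (Mm H q q' *\<^sub>v xp H t \<omega>) + transpose_mat (J q') *\<^sub>v (Bm H q q' *\<^sub>v v t \<omega>)"
      by (rule mult_add_distrib_mat_vec[OF Jt[OF Q(2)] mult_mat_vec_carrier[OF Mm_carrier[OF Q] x] mult_mat_vec_carrier[OF Bm_carrier[OF Q] vc]])
    also have "transpose_mat (J q') *\<^sub>v (Mm H q q' *\<^sub>v xp H t \<omega>) = Mq q q' *\<^sub>v (transpose_mat (J q) *\<^sub>v xp H t \<omega>)"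
      using Mq_intertwines(2)[OF Q] assoc_mult_mat_vec[OF Jt[OF Q(2)] Mm_carrier[OF Q] x] assoc_mult_mat_vec[OF Mq_carrier[OF Q] Jt[OF Q(1)] x] by simp
    also have "transpose_mat (J q') *\<^sub>v (Bm H q q' *\<^sub>v v t \<omega>) = transpose_mat (J q') * Bm H q q' *\<^sub>v v t \<omega>"
      by (rule assoc_mult_mat_vec[OF Jt[OF Q(2)] Bm_carrier[OF Q] vc, symmetric])
    finally show ?case using elim(1) by (simp add: q_def q'_def)
  qed
qed

lemma Hq_realizes:
  assumes "realizes M \<theta> H y" shows "realizes M \<theta> Hq y"
  unfolding realizes_def
proof
  fix t
  have "AE \<omega> in M. y t \<omega> = Cm H (\<theta> t \<omega>) *\<^sub>v xp H t \<omega> + Dm H (\<theta> t \<omega>) *\<^sub>v vp H t \<omega>"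
    using assms unfolding realizes_def by blast
  then show "AE \<omega> in M. y t \<omega> = Cm Hq (\<theta> t \<omega>) *\<^sub>v xp Hq t \<omega> + Dm Hq (\<theta> t \<omega>) *\<^sub>v vp Hq t \<omega>"
    using AE_space
  proof eventually_elim
    case (elim \<omega>)
    have q: "\<theta> t \<omega> \<in> Qs d" by (rule theta_range[OF elim(2)])
    have "Cm H (\<theta> t \<omega>) * J (\<theta> t \<omega>) *\<^sub>v (transpose_mat (J (\<theta> t \<omega>)) *\<^sub>v xp H t \<omega>) = Cm H (\<theta> t \<omega>) *\<^sub>v xp H t \<omega>"
      using CJJ[OF q] assoc_mult_mat_vec[OF mult_carrier_mat[OF Cm_carrier[OF q] Jc[OF q]] Jt[OF q] x_carrier[OF elim(2)]] by simp
    then show ?case using elim(1) by simp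
  qed
qed

text \<open>Here \<open>J\<close> intertwines the transposed maps, so it is the adjoint form of the
  stability condition that can be restricted.\<close>

lemma Hq_contractive: "contractive {1..d} r (\<lambda>i j. P j i) (\<lambda>i j c a. Mq j i $$ (a, c))"
proof (rule contractive_restrict[where n=n and A="\<lambda>i j c a. Mm H j i $$ (a, c)" and L="\<lambda>i k a. J i $$ (a, k)" and J="\<lambda>i a k. J i $$ (a, k)"])
  show "contractive {1..d} n (\<lambda>i j. P j i) (\<lambda>i j c a. Mm H j i $$ (a, c))"
    using stable_iff_contractive(1)[of d H P] Mm_carrier G unfolding assumptionG_def Qs_def by blast
next
  fix i k l assume i: "i \<in> {1..d}" and kl: "k < r i" "l < r i"
  have i': "i \<in> Qs d" using i by (simp add: Qs_def)
  have "(\<Sum>a\<in>{0..<n i}. J i $$ (a, k) * J i $$ (a, l)) = (transpose_mat (J i) * J i) $$ (k, l)"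
    unfolding index_mult_mat_sum[OF Jt[OF i'] Jc[OF i'] kl] using Jc[OF i'] kl by (intro sum.cong refl) simp
  then show "(\<Sum>a\<in>{0..<n i}. J i $$ (a, k) * J i $$ (a, l)) = (if k = l then 1 else 0)"
    using JJ1[OF i'] kl by simp
next
  fix i j c k assume ij: "i \<in> {1..d}" "j \<in> {1..d}" and ck: "c < n j" "k < r i"
  have ij': "i \<in> Qs d" "j \<in> Qs d" using ij by (auto simp: Qs_def)
  have Mt: "transpose_mat (Mm H j i) \<in> carrier_mat (n j) (n i)" using Mm_carrier[OF ij'(2,1)] by simp
  have Mqt: "transpose_mat (Mq j i) \<in> carrier_mat (r j) (r i)" using Mq_carrier[OF ij'(2,1)] by simp
  have "(\<Sum>a\<in>{0..<n i}. Mm H j i $$ (a, c) * J i $$ (a, k)) = (transpose_mat (Mm H j i) * J i) $$ (c, k)"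
    unfolding index_mult_mat_sum[OF Mt Jc[OF ij'(1)] ck] using Mm_carrier[OF ij'(2,1)] ck by (intro sum.cong refl) simp
  also have "\<dots> = (J j * transpose_mat (Mq j i)) $$ (c, k)" by (simp only: Mq_intertwines(1)[OF ij'(2,1)])
  also have "\<dots> = (\<Sum>l\<in>{0..<r j}. J j $$ (c, l) * Mq j i $$ (k, l))"
    unfolding index_mult_mat_sum[OF Jc[OF ij'(2)] Mqt ck] using Mq_carrier[OF ij'(2,1)] ck by (intro sum.cong refl) simp
  finally show "(\<Sum>a\<in>{0..<n i}. Mm H j i $$ (a, c) * J i $$ (a, k)) = (\<Sum>l\<in>{0..<r j}. J j $$ (c, l) * Mq j i $$ (k, l))" .
qed

lemma Hq_G3:
  assumes q: "q \<in> Qs d" and i: "i < r q"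
  shows "(\<lambda>\<omega>. xp Hq t \<omega> $ i * \<eta> q t \<omega>) \<in> cl M (Gen 2 V m t)"
proof -
  have "xp Hq t \<omega> $ i * \<eta> q t \<omega> = (\<Sum>l\<in>{0..<n q}. J q $$ (l, i) * X l q t \<omega>)" for \<omega>
  proof (cases "\<omega> \<in> space M \<and> \<theta> t \<omega> = q")
    case True
    have x: "xp H t \<omega> \<in> carrier_vec (n q)" using x_carrier[of \<omega> t] True by simp
    have "xp Hq t \<omega> $ i = (\<Sum>l\<in>{0..<n q}. transpose_mat (J q) $$ (i, l) * xp H t \<omega> $ l)"
      using True by (simp add: mult_mat_sum[OF Jt[OF q] x i] del: index_mult_mat_vec)
    then show ?thesis using True Jc[OF q] i by (simp add: X_def chi_space)
  next
    case False
    then have "\<eta> q t \<omega> = 0" by (cases "\<omega> \<in> space M") (auto simp: chi_space chi_outside)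
    then show ?thesis by (simp add: X_def)
  qed
  moreover have "(\<lambda>\<omega>. \<Sum>l\<in>{0..<n q}. J q $$ (l, i) * X l q t \<omega>) \<in> cl M (Gen 2 V m t)"
    using q by (intro cl_sum[OF Gen_L2[OF V_family]] cl_scale[OF Gen_L2[OF V_family]] X_cl) auto
  ultimately show ?thesis by simp
qed

text \<open>Noise and feedthrough are unchanged, so only (G3) and (G5) have to be proved
  anew.\<close>

lemma Hq_assumptionG: "assumptionG M d \<theta> P p Hq"
proof -
  have c: "Mm Hq i j \<in> carrier_mat (nst Hq j) (nst Hq i)" if "i \<in> {1..d}" "j \<in> {1..d}" for i j
    using Mq_carrier[of i j] that by (simp add: Qs_def)
  have "contractive {1..d} (nst Hq) (\<lambda>i j. P j i) (\<lambda>i j c a. Mm Hq j i $$ (a, c))" using Hq_contractive by simp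
  then have 5: "\<forall>ev. eigenvalue (map_mat complex_of_real (stab_mat d P Hq)) ev \<longrightarrow> cmod ev < 1"
    using stable_iff_contractive(1)[of d Hq P, OF c] by blast
  have 3: "(\<lambda>\<omega>. xp Hq t \<omega> $ i * ind M \<theta> q t \<omega>) \<in> ms_closure M
          {(\<lambda>\<omega>. vp Hq (t - int k) \<omega> $ j *
                  indicator {\<omega> \<in> space M. \<forall>r \<le> k. \<theta> (t - int k + int r) \<omega> = qs ! r} \<omega>)
           | k qs j. k > 0 \<and> length qs = k + 1 \<and> set qs \<subseteq> Qs d \<and> j < mdim Hq}" if "q \<in> Qs d" "i < nst Hq q" for t q i
    unfolding delayed_generators
    using Hq_G3[of q i t] that ms_closure_eq_cl[OF Gen_L2[OF V_family], of 2 t] unfolding V_def[abs_def] by simp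
  have Q: "Qmat M \<theta> Hq q = Qmat M \<theta> H q" for q by (simp add: Qmat_def)
  have G3: "\<forall>t. \<forall>q\<in>Qs d. \<forall>i<nst Hq q. (\<lambda>\<omega>. xp Hq t \<omega> $ i * ind M \<theta> q t \<omega>) \<in> ms_closure M
          {(\<lambda>\<omega>. v (t - int k) \<omega> $ j *
                  indicator {\<omega> \<in> space M. \<forall>r \<le> k. \<theta> (t - int k + int r) \<omega> = qs ! r} \<omega>)
           | k qs j. k > 0 \<and> length qs = k + 1 \<and> set qs \<subseteq> Qs d \<and> j < m}"
  proof (intro allI ballI impI)
    fix t q i assume "q \<in> Qs d" "i < nst Hq q"
    from 3[OF this, of t] show "(\<lambda>\<omega>. xp Hq t \<omega> $ i * ind M \<theta> q t \<omega>) \<in> ms_closure M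
          {(\<lambda>\<omega>. v (t - int k) \<omega> $ j *
                  indicator {\<omega> \<in> space M. \<forall>r \<le> k. \<theta> (t - int k + int r) \<omega> = qs ! r} \<omega>)
           | k qs j. k > 0 \<and> length qs = k + 1 \<and> set qs \<subseteq> Qs d \<and> j < m}"
      by (simp only: Hq_simps(2,7))
  qed
  show ?thesis using G unfolding assumptionG_def Q Hq_simps(2,6,7)
    by (elim conjE) (intro conjI; (rule G3 5 | assumption))
qed

end

subsection \<open>Hankel matrices of the Markov parameters\<close>

text \<open>Pairing each word with a row number makes every row of the stack addressable through
  \<open>List.product\<close>. The column version is its transpose and so inherits the
  lemmas.\<close>

definition rowstack :: "nat \<Rightarrow> nat \<Rightarrow> ('b \<Rightarrow> real mat) \<Rightarrow> 'b list \<Rightarrow> real mat" where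
  "rowstack n p F ws = mat_of_rows n (map (\<lambda>(w, i). row (F w) i) (List.product ws [0..<p]))"

definition colstack :: "nat \<Rightarrow> nat \<Rightarrow> ('b \<Rightarrow> real mat) \<Rightarrow> 'b list \<Rightarrow> real mat" where
  "colstack n p F ws = transpose_mat (rowstack n p (\<lambda>w. transpose_mat (F w)) ws)"

lemma concat_map_eq_product:
  assumes "\<And>w. w \<in> set ws \<Longrightarrow> g (F w) = map (h (F w)) ks"
  shows "concat (map g (map F ws)) = map (\<lambda>(w, i). h (F w) i) (List.product ws ks)"
  using assms by (induction ws) auto

lemma rowstack_rows:
  assumes "\<And>w. w \<in> set ws \<Longrightarrow> F w \<in> carrier_mat p n"
  shows "mat_of_rows n (concat (map rows (map F ws))) = rowstack n p F ws"
  unfolding rowstack_def using assms by (subst concat_map_eq_product[where h=row and ks="[0..<p]"]) (auto simp: rows_def)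

lemma colstack_cols:
  assumes "\<And>w. w \<in> set ws \<Longrightarrow> F w \<in> carrier_mat n p"
  shows "mat_of_cols n (concat (map cols (map F ws))) = colstack n p F ws"
proof -
  have "concat (map cols (map F ws)) = concat (map rows (map (\<lambda>w. transpose_mat (F w)) ws))"
    by (simp add: o_def)
  moreover have "mat_of_rows n (concat (map rows (map (\<lambda>w. transpose_mat (F w)) ws))) = rowstack n p (\<lambda>w. transpose_mat (F w)) ws"
    by (rule rowstack_rows) (use assms in auto)
  ultimately show ?thesis unfolding colstack_def by (metis transpose_mat_of_rows)
qed

lemma rowstack_carrier: "rowstack n p F ws \<in> carrier_mat (length ws * p) n"
  unfolding rowstack_def by (simp add: carrier_matI)

lemma colstack_carrier: "colstack n p F ws \<in> carrier_mat n (length ws * p)"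
  unfolding colstack_def using rowstack_carrier by auto

lemma rowstack_row:
  assumes F: "\<And>w. w \<in> set ws \<Longrightarrow> F w \<in> carrier_mat p n" and k: "k < length ws * p"
  shows "row (rowstack n p F ws) k = row (F (fst (List.product ws [0..<p] ! k))) (snd (List.product ws [0..<p] ! k))"
    and "fst (List.product ws [0..<p] ! k) \<in> set ws" and "snd (List.product ws [0..<p] ! k) < p"
proof -
  have "List.product ws [0..<p] ! k \<in> set (List.product ws [0..<p])" by (rule nth_mem) (use k in simp)
  then have m: "List.product ws [0..<p] ! k \<in> set ws \<times> {0..<p}" by (simp only: set_product set_upt)
  then show 1: "fst (List.product ws [0..<p] ! k) \<in> set ws" and "snd (List.product ws [0..<p] ! k) < p" by auto
  show "row (rowstack n p F ws) k = row (F (fst (List.product ws [0..<p] ! k))) (snd (List.product ws [0..<p] ! k))"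
    unfolding rowstack_def using k F[OF 1] by (subst mat_of_rows_row) (auto simp: case_prod_beta row_def)
qed

text \<open>The inner dimensions \<open>n\<close> and \<open>n'\<close> are kept apart because
  systems with different state dimensions are compared.\<close>

lemma rowstack_eq_iff:
  assumes F: "\<And>w. w \<in> set ws \<Longrightarrow> F w \<in> carrier_mat p n" "\<And>w. w \<in> set ws \<Longrightarrow> F' w \<in> carrier_mat p n'"
    and B: "B \<in> carrier_mat n c" "B' \<in> carrier_mat n' c"
  shows "rowstack n p F ws * B = rowstack n' p F' ws * B' \<longleftrightarrow> (\<forall>w\<in>set ws. F w * B = F' w * B')"
proof
  assume eq: "rowstack n p F ws * B = rowstack n' p F' ws * B'"
  show "\<forall>w\<in>set ws. F w * B = F' w * B'"
  proof (intro ballI eq_matI)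
    fix w i j assume w: "w \<in> set ws" and ij: "i < dim_row (F' w * B')" "j < dim_col (F' w * B')"
    have ip: "i < p" "j < c" using ij F(2)[OF w] B by auto
    have "(w, i) \<in> set (List.product ws [0..<p])" using w ip by simp
    then obtain k where k: "k < length ws * p" "List.product ws [0..<p] ! k = (w, i)"
      unfolding in_set_conv_nth by auto
    have "(F w * B) $$ (i, j) = (rowstack n p F ws * B) $$ (k, j)"
      using rowstack_row(1)[OF F(1) k(1)] k F(1)[OF w] ip B rowstack_carrier[of n p F ws] by simp
    also have "\<dots> = (F' w * B') $$ (i, j)"
      unfolding eq using rowstack_row(1)[OF F(2) k(1)] k F(2)[OF w] ip B rowstack_carrier[of n' p F' ws] by simp
    finally show "(F w * B) $$ (i, j) = (F' w * B') $$ (i, j)" .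
  next
    fix w assume "w \<in> set ws"
    then have "dim_row (F w) = p" "dim_row (F' w) = p" using F by auto
    then show "dim_row (F w * B) = dim_row (F' w * B')" "dim_col (F w * B) = dim_col (F' w * B')" using B by auto
  qed
next
  assume eq: "\<forall>w\<in>set ws. F w * B = F' w * B'"
  show "rowstack n p F ws * B = rowstack n' p F' ws * B'"
  proof (rule eq_matI)
    fix k j assume "k < dim_row (rowstack n' p F' ws * B')" "j < dim_col (rowstack n' p F' ws * B')"
    then have kj: "k < length ws * p" "j < c" using rowstack_carrier[of n' p F' ws] B by auto
    obtain w i where wi: "List.product ws [0..<p] ! k = (w, i)" by fastforce
    have w: "w \<in> set ws" "i < p" using rowstack_row(2,3)[OF F(1) kj(1)] wi by auto
    have "(rowstack n p F ws * B) $$ (k, j) = (F w * B) $$ (i, j)"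
      using rowstack_row(1)[OF F(1) kj(1)] kj wi w F(1)[OF w(1)] B rowstack_carrier[of n p F ws] by simp
    also have "\<dots> = (rowstack n' p F' ws * B') $$ (k, j)"
      using eq w rowstack_row(1)[OF F(2) kj(1)] kj wi F(2)[OF w(1)] B rowstack_carrier[of n' p F' ws] by simp
    finally show "(rowstack n p F ws * B) $$ (k, j) = (rowstack n' p F' ws * B') $$ (k, j)" .
  qed (use rowstack_carrier[of n p F ws] rowstack_carrier[of n' p F' ws] B in auto)
qed

lemma colstack_eq_iff:
  assumes F: "\<And>w. w \<in> set ws \<Longrightarrow> F w \<in> carrier_mat n p" "\<And>w. w \<in> set ws \<Longrightarrow> F' w \<in> carrier_mat n' p"
    and B: "B \<in> carrier_mat c n" "B' \<in> carrier_mat c n'"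
  shows "B * colstack n p F ws = B' * colstack n' p F' ws \<longleftrightarrow> (\<forall>w\<in>set ws. B * F w = B' * F' w)"
proof -
  have t: "X * Y = X' * Y' \<longleftrightarrow> transpose_mat Y * transpose_mat X = transpose_mat Y' * transpose_mat X'"
    if "X \<in> carrier_mat c l" "Y \<in> carrier_mat l k" "X' \<in> carrier_mat c l'" "Y' \<in> carrier_mat l' k" for X Y X' Y' :: "real mat" and l l' k
    by (metis that transpose_mult transpose_transpose)
  have "B * colstack n p F ws = B' * colstack n' p F' ws \<longleftrightarrow>
    rowstack n p (\<lambda>w. transpose_mat (F w)) ws * transpose_mat B = rowstack n' p (\<lambda>w. transpose_mat (F' w)) ws * transpose_mat B'"
    by (subst t[OF B(1) colstack_carrier B(2) colstack_carrier]) (simp add: colstack_def)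
  also have "\<dots> \<longleftrightarrow> (\<forall>w\<in>set ws. transpose_mat (F w) * transpose_mat B = transpose_mat (F' w) * transpose_mat B')"
    by (rule rowstack_eq_iff) (use F B in auto)
  also have "\<dots> \<longleftrightarrow> (\<forall>w\<in>set ws. B * F w = B' * F' w)"
    using t[OF B(1) F(1) B(2) F(2)] by blast
  finally show ?thesis .
qed

lemma rowstack_kernel:
  assumes F: "\<And>w. w \<in> set ws \<Longrightarrow> F w \<in> carrier_mat p n" and z: "z \<in> carrier_vec n"
  shows "rowstack n p F ws *\<^sub>v z = 0\<^sub>v (length ws * p) \<longleftrightarrow> (\<forall>w\<in>set ws. F w *\<^sub>v z = 0\<^sub>v p)"
proof
  assume eq: "rowstack n p F ws *\<^sub>v z = 0\<^sub>v (length ws * p)"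
  show "\<forall>w\<in>set ws. F w *\<^sub>v z = 0\<^sub>v p"
  proof (intro ballI eq_vecI)
    fix w i assume w: "w \<in> set ws" and "i < dim_vec (0\<^sub>v p :: real vec)"
    then have i: "i < p" by simp
    have "(w, i) \<in> set (List.product ws [0..<p])" using w i by simp
    then obtain k where k: "k < length ws * p" "List.product ws [0..<p] ! k = (w, i)"
      unfolding in_set_conv_nth by auto
    have "(F w *\<^sub>v z) $ i = (rowstack n p F ws *\<^sub>v z) $ k"
      using rowstack_row(1)[OF F k(1)] k F[OF w] i rowstack_carrier[of n p F ws] by simp
    then show "(F w *\<^sub>v z) $ i = 0\<^sub>v p $ i" using eq k i by simp
  qed (use F in auto)
next
  assume eq: "\<forall>w\<in>set ws. F w *\<^sub>v z = 0\<^sub>v p"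
  show "rowstack n p F ws *\<^sub>v z = 0\<^sub>v (length ws * p)"
  proof (rule eq_vecI)
    fix k assume "k < dim_vec (0\<^sub>v (length ws * p) :: real vec)"
    then have k: "k < length ws * p" by simp
    obtain w i where wi: "List.product ws [0..<p] ! k = (w, i)" by fastforce
    have w: "w \<in> set ws" "i < p" using rowstack_row(2,3)[OF F k] wi by auto
    have "(rowstack n p F ws *\<^sub>v z) $ k = (F w *\<^sub>v z) $ i"
      using rowstack_row(1)[OF F k] k wi w F[OF w(1)] rowstack_carrier[of n p F ws] by simp
    then show "(rowstack n p F ws *\<^sub>v z) $ k = 0\<^sub>v (length ws * p) $ k" using eq w k by simp
  qed (use rowstack_carrier[of n p F ws] in simp)
qed

section \<open>Word lists and the rank conditions\<close>

definition reach_words :: "nat \<Rightarrow> nat \<Rightarrow> nat \<Rightarrow> nat list list" where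
  "reach_words d N q = [qs. k \<leftarrow> [2..<N + 2], qs \<leftarrow> state_seqs d k, last qs = q]"

text \<open>A state list of length \<open>k\<close> encodes \<open>k - 1\<close> letters, so
  \<open>[2..<N + 2]\<close> yields the words with 1 to \<open>N\<close> letters. The leading
  \<open>[q]\<close> is the empty word, whose block is \<open>C_q\<close>.\<close>

definition obs_words :: "nat \<Rightarrow> nat \<Rightarrow> nat \<Rightarrow> nat list list" where
  "obs_words d N q = [q] # [qs. k \<leftarrow> [2..<N + 2], qs \<leftarrow> state_seqs d k, hd qs = q]"

lemma set_state_seqs: "set (state_seqs d k) = {qs. length qs = k \<and> set qs \<subseteq> Qs d}"
  unfolding state_seqs_def set_n_lists Qs_def by auto

lemma set_reach_words:
  "set (reach_words d N q) = {qs. 2 \<le> length qs \<and> length qs \<le> N + 1 \<and> set qs \<subseteq> Qs d \<and> last qs = q}"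
  unfolding reach_words_def by (auto simp: set_state_seqs)

lemma set_obs_words:
  assumes "q \<in> Qs d"
  shows "set (obs_words d N q) = {qs. qs \<noteq> [] \<and> length qs \<le> N + 1 \<and> set qs \<subseteq> Qs d \<and> hd qs = q}"
proof -
  have 1: "qs = [q]" if "qs \<noteq> []" "\<not> 2 \<le> length qs" "hd qs = q" for qs
    using that by (cases qs; cases "tl qs") auto
  have 2: "set (obs_words d N q) = {[q]} \<union> {qs. 2 \<le> length qs \<and> length qs \<le> N + 1 \<and> set qs \<subseteq> Qs d \<and> hd qs = q}"
    unfolding obs_words_def by (auto simp: set_state_seqs)
  show ?thesis
  proof (intro equalityI subsetI)
    fix qs assume "qs \<in> set (obs_words d N q)"
    then show "qs \<in> {qs. qs \<noteq> [] \<and> length qs \<le> N + 1 \<and> set qs \<subseteq> Qs d \<and> hd qs = q}"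
      unfolding 2 using assms by auto
  next
    fix qs assume "qs \<in> {qs. qs \<noteq> [] \<and> length qs \<le> N + 1 \<and> set qs \<subseteq> Qs d \<and> hd qs = q}"
    then show "qs \<in> set (obs_words d N q)" unfolding 2 using 1[of qs] by blast
  qed
qed

definition Rw where "Rw M \<theta> P H us = Mpath H (tl us) * Gmat M \<theta> P H (us ! 0) (us ! 1)"

definition Ow where "Ow H us = Cm H (last us) * Mpath H us"

lemma map_filter_comp:
  "[F x. k \<leftarrow> ks, x \<leftarrow> S k, Q x] = map F [x. k \<leftarrow> ks, x \<leftarrow> S k, Q x]"
  by (simp add: map_concat o_def if_distrib cong: if_cong)

context gsys begin

lemma Rw_carrier: "set us \<subseteq> Qs d \<Longrightarrow> 2 \<le> length us \<Longrightarrow> Rw M \<theta> P H us \<in> carrier_mat (n (last us)) p"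
  unfolding Rw_def by (rule word_mat_carrier(2))

lemma Mpath_carrier: "set us \<subseteq> Qs d \<Longrightarrow> us \<noteq> [] \<Longrightarrow> Mpath H us \<in> carrier_mat (n (last us)) (n (hd us))"
proof -
  assume a: "set us \<subseteq> Qs d" "us \<noteq> []"
  then have h: "hd us \<in> Qs d" using hd_in_set by blast
  show ?thesis
  proof (rule Mpath_snoc(2)[OF a(2), where q="hd us"])
    fix b c assume "b \<in> set (us @ [hd us])" "c \<in> set (us @ [hd us])"
    then show "Mm H b c \<in> carrier_mat (n c) (n b)" using a h by (intro Mm_carrier) auto
  qed
qed

lemma Ow_carrier: "set us \<subseteq> Qs d \<Longrightarrow> us \<noteq> [] \<Longrightarrow> Ow H us \<in> carrier_mat p (n (hd us))"
  unfolding Ow_def by (rule mult_carrier_mat[OF Cm_carrier Mpath_carrier]) auto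

text \<open>Words are lists of states, so concatenation identifies the last state of one with the
  first state of the other; \<open>tl\<close> drops the duplicate.\<close>

lemma Mpath_append:
  assumes "set us \<subseteq> Qs d" "set ws \<subseteq> Qs d" "us \<noteq> []" "ws \<noteq> []" "last us = hd ws"
  shows "Mpath H (us @ tl ws) = Mpath H ws * Mpath H us"
  using assms
proof (induction us rule: induct_list012)
  case (2 a)
  have "ws = a # tl ws" using 2(4,5) by (cases ws) auto
  then have "Mpath H ([a] @ tl ws) = Mpath H ws" by simp
  also have "\<dots> = Mpath H ws * 1\<^sub>m (n a)" using Mpath_carrier[OF 2(2,4)] 2(5) by simp
  finally show ?case by simp
next
  case (3 a b us)
  have c: "Mpath H ws \<in> carrier_mat (n (last ws)) (n (last (b # us)))" "Mpath H (b # us) \<in> carrier_mat (n (last (b # us))) (n b)"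
    "Mm H a b \<in> carrier_mat (n b) (n a)"
    using Mpath_carrier[of ws] Mpath_carrier[of "b # us"] Mm_carrier[of a b] 3(3-7) by auto
  have "Mpath H (b # us @ tl ws) = Mpath H ws * Mpath H (b # us)" using 3 by simp
  then show ?case using assoc_mult_mat[OF c] by simp
qed simp

lemma Rw_append:
  assumes "set us \<subseteq> Qs d" "set ws \<subseteq> Qs d" "2 \<le> length us" "ws \<noteq> []" "last us = hd ws"
  shows "Rw M \<theta> P H (us @ tl ws) = Mpath H ws * Rw M \<theta> P H us"
proof -
  obtain a b r where us: "us = a # b # r" using assms(3) by (metis Suc_le_length_iff numeral_2_eq_2)
  have c: "Mpath H ws \<in> carrier_mat (n (last ws)) (n (last us))" "Mpath H (b # r) \<in> carrier_mat (n (last us)) (n b)"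
    "Gmat M \<theta> P H a b \<in> carrier_mat (n b) p"
    using Mpath_carrier[of ws] Mpath_carrier[of "b # r"] Gmat_carrier[of a b] assms us by auto
  have "Mpath H ((b # r) @ tl ws) = Mpath H ws * Mpath H (b # r)"
    by (rule Mpath_append) (use assms us in auto)
  then show ?thesis using assoc_mult_mat[OF c] by (simp add: Rw_def us)
qed

lemma Rw_snoc:
  assumes "set us \<subseteq> Qs d" "2 \<le> length us" "q \<in> Qs d"
  shows "Rw M \<theta> P H (us @ [q]) = Mm H (last us) q * Rw M \<theta> P H us"
proof -
  have "us \<noteq> []" using assms by auto
  then have l: "last us \<in> Qs d" using assms(1) last_in_set by blast
  then have "Mpath H [last us, q] = Mm H (last us) q" using left_mult_one_mat[OF Mm_carrier[OF l assms(3)]] by simp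
  then show ?thesis using Rw_append[of us "[last us, q]"] assms l by simp
qed

lemma Rw_letter: "q \<in> Qs d \<Longrightarrow> q' \<in> Qs d \<Longrightarrow> Rw M \<theta> P H [q, q'] = Gmat M \<theta> P H q q'"
  using left_mult_one_mat[OF Gmat_carrier] by (simp add: Rw_def)

lemma Ow_single: "q \<in> Qs d \<Longrightarrow> Ow H [q] = Cm H q"
  using right_mult_one_mat[OF Cm_carrier] by (simp add: Ow_def)

lemma Ow_Cons:
  assumes "q \<in> Qs d" "set ws \<subseteq> Qs d" "ws \<noteq> []"
  shows "Ow H (q # ws) = Ow H ws * Mm H q (hd ws)"
proof -
  have l: "last ws \<in> Qs d" "hd ws \<in> Qs d" using assms(2,3) by auto
  show ?thesis using assoc_mult_mat[OF Cm_carrier[OF l(1)] Mpath_carrier[OF assms(2,3)] Mm_carrier[OF assms(1) l(2)]] assms(3)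
    by (cases ws) (simp_all add: Ow_def)
qed

text \<open>The Hankel factorisation: the product of an observability block with a reachability
  block is the Markov parameter of the concatenated word.\<close>

lemma Ow_Rw:
  assumes "set us \<subseteq> Qs d" "set ws \<subseteq> Qs d" "2 \<le> length us" "ws \<noteq> []" "last us = hd ws"
  shows "Ow H ws * Rw M \<theta> P H us = Cm H (last ws) * Rw M \<theta> P H (us @ tl ws)"
proof -
  have l: "last ws \<in> Qs d" using assms(2,4) by auto
  show ?thesis unfolding Rw_append[OF assms] Ow_def
    by (rule assoc_mult_mat[OF Cm_carrier[OF l] Mpath_carrier[OF assms(2,4)]]) (use Rw_carrier[OF assms(1,3)] assms(5) in simp)
qed

lemma reachable_iff:
  "reachable M d \<theta> P H \<longleftrightarrow> (\<forall>q\<in>Qs d. \<forall>z\<in>carrier_vec (n q).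
     (\<forall>us\<in>set (reach_words d (dimH d H) q). transpose_mat (Rw M \<theta> P H us) *\<^sub>v z = 0\<^sub>v p) \<longrightarrow> z = 0\<^sub>v (n q))"
  unfolding reachable_def
proof (rule ball_cong[OF refl])
  fix q assume q: "q \<in> Qs d"
  let ?W = "reach_words d (dimH d H) q"
  have c: "Rw M \<theta> P H us \<in> carrier_mat (n q) p" if "us \<in> set ?W" for us
    using that Rw_carrier[of us] by (auto simp: set_reach_words)
  have ct: "transpose_mat (Rw M \<theta> P H us) \<in> carrier_mat p (n q)" if "us \<in> set ?W" for us
    using c[OF that] by simp
  have "reach_mat M d \<theta> P H q = colstack (n q) p (Rw M \<theta> P H) ?W"
    unfolding reach_mat_def Rw_def[symmetric] map_filter_comp[where F="Rw M \<theta> P H"] reach_words_def[symmetric]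
    by (rule colstack_cols) (rule c)
  moreover have "transpose_mat (colstack (n q) p (Rw M \<theta> P H) ?W) = rowstack (n q) p (\<lambda>us. transpose_mat (Rw M \<theta> P H us)) ?W"
    unfolding colstack_def by simp
  moreover have "rowstack (n q) p (\<lambda>us. transpose_mat (Rw M \<theta> P H us)) ?W *\<^sub>v z = 0\<^sub>v (length ?W * p) \<longleftrightarrow>
      (\<forall>us\<in>set ?W. transpose_mat (Rw M \<theta> P H us) *\<^sub>v z = 0\<^sub>v p)" if "z \<in> carrier_vec (n q)" for z
    by (rule rowstack_kernel[OF ct that])
  ultimately show "vec_space.rank (n q) (reach_mat M d \<theta> P H q) = n q \<longleftrightarrow> (\<forall>z\<in>carrier_vec (n q).
     (\<forall>us\<in>set ?W. transpose_mat (Rw M \<theta> P H us) *\<^sub>v z = 0\<^sub>v p) \<longrightarrow> z = 0\<^sub>v (n q))"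
    using rank_eq_nrows_iff[OF colstack_carrier, of "n q" p "Rw M \<theta> P H" ?W] by simp
qed

lemma observable_iff:
  "observable d H \<longleftrightarrow> (\<forall>q\<in>Qs d. \<forall>z\<in>carrier_vec (n q).
     (\<forall>ws\<in>set (obs_words d (dimH d H) q). Ow H ws *\<^sub>v z = 0\<^sub>v p) \<longrightarrow> z = 0\<^sub>v (n q))"
  unfolding observable_def
proof (rule ball_cong[OF refl])
  fix q assume q: "q \<in> Qs d"
  let ?W = "obs_words d (dimH d H) q"
  have c: "Ow H us \<in> carrier_mat p (n q)" if "us \<in> set ?W" for us
    using that Ow_carrier[of us] by (auto simp: set_obs_words[OF q])
  have "obs_mat d H q = mat_of_rows (n q) (concat (map rows (map (Ow H) ?W)))"
    unfolding obs_mat_def Ow_def[symmetric] map_filter_comp[where F="Ow H"] obs_words_def list.map(2) Ow_single[OF q] ..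
  also have "\<dots> = rowstack (n q) p (Ow H) ?W" by (rule rowstack_rows) (rule c)
  finally have e: "obs_mat d H q = rowstack (n q) p (Ow H) ?W" .
  have "rowstack (n q) p (Ow H) ?W *\<^sub>v z = 0\<^sub>v (length ?W * p) \<longleftrightarrow> (\<forall>ws\<in>set ?W. Ow H ws *\<^sub>v z = 0\<^sub>v p)"
    if "z \<in> carrier_vec (n q)" for z
    by (rule rowstack_kernel[OF c that])
  then show "vec_space.rank (dim_row (obs_mat d H q)) (obs_mat d H q) = n q \<longleftrightarrow> (\<forall>z\<in>carrier_vec (n q).
     (\<forall>ws\<in>set ?W. Ow H ws *\<^sub>v z = 0\<^sub>v p) \<longrightarrow> z = 0\<^sub>v (n q))"
    using rank_eq_ncols_iff[OF rowstack_carrier[of "n q" p "Ow H" ?W]]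
    unfolding e carrier_matD(1)[OF rowstack_carrier] by simp
qed

section \<open>Minimal systems are reachable and observable\<close>

lemma unreachable_in_unobs:
  assumes "q \<in> Qs d" "z \<in> carrier_vec (n q)"
    and "\<And>us. set us \<subseteq> Qs d \<Longrightarrow> 2 \<le> length us \<Longrightarrow> length us \<le> k + 1 \<Longrightarrow> last us = q \<Longrightarrow> transpose_mat (Rw M \<theta> P H us) *\<^sub>v z = 0\<^sub>v p"
  shows "z \<in> unobs (Qs d) n (\<lambda>q' q. transpose_mat (Mm H q' q)) (\<lambda>q. {transpose_mat (Gmat M \<theta> P H q' q) | q'. q' \<in> Qs d}) k q"
  using assms
proof (induction k arbitrary: q z)
  case (Suc k)
  have "transpose_mat (Gmat M \<theta> P H q' q) *\<^sub>v z = 0\<^sub>v p" if "q' \<in> Qs d" for q'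
    using Suc.prems(3)[of "[q', q]"] Rw_letter[OF that Suc.prems(1)] that Suc.prems(1) by simp
  moreover have "dim_col (Gmat M \<theta> P H q' q) = p" if "q' \<in> Qs d" for q'
    using Gmat_carrier[OF that Suc.prems(1)] by simp
  moreover have "transpose_mat (Mm H q' q) *\<^sub>v z
      \<in> unobs (Qs d) n (\<lambda>q' q. transpose_mat (Mm H q' q)) (\<lambda>q. {transpose_mat (Gmat M \<theta> P H q' q) | q'. q' \<in> Qs d}) k q'"
    if q': "q' \<in> Qs d" for q'
  proof (rule Suc.IH[OF q'])
    have Mt: "transpose_mat (Mm H q' q) \<in> carrier_mat (n q') (n q)" using Mm_carrier[OF q' Suc.prems(1)] by simp
    show "transpose_mat (Mm H q' q) *\<^sub>v z \<in> carrier_vec (n q')" by (rule mult_mat_vec_carrier[OF Mt Suc.prems(2)])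
    fix us assume us: "set us \<subseteq> Qs d" "2 \<le> length us" "length us \<le> k + 1" "last us = q'"
    have Rc: "Rw M \<theta> P H us \<in> carrier_mat (n q') p" using Rw_carrier[OF us(1,2)] us(4) by simp
    have "transpose_mat (Rw M \<theta> P H us) *\<^sub>v (transpose_mat (Mm H q' q) *\<^sub>v z) = transpose_mat (Mm H q' q * Rw M \<theta> P H us) *\<^sub>v z"
      unfolding transpose_mult[OF Mm_carrier[OF q' Suc.prems(1)] Rc]
      by (rule assoc_mult_mat_vec[OF _ Mt Suc.prems(2), symmetric, of _ p]) (use Rc in simp)
    also have "\<dots> = transpose_mat (Rw M \<theta> P H (us @ [q])) *\<^sub>v z" using Rw_snoc[OF us(1,2) Suc.prems(1)] us(4) by simp
    also have "\<dots> = 0\<^sub>v p" by (rule Suc.prems(3)) (use us Suc.prems(1) in auto)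
    finally show "transpose_mat (Rw M \<theta> P H us) *\<^sub>v (transpose_mat (Mm H q' q) *\<^sub>v z) = 0\<^sub>v p" .
  qed
  ultimately show ?case using Suc.prems(2) by auto
qed simp

text \<open>Level \<open>k\<close> of \<open>unobs\<close> tests the outputs after fewer than
  \<open>k\<close> letters, that is on state lists of length at most \<open>k\<close>. For
  reachability each block has one letter built in through \<open>G\<close>, hence the lists up to
  length \<open>k + 1\<close> there.\<close>

lemma unobservable_in_unobs:
  assumes "q \<in> Qs d" "z \<in> carrier_vec (n q)"
    and "\<And>ws. set ws \<subseteq> Qs d \<Longrightarrow> ws \<noteq> [] \<Longrightarrow> length ws \<le> k \<Longrightarrow> hd ws = q \<Longrightarrow> Ow H ws *\<^sub>v z = 0\<^sub>v p"
  shows "z \<in> unobs (Qs d) n (\<lambda>q' q. Mm H q q') (\<lambda>q. {Cm H q}) k q"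
  using assms
proof (induction k arbitrary: q z)
  case (Suc k)
  have "Cm H q *\<^sub>v z = 0\<^sub>v (dim_row (Cm H q))"
    using Suc.prems(3)[of "[q]"] Ow_single[OF Suc.prems(1)] Suc.prems(1) Cm_carrier[OF Suc.prems(1)] by simp
  moreover have "Mm H q q' *\<^sub>v z \<in> unobs (Qs d) n (\<lambda>q' q. Mm H q q') (\<lambda>q. {Cm H q}) k q'" if q': "q' \<in> Qs d" for q'
  proof (rule Suc.IH[OF q'])
    have Mc: "Mm H q q' \<in> carrier_mat (n q') (n q)" by (rule Mm_carrier[OF Suc.prems(1) q'])
    show "Mm H q q' *\<^sub>v z \<in> carrier_vec (n q')" by (rule mult_mat_vec_carrier[OF Mc Suc.prems(2)])
    fix ws assume ws: "set ws \<subseteq> Qs d" "ws \<noteq> []" "length ws \<le> k" "hd ws = q'"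
    have Oc: "Ow H ws \<in> carrier_mat p (n q')" using Ow_carrier[OF ws(1,2)] ws(4) by simp
    have "Ow H ws *\<^sub>v (Mm H q q' *\<^sub>v z) = Ow H (q # ws) *\<^sub>v z"
      using Ow_Cons[OF Suc.prems(1) ws(1,2)] assoc_mult_mat_vec[OF Oc Mc Suc.prems(2)] ws(4) by simp
    also have "\<dots> = 0\<^sub>v p" by (rule Suc.prems(3)) (use ws Suc.prems(1) in auto)
    finally show "Ow H ws *\<^sub>v (Mm H q q' *\<^sub>v z) = 0\<^sub>v p" .
  qed
  ultimately show ?case using Suc.prems(2) by simp
qed simp

text \<open>The innovation representation on the reachable subspaces cannot be smaller than a
  minimal system. Since no mode grows under the reduction, every dimension is kept, and the
  unreachable directions vanish.\<close>

lemma minimal_imp_reachable: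
  assumes min: "minimal_realization M d \<theta> P p y H"
  shows "reachable M d \<theta> P H"
proof -
  have 1: "transpose_mat (Mm H q' q) \<in> carrier_mat (n q') (n q)" if "q \<in> Qs d" "q' \<in> Qs d" for q q'
    using Mm_carrier[OF that(2,1)] by simp
  have 2: "dim_col C = n q" if "q \<in> Qs d" "C \<in> {transpose_mat (Gmat M \<theta> P H q' q) | q'. q' \<in> Qs d}" for q C
    using that carrier_matD(1)[OF Gmat_carrier] by auto
  obtain r J where Jr: "\<And>q. q \<in> Qs d \<Longrightarrow> J q \<in> carrier_mat (n q) (r q)"
    "\<And>q. q \<in> Qs d \<Longrightarrow> transpose_mat (J q) * J q = 1\<^sub>m (r q)"
    "\<And>q C. q \<in> Qs d \<Longrightarrow> C \<in> {transpose_mat (Gmat M \<theta> P H q' q) | q'. q' \<in> Qs d} \<Longrightarrow>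
       J q * transpose_mat (J q) * transpose_mat C = transpose_mat C"
    "\<And>q q'. q \<in> Qs d \<Longrightarrow> q' \<in> Qs d \<Longrightarrow> J q * transpose_mat (J q) *
       (transpose_mat (transpose_mat (Mm H q' q)) * J q') = transpose_mat (transpose_mat (Mm H q' q)) * J q'"
    "\<And>q. q \<in> Qs d \<Longrightarrow> r q \<le> n q"
    "\<And>q. q \<in> Qs d \<Longrightarrow> r q = n q \<Longrightarrow> unobs (Qs d) n (\<lambda>q' q. transpose_mat (Mm H q' q))
        (\<lambda>q. {transpose_mat (Gmat M \<theta> P H q' q) | q'. q' \<in> Qs d}) (\<Sum>q\<in>Qs d. n q) q \<subseteq> {0\<^sub>v (n q)}"
    apply (rule observable_reduction[of "Qs d" "\<lambda>q' q. transpose_mat (Mm H q' q)" n "\<lambda>q. {transpose_mat (Gmat M \<theta> P H q' q) | q'. q' \<in> Qs d}", OF 1 2 finite_Qs])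
     apply assumption+
    subgoal premises prems for r J by (rule that[of J r]) (fact prems)+
    done
  interpret red: reduction M d \<theta> P p H J r
  proof unfold_locales
    fix q q' assume q: "q \<in> Qs d" "q' \<in> Qs d"
    show "J q' * transpose_mat (J q') * Gmat M \<theta> P H q q' = Gmat M \<theta> P H q q'"
      using Jr(3)[OF q(2), of "transpose_mat (Gmat M \<theta> P H q q')"] q by auto
    show "J q' * transpose_mat (J q') * (Mm H q q' * J q) = Mm H q q' * J q"
      using Jr(4)[OF q(2,1)] by simp
  qed (use Jr(1,2) in auto)
  have "dimH d H \<le> dimH d red.Hr"
    using min red.Hr_gjmls red.Hr_realizes red.Hr_assumptionG unfolding minimal_realization_def by blast
  then have "(\<Sum>q\<in>Qs d. n q) \<le> (\<Sum>q\<in>Qs d. r q)" by (simp add: dimH_def)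
  \<comment> \<open>Each \<open>r q\<close> is at most \<open>n q\<close>, so the inequality between
    the sums forces equality in every mode.\<close>
  then have req: "r q = n q" if "q \<in> Qs d" for q
    using sum_mono_inv[of r "Qs d" n q] sum_mono[of "Qs d" r n] Jr(5) that finite_Qs by force
  show ?thesis unfolding reachable_iff
  proof (intro ballI impI)
    fix q z assume q: "q \<in> Qs d" "z \<in> carrier_vec (n q)"
      and z: "\<forall>us\<in>set (reach_words d (dimH d H) q). transpose_mat (Rw M \<theta> P H us) *\<^sub>v z = 0\<^sub>v p"
    have "z \<in> unobs (Qs d) n (\<lambda>q' q. transpose_mat (Mm H q' q))
        (\<lambda>q. {transpose_mat (Gmat M \<theta> P H q' q) | q'. q' \<in> Qs d}) (dimH d H) q"
      by (rule unreachable_in_unobs[OF q]) (use z in \<open>simp add: set_reach_words\<close>)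
    then show "z = 0\<^sub>v (n q)" using Jr(6)[OF q(1) req[OF q(1)]] unfolding dimH_def by blast
  qed
qed

text \<open>The same dimension count, now against the quotient by the unobservable
  subspaces.\<close>

lemma minimal_imp_observable:
  assumes min: "minimal_realization M d \<theta> P p y H"
  shows "observable d H"
proof -
  have 1: "Mm H q q' \<in> carrier_mat (n q') (n q)" if "q \<in> Qs d" "q' \<in> Qs d" for q q'
    using Mm_carrier[OF that] .
  have 2: "dim_col C = n q" if "q \<in> Qs d" "C \<in> {Cm H q}" for q C
    using that carrier_matD(2)[OF Cm_carrier] by auto
  obtain r J where Jr: "\<And>q. q \<in> Qs d \<Longrightarrow> J q \<in> carrier_mat (n q) (r q)"
    "\<And>q. q \<in> Qs d \<Longrightarrow> transpose_mat (J q) * J q = 1\<^sub>m (r q)"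
    "\<And>q C. q \<in> Qs d \<Longrightarrow> C \<in> {Cm H q} \<Longrightarrow> J q * transpose_mat (J q) * transpose_mat C = transpose_mat C"
    "\<And>q q'. q \<in> Qs d \<Longrightarrow> q' \<in> Qs d \<Longrightarrow> J q * transpose_mat (J q) * (transpose_mat (Mm H q q') * J q') = transpose_mat (Mm H q q') * J q'"
    "\<And>q. q \<in> Qs d \<Longrightarrow> r q \<le> n q"
    "\<And>q. q \<in> Qs d \<Longrightarrow> r q = n q \<Longrightarrow> unobs (Qs d) n (\<lambda>q' q. Mm H q q') (\<lambda>q. {Cm H q}) (\<Sum>q\<in>Qs d. n q) q \<subseteq> {0\<^sub>v (n q)}"
    apply (rule observable_reduction[of "Qs d" "\<lambda>q' q. Mm H q q'" n "\<lambda>q. {Cm H q}", OF 1 2 finite_Qs])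
     apply assumption+
    subgoal premises prems for r J by (rule that[of J r]) (fact prems)+
    done
  interpret red: quotient M d \<theta> P p H J r
    by unfold_locales (use Jr(1-4) in auto)
  have "dimH d H \<le> dimH d red.Hq"
    using min red.Hq_gjmls red.Hq_realizes red.Hq_assumptionG unfolding minimal_realization_def by blast
  then have "(\<Sum>q\<in>Qs d. n q) \<le> (\<Sum>q\<in>Qs d. r q)" by (simp add: dimH_def)
  then have req: "r q = n q" if "q \<in> Qs d" for q
    using sum_mono_inv[of r "Qs d" n q] sum_mono[of "Qs d" r n] Jr(5) that finite_Qs by force
  show ?thesis unfolding observable_iff
  proof (intro ballI impI)
    fix q z assume q: "q \<in> Qs d" "z \<in> carrier_vec (n q)"
      and z: "\<forall>ws\<in>set (obs_words d (dimH d H) q). Ow H ws *\<^sub>v z = 0\<^sub>v p"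
    have "z \<in> unobs (Qs d) n (\<lambda>q' q. Mm H q q') (\<lambda>q. {Cm H q}) (dimH d H) q"
      by (rule unobservable_in_unobs[OF q]) (use z in \<open>simp add: set_obs_words[OF q(1)]\<close>)
    then show "z = 0\<^sub>v (n q)" using Jr(6)[OF q(1) req[OF q(1)]] unfolding dimH_def by blast
  qed
qed

end

lemma left_inverse_cancel:
  fixes A B :: "real mat"
  assumes "L * X = 1\<^sub>m n" "L \<in> carrier_mat n k" "X \<in> carrier_mat k n" "A \<in> carrier_mat n c" "B \<in> carrier_mat n c" "X * A = X * B"
  shows "A = B"
  using assoc_mult_mat[OF assms(2,3,4)] assoc_mult_mat[OF assms(2,3,5)] assms(1,6)
    left_mult_one_mat[OF assms(4)] left_mult_one_mat[OF assms(5)] by metis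

lemma right_inverse_cancel:
  fixes A B :: "real mat"
  assumes "X * R = 1\<^sub>m n" "R \<in> carrier_mat k n" "X \<in> carrier_mat n k" "A \<in> carrier_mat c n" "B \<in> carrier_mat c n" "A * X = B * X"
  shows "A = B"
  using assoc_mult_mat[OF assms(4,3,2)] assoc_mult_mat[OF assms(5,3,2)] assms(1,6)
    right_mult_one_mat[OF assms(4)] right_mult_one_mat[OF assms(5)] by metis

section \<open>Two realizations of the same output\<close>

locale realization_pair = A: gsys M d \<theta> P p H + B: gsys M d \<theta> P p H'
  for M :: "'w measure" and d :: nat and \<theta> :: "int \<Rightarrow> 'w \<Rightarrow> nat" and P :: "nat \<Rightarrow> nat \<Rightarrow> real"
    and p :: nat and H H' :: "'w gjmls" +
  fixes y :: "int \<Rightarrow> 'w \<Rightarrow> real vec"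
  assumes yA: "realizes M \<theta> H y" and yB: "realizes M \<theta> H' y"
begin

lemma Y_agree:
  assumes "i < p" "q \<in> Qs d"
  shows "AE \<omega> in M. A.Y i q t \<omega> = B.Y i q t \<omega>"
proof -
  have "AE \<omega> in M. y t \<omega> = Cm H (\<theta> t \<omega>) *\<^sub>v xp H t \<omega> + Dm H (\<theta> t \<omega>) *\<^sub>v vp H t \<omega>"
    "AE \<omega> in M. y t \<omega> = Cm H' (\<theta> t \<omega>) *\<^sub>v xp H' t \<omega> + Dm H' (\<theta> t \<omega>) *\<^sub>v vp H' t \<omega>"
    using yA yB unfolding realizes_def by auto
  then show ?thesis using AE_space
    by eventually_elim (simp only: A.Y_output[OF _ assms] B.Y_output[OF _ assms])
qed

text \<open>The output covariances are common to both systems. Their path weights depend only on the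
  chain and are positive, so they cancel.\<close>

lemma markov_parameters_agree:
  assumes us: "set us \<subseteq> Qs d" "2 \<le> length us"
  shows "Cm H (last us) * Rw M \<theta> P H us = Cm H' (last us) * Rw M \<theta> P H' us"
proof -
  obtain q w where rus: "rev us = q # w" using us(2) by (cases "rev us") auto
  then have qw: "set (q # w) \<subseteq> Qs d" "w \<noteq> []" "us = rev (q # w)" "last us = q"
    using us rev_rev_ident[of us] set_rev[of us] length_rev[of us] by auto
  have l: "last us \<in> Qs d" using qw by simp
  show ?thesis
  proof (rule eq_matI)
    fix i j assume "i < dim_row (Cm H' (last us) * Rw M \<theta> P H' us)" "j < dim_col (Cm H' (last us) * Rw M \<theta> P H' us)"
    then have ij: "i < p" "j < p" using B.Cm_carrier[OF l] B.Rw_carrier[OF us] by auto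
    have "ip M (A.Y i q 0) (A.Zg (A.Y j) (q # w) 0) = ip M (B.Y i q 0) (A.Zg (B.Y j) (q # w) 0)"
    proof (rule ip_cong_AE)
      show "AE \<omega> in M. A.Y i q 0 \<omega> = B.Y i q 0 \<omega>" using Y_agree ij qw(1) by simp
      show "AE \<omega> in M. A.Zg (A.Y j) (q # w) 0 \<omega> = A.Zg (B.Y j) (q # w) 0 \<omega>"
        by (rule A.Zg_cong_AE) (use Y_agree ij qw(1) in auto)
    qed (use A.Y_L2 B.Y_L2 A.Zg_L2[OF A.Y_family] A.Zg_L2[OF B.Y_family] ij qw(1) in auto)
    then show "(Cm H (last us) * Rw M \<theta> P H us) $$ (i, j) = (Cm H' (last us) * Rw M \<theta> P H' us) $$ (i, j)"
      unfolding A.Y_Y_cross[OF qw(1,2) ij] B.Y_Y_cross[OF qw(1,2) ij] qw(4) Rw_def qw(3)[symmetric]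
      using A.path_weight_pos[OF qw(1)] by simp
  qed (use A.Cm_carrier[OF l] B.Cm_carrier[OF l] A.Rw_carrier[OF us] B.Rw_carrier[OF us] in auto)
qed

lemma hankel_blocks_agree:
  assumes "set us \<subseteq> Qs d" "set ws \<subseteq> Qs d" "2 \<le> length us" "ws \<noteq> []" "last us = hd ws"
  shows "Ow H ws * Rw M \<theta> P H us = Ow H' ws * Rw M \<theta> P H' us"
proof -
  have "last (us @ tl ws) = last ws" using assms(4,5) by (cases ws) auto
  moreover have "set (us @ tl ws) \<subseteq> Qs d" using assms(1,2,4) by (cases ws) auto
  ultimately show ?thesis
    using markov_parameters_agree[of "us @ tl ws"] assms(3) unfolding A.Ow_Rw[OF assms] B.Ow_Rw[OF assms] by simp
qed

abbreviation "Rb N q \<equiv> colstack (nst H q) p (Rw M \<theta> P H) (reach_words d N q)"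
abbreviation "Rb' N q \<equiv> colstack (nst H' q) p (Rw M \<theta> P H') (reach_words d N q)"
abbreviation "Ob N q \<equiv> rowstack (nst H q) p (Ow H) (obs_words d N q)"
abbreviation "Ob' N q \<equiv> rowstack (nst H' q) p (Ow H') (obs_words d N q)"

lemma reach_word_carrier:
  assumes "us \<in> set (reach_words d N q)"
  shows "Rw M \<theta> P H us \<in> carrier_mat (nst H q) p" "Rw M \<theta> P H' us \<in> carrier_mat (nst H' q) p"
  using assms A.Rw_carrier[of us] B.Rw_carrier[of us] by (auto simp: set_reach_words)

lemma obs_word_carrier:
  assumes "ws \<in> set (obs_words d N q)" "q \<in> Qs d"
  shows "Ow H ws \<in> carrier_mat p (nst H q)" "Ow H' ws \<in> carrier_mat p (nst H' q)"
  using assms A.Ow_carrier[of ws] B.Ow_carrier[of ws] by (auto simp: set_obs_words)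

text \<open>\<open>N\<close> and \<open>N'\<close> are free, so that both systems can be tested with
  the same word lists whatever their dimensions are.\<close>

lemma hankel_agree:
  assumes q: "q \<in> Qs d"
  shows "Ob N q * Rb N' q = Ob' N q * Rb' N' q"
proof (subst rowstack_eq_iff[OF obs_word_carrier(1)[OF _ q] obs_word_carrier(2)[OF _ q] colstack_carrier colstack_carrier]; (assumption | intro ballI)?)
  fix w assume w: "w \<in> set (obs_words d N q)"
  show "Ow H w * Rb N' q = Ow H' w * Rb' N' q"
    by (subst colstack_eq_iff[OF reach_word_carrier obs_word_carrier[OF w q]])
      (use w q in \<open>auto simp: set_reach_words set_obs_words intro!: hankel_blocks_agree\<close>)
qed

text \<open>The additional letter between the two words exposes the state map itself, which the
  isomorphism has to intertwine.\<close>

lemma shifted_hankel_agree: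
  assumes q: "q1 \<in> Qs d" "q2 \<in> Qs d"
  shows "Ob N q2 * (Mm H q1 q2 * Rb N' q1) = Ob' N q2 * (Mm H' q1 q2 * Rb' N' q1)"
proof (subst rowstack_eq_iff[OF obs_word_carrier(1)[OF _ q(2)] obs_word_carrier(2)[OF _ q(2)]
    mult_carrier_mat[OF A.Mm_carrier[OF q] colstack_carrier] mult_carrier_mat[OF B.Mm_carrier[OF q] colstack_carrier]]; (assumption | intro ballI)?)
  fix w assume w: "w \<in> set (obs_words d N q2)"
  have wc: "set w \<subseteq> Qs d" "w \<noteq> []" "hd w = q2" using w q by (auto simp: set_obs_words)
  have c: "Ow H w * Mm H q1 q2 \<in> carrier_mat p (nst H q1)" "Ow H' w * Mm H' q1 q2 \<in> carrier_mat p (nst H' q1)"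
    using A.Mm_carrier[OF q] B.Mm_carrier[OF q] obs_word_carrier[OF w q(2)] by auto
  have "Ow H w * Mm H q1 q2 * Rb N' q1 = Ow H' w * Mm H' q1 q2 * Rb' N' q1"
  proof (subst colstack_eq_iff[OF reach_word_carrier c]; (assumption | intro ballI)?)
    fix us assume us: "us \<in> set (reach_words d N' q1)"
    have u: "set us \<subseteq> Qs d" "2 \<le> length us" "last us = q1" using us by (auto simp: set_reach_words)
    have "Ow H w * Mm H q1 q2 = Ow H (q1 # w)" "Ow H' w * Mm H' q1 q2 = Ow H' (q1 # w)"
      using A.Ow_Cons[OF q(1) wc(1,2)] B.Ow_Cons[OF q(1) wc(1,2)] wc(3) by simp_all
    then show "Ow H w * Mm H q1 q2 * Rw M \<theta> P H us = Ow H' w * Mm H' q1 q2 * Rw M \<theta> P H' us"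
      using hankel_blocks_agree[of us "q1 # w"] u wc q by simp
  qed
  then show "Ow H w * (Mm H q1 q2 * Rb N' q1) = Ow H' w * (Mm H' q1 q2 * Rb' N' q1)"
    unfolding assoc_mult_mat[OF obs_word_carrier(1)[OF w q(2)] A.Mm_carrier[OF q] colstack_carrier]
      assoc_mult_mat[OF obs_word_carrier(2)[OF w q(2)] B.Mm_carrier[OF q] colstack_carrier] .
qed

end

section \<open>One-sided inverses of observability and reachability matrices\<close>

context gsys begin

lemma observable_left_inverse:
  assumes "observable d H" "q \<in> Qs d"
  obtains L where "L \<in> carrier_mat (n q) (length (obs_words d (dimH d H) q) * p)"
    "L * rowstack (n q) p (Ow H) (obs_words d (dimH d H) q) = 1\<^sub>m (n q)"
proof (rule left_inverse_exists[OF rowstack_carrier, of "n q" p "Ow H" "obs_words d (dimH d H) q"])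
  fix z assume z: "z \<in> carrier_vec (n q)"
    and 0: "rowstack (n q) p (Ow H) (obs_words d (dimH d H) q) *\<^sub>v z = 0\<^sub>v (length (obs_words d (dimH d H) q) * p)"
  have "Ow H ws \<in> carrier_mat p (n q)" if "ws \<in> set (obs_words d (dimH d H) q)" for ws
    using that Ow_carrier[of ws] assms(2) by (auto simp: set_obs_words)
  then have "\<forall>ws\<in>set (obs_words d (dimH d H) q). Ow H ws *\<^sub>v z = 0\<^sub>v p"
    using iffD1[OF rowstack_kernel 0] z by blast
  then show "z = 0\<^sub>v (n q)" using assms z unfolding observable_iff by blast
qed (rule that)

lemma reachable_right_inverse:
  assumes "reachable M d \<theta> P H" "q \<in> Qs d"
  obtains S where "S \<in> carrier_mat (length (reach_words d (dimH d H) q) * p) (n q)"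
    "colstack (n q) p (Rw M \<theta> P H) (reach_words d (dimH d H) q) * S = 1\<^sub>m (n q)"
proof (rule right_inverse_exists[OF colstack_carrier, of "n q" p "Rw M \<theta> P H" "reach_words d (dimH d H) q"])
  fix z assume z: "z \<in> carrier_vec (n q)"
    and 0: "transpose_mat (colstack (n q) p (Rw M \<theta> P H) (reach_words d (dimH d H) q)) *\<^sub>v z = 0\<^sub>v (length (reach_words d (dimH d H) q) * p)"
  have "transpose_mat (Rw M \<theta> P H us) \<in> carrier_mat p (n q)" if "us \<in> set (reach_words d (dimH d H) q)" for us
    using that Rw_carrier[of us] by (auto simp: set_reach_words)
  then have "\<forall>us\<in>set (reach_words d (dimH d H) q). transpose_mat (Rw M \<theta> P H us) *\<^sub>v z = 0\<^sub>v p"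
    using iffD1[OF rowstack_kernel 0[unfolded colstack_def transpose_transpose]] z by blast
  then show "z = 0\<^sub>v (n q)"
    using assms z unfolding reachable_iff by blast
qed (rule that)

end

section \<open>Comparison of dimensions and the isomorphism\<close>

context realization_pair begin

text \<open>The identity on the states of \<open>H\<close> factors as \<open>(L Ob') (Rb' S)\<close>
  through the states of \<open>H'\<close>. Words are bounded by \<open>dimH d H\<close> for both
  systems, since the matrices of \<open>H\<close> are the ones that get inverted.\<close>

lemma nst_le_of_reachable_observable:
  assumes "reachable M d \<theta> P H" "observable d H" and q: "q \<in> Qs d"
  shows "nst H q \<le> nst H' q"
proof -
  let ?N = "dimH d H"
  let ?k = "length (obs_words d ?N q) * p" and ?l = "length (reach_words d ?N q) * p"
  obtain L where L: "L \<in> carrier_mat (nst H q) ?k" "L * Ob ?N q = 1\<^sub>m (nst H q)"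
    using A.observable_left_inverse[OF assms(2) q] by blast
  obtain S where S: "S \<in> carrier_mat ?l (nst H q)" "Rb ?N q * S = 1\<^sub>m (nst H q)"
    using A.reachable_right_inverse[OF assms(1) q] by blast
  have O: "Ob ?N q \<in> carrier_mat ?k (nst H q)" and O': "Ob' ?N q \<in> carrier_mat ?k (nst H' q)"
    and R: "Rb ?N q \<in> carrier_mat (nst H q) ?l" and R': "Rb' ?N q \<in> carrier_mat (nst H' q) ?l"
    by (rule rowstack_carrier colstack_carrier)+
  have LO: "L * Ob' ?N q \<in> carrier_mat (nst H q) (nst H' q)" and RS: "Rb' ?N q * S \<in> carrier_mat (nst H' q) (nst H q)"
    using mult_carrier_mat[OF L(1) O'] mult_carrier_mat[OF R' S(1)] .
  have "(L * Ob' ?N q) * (Rb' ?N q * S) = L * (Ob' ?N q * Rb' ?N q) * S"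
    using assoc_mult_mat[OF LO R' S(1)] assoc_mult_mat[OF L(1) O' R'] by simp
  also have "\<dots> = (L * Ob ?N q) * (Rb ?N q * S)"
    using assoc_mult_mat[OF mult_carrier_mat[OF L(1) O] R S(1)] assoc_mult_mat[OF L(1) O R] hankel_agree[OF q] by simp
  also have "\<dots> = 1\<^sub>m (nst H q)" unfolding L(2) S(2) by simp
  finally show ?thesis by (rule wide_right_inverse_dim_le[OF LO RS])
qed

lemma isomorphic_of_reachable_observable:
  assumes rA: "reachable M d \<theta> P H" and oA: "observable d H" and rB: "reachable M d \<theta> P H'" and oB: "observable d H'"
    and nn: "\<And>q. q \<in> Qs d \<Longrightarrow> nst H' q = nst H q"
  shows "isomorphic M d \<theta> P H H'"
proof -
  let ?N = "dimH d H"
  let ?k = "\<lambda>q. length (obs_words d ?N q) * p" and ?l = "\<lambda>q. length (reach_words d ?N q) * p"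
  have N: "dimH d H' = ?N" using nn by (simp add: dimH_def)
  have "\<exists>L. q \<in> Qs d \<longrightarrow> L \<in> carrier_mat (nst H q) (?k q) \<and> L * Ob' ?N q = 1\<^sub>m (nst H q)" for q
    using B.observable_left_inverse[OF oB, of q] nn[of q] unfolding N by metis
  then obtain L where L: "\<And>q. q \<in> Qs d \<Longrightarrow> L q \<in> carrier_mat (nst H q) (?k q)"
    "\<And>q. q \<in> Qs d \<Longrightarrow> L q * Ob' ?N q = 1\<^sub>m (nst H q)" by metis
  have "\<exists>S. q \<in> Qs d \<longrightarrow> S \<in> carrier_mat (?l q) (nst H q) \<and> Rb ?N q * S = 1\<^sub>m (nst H q)" for q
    using A.reachable_right_inverse[OF rA, of q] by metis
  then obtain S where S: "\<And>q. q \<in> Qs d \<Longrightarrow> S q \<in> carrier_mat (?l q) (nst H q)"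
    "\<And>q. q \<in> Qs d \<Longrightarrow> Rb ?N q * S q = 1\<^sub>m (nst H q)" by metis
  have "\<exists>S. q \<in> Qs d \<longrightarrow> S \<in> carrier_mat (?l q) (nst H q) \<and> Rb' ?N q * S = 1\<^sub>m (nst H q)" for q
    using B.reachable_right_inverse[OF rB, of q] nn[of q] unfolding N by metis
  then obtain S' where S': "\<And>q. q \<in> Qs d \<Longrightarrow> S' q \<in> carrier_mat (?l q) (nst H q)"
    "\<And>q. q \<in> Qs d \<Longrightarrow> Rb' ?N q * S' q = 1\<^sub>m (nst H q)" by metis
  have O: "Ob ?N q \<in> carrier_mat (?k q) (nst H q)" and R: "Rb ?N q \<in> carrier_mat (nst H q) (?l q)" for q
    by (rule rowstack_carrier colstack_carrier)+
  have O': "Ob' ?N q \<in> carrier_mat (?k q) (nst H q)" and R': "Rb' ?N q \<in> carrier_mat (nst H q) (?l q)" if "q \<in> Qs d" for q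
    using rowstack_carrier[of "nst H' q" p "Ow H'" "obs_words d ?N q"]
      colstack_carrier[of "nst H' q" p "Rw M \<theta> P H'" "reach_words d ?N q"] nn[OF that] by simp_all
  \<comment> \<open>The relation \<open>Ob = Ob' T\<close> leaves no other choice, as
    \<open>L q\<close> is a left inverse of \<open>Ob'\<close>.\<close>
  define T where "T q = L q * Ob ?N q" for q
  have T: "T q \<in> carrier_mat (nst H q) (nst H q)" if "q \<in> Qs d" for q
    unfolding T_def by (rule mult_carrier_mat[OF L(1)[OF that] O])
  have TR: "T q * Rb ?N q = Rb' ?N q" if q: "q \<in> Qs d" for q
  proof -
    have "T q * Rb ?N q = L q * (Ob' ?N q * Rb' ?N q)"
      unfolding T_def using assoc_mult_mat[OF L(1)[OF q] O R] hankel_agree[OF q] by simp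
    also have "\<dots> = Rb' ?N q"
      using assoc_mult_mat[OF L(1)[OF q] O'[OF q] R'[OF q]] L(2)[OF q] left_mult_one_mat[OF R'[OF q]] by simp
    finally show ?thesis .
  qed
  have OT: "Ob' ?N q * T q = Ob ?N q" if q: "q \<in> Qs d" for q
  proof (rule right_inverse_cancel[OF S(2)[OF q] S(1)[OF q] R mult_carrier_mat[OF O'[OF q] T[OF q]] O])
    show "Ob' ?N q * T q * Rb ?N q = Ob ?N q * Rb ?N q"
      using assoc_mult_mat[OF O'[OF q] T[OF q] R] TR[OF q] hankel_agree[OF q] by simp
  qed
  have inv: "invertible_mat (T q)" if q: "q \<in> Qs d" for q
  proof -
    \<comment> \<open>The inverse of \<open>T\<close> comes from the reachability side:
      \<open>T\<close> carries \<open>Rb\<close> to \<open>Rb'\<close>, and \<open>S'\<close> is a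
      right inverse of the latter.\<close>
    have c: "Rb ?N q * S' q \<in> carrier_mat (nst H q) (nst H q)" by (rule mult_carrier_mat[OF R S'(1)[OF q]])
    have 1: "T q * (Rb ?N q * S' q) = 1\<^sub>m (nst H q)"
      using assoc_mult_mat[OF T[OF q] R S'(1)[OF q]] TR[OF q] S'(2)[OF q] by simp
    have 2: "(Rb ?N q * S' q) * T q = 1\<^sub>m (nst H q)" by (rule mat_mult_left_right_inverse[OF T[OF q] c 1])
    show ?thesis unfolding invertible_mat_def inverts_mat_def
      using 1 2 carrier_matD[OF T[OF q]] carrier_matD[OF c] by (auto simp: square_mat.simps)
  qed
  \<comment> \<open>In the shifted Hankel identity, \<open>Ob'\<close> is cancelled on the left and
    \<open>Rb\<close> on the right.\<close>
  have TM: "T q2 * Mm H q1 q2 = Mm H' q1 q2 * T q1" if q: "q1 \<in> Qs d" "q2 \<in> Qs d" for q1 q2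
  proof -
    have M': "Mm H' q1 q2 \<in> carrier_mat (nst H q2) (nst H q1)" using B.Mm_carrier[OF q] nn[OF q(1)] nn[OF q(2)] by simp
    note Mc = A.Mm_carrier[OF q]
    have c: "T q2 * Mm H q1 q2 \<in> carrier_mat (nst H q2) (nst H q1)" "Mm H' q1 q2 * T q1 \<in> carrier_mat (nst H q2) (nst H q1)"
      by (rule mult_carrier_mat[OF T[OF q(2)] Mc], rule mult_carrier_mat[OF M' T[OF q(1)]])
    have "Ob' ?N q2 * (T q2 * Mm H q1 q2 * Rb ?N q1) = Ob ?N q2 * (Mm H q1 q2 * Rb ?N q1)"
      using assoc_mult_mat[OF T[OF q(2)] Mc R] assoc_mult_mat[OF O'[OF q(2)] T[OF q(2)] mult_carrier_mat[OF Mc R]] OT[OF q(2)] by simp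
    also have "\<dots> = Ob' ?N q2 * (Mm H' q1 q2 * T q1 * Rb ?N q1)"
      using shifted_hankel_agree[OF q] assoc_mult_mat[OF M' T[OF q(1)] R] TR[OF q(1)] by simp
    finally have "T q2 * Mm H q1 q2 * Rb ?N q1 = Mm H' q1 q2 * T q1 * Rb ?N q1"
      by (rule left_inverse_cancel[OF L(2)[OF q(2)] L(1)[OF q(2)] O'[OF q(2)] mult_carrier_mat[OF c(1) R] mult_carrier_mat[OF c(2) R]])
    then show ?thesis by (rule right_inverse_cancel[OF S(2)[OF q(1)] S(1)[OF q(1)] R c])
  qed
  \<comment> \<open>This is the block of the empty word \<open>[q]\<close> in
    \<open>Ob' T = Ob\<close>.\<close>
  have TC: "Cm H q = Cm H' q * T q" if q: "q \<in> Qs d" for q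
  proof -
    have "\<forall>w\<in>set (obs_words d ?N q). Ow H w * 1\<^sub>m (nst H q) = Ow H' w * T q"
    proof (subst rowstack_eq_iff[OF obs_word_carrier(1)[OF _ q] obs_word_carrier(2)[OF _ q], symmetric]; assumption?)
      show "T q \<in> carrier_mat (nst H' q) (nst H q)" using T[OF q] nn[OF q] by simp
      show "Ob ?N q * 1\<^sub>m (nst H q) = Ob' ?N q * T q" using OT[OF q] right_mult_one_mat[OF O] by simp
    qed simp
    moreover have "[q] \<in> set (obs_words d ?N q)" using q by (simp add: set_obs_words)
    ultimately show ?thesis using A.Ow_single[OF q] B.Ow_single[OF q] right_mult_one_mat[OF A.Cm_carrier[OF q]] by auto
  qed
  have TG: "T q2 * Gmat M \<theta> P H q1 q2 = Gmat M \<theta> P H' q1 q2" if q: "q1 \<in> Qs d" "q2 \<in> Qs d" for q1 q2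
  proof -
    have G': "Gmat M \<theta> P H' q1 q2 \<in> carrier_mat (nst H q2) p" using B.Gmat_carrier[OF q] nn[OF q(2)] by simp
    note Gc = A.Gmat_carrier[OF q]
    have c: "T q2 * Gmat M \<theta> P H q1 q2 \<in> carrier_mat (nst H q2) p" by (rule mult_carrier_mat[OF T[OF q(2)] Gc])
    have G'': "Gmat M \<theta> P H' q1 q2 \<in> carrier_mat (nst H' q2) p" by (rule B.Gmat_carrier[OF q])
    have "Ob' ?N q2 * (T q2 * Gmat M \<theta> P H q1 q2) = Ob ?N q2 * Gmat M \<theta> P H q1 q2"
      using assoc_mult_mat[OF O'[OF q(2)] T[OF q(2)] Gc] OT[OF q(2)] by simp
    also have "\<dots> = Ob' ?N q2 * Gmat M \<theta> P H' q1 q2"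
    proof (subst rowstack_eq_iff[OF obs_word_carrier(1)[OF _ q(2)] obs_word_carrier(2)[OF _ q(2)] Gc G'']; (assumption | intro ballI)?)
      fix w assume w: "w \<in> set (obs_words d ?N q2)"
      show "Ow H w * Gmat M \<theta> P H q1 q2 = Ow H' w * Gmat M \<theta> P H' q1 q2"
        using hankel_blocks_agree[of "[q1, q2]" w] w q A.Rw_letter[OF q] B.Rw_letter[OF q] by (auto simp: set_obs_words)
    qed
    finally show ?thesis
      by (rule left_inverse_cancel[OF L(2)[OF q(2)] L(1)[OF q(2)] O'[OF q(2)] c G'])
  qed
  show ?thesis unfolding isomorphic_def
  proof (intro conjI exI[of _ T] ballI)
    show "nst H' q = nst H q" if "q \<in> Qs d" for q by (rule nn[OF that])
  qed (use T inv TM TC TG in auto)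
qed

end

theorem mainTheorem16:
  fixes M :: "'w measure" and d p :: nat and \<theta> :: "int \<Rightarrow> 'w \<Rightarrow> nat"
    and P :: "nat \<Rightarrow> nat \<Rightarrow> real" and y :: "int \<Rightarrow> 'w \<Rightarrow> real vec" and H :: "'w gjmls"
  assumes "stat_markov_chain M d \<theta> P"
    and "is_gjmls M d \<theta> p H"
    and "realizes M \<theta> H y"
    and "assumptionG M d \<theta> P p H"
  shows "(minimal_realization M d \<theta> P p y H \<longleftrightarrow>
            reachable M d \<theta> P H \<and> observable d H) \<and>
         (minimal_realization M d \<theta> P p y H \<longrightarrow>
            (\<forall>H'. minimal_realization M d \<theta> P p y H' \<longrightarrow> isomorphic M d \<theta> P H H'))"
proof -
  have sys: "gsys M d \<theta> P p K" if "is_gjmls M d \<theta> p K" "assumptionG M d \<theta> P p K" for K :: "'w gjmls"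
    using assms(1) that by (auto simp: gsys_def gsys_axioms_def markov_chain_def markov_chain_axioms_def stat_markov_chain_def)
  have pair: "realization_pair M d \<theta> P p K K' y"
    if "is_gjmls M d \<theta> p K" "assumptionG M d \<theta> P p K" "realizes M \<theta> K y"
      "is_gjmls M d \<theta> p K'" "assumptionG M d \<theta> P p K'" "realizes M \<theta> K' y" for K K' :: "'w gjmls"
    using sys that by (simp add: realization_pair_def realization_pair_axioms_def)
  have nec: "reachable M d \<theta> P K \<and> observable d K" if "minimal_realization M d \<theta> P p y K" for K :: "'w gjmls"
  proof -
    interpret gsys M d \<theta> P p K by (rule sys) (use that in \<open>auto simp: minimal_realization_def\<close>)
    show ?thesis using minimal_imp_reachable[OF that] minimal_imp_observable[OF that] by simp
  qed
  have suf: "minimal_realization M d \<theta> P p y H" if ro: "reachable M d \<theta> P H" "observable d H"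
    unfolding minimal_realization_def
  proof (intro conjI assms allI impI; elim conjE)
    fix H' :: "'w gjmls" assume H': "is_gjmls M d \<theta> p H'" "realizes M \<theta> H' y" "assumptionG M d \<theta> P p H'"
    interpret realization_pair M d \<theta> P p H H' y by (rule pair) (use assms H' in auto)
    show "dimH d H \<le> dimH d H'"
      unfolding dimH_def by (intro sum_mono nst_le_of_reachable_observable ro)
  qed
  have "isomorphic M d \<theta> P H H'" if min: "minimal_realization M d \<theta> P p y H" "minimal_realization M d \<theta> P p y H'" for H' :: "'w gjmls"
  proof -
    have H': "is_gjmls M d \<theta> p H'" "realizes M \<theta> H' y" "assumptionG M d \<theta> P p H'"
      using min(2) by (auto simp: minimal_realization_def)
    interpret AB: realization_pair M d \<theta> P p H H' y by (rule pair) (use assms H' in auto)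
    \<comment> \<open>Reading the pair in both orders gives equal dimensions in every mode.\<close>
    interpret BA: realization_pair M d \<theta> P p H' H y by (rule pair) (use assms H' in auto)
    show ?thesis
      by (rule AB.isomorphic_of_reachable_observable)
        (use nec[OF min(1)] nec[OF min(2)] AB.nst_le_of_reachable_observable BA.nst_le_of_reachable_observable
          in \<open>auto intro: antisym\<close>)
  qed
  then show ?thesis using nec suf by blast
qed

end
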